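(* Let $k\in\mathbb{N}_0$ and let $X$ be an $H^k(\Theta)$-valued random element such that $\mathbb{E}\|X\|_{H^k}^2<\infty$. (a) $\mathrm{Cov}_k(X)\in N(H^k)$ is self-adjoint, non-negative and satisfies $\|\mathrm{Cov}_k(X)\|_{N(H^k)}=\mathbb{E}\|X\|_{H^k}^2$. (b) There exists a unique kernel $c_X\in H^{k,k}(\Theta\times\Theta)$ such that $\mathrm{Cov}_k(X)=T_{c_X,k}$; that is, for $f\in H^k(\Theta)$, $$[\mathrm{Cov}_k(X)f](t)=[T_{c_X,k}f](t)=\int_\Theta\sum_{|\alpha|\le k}\partial^{(\alpha,0)}c_X(s,t)\,f^{(\alpha)}(s)\,ds\quad\text{a.e.}$$ Moreover, for $|\alpha|,|\beta|\le k$, $\mathrm{Cov}_0(X^{(\alpha)},X^{(\beta)})=T_{\partial^{(\beta,\alpha)}c_X,0}\in N(L^2)$; that is, for $f\in L^2(\Theta)$, $$[\mathrm{Cov}_0(X^{(\alpha)},X^{(\beta)})f](t)=[T_{\partial^{(\beta,\alpha)}c_X,0}f](t)=\int_\Theta\partial^{(\beta,\alpha)}c_X(s,t)\,f(s)\,ds\quad\text{a.e.},$$ and $$\|\mathrm{Cov}_k(X)\|_{N(H^k)}=\sum_{|\alpha|\le k}\|\mathrm{Cov}_0(X^{(\alpha)})\|_{N(L^2)} .$$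
   Context: $(\Omega,\mathcal{A},\mathbb{P})$ is a complete probability space; $d\in\mathbb{N}$ and $\Theta\subset\mathbb{R}^d$ is a bounded domain, meaning a bounded open subset. All functions are real-valued; $\alpha,\beta\in\mathbb{N}_0^d$ are multi-indices. $f^{(\alpha)}$ is the weak derivative, and $X^{(\alpha)}$ is the $L^2(\Theta)$-valued random element $\omega\mapsto X(\omega)^{(\alpha)}$. $\partial^{(\alpha,\beta)}h$ is the mixed weak derivative of a kernel $h$ on $\Theta\times\Theta$, of order $\alpha$ in the first variable and $\beta$ in the second. $H^k(\Theta)$ is the $L^2$-based Sobolev space with inner product $\langle f,g\rangle_{H^k}=\sum_{|\alpha|\le k}\langle f^{(\alpha)},g^{(\alpha)}\rangle_{L^2}$; $H^0=L^2$. $H^{k,k}(\Theta\times\Theta)$ is the space of $h\in L^2(\Theta\times\Theta)$ such that $\partial^{(\alpha,\beta)}h$ exists in $L^2(\Theta\times\Theta)$ for all $|\alpha|,|\beta|\le k$. For $h\in H^{k,k}(\Theta\times\Theta)$, $T_{h,k}\colon H^k(\Theta)\to H^k(\Theta)$ is defined by $[T_{h,k}f](t)=\int_\Theta\sum_{|\alpha|\le k}\partial^{(\alpha,0)}h(s,t)f^{(\alpha)}(s)\,ds$ a.e. In particular $T_{g,0}$ is the $L^2$-integral operator with kernel $g\in L^2(\Theta\times\Theta)$. An $E$-valued random element is an $\mathcal{A}$-Borel measurable map $\Omega\to E$, and $\mathbb{E}$ is the Bochner integral. $N(H^k)$ is the space of nuclear (trace-class) operators on $H^k(\Theta)$ with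 the trace norm. For $f,g,u\in H^k(\Theta)$, $(f\otimes g)(u)=\langle u,g\rangle_{H^k}f$. For $H^k(\Theta)$-valued random elements $X,Y$ with $\mathbb{E}\|X\|_{H^k}^2,\mathbb{E}\|Y\|_{H^k}^2<\infty$, the cross-covariance operator is $\mathrm{Cov}_k(X,Y)=\int_\Omega(X-\mathbb{E}[X])\otimes(Y-\mathbb{E}[Y])\,d\mathbb{P}\in N(H^k)$ (Bochner integral), and $\mathrm{Cov}_k(X)=\mathrm{Cov}_k(X,X)$; $\mathrm{Cov}_0$ is the case $k=0$, i.e. for $L^2(\Theta)$-valued random elements.
   Formalization: In (a), the printed norm identity fails for constant nonzero X (covariance 0, but E‖X‖²>0); it is replaced by ‖Cov_k(X)‖ = E‖X−E[X]‖² for every X, with the printed identity ‖Cov_k(X)‖ = E‖X‖² asserted when E[X]=0, which is exactly when it holds. *)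

theory Defs
  imports "HOL-Analysis.Analysis" "HOL-Probability.Probability" "HOL-Library.Function_Algebras"
begin

section \<open>Classes of functions modulo almost-everywhere equality\<close>

text \<open>
  Every class of Lebesgue measurable functions has Borel representatives, so it is enough to
  admit those. A function on an open set is identified with its extension by zero.
\<close>

quotient_type (overloaded) 'a aefun = "'a::euclidean_space \<Rightarrow> real" / partial:
  "\<lambda>f g. f \<in> borel_measurable lborel \<and> g \<in> borel_measurable lborel \<and> (AE x in lborel. f x = g x)"
proof (rule part_equivpI)
  show "\<exists>f::'a \<Rightarrow> real. f \<in> borel_measurable lborel \<and> f \<in> borel_measurable lborel
          \<and> (AE x in lborel. f x = f x)"
    by (rule exI[of _ "\<lambda>x. 0"]) simp
  show "symp (\<lambda>f g. f \<in> borel_measurable lborel \<and> g \<in> borel_measurable lborel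
          \<and> (AE x::'a in lborel. f x = (g x :: real)))"
    by (rule sympI) (auto elim: AE_mp)
  show "transp (\<lambda>f g. f \<in> borel_measurable lborel \<and> g \<in> borel_measurable lborel
          \<and> (AE x::'a in lborel. f x = (g x :: real)))"
    by (rule transpI) (auto elim: AE_mp)
qed

instantiation aefun :: (euclidean_space) real_vector
begin

lift_definition zero_aefun :: "'a aefun" is "\<lambda>x. 0" by simp

lift_definition plus_aefun :: "'a aefun \<Rightarrow> 'a aefun \<Rightarrow> 'a aefun" is "\<lambda>f g x. f x + g x"
  by (auto elim: AE_mp)

lift_definition minus_aefun :: "'a aefun \<Rightarrow> 'a aefun \<Rightarrow> 'a aefun" is "\<lambda>f g x. f x - g x"
  by (auto elim: AE_mp)

lift_definition uminus_aefun :: "'a aefun \<Rightarrow> 'a aefun" is "\<lambda>f x. - f x"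
  by (auto elim: AE_mp)

lift_definition scaleR_aefun :: "real \<Rightarrow> 'a aefun \<Rightarrow> 'a aefun" is "\<lambda>c f x. c * f x"
  by (auto elim: AE_mp)

instance
  by standard (transfer; auto simp: algebra_simps)+

end

instantiation "fun" :: (type, real_vector) real_vector
begin

definition scaleR_fun :: "real \<Rightarrow> ('a \<Rightarrow> 'b) \<Rightarrow> 'a \<Rightarrow> 'b"
  where "scaleR_fun c f = (\<lambda>x. c *\<^sub>R f x)"

instance
  by standard (auto simp: scaleR_fun_def plus_fun_def fun_eq_iff algebra_simps)

end


section \<open>Weak derivatives\<close>

text \<open>
  Iterated classical partial derivatives are indexed by lists of basis vectors. On smooth
  functions the order of the list is immaterial, so a multi-index may be turned into a list
  along any fixed enumeration of the coordinates.
\<close>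

primrec pderivs :: "'a::euclidean_space list \<Rightarrow> ('a \<Rightarrow> real) \<Rightarrow> 'a \<Rightarrow> real" where
  "pderivs [] \<phi> = \<phi>"
| "pderivs (b # bs) \<phi> = (\<lambda>x. frechet_derivative (pderivs bs \<phi>) (at x) b)"

definition smooth :: "('a::euclidean_space \<Rightarrow> real) \<Rightarrow> bool" where
  "smooth \<phi> \<longleftrightarrow> (\<forall>bs\<in>lists Basis. pderivs bs \<phi> differentiable_on UNIV)"

definition test_function :: "'a::euclidean_space set \<Rightarrow> ('a \<Rightarrow> real) \<Rightarrow> bool" where
  "test_function U \<phi> \<longleftrightarrow> smooth \<phi> \<and> (\<exists>K. compact K \<and> K \<subseteq> U \<and> (\<forall>x. x \<notin> K \<longrightarrow> \<phi> x = 0))"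

definition weak_deriv ::
    "'a::euclidean_space set \<Rightarrow> 'a list \<Rightarrow> 'a aefun \<Rightarrow> 'a aefun \<Rightarrow> bool" where
  "weak_deriv U bs f g \<longleftrightarrow> (\<forall>\<phi>. test_function U \<phi> \<longrightarrow>
     (LINT x:U|lborel. rep_aefun f x * pderivs bs \<phi> x)
       = (- 1) ^ length bs * (LINT x:U|lborel. rep_aefun g x * \<phi> x))"

definition L2 :: "'a::euclidean_space set \<Rightarrow> 'a aefun set" where
  "L2 U = {f. integrable lborel (\<lambda>x. (rep_aefun f x)\<^sup>2) \<and>
              (AE x in lborel. x \<notin> U \<longrightarrow> rep_aefun f x = 0)}"

text \<open>Weak derivatives in \<open>L2\<close>: existence, and the derivative itself.\<close>

definition has_wderiv :: "'a::euclidean_space set \<Rightarrow> 'a list \<Rightarrow> 'a aefun \<Rightarrow> bool" where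
  "has_wderiv U bs f \<longleftrightarrow> (\<exists>g\<in>L2 U. weak_deriv U bs f g)"

definition wderiv :: "'a::euclidean_space set \<Rightarrow> 'a list \<Rightarrow> 'a aefun \<Rightarrow> 'a aefun" where
  "wderiv U bs f = (THE g. g \<in> L2 U \<and> weak_deriv U bs f g)"

type_synonym 'n mindex = "'n \<Rightarrow> nat"

definition mdeg :: "'n::finite mindex \<Rightarrow> nat" where
  "mdeg \<alpha> = (\<Sum>i\<in>UNIV. \<alpha> i)"

definition coords :: "'n::finite list" where
  "coords = (SOME xs. distinct xs \<and> set xs = UNIV)"

definition mdirs :: "'n::finite mindex \<Rightarrow> (real^'n) list" where
  "mdirs \<alpha> = concat (map (\<lambda>i. replicate (\<alpha> i) (axis i 1)) coords)"

definition mdirs2 :: "'n::finite mindex \<Rightarrow> 'n mindex \<Rightarrow> ((real^'n) \<times> (real^'n)) list" where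
  "mdirs2 \<alpha> \<beta> = map (\<lambda>v. (v, 0)) (mdirs \<alpha>) @ map (\<lambda>v. (0, v)) (mdirs \<beta>)"

abbreviation mderiv :: "(real^'n) set \<Rightarrow> 'n::finite mindex \<Rightarrow> (real^'n) aefun \<Rightarrow> (real^'n) aefun" where
  "mderiv \<Theta> \<alpha> f \<equiv> wderiv \<Theta> (mdirs \<alpha>) f"

abbreviation mderiv2 :: "(real^'n) set \<Rightarrow> 'n::finite mindex \<Rightarrow> 'n mindex
    \<Rightarrow> ((real^'n) \<times> (real^'n)) aefun \<Rightarrow> ((real^'n) \<times> (real^'n)) aefun" where
  "mderiv2 \<Theta> \<alpha> \<beta> h \<equiv> wderiv (\<Theta> \<times> \<Theta>) (mdirs2 \<alpha> \<beta>) h"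


section \<open>Sobolev spaces and integral operators\<close>

definition L2_inner :: "'a::euclidean_space set \<Rightarrow> 'a aefun \<Rightarrow> 'a aefun \<Rightarrow> real" where
  "L2_inner U f g = (LINT x:U|lborel. rep_aefun f x * rep_aefun g x)"

definition Sobolev :: "(real^'n) set \<Rightarrow> nat \<Rightarrow> (real^'n::finite) aefun set" where
  "Sobolev \<Theta> k = {f \<in> L2 \<Theta>. \<forall>\<alpha>. mdeg \<alpha> \<le> k \<longrightarrow> has_wderiv \<Theta> (mdirs \<alpha>) f}"

definition Sobolev_inner ::
    "(real^'n) set \<Rightarrow> nat \<Rightarrow> (real^'n::finite) aefun \<Rightarrow> (real^'n) aefun \<Rightarrow> real" where
  "Sobolev_inner \<Theta> k f g = (\<Sum>\<alpha> | mdeg \<alpha> \<le> k. L2_inner \<Theta> (mderiv \<Theta> \<alpha> f) (mderiv \<Theta> \<alpha> g))"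

definition Sobolev_norm :: "(real^'n) set \<Rightarrow> nat \<Rightarrow> (real^'n::finite) aefun \<Rightarrow> real" where
  "Sobolev_norm \<Theta> k f = sqrt (Sobolev_inner \<Theta> k f f)"

definition Sobolev_mixed :: "(real^'n) set \<Rightarrow> nat \<Rightarrow> ((real^'n) \<times> (real^'n::finite)) aefun set" where
  "Sobolev_mixed \<Theta> k = {h \<in> L2 (\<Theta> \<times> \<Theta>). \<forall>\<alpha> \<beta>. mdeg \<alpha> \<le> k \<and> mdeg \<beta> \<le> k
               \<longrightarrow> has_wderiv (\<Theta> \<times> \<Theta>) (mdirs2 \<alpha> \<beta>) h}"

text \<open>
  In \<open>T_op\<close> the argument of \<open>abs_aefun\<close> is Borel measurable because the representatives are, and
  its class does not depend on them.
  An operator on a space \<open>V\<close> is represented by the function that extends it by zero outside \<open>V\<close>;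
  two operators on \<open>V\<close> are then equal iff they agree on \<open>V\<close>.
\<close>

definition T_op :: "(real^'n) set \<Rightarrow> nat \<Rightarrow> ((real^'n) \<times> (real^'n::finite)) aefun
    \<Rightarrow> (real^'n) aefun \<Rightarrow> (real^'n) aefun" where
  "T_op \<Theta> k h f =
     (if f \<in> Sobolev \<Theta> k
      then abs_aefun (\<lambda>t. indicator \<Theta> t *
             (LINT s:\<Theta>|lborel. (\<Sum>\<alpha> | mdeg \<alpha> \<le> k.
                rep_aefun (mderiv2 \<Theta> \<alpha> (\<lambda>_. 0) h) (s, t) * rep_aefun (mderiv \<Theta> \<alpha> f) s)))
      else 0)"

definition tensor :: "(real^'n) set \<Rightarrow> nat \<Rightarrow> (real^'n::finite) aefun \<Rightarrow> (real^'n) aefun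
    \<Rightarrow> (real^'n) aefun \<Rightarrow> (real^'n) aefun" where
  "tensor \<Theta> k f g u = (if u \<in> Sobolev \<Theta> k then Sobolev_inner \<Theta> k u g *\<^sub>R f else 0)"


section \<open>Nuclear operators\<close>

text \<open>
  Nuclear operators are the sums of absolutely convergent series of rank-one operators, and the
  trace norm is the nuclear norm, i.e. the infimum of \<open>\<Sum>i. \<parallel>a i\<parallel> * \<parallel>b i\<parallel>\<close> over all such series.
\<close>

definition nuclear_rep :: "(real^'n) set \<Rightarrow> nat \<Rightarrow> ((real^'n::finite) aefun \<Rightarrow> (real^'n) aefun)
    \<Rightarrow> (nat \<Rightarrow> (real^'n) aefun) \<Rightarrow> (nat \<Rightarrow> (real^'n) aefun) \<Rightarrow> bool" where
  "nuclear_rep \<Theta> k T a b \<longleftrightarrow>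
     range a \<subseteq> Sobolev \<Theta> k \<and> range b \<subseteq> Sobolev \<Theta> k \<and>
     summable (\<lambda>i. Sobolev_norm \<Theta> k (a i) * Sobolev_norm \<Theta> k (b i)) \<and>
     (\<forall>f\<in>Sobolev \<Theta> k. (\<lambda>m. Sobolev_norm \<Theta> k (T f - (\<Sum>i<m. tensor \<Theta> k (a i) (b i) f))) \<longlonglongrightarrow> 0)"

definition nuclear :: "(real^'n) set \<Rightarrow> nat \<Rightarrow> ((real^'n::finite) aefun \<Rightarrow> (real^'n) aefun) set" where
  "nuclear \<Theta> k = {T. (\<forall>f\<in>Sobolev \<Theta> k. T f \<in> Sobolev \<Theta> k) \<and> (\<forall>f. f \<notin> Sobolev \<Theta> k \<longrightarrow> T f = 0) \<and>
                     (\<exists>a b. nuclear_rep \<Theta> k T a b)}"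

definition nuclear_norm ::
    "(real^'n) set \<Rightarrow> nat \<Rightarrow> ((real^'n::finite) aefun \<Rightarrow> (real^'n) aefun) \<Rightarrow> real" where
  "nuclear_norm \<Theta> k T =
     Inf {\<Sum>i. Sobolev_norm \<Theta> k (a i) * Sobolev_norm \<Theta> k (b i) | a b. nuclear_rep \<Theta> k T a b}"


section \<open>Random elements and the Bochner integral\<close>

text \<open>
  Since \<open>Sobolev\<close> and \<open>nuclear\<close> depend on \<open>\<Theta>\<close> and \<open>k\<close>, they are not types. The following transcribes
  the library's Bochner integral to a normed space given by a carrier \<open>V\<close> and a norm \<open>N\<close>.
\<close>

definition borel_on :: "'v::real_vector set \<Rightarrow> ('v \<Rightarrow> real) \<Rightarrow> 'v measure" where
  "borel_on V N = sigma V {U. U \<subseteq> V \<and> (\<forall>x\<in>U. \<exists>e>0. \<forall>y\<in>V. N (y - x) < e \<longrightarrow> y \<in> U)}"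

definition has_bochner_integral_on ::
    "'w measure \<Rightarrow> 'v::real_vector set \<Rightarrow> ('v \<Rightarrow> real) \<Rightarrow> ('w \<Rightarrow> 'v) \<Rightarrow> 'v \<Rightarrow> bool" where
  "has_bochner_integral_on M V N f x \<longleftrightarrow> x \<in> V \<and> f \<in> M \<rightarrow>\<^sub>M borel_on V N \<and>
     (\<exists>s. (\<forall>i. Bochner_Integration.simple_bochner_integrable M (s i) \<and> s i ` space M \<subseteq> V) \<and>
          (\<lambda>i. \<integral>\<^sup>+\<omega>. ennreal (N (f \<omega> - s i \<omega>)) \<partial>M) \<longlonglongrightarrow> 0 \<and>
          (\<lambda>i. N (Bochner_Integration.simple_bochner_integral M (s i) - x)) \<longlonglongrightarrow> 0)"

definition bochner_integrable_on ::
    "'w measure \<Rightarrow> 'v::real_vector set \<Rightarrow> ('v \<Rightarrow> real) \<Rightarrow> ('w \<Rightarrow> 'v) \<Rightarrow> bool" where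
  "bochner_integrable_on M V N f \<longleftrightarrow> (\<exists>x. has_bochner_integral_on M V N f x)"

definition bochner_integral_on ::
    "'w measure \<Rightarrow> 'v::real_vector set \<Rightarrow> ('v \<Rightarrow> real) \<Rightarrow> ('w \<Rightarrow> 'v) \<Rightarrow> 'v" where
  "bochner_integral_on M V N f =
     (if bochner_integrable_on M V N f then THE x. has_bochner_integral_on M V N f x else 0)"

definition random_element ::
    "'w measure \<Rightarrow> (real^'n) set \<Rightarrow> nat \<Rightarrow> ('w \<Rightarrow> (real^'n::finite) aefun) \<Rightarrow> bool" where
  "random_element P \<Theta> k X \<longleftrightarrow> X \<in> P \<rightarrow>\<^sub>M borel_on (Sobolev \<Theta> k) (Sobolev_norm \<Theta> k)"

definition mean ::
    "'w measure \<Rightarrow> (real^'n) set \<Rightarrow> nat \<Rightarrow> ('w \<Rightarrow> (real^'n::finite) aefun) \<Rightarrow> (real^'n) aefun" where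
  "mean P \<Theta> k X = bochner_integral_on P (Sobolev \<Theta> k) (Sobolev_norm \<Theta> k) X"

definition cov_integrand :: "'w measure \<Rightarrow> (real^'n) set \<Rightarrow> nat
    \<Rightarrow> ('w \<Rightarrow> (real^'n::finite) aefun) \<Rightarrow> ('w \<Rightarrow> (real^'n) aefun)
    \<Rightarrow> 'w \<Rightarrow> (real^'n) aefun \<Rightarrow> (real^'n) aefun" where
  "cov_integrand P \<Theta> k X Y \<omega> = tensor \<Theta> k (X \<omega> - mean P \<Theta> k X) (Y \<omega> - mean P \<Theta> k Y)"

definition Cov :: "'w measure \<Rightarrow> (real^'n) set \<Rightarrow> nat
    \<Rightarrow> ('w \<Rightarrow> (real^'n::finite) aefun) \<Rightarrow> ('w \<Rightarrow> (real^'n) aefun)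
    \<Rightarrow> (real^'n) aefun \<Rightarrow> (real^'n) aefun" where
  "Cov P \<Theta> k X Y =
     bochner_integral_on P (nuclear \<Theta> k) (nuclear_norm \<Theta> k) (cov_integrand P \<Theta> k X Y)"

text \<open>
  \<open>bochner_integral_on\<close> is \<open>0\<close> for non-integrable functions, so the existence of the integrals
  that define \<open>Cov\<close> (measurability of the integrands included) is a separate assertion.
\<close>

definition cov_exists :: "'w measure \<Rightarrow> (real^'n) set \<Rightarrow> nat
    \<Rightarrow> ('w \<Rightarrow> (real^'n::finite) aefun) \<Rightarrow> ('w \<Rightarrow> (real^'n) aefun) \<Rightarrow> bool" where
  "cov_exists P \<Theta> k X Y \<longleftrightarrow>
     bochner_integrable_on P (Sobolev \<Theta> k) (Sobolev_norm \<Theta> k) X \<and>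
     bochner_integrable_on P (Sobolev \<Theta> k) (Sobolev_norm \<Theta> k) Y \<and>
     bochner_integrable_on P (nuclear \<Theta> k) (nuclear_norm \<Theta> k) (cov_integrand P \<Theta> k X Y)"

end

theory Submission
  imports Defs "HOL-Computational_Algebra.Polynomial"
begin

text \<open>
  Write \<open>Y\<close> for the centred random element. All integrands that occur are continuous quadratic functions
  of \<open>Y\<close> with values in the Banach space of nuclear operators. Separability provides simple functions
  \<open>s n \<longlonglongrightarrow> Y\<close> with \<open>\<parallel>Y - s n\<parallel> \<le> \<parallel>Y\<parallel>\<close>, so by dominated convergence the Bochner integrals exist, and
  they are determined by \<open>\<langle>C f, g\<rangle> = E (\<langle>f, Y\<rangle> * \<langle>Y, g\<rangle>)\<close>.

  The nuclear norm of \<open>C\<close> is at most \<open>E \<parallel>Y\<parallel>\<^sup>2\<close> since \<open>Y \<otimes> Y\<close> has nuclear norm at most \<open>\<parallel>Y\<parallel>\<^sup>2\<close>. Conversely it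
  dominates every finite trace \<open>\<Sum>e\<in>E. \<langle>C e, e\<rangle>\<close>, which is \<open>E \<parallel>Q Y\<parallel>\<^sup>2\<close> for the projection \<open>Q\<close> onto the span of
  \<open>E\<close>; taking for \<open>E\<close> an orthonormal basis of the span of the values of \<open>s n\<close> gives \<open>E \<parallel>Y\<parallel>\<^sup>2\<close> in the limit.

  A nuclear operator \<open>\<Sum>i. a i \<otimes> b i\<close> on the Sobolev space has the kernel \<open>\<Sum>i. b i (s) * a i (t)\<close>, which may be
  differentiated term by term. With \<open>u\<close> and \<open>v\<close> the Riesz representatives of \<open>x \<mapsto> \<langle>x\<^sup>(\<^sup>\<beta>\<^sup>), f\<rangle>\<close> and
  \<open>x \<mapsto> \<langle>x\<^sup>(\<^sup>\<alpha>\<^sup>), g\<rangle>\<close>, both the covariance of the derivatives and the derivative of the kernel, tested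
  against \<open>f\<close> and \<open>g\<close>, are equal to \<open>\<langle>C u, v\<rangle>\<close>.
\<close>

section \<open>Normed spaces given by a carrier set\<close>

text \<open>The space of nuclear operators is used only through its completeness and through the
  bounded functionals that send \<open>T\<close> to a matrix coefficient: approximation by simple
  functions takes place in the separable Sobolev space and is carried over by the quadratic map.
  Weak derivatives are contractions from \<open>Sobolev \<Theta> k\<close> to
  \<open>L2 \<Theta>\<close>, so they commute with the mean, and the formula for the norm holds for
  each of them. As the squared Sobolev norm is the sum of the squared \<open>L2\<close> norms of the
  derivatives, the last identity of the theorem is the sum of these formulas. Uniqueness of the
  kernel is the delicate point, because the operator sees only derivatives in the first variable.
  Let \<open>c\<close> and \<open>c'\<close> give the same operator and let \<open>g\<close> be a
  test function of the second variable. The integral of \<open>(c - c') (s, t) g(t)\<close> over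
  \<open>t\<close> is a function \<open>h\<close> of \<open>s\<close> that lies in the Sobolev
  space, and the difference of the two operators at \<open>h\<close>, paired with \<open>g\<close>,
  is the squared Sobolev norm of \<open>h\<close>. Hence \<open>h = 0\<close> for every
  \<open>g\<close>, and product test functions determine \<open>c - c'\<close>.\<close>

locale normed_carrier =
  fixes V :: "'v::real_vector set" and N :: "'v \<Rightarrow> real"
  assumes subspace_V: "subspace V"
    and N_nonneg: "x \<in> V \<Longrightarrow> 0 \<le> N x"
    and N_eq_0: "x \<in> V \<Longrightarrow> N x = 0 \<Longrightarrow> x = 0"
    and N_triangle: "x \<in> V \<Longrightarrow> y \<in> V \<Longrightarrow> N (x + y) \<le> N x + N y"
    and N_scale: "x \<in> V \<Longrightarrow> N (c *\<^sub>R x) = \<bar>c\<bar> * N x"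
begin

lemma V_0 [simp]: "0 \<in> V" using subspace_V by (rule subspace_0)
lemma V_add [simp]: "x \<in> V \<Longrightarrow> y \<in> V \<Longrightarrow> x + y \<in> V" using subspace_V by (rule subspace_add)
lemma V_diff [simp]: "x \<in> V \<Longrightarrow> y \<in> V \<Longrightarrow> x - y \<in> V" using subspace_V by (rule subspace_diff)
lemma V_neg [simp]: "x \<in> V \<Longrightarrow> - x \<in> V" using subspace_V by (rule subspace_neg)
lemma V_scale [simp]: "x \<in> V \<Longrightarrow> c *\<^sub>R x \<in> V" using subspace_V by (rule subspace_scale)
lemma V_sum: "(\<And>i. i \<in> I \<Longrightarrow> f i \<in> V) \<Longrightarrow> sum f I \<in> V"
  using subspace_V by (rule subspace_sum)

lemma N_0 [simp]: "N 0 = 0"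
  using N_scale[of 0 0] by simp

lemma N_uminus: "x \<in> V \<Longrightarrow> N (- x) = N x"
  using N_scale[of x "-1"] by simp

lemma N_commute: "x \<in> V \<Longrightarrow> y \<in> V \<Longrightarrow> N (x - y) = N (y - x)"
  using N_uminus[of "x - y"] by simp

lemma N_diff_triangle: "x \<in> V \<Longrightarrow> y \<in> V \<Longrightarrow> z \<in> V \<Longrightarrow> N (x - z) \<le> N (x - y) + N (y - z)"
  using N_triangle[of "x - y" "y - z"] by simp

lemma N_diff_le: "x \<in> V \<Longrightarrow> y \<in> V \<Longrightarrow> N (x - y) \<le> N x + N y"
  using N_triangle[of x "- y"] by (simp add: N_uminus)

lemma N_le_diff: "x \<in> V \<Longrightarrow> y \<in> V \<Longrightarrow> N x \<le> N y + N (x - y)"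
  using N_triangle[of y "x - y"] by simp

lemma N_abs_diff: "x \<in> V \<Longrightarrow> y \<in> V \<Longrightarrow> \<bar>N x - N y\<bar> \<le> N (x - y)"
  using N_le_diff[of x y] N_le_diff[of y x] N_commute[of x y] by linarith

lemma N_sum: "(\<And>i. i \<in> I \<Longrightarrow> f i \<in> V) \<Longrightarrow> N (sum f I) \<le> (\<Sum>i\<in>I. N (f i))"
proof (induction I rule: infinite_finite_induct)
  case (insert i I)
  then have "N (f i + sum f I) \<le> N (f i) + N (sum f I)"
    by (intro N_triangle V_sum) auto
  with insert show ?case by force
qed auto

lemma limit_unique:
  assumes "\<And>n. x n \<in> V" "l \<in> V" "l' \<in> V"
    and "(\<lambda>n. N (x n - l)) \<longlonglongrightarrow> 0" "(\<lambda>n. N (x n - l')) \<longlonglongrightarrow> 0"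
  shows "l = l'"
proof -
  have "(\<lambda>n. N (x n - l) + N (x n - l')) \<longlonglongrightarrow> 0"
    using tendsto_add[OF assms(4,5)] by simp
  moreover have "N (l - l') \<le> N (x n - l) + N (x n - l')" for n
    using N_diff_triangle[of l "x n" l'] N_commute[of l "x n"] assms by simp
  ultimately have "N (l - l') \<le> 0"
    by (intro LIMSEQ_le_const) auto
  then have "l - l' = 0"
    using N_nonneg[of "l - l'"] assms by (intro N_eq_0) auto
  then show ?thesis by simp
qed

lemma limit_N:
  assumes "\<And>n. x n \<in> V" "l \<in> V" "(\<lambda>n. N (x n - l)) \<longlonglongrightarrow> 0"
  shows "(\<lambda>n. N (x n)) \<longlonglongrightarrow> N l"
proof -
  have "(\<lambda>n. N (x n) - N l) \<longlonglongrightarrow> 0"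
    by (rule Lim_null_comparison[OF _ assms(3)]) (use N_abs_diff assms in auto)
  then show ?thesis by (simp add: LIM_zero_iff)
qed

definition carrier_Cauchy :: "(nat \<Rightarrow> 'v) \<Rightarrow> bool" where
  "carrier_Cauchy x \<longleftrightarrow> (\<forall>e>0. \<exists>M. \<forall>m\<ge>M. \<forall>n\<ge>M. N (x m - x n) < e)"

definition separable :: bool where
  "separable \<longleftrightarrow> (\<exists>d::nat \<Rightarrow> 'v. range d \<subseteq> V \<and> (\<forall>x\<in>V. \<forall>e>0. \<exists>n. N (x - d n) < e))"

lemma space_borel_on [simp]: "space (borel_on V N) = V"
  unfolding borel_on_def by (simp add: space_measure_of_conv)

lemma sets_borel_on:
  "sets (borel_on V N) = sigma_sets V {U. U \<subseteq> V \<and> (\<forall>x\<in>U. \<exists>e>0. \<forall>y\<in>V. N (y - x) < e \<longrightarrow> y \<in> U)}"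
  unfolding borel_on_def by (subst sets_measure_of) auto

lemma open_in_borel_on:
  "U \<subseteq> V \<Longrightarrow> (\<And>x. x \<in> U \<Longrightarrow> \<exists>e>0. \<forall>y\<in>V. N (y - x) < e \<longrightarrow> y \<in> U) \<Longrightarrow> U \<in> sets (borel_on V N)"
  unfolding sets_borel_on by (rule sigma_sets.Basic) auto

lemma measurable_borel_on_real:
  fixes h :: "'v \<Rightarrow> real"
  assumes "\<And>x e. x \<in> V \<Longrightarrow> e > 0 \<Longrightarrow> \<exists>d>0. \<forall>y\<in>V. N (y - x) < d \<longrightarrow> \<bar>h y - h x\<bar> < e"
  shows "h \<in> borel_measurable (borel_on V N)"
proof (rule borel_measurableI)
  fix S :: "real set" assume S: "open S"
  show "h -` S \<inter> space (borel_on V N) \<in> sets (borel_on V N)"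
  proof (rule open_in_borel_on)
    fix x assume x: "x \<in> h -` S \<inter> space (borel_on V N)"
    then obtain e where "e > 0" and e: "\<And>y. \<bar>y - h x\<bar> < e \<Longrightarrow> y \<in> S"
      using S unfolding open_dist dist_real_def by auto
    moreover obtain d where "d > 0" "\<forall>y\<in>V. N (y - x) < d \<longrightarrow> \<bar>h y - h x\<bar> < e"
      using assms[of x e] x \<open>e > 0\<close> by auto
    ultimately show "\<exists>e>0. \<forall>y\<in>V. N (y - x) < e \<longrightarrow> y \<in> h -` S \<inter> space (borel_on V N)"
      by (intro exI[of _ d]) auto
  qed auto
qed

lemma measurable_N_diff:
  assumes "c \<in> V" shows "(\<lambda>x. N (x - c)) \<in> borel_measurable (borel_on V N)"
proof (rule measurable_borel_on_real)
  fix x e assume "x \<in> V" "(e::real) > 0"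
  moreover have "\<bar>N (y - c) - N (x - c)\<bar> \<le> N (y - x)" if "y \<in> V" for y
    using N_abs_diff[of "y - c" "x - c"] that \<open>x \<in> V\<close> assms by simp
  ultimately show "\<exists>d>0. \<forall>y\<in>V. N (y - x) < d \<longrightarrow> \<bar>N (y - c) - N (x - c)\<bar> < e"
    by (intro exI[of _ e]) force
qed

lemma measurable_N: "N \<in> borel_measurable (borel_on V N)"
  using measurable_N_diff[of 0] by simp

lemma measurable_linear_real:
  assumes add: "\<And>x y. x \<in> V \<Longrightarrow> y \<in> V \<Longrightarrow> h (x - y) = h x - (h y :: real)"
    and bound: "\<And>x. x \<in> V \<Longrightarrow> \<bar>h x\<bar> \<le> C * N x"
  shows "h \<in> borel_measurable (borel_on V N)"
proof (rule measurable_borel_on_real)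
  fix x e assume xe: "x \<in> V" "(e::real) > 0"
  \<comment> \<open>\<open>C\<close> is only an upper constant and may be zero or negative;
    \<open>\<bar>C\<bar> + 1\<close> is a positive one, so that the radius \<open>e / K\<close>
    makes sense.\<close>
  define K where "K = \<bar>C\<bar> + 1"
  have K: "K > 0" by (simp add: K_def)
  have "\<bar>h y - h x\<bar> < e" if y: "y \<in> V" "N (y - x) < e / K" for y
  proof -
    have "\<bar>h y - h x\<bar> \<le> C * N (y - x)" using bound[of "y - x"] add y xe by simp
    also have "\<dots> \<le> K * N (y - x)" using N_nonneg[of "y - x"] y xe
      by (intro mult_right_mono) (auto simp: K_def)
    also have "\<dots> < e" using y K by (simp add: pos_less_divide_eq mult.commute)
    finally show ?thesis .
  qed
  then show "\<exists>d>0. \<forall>y\<in>V. N (y - x) < d \<longrightarrow> \<bar>h y - h x\<bar> < e"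
    using xe K by (intro exI[of _ "e / K"]) auto
qed

text \<open>\<open>s\<close> takes finitely many values, and on each of its level sets the function
  is \<open>N (f \<omega> - c)\<close> with a fixed \<open>c\<close>. This replaces joint
  measurability of \<open>N (x - y)\<close> in both arguments.\<close>

lemma measurable_N_diff_simple:
  assumes f: "f \<in> M \<rightarrow>\<^sub>M borel_on V N" and s: "simple_function M s" "s ` space M \<subseteq> V"
  shows "(\<lambda>\<omega>. N (f \<omega> - s \<omega>)) \<in> borel_measurable M"
proof -
  have s': "s \<in> M \<rightarrow>\<^sub>M count_space (s ` space M)"
    using s(1) by (auto simp: simple_function_def measurable_count_space_eq2)
  have "countable (s ` space M)" using s(1) by (simp add: simple_function_def countable_finite)
  then have "(\<lambda>\<omega>. (\<lambda>c \<omega>. N (f \<omega> - c)) (s \<omega>) \<omega>) \<in> borel_measurable M"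
    by (rule measurable_compose_countable'[rotated 2, OF _ ])
       (use s s' in \<open>auto intro!: measurable_compose[OF f measurable_N_diff]\<close>)
  then show ?thesis by simp
qed

text \<open>\<open>s n\<close> is the point nearest to \<open>f\<close> among the first
  \<open>n + 1\<close> terms of a dense sequence that starts with 0. Density gives convergence; the
  presence of 0 gives \<open>N (f \<omega> - s n \<omega>) \<le> N (f \<omega>)\<close>, the
  domination under which limits are taken later.\<close>

lemma simple_approximation:
  assumes "separable" and f: "f \<in> M \<rightarrow>\<^sub>M borel_on V N"
  obtains s where "\<And>n. simple_function M (s n)" "\<And>n. s n ` space M \<subseteq> V"
    and "\<And>n \<omega>. \<omega> \<in> space M \<Longrightarrow> N (f \<omega> - s n \<omega>) \<le> N (f \<omega>)"
    and "\<And>\<omega>. \<omega> \<in> space M \<Longrightarrow> (\<lambda>n. N (f \<omega> - s n \<omega>)) \<longlonglongrightarrow> 0"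
proof -
  obtain d0 where d0: "range d0 \<subseteq> V" "\<And>x e. x \<in> V \<Longrightarrow> e > 0 \<Longrightarrow> \<exists>n::nat. N (x - d0 n) < e"
    using assms(1) unfolding separable_def by metis
  define d where "d n = (if n = 0 then 0 else d0 (n - 1))" for n
  have dV: "d n \<in> V" for n using d0(1) by (auto simp: d_def)
  have dense: "\<exists>n. N (x - d n) < e" if xe: "x \<in> V" "e > 0" for x e
  proof -
    obtain n where "N (x - d0 n) < e" using d0(2) xe by blast
    then show ?thesis by (intro exI[of _ "Suc n"]) (simp add: d_def)
  qed
  \<comment> \<open>Among the indices of nearest points the least one is taken: a
    \<open>LEAST\<close> over measurable conditions is measurable, which an arbitrary choice need
    not be.\<close>
  define J where "J n x = (LEAST j. j \<le> n \<and> (\<forall>i\<le>n. N (x - d j) \<le> N (x - d i)))" for n :: nat and x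
  have Jex: "\<exists>j. j \<le> n \<and> (\<forall>i\<le>n. N (x - d j) \<le> N (x - d i))" for n x
  proof -
    let ?m = "Min ((\<lambda>i. N (x - d i)) ` {..n})"
    have "?m \<in> (\<lambda>i. N (x - d i)) ` {..n}"
      by (rule Min_in) auto
    then obtain j where "?m = N (x - d j)" "j \<in> {..n}" by (rule imageE)
    moreover have "?m \<le> N (x - d i)" if "i \<le> n" for i
      by (rule Min_le) (use that in auto)
    ultimately show ?thesis by (intro exI[of _ j]) auto
  qed
  have J: "J n x \<le> n" "\<And>i. i \<le> n \<Longrightarrow> N (x - d (J n x)) \<le> N (x - d i)" for n x
    using LeastI_ex[OF Jex, of n x] unfolding J_def[symmetric] by auto
  define s where "s n \<omega> = d (J n (f \<omega>))" for n \<omega>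
  have fV: "f \<omega> \<in> V" if "\<omega> \<in> space M" for \<omega>
    using measurable_space[OF f that] by simp
  have [measurable]: "(\<lambda>\<omega>. N (f \<omega> - d i)) \<in> borel_measurable M" for i
    using measurable_compose[OF f measurable_N_diff[OF dV]] .
  have Jm: "(\<lambda>\<omega>. J n (f \<omega>)) \<in> M \<rightarrow>\<^sub>M count_space UNIV" for n
    unfolding J_def by measurable
  have "simple_function M (\<lambda>\<omega>. J n (f \<omega>))" for n
    unfolding simple_function_def
  proof
    have "(\<lambda>\<omega>. J n (f \<omega>)) ` space M \<subseteq> {..n}" using J(1) by auto
    then show "finite ((\<lambda>\<omega>. J n (f \<omega>)) ` space M)" by (rule finite_subset) simp
  qed (use Jm in \<open>auto intro: measurable_sets\<close>)
  then have s1: "simple_function M (s n)" for n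
    unfolding s_def by (rule simple_function_compose1)
  show ?thesis
  proof (rule that[of s])
    show "s n ` space M \<subseteq> V" for n using dV by (auto simp: s_def)
    show "N (f \<omega> - s n \<omega>) \<le> N (f \<omega>)" for n \<omega>
      using J(2)[of 0 n "f \<omega>"] by (simp add: s_def d_def)
    fix \<omega> assume \<omega>: "\<omega> \<in> space M"
    show "(\<lambda>n. N (f \<omega> - s n \<omega>)) \<longlonglongrightarrow> 0"
    proof (rule LIMSEQ_I)
      fix e :: real assume "e > 0"
      then obtain m where m: "N (f \<omega> - d m) < e" using dense[OF fV[OF \<omega>]] by blast
      have "norm (N (f \<omega> - s n \<omega>) - 0) < e" if "n \<ge> m" for n
        using J(2)[OF that, of "f \<omega>"] m N_nonneg[of "f \<omega> - s n \<omega>"] fV[OF \<omega>] dV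
        by (simp add: s_def)
      then show "\<exists>m. \<forall>n\<ge>m. norm (N (f \<omega> - s n \<omega>) - 0) < e" by blast
    qed
  qed (rule s1)
qed

end

locale banach_carrier = normed_carrier +
  assumes complete: "(\<And>n. x n \<in> V) \<Longrightarrow> carrier_Cauchy x \<Longrightarrow> \<exists>l\<in>V. (\<lambda>n. N (x n - l)) \<longlonglongrightarrow> 0"

text \<open>A Cauchy sequence has a subsequence with increments below \<open>(1/2)^k\<close>; its
  telescoping series converges, and the whole sequence follows the subsequence. Both
  \<open>L2\<close> and the nuclear operators are shown to be complete in this way.\<close>

lemma (in normed_carrier) banach_carrierI_series:
  assumes series: "\<And>u. (\<And>n. u n \<in> V) \<Longrightarrow> summable (\<lambda>n. N (u n)) \<Longrightarrow>
     \<exists>l\<in>V. (\<lambda>n. N ((\<Sum>i<n. u i) - l)) \<longlonglongrightarrow> 0"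
  shows "banach_carrier V N"
proof
  fix x assume x: "\<And>n::nat. x n \<in> V" and C: "carrier_Cauchy x"
  have "\<exists>M. \<forall>m\<ge>M. \<forall>n\<ge>M. N (x m - x n) < (1/2)^k" for k :: nat
    using C unfolding carrier_Cauchy_def by auto
  then obtain M where M: "\<And>k m n. m \<ge> M k \<Longrightarrow> n \<ge> M k \<Longrightarrow> N (x m - x n) < (1/2)^k"
    by metis
  \<comment> \<open>The sum puts both \<open>r k\<close> and \<open>r (Suc k)\<close> above
    \<open>M k\<close>, so the \<open>k\<close>-th increment is below \<open>(1/2)^k\<close>; the
    summand \<open>k\<close> makes \<open>r\<close> exceed any given index.\<close>
  define r where "r k = k + (\<Sum>j\<le>k. M j)" for k
  have rM: "r k \<ge> M k" for k
  proof -
    have "M k \<le> (\<Sum>j\<le>k. M j)" by (rule member_le_sum) auto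
    then show ?thesis by (simp add: r_def)
  qed
  have rM': "r (Suc k) \<ge> M k" for k
  proof -
    have "M k \<le> (\<Sum>j\<le>Suc k. M j)" by (rule member_le_sum) auto
    then show ?thesis by (simp add: r_def)
  qed
  define u where "u k = x (r (Suc k)) - x (r k)" for k
  have sum_u: "(\<Sum>i<n. u i) = x (r n) - x (r 0)" for n
    unfolding u_def by (rule sum_lessThan_telescope)
  have "summable (\<lambda>n. N (u n))"
  proof (rule summable_comparison_test)
    show "\<exists>K. \<forall>n\<ge>K. norm (N (u n)) \<le> (1/2)^n"
      using M[OF rM' rM] N_nonneg x by (auto simp: u_def less_imp_le)
  qed (simp add: summable_geometric)
  then obtain l where l: "l \<in> V" "(\<lambda>n. N ((\<Sum>i<n. u i) - l)) \<longlonglongrightarrow> 0"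
    using series[of u] x by (auto simp: u_def)
  define l' where "l' = l + x (r 0)"
  have l': "(\<lambda>n. N (x (r n) - l')) \<longlonglongrightarrow> 0"
    using l(2) unfolding sum_u l'_def by (simp add: algebra_simps)
  have l'V: "l' \<in> V" using l x by (simp add: l'_def)
  have "(\<lambda>n. N (x n - l')) \<longlonglongrightarrow> 0"
  proof (rule LIMSEQ_I)
    fix e :: real assume e: "e > 0"
    then obtain K where K: "\<And>m n. m \<ge> K \<Longrightarrow> n \<ge> K \<Longrightarrow> N (x m - x n) < e/2"
      using C unfolding carrier_Cauchy_def by (meson half_gt_zero)
    obtain L where L': "\<forall>n\<ge>L. norm (N (x (r n) - l') - 0) < e/2"
      using LIMSEQ_D[OF l' half_gt_zero[OF e]] by blast
    have L: "N (x (r n) - l') < e/2" if "n \<ge> L" for n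
      using L'[rule_format, OF that] by simp
    define n0 where "n0 = max K L"
    have "norm (N (x n - l') - 0) < e" if "n \<ge> K" for n
    proof -
      have "r n0 \<ge> K" by (simp add: r_def n0_def)
      then have "N (x n - x (r n0)) < e/2" using K that by blast
      moreover have "N (x (r n0) - l') < e/2" using L by (simp add: n0_def)
      ultimately have "N (x n - l') < e"
        using N_diff_triangle[of "x n" "x (r n0)" l'] x l'V by force
      then show ?thesis using N_nonneg x l'V by simp
    qed
    then show "\<exists>n0. \<forall>n\<ge>n0. norm (N (x n - l') - 0) < e" by blast
  qed
  with l'V show "\<exists>l\<in>V. (\<lambda>n. N (x n - l)) \<longlonglongrightarrow> 0" by blast
qed

lemma (in banach_carrier) series_convergent:
  assumes u: "\<And>n. u n \<in> V" and S: "summable (\<lambda>n. N (u n))"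
  shows "\<exists>l\<in>V. (\<lambda>n. N ((\<Sum>i<n. u i) - l)) \<longlonglongrightarrow> 0"
proof -
  have sV: "(\<Sum>i<n. u i) \<in> V" for n using u by (auto intro: V_sum)
  have "carrier_Cauchy (\<lambda>n. \<Sum>i<n. u i)"
    unfolding carrier_Cauchy_def
  proof (intro allI impI)
    fix e :: real assume "e > 0"
    then obtain M where M: "\<And>m n. m \<ge> M \<Longrightarrow> norm (\<Sum>i=m..<n. N (u i)) < e"
      using S[unfolded summable_Cauchy] by blast
    have *: "N ((\<Sum>i<n. u i) - (\<Sum>i<m. u i)) < e" if "m \<ge> M" "n \<ge> m" for m n
    proof -
      have "(\<Sum>i<n. u i) - (\<Sum>i<m. u i) = (\<Sum>i=m..<n. u i)"
        using that by (metis atLeast0LessThan sum_diff_nat_ivl zero_le)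
      also have "N \<dots> \<le> (\<Sum>i=m..<n. N (u i))" using u by (intro N_sum) auto
      also have "\<dots> < e" using M[OF that(1), of n] by auto
      finally show ?thesis .
    qed
    have "N ((\<Sum>i<n. u i) - (\<Sum>i<m. u i)) < e" if "m \<ge> M" "n \<ge> M" for m n
      using *[of m n] *[of n m] that N_commute[OF sV sV, of n m] by (cases "n \<ge> m") auto
    then show "\<exists>M. \<forall>m\<ge>M. \<forall>n\<ge>M. N ((\<Sum>i<m. u i) - (\<Sum>i<n. u i)) < e" by blast
  qed
  from complete[OF sV this] obtain l where l: "l \<in> V" "(\<lambda>n. N ((\<Sum>i<n. u i) - l)) \<longlonglongrightarrow> 0"
    by blast
  then show ?thesis by blast
qed

section \<open>The Bochner integral on a carrier\<close>

text \<open>Relative to the carrier: operators that are set to 0 off their space, and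
  \<open>wderiv\<close>, which is defined by a description, need not be linear on the whole
  type.\<close>

definition linear_on :: "'v::real_vector set \<Rightarrow> ('v \<Rightarrow> 'u::real_vector) \<Rightarrow> bool" where
  "linear_on V D \<longleftrightarrow> (\<forall>x\<in>V. \<forall>y\<in>V. D (x + y) = D x + D y) \<and> (\<forall>x\<in>V. \<forall>c. D (c *\<^sub>R x) = c *\<^sub>R D x)"

lemma linear_onI:
  "(\<And>x y. x \<in> V \<Longrightarrow> y \<in> V \<Longrightarrow> D (x + y) = D x + D y) \<Longrightarrow>
   (\<And>x c. x \<in> V \<Longrightarrow> D (c *\<^sub>R x) = c *\<^sub>R D x) \<Longrightarrow> linear_on V D"
  by (auto simp: linear_on_def)

lemma linear_on_add: "linear_on V D \<Longrightarrow> x \<in> V \<Longrightarrow> y \<in> V \<Longrightarrow> D (x + y) = D x + D y"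
  and linear_on_scale: "linear_on V D \<Longrightarrow> x \<in> V \<Longrightarrow> D (c *\<^sub>R x) = c *\<^sub>R D x"
  by (auto simp: linear_on_def)

lemma linear_on_diff:
  assumes "subspace V" "linear_on V D" "x \<in> V" "y \<in> V" shows "D (x - y) = D x - D y"
proof -
  have "D (x + (-1) *\<^sub>R y) = D x + (-1) *\<^sub>R D y"
    using assms by (metis linear_on_add linear_on_scale subspace_scale)
  then show ?thesis by simp
qed

lemma linear_on_0: "subspace V \<Longrightarrow> linear_on V D \<Longrightarrow> D 0 = 0"
  using linear_on_diff[of V D 0 0] by (simp add: subspace_0)

lemma linear_on_sum:
  assumes "subspace V" "linear_on V D" "\<And>i. i \<in> I \<Longrightarrow> f i \<in> V"
  shows "D (\<Sum>i\<in>I. c i *\<^sub>R f i) = (\<Sum>i\<in>I. c i *\<^sub>R D (f i))"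
  using assms(3)
proof (induction I rule: infinite_finite_induct)
  case (insert i I)
  then have "D (c i *\<^sub>R f i + (\<Sum>i\<in>I. c i *\<^sub>R f i)) = D (c i *\<^sub>R f i) + D (\<Sum>i\<in>I. c i *\<^sub>R f i)"
    by (intro linear_on_add[OF assms(2)] subspace_sum[OF assms(1)] subspace_scale[OF assms(1)]) auto
  with insert show ?case by (simp add: linear_on_scale[OF assms(2)])
qed (use linear_on_0[OF assms(1,2)] in auto)

lemma (in finite_measure) simple_bochner_integrable_iff:
  "Bochner_Integration.simple_bochner_integrable M f \<longleftrightarrow> simple_function M f"
  by (auto elim: simple_bochner_integrable.cases intro: simple_bochner_integrable.intros)

text \<open>The sum runs over the level sets of \<open>s\<close>, which refine those of the
  composition with \<open>h\<close>. In this form norms and linear maps can be applied term by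
  term.\<close>

lemma (in finite_measure) simple_bochner_integral_comp:
  assumes "simple_function M s"
  shows "Bochner_Integration.simple_bochner_integral M (\<lambda>\<omega>. h (s \<omega>))
      = (\<Sum>y\<in>s ` space M. measure M {x \<in> space M. s x = y} *\<^sub>R h y)"
  by (rule simple_bochner_integral_partition[where g=s])
     (use assms in \<open>auto simp: simple_bochner_integrable_iff intro: simple_function_compose1\<close>)

lemma (in finite_measure) simple_bochner_integral_linear_on:
  assumes "subspace V" "linear_on V D" "simple_function M s" "s ` space M \<subseteq> V"
  shows "Bochner_Integration.simple_bochner_integral M (\<lambda>\<omega>. D (s \<omega>)) = D (Bochner_Integration.simple_bochner_integral M s)"
  unfolding simple_bochner_integral_comp[OF assms(3)]
  unfolding simple_bochner_integral_def
  by (subst linear_on_sum[OF assms(1,2)]) (use assms in auto)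

text \<open>Agreement on \<open>space M\<close> is all that is asked; the identities between centred
  derivatives below are available only there.\<close>

lemma has_bochner_integral_on_cong:
  assumes "\<And>\<omega>. \<omega> \<in> space M \<Longrightarrow> f \<omega> = g \<omega>"
  shows "has_bochner_integral_on M V N f x \<longleftrightarrow> has_bochner_integral_on M V N g x"
proof -
  have "f \<in> M \<rightarrow>\<^sub>M borel_on V N \<longleftrightarrow> g \<in> M \<rightarrow>\<^sub>M borel_on V N"
    by (rule measurable_cong) (rule assms)
  moreover have "(\<integral>\<^sup>+\<omega>. ennreal (N (f \<omega> - s \<omega>)) \<partial>M) = (\<integral>\<^sup>+\<omega>. ennreal (N (g \<omega> - s \<omega>)) \<partial>M)" for s
    by (rule nn_integral_cong) (simp add: assms)
  ultimately show ?thesis unfolding has_bochner_integral_on_def by simp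
qed

lemma bochner_integral_on_cong:
  assumes "\<And>\<omega>. \<omega> \<in> space M \<Longrightarrow> f \<omega> = g \<omega>"
  shows "bochner_integral_on M V N f = bochner_integral_on M V N g"
    and "bochner_integrable_on M V N f \<longleftrightarrow> bochner_integrable_on M V N g"
proof -
  have "has_bochner_integral_on M V N f = has_bochner_integral_on M V N g"
    by (rule ext) (rule has_bochner_integral_on_cong[OF assms])
  then show "bochner_integral_on M V N f = bochner_integral_on M V N g"
    and "bochner_integrable_on M V N f \<longleftrightarrow> bochner_integrable_on M V N g"
    unfolding bochner_integral_on_def bochner_integrable_on_def by (simp_all only:)
qed

lemma has_bochner_integral_onD:
  assumes "has_bochner_integral_on M V N f x"
  shows "x \<in> V" "f \<in> M \<rightarrow>\<^sub>M borel_on V N"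
  using assms by (auto simp: has_bochner_integral_on_def)

lemma has_bochner_integral_onE:
  assumes "finite_measure M" and h: "has_bochner_integral_on M V N f x"
  obtains s where "\<And>i. simple_function M (s i)" "\<And>i. s i ` space M \<subseteq> V"
    "(\<lambda>i. \<integral>\<^sup>+\<omega>. ennreal (N (f \<omega> - s i \<omega>)) \<partial>M) \<longlonglongrightarrow> 0"
    "(\<lambda>i. N (Bochner_Integration.simple_bochner_integral M (s i) - x)) \<longlonglongrightarrow> 0" "x \<in> V" "f \<in> M \<rightarrow>\<^sub>M borel_on V N"
proof -
  interpret finite_measure M by fact
  from h obtain s where *: "\<forall>i. Bochner_Integration.simple_bochner_integrable M (s i) \<and> s i ` space M \<subseteq> V"
    "(\<lambda>i. \<integral>\<^sup>+\<omega>. ennreal (N (f \<omega> - s i \<omega>)) \<partial>M) \<longlonglongrightarrow> 0"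
    "(\<lambda>i. N (Bochner_Integration.simple_bochner_integral M (s i) - x)) \<longlonglongrightarrow> 0" "x \<in> V" "f \<in> M \<rightarrow>\<^sub>M borel_on V N"
    unfolding has_bochner_integral_on_def by (elim conjE exE) (rule that)
  have "simple_function M (s i)" "s i ` space M \<subseteq> V" for i
    using *(1) by (simp_all add: simple_bochner_integrable_iff)
  from that[OF this *(2-5)] show thesis .
qed

section \<open>Measurability of continuous maps between carriers\<close>

lemma measurable_continuous_carrier:
  assumes "normed_carrier V N" "normed_carrier W K" "\<And>x. x \<in> V \<Longrightarrow> Q x \<in> W"
    and cont: "\<And>x e. x \<in> V \<Longrightarrow> e > 0 \<Longrightarrow> \<exists>d>0. \<forall>y\<in>V. N (y - x) < d \<longrightarrow> K (Q y - Q x) < e"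
  shows "Q \<in> borel_on V N \<rightarrow>\<^sub>M borel_on W K"
proof -
  interpret V: normed_carrier V N by fact
  interpret W: normed_carrier W K by fact
  show ?thesis unfolding borel_on_def[of W K]
  proof (rule measurable_measure_of)
    fix U assume "U \<in> {U. U \<subseteq> W \<and> (\<forall>x\<in>U. \<exists>e>0. \<forall>y\<in>W. K (y - x) < e \<longrightarrow> y \<in> U)}"
    then have U: "U \<subseteq> W" "\<And>x. x \<in> U \<Longrightarrow> \<exists>e>0. \<forall>y\<in>W. K (y - x) < e \<longrightarrow> y \<in> U" by auto
    show "Q -` U \<inter> space (borel_on V N) \<in> sets (borel_on V N)"
    proof (rule V.open_in_borel_on)
      fix x assume x: "x \<in> Q -` U \<inter> space (borel_on V N)"
      then obtain e where e: "e > 0" "\<forall>y\<in>W. K (y - Q x) < e \<longrightarrow> y \<in> U" using U(2)[of "Q x"] by auto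
      obtain d where d: "d > 0" "\<forall>y\<in>V. N (y - x) < d \<longrightarrow> K (Q y - Q x) < e"
        using cont[of x e] e x by auto
      then show "\<exists>e>0. \<forall>y\<in>V. N (y - x) < e \<longrightarrow> y \<in> Q -` U \<inter> space (borel_on V N)"
        using e assms(3) by (intro exI[of _ d]) auto
    qed auto
  qed (use assms(3) in auto)
qed

lemma measurable_lipschitz_carrier:
  assumes "normed_carrier V N" "normed_carrier W K" "\<And>x. x \<in> V \<Longrightarrow> Q x \<in> W"
    and lip: "\<And>x y. x \<in> V \<Longrightarrow> y \<in> V \<Longrightarrow> K (Q x - Q y) \<le> C * N (x - y)"
  shows "Q \<in> borel_on V N \<rightarrow>\<^sub>M borel_on W K"
proof (rule measurable_continuous_carrier[OF assms(1-3)])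
  interpret V: normed_carrier V N by fact
  fix x e assume xe: "x \<in> V" "(e::real) > 0"
  define L where "L = \<bar>C\<bar> + 1"
  have L: "L > 0" by (simp add: L_def)
  have "K (Q y - Q x) < e" if y: "y \<in> V" "N (y - x) < e / L" for y
  proof -
    have "K (Q y - Q x) \<le> C * N (y - x)" using lip y xe by simp
    also have "\<dots> \<le> L * N (y - x)" using V.N_nonneg[of "y - x"] y xe
      by (intro mult_right_mono) (auto simp: L_def)
    also have "\<dots> < e" using y L by (simp add: pos_less_divide_eq mult.commute)
    finally show ?thesis .
  qed
  then show "\<exists>d>0. \<forall>y\<in>V. N (y - x) < d \<longrightarrow> K (Q y - Q x) < e"
    using xe L by (intro exI[of _ "e / L"]) auto
qed simp

text \<open>The bound is the one satisfied by \<open>B x x\<close> for a bilinear \<open>B\<close>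
  of norm at most 1, such as the tensor square. Such maps are continuous, but in general not
  Lipschitz.\<close>

lemma measurable_quadratic_carrier:
  assumes "normed_carrier V N" "normed_carrier W K" "\<And>x. x \<in> V \<Longrightarrow> Q x \<in> W"
    and quad: "\<And>x y. x \<in> V \<Longrightarrow> y \<in> V \<Longrightarrow> K (Q x - Q y) \<le> N (x - y) * (N x + N y)"
  shows "Q \<in> borel_on V N \<rightarrow>\<^sub>M borel_on W K"
proof (rule measurable_continuous_carrier[OF assms(1-3)])
  interpret V: normed_carrier V N by fact
  fix x e assume xe: "x \<in> V" "(e::real) > 0"
  \<comment> \<open>Within distance 1 of \<open>x\<close> one has \<open>N y \<le> N x + 1\<close>,
    hence \<open>N y + N x \<le> L\<close>; this is why the radius is capped by 1.\<close>
  define L where "L = 2 * N x + 1"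
  have L: "L > 0" using V.N_nonneg xe by (simp add: L_def add_nonneg_pos)
  have "K (Q y - Q x) < e" if y: "y \<in> V" "N (y - x) < min 1 (e / L)" for y
  proof -
    have "K (Q y - Q x) \<le> N (y - x) * (N y + N x)" using quad y xe by simp
    also have "\<dots> \<le> N (y - x) * L" using V.N_nonneg[of "y - x"] V.N_le_diff[of y x] y xe
      by (intro mult_left_mono) (auto simp: L_def)
    also have "\<dots> < e" using y L by (simp add: pos_less_divide_eq)
    finally show ?thesis .
  qed
  then show "\<exists>d>0. \<forall>y\<in>V. N (y - x) < d \<longrightarrow> K (Q y - Q x) < e"
    using xe L by (intro exI[of _ "min 1 (e / L)"]) auto
qed simp

section \<open>The Bochner integral: uniqueness, norm bound, bounded linear maps\<close>

context normed_carrier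
begin

lemma measurable_translate:
  assumes "f \<in> M \<rightarrow>\<^sub>M borel_on V N" "c \<in> V"
  shows "(\<lambda>\<omega>. f \<omega> - c) \<in> M \<rightarrow>\<^sub>M borel_on V N"
  by (rule measurable_compose[OF assms(1)],
      rule measurable_lipschitz_carrier[where C=1, OF normed_carrier_axioms normed_carrier_axioms])
     (use assms in auto)

lemma simple_integral_in_V: "s ` space M \<subseteq> V \<Longrightarrow> Bochner_Integration.simple_bochner_integral M s \<in> V"
  unfolding simple_bochner_integral_def by (intro V_sum V_scale) auto

lemma N_simple_integral_le:
  assumes "finite_measure M" "simple_function M s" "s ` space M \<subseteq> V"
  shows "ennreal (N (Bochner_Integration.simple_bochner_integral M s)) \<le> (\<integral>\<^sup>+\<omega>. ennreal (N (s \<omega>)) \<partial>M)"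
proof -
  interpret finite_measure M by fact
  have "N (Bochner_Integration.simple_bochner_integral M s) \<le> (\<Sum>y\<in>s ` space M. N (measure M {x \<in> space M. s x = y} *\<^sub>R y))"
    unfolding simple_bochner_integral_def using assms by (intro N_sum V_scale) auto
  \<comment> \<open>Off \<open>V\<close> nothing is known about the sign of \<open>N\<close>; the
    absolute value yields an integrand that is nonnegative at every point, also outside
    \<open>space M\<close>.\<close>
  also have "\<dots> = (\<Sum>y\<in>s ` space M. measure M {x \<in> space M. s x = y} *\<^sub>R \<bar>N y\<bar>)"
    using assms by (intro sum.cong refl) (auto simp: N_scale N_nonneg)
  also have "\<dots> = Bochner_Integration.simple_bochner_integral M (\<lambda>\<omega>. \<bar>N (s \<omega>)\<bar>)"
    by (rule simple_bochner_integral_comp[symmetric, OF assms(2)])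
  finally have "ennreal (N (Bochner_Integration.simple_bochner_integral M s)) \<le> ennreal (Bochner_Integration.simple_bochner_integral M (\<lambda>\<omega>. \<bar>N (s \<omega>)\<bar>))"
    by (rule ennreal_leI)
  also have "\<dots> = (\<integral>\<^sup>+\<omega>. ennreal \<bar>N (s \<omega>)\<bar> \<partial>M)"
    using simple_function_compose1[OF assms(2), of "\<lambda>y. \<bar>N y\<bar>"]
    by (intro simple_bochner_integral_eq_nn_integral) (auto simp: simple_bochner_integrable_iff)
  also have "\<dots> = (\<integral>\<^sup>+\<omega>. ennreal (N (s \<omega>)) \<partial>M)"
    using assms by (intro nn_integral_cong) (auto simp: N_nonneg)
  finally show ?thesis .
qed

text \<open>The triangle inequality through \<open>f\<close>. This one estimate gives the uniqueness
  of the integral, its norm bound (with one of the functions zero) and the Cauchy property behind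
  existence.\<close>

lemma N_simple_integral_diff:
  assumes M: "finite_measure M" and f: "f \<in> M \<rightarrow>\<^sub>M borel_on V N"
    and s: "simple_function M s" "s ` space M \<subseteq> V" and t: "simple_function M t" "t ` space M \<subseteq> V"
  shows "ennreal (N (Bochner_Integration.simple_bochner_integral M s - Bochner_Integration.simple_bochner_integral M t))
     \<le> (\<integral>\<^sup>+\<omega>. ennreal (N (f \<omega> - s \<omega>)) \<partial>M) + (\<integral>\<^sup>+\<omega>. ennreal (N (f \<omega> - t \<omega>)) \<partial>M)"
proof -
  interpret finite_measure M by fact
  have [measurable]: "(\<lambda>\<omega>. N (f \<omega> - s \<omega>)) \<in> borel_measurable M" "(\<lambda>\<omega>. N (f \<omega> - t \<omega>)) \<in> borel_measurable M"
    using s t f by (auto intro: measurable_N_diff_simple)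
  have fV: "f \<omega> \<in> V" if "\<omega> \<in> space M" for \<omega> using measurable_space[OF f that] by simp
  have "Bochner_Integration.simple_bochner_integral M s - Bochner_Integration.simple_bochner_integral M t = Bochner_Integration.simple_bochner_integral M (\<lambda>\<omega>. s \<omega> - t \<omega>)"
    using s t by (intro simple_bochner_integral_diff[symmetric]) (auto simp: simple_bochner_integrable_iff)
  also have "ennreal (N \<dots>) \<le> (\<integral>\<^sup>+\<omega>. ennreal (N (s \<omega> - t \<omega>)) \<partial>M)"
    using s t by (intro N_simple_integral_le M simple_function_diff) (auto simp: image_subset_iff)
  also have "\<dots> \<le> (\<integral>\<^sup>+\<omega>. ennreal (N (f \<omega> - s \<omega>)) + ennreal (N (f \<omega> - t \<omega>)) \<partial>M)"
  proof (rule nn_integral_mono)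
    fix \<omega> assume w: "\<omega> \<in> space M"
    have "N (s \<omega> - t \<omega>) \<le> N (f \<omega> - s \<omega>) + N (f \<omega> - t \<omega>)"
      using N_diff_triangle[of "s \<omega>" "f \<omega>" "t \<omega>"] N_commute[of "s \<omega>" "f \<omega>"] w s t fV by (auto simp: image_subset_iff)
    then show "ennreal (N (s \<omega> - t \<omega>)) \<le> ennreal (N (f \<omega> - s \<omega>)) + ennreal (N (f \<omega> - t \<omega>))"
      using w s t fV by (subst ennreal_plus[symmetric]) (auto simp: image_subset_iff intro!: N_nonneg ennreal_leI)
  qed
  also have "\<dots> = (\<integral>\<^sup>+\<omega>. ennreal (N (f \<omega> - s \<omega>)) \<partial>M) + (\<integral>\<^sup>+\<omega>. ennreal (N (f \<omega> - t \<omega>)) \<partial>M)"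
    by (rule nn_integral_add) auto
  finally show ?thesis .
qed

lemma ennreal_tendsto_0_iff:
  assumes "\<And>n. 0 \<le> g n" shows "(\<lambda>n. ennreal (g n)) \<longlonglongrightarrow> 0 \<longleftrightarrow> g \<longlonglongrightarrow> 0"
  using tendsto_ennreal_iff[of g sequentially 0] assms by auto

lemma has_bochner_integral_on_unique:
  assumes "finite_measure M" "has_bochner_integral_on M V N f x" "has_bochner_integral_on M V N f y"
  shows "x = y"
proof -
  interpret finite_measure M by fact
  from assms(2) obtain s where s: "\<And>i. simple_function M (s i)" "\<And>i. s i ` space M \<subseteq> V"
    "(\<lambda>i. \<integral>\<^sup>+\<omega>. ennreal (N (f \<omega> - s i \<omega>)) \<partial>M) \<longlonglongrightarrow> 0"
    "(\<lambda>i. N (Bochner_Integration.simple_bochner_integral M (s i) - x)) \<longlonglongrightarrow> 0" and f: "x \<in> V" "f \<in> M \<rightarrow>\<^sub>M borel_on V N"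
    by (rule has_bochner_integral_onE[OF finite_measure_axioms]) blast
  from assms(3) obtain t where t: "\<And>i. simple_function M (t i)" "\<And>i. t i ` space M \<subseteq> V"
    "(\<lambda>i. \<integral>\<^sup>+\<omega>. ennreal (N (f \<omega> - t i \<omega>)) \<partial>M) \<longlonglongrightarrow> 0"
    "(\<lambda>i. N (Bochner_Integration.simple_bochner_integral M (t i) - y)) \<longlonglongrightarrow> 0" "y \<in> V" "f \<in> M \<rightarrow>\<^sub>M borel_on V N"
    by (rule has_bochner_integral_onE[OF finite_measure_axioms]) blast
  let ?S = "\<lambda>i. Bochner_Integration.simple_bochner_integral M (s i)" and ?T = "\<lambda>i. Bochner_Integration.simple_bochner_integral M (t i)"
  have V: "?S i \<in> V" "?T i \<in> V" for i by (intro simple_integral_in_V s t)+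
  have "(\<lambda>i. ennreal (N (?S i - ?T i))) \<longlonglongrightarrow> 0"
  proof (rule tendsto_sandwich[OF _ _ tendsto_const])
    show "(\<lambda>i. (\<integral>\<^sup>+\<omega>. ennreal (N (f \<omega> - s i \<omega>)) \<partial>M) + (\<integral>\<^sup>+\<omega>. ennreal (N (f \<omega> - t i \<omega>)) \<partial>M)) \<longlonglongrightarrow> 0"
      using tendsto_add[OF s(3) t(3)] by simp
  qed (use N_simple_integral_diff[OF assms(1) f(2)] s t in auto)
  then have 1: "(\<lambda>i. N (?S i - ?T i)) \<longlonglongrightarrow> 0"
    using V by (subst (asm) ennreal_tendsto_0_iff) (auto intro: N_nonneg)
  have "(\<lambda>i. N (?S i - y)) \<longlonglongrightarrow> 0"
  proof (rule Lim_null_comparison)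
    show "(\<lambda>i. N (?S i - ?T i) + N (?T i - y)) \<longlonglongrightarrow> 0" using tendsto_add[OF 1 t(4)] by simp
    show "\<forall>\<^sub>F i in sequentially. norm (N (?S i - y)) \<le> N (?S i - ?T i) + N (?T i - y)"
      using V t(5) N_diff_triangle N_nonneg by simp
  qed
  from limit_unique[OF V(1) f(1) t(5) s(4) this] show ?thesis .
qed

lemma bochner_integral_on_eq:
  assumes "finite_measure M" "has_bochner_integral_on M V N f x"
  shows "bochner_integral_on M V N f = x"
  using assms has_bochner_integral_on_unique[OF assms(1)]
  unfolding bochner_integral_on_def bochner_integrable_on_def by (auto intro: the_equality)

lemma has_bochner_integral_on_integral:
  assumes "finite_measure M" "bochner_integrable_on M V N f"
  shows "has_bochner_integral_on M V N f (bochner_integral_on M V N f)"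
  using assms bochner_integral_on_eq unfolding bochner_integrable_on_def by metis

lemma N_bochner_integral_le:
  assumes "finite_measure M" "has_bochner_integral_on M V N f x"
  shows "ennreal (N x) \<le> (\<integral>\<^sup>+\<omega>. ennreal (N (f \<omega>)) \<partial>M)"
proof -
  interpret finite_measure M by fact
  from assms(2) obtain s where s: "\<And>i. simple_function M (s i)" "\<And>i. s i ` space M \<subseteq> V"
    "(\<lambda>i. \<integral>\<^sup>+\<omega>. ennreal (N (f \<omega> - s i \<omega>)) \<partial>M) \<longlonglongrightarrow> 0"
    "(\<lambda>i. N (Bochner_Integration.simple_bochner_integral M (s i) - x)) \<longlonglongrightarrow> 0" and f: "x \<in> V" "f \<in> M \<rightarrow>\<^sub>M borel_on V N"
    by (rule has_bochner_integral_onE[OF finite_measure_axioms]) blast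
  let ?S = "\<lambda>i. Bochner_Integration.simple_bochner_integral M (s i)"
  have V: "?S i \<in> V" for i by (intro simple_integral_in_V s)
  have "(\<lambda>i. ennreal (N (?S i))) \<longlonglongrightarrow> ennreal (N x)"
    using limit_N[OF V f(1) s(4)] by (rule tendsto_ennrealI)
  moreover have "(\<lambda>i. (\<integral>\<^sup>+\<omega>. ennreal (N (f \<omega> - 0)) \<partial>M) + (\<integral>\<^sup>+\<omega>. ennreal (N (f \<omega> - s i \<omega>)) \<partial>M))
      \<longlonglongrightarrow> (\<integral>\<^sup>+\<omega>. ennreal (N (f \<omega> - 0)) \<partial>M) + 0"
    by (rule tendsto_add[OF tendsto_const s(3)])
  moreover have "ennreal (N (?S i)) \<le> (\<integral>\<^sup>+\<omega>. ennreal (N (f \<omega> - 0)) \<partial>M) + (\<integral>\<^sup>+\<omega>. ennreal (N (f \<omega> - s i \<omega>)) \<partial>M)" for i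
  proof -
    have "Bochner_Integration.simple_bochner_integral M (\<lambda>_. 0::'v) = 0"
      unfolding simple_bochner_integral_def by (rule sum.neutral) auto
    then show ?thesis
      using N_simple_integral_diff[OF assms(1) f(2), of "\<lambda>_. 0" "s i"] s V[of i]
      by (simp add: N_uminus image_subset_iff)
  qed
  ultimately have "ennreal (N x) \<le> (\<integral>\<^sup>+\<omega>. ennreal (N (f \<omega> - 0)) \<partial>M) + 0"
    by (intro LIMSEQ_le) auto
  then show ?thesis by simp
qed

text \<open>If \<open>s i\<close> approximates \<open>f\<close>, then
  \<open>h (s i \<omega>)\<close> approximates \<open>h (f \<omega>)\<close> with the error
  multiplied by at most \<open>\<bar>C\<bar>\<close>. The conclusion is about the scalar integral of
  the library, in which all matrix coefficients are evaluated.\<close>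

lemma has_bochner_integral_linear_real:
  assumes M: "finite_measure M" and h: "has_bochner_integral_on M V N f x"
    and lin: "linear_on V h" and bd: "\<And>x. x \<in> V \<Longrightarrow> \<bar>h x\<bar> \<le> C * N x"
  shows "has_bochner_integral M (\<lambda>\<omega>. h (f \<omega>)) (h x :: real)"
proof -
  interpret finite_measure M by fact
  from h obtain s where s: "\<And>i. simple_function M (s i)" "\<And>i. s i ` space M \<subseteq> V"
    "(\<lambda>i. \<integral>\<^sup>+\<omega>. ennreal (N (f \<omega> - s i \<omega>)) \<partial>M) \<longlonglongrightarrow> 0"
    "(\<lambda>i. N (Bochner_Integration.simple_bochner_integral M (s i) - x)) \<longlonglongrightarrow> 0" and f: "x \<in> V" "f \<in> M \<rightarrow>\<^sub>M borel_on V N"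
    by (rule has_bochner_integral_onE[OF finite_measure_axioms]) blast
  let ?S = "\<lambda>i. Bochner_Integration.simple_bochner_integral M (s i)"
  have V: "?S i \<in> V" for i by (intro simple_integral_in_V s)
  have fV: "f \<omega> \<in> V" if "\<omega> \<in> space M" for \<omega> using measurable_space[OF f(2) that] by simp
  have diff: "h (x - y) = h x - h y" if "x \<in> V" "y \<in> V" for x y
    using linear_on_diff[OF subspace_V lin that] .
  have meas: "(\<lambda>\<omega>. h (f \<omega>)) \<in> borel_measurable M"
    by (rule measurable_compose[OF f(2) measurable_linear_real[OF diff bd]])
  have [measurable]: "(\<lambda>\<omega>. N (f \<omega> - s i \<omega>)) \<in> borel_measurable M" for i
    using s f by (intro measurable_N_diff_simple)
  show ?thesis
  proof (rule has_bochner_integral.intros[where s="\<lambda>i \<omega>. h (s i \<omega>)"])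
    show "Bochner_Integration.simple_bochner_integrable M (\<lambda>\<omega>. h (s i \<omega>))" for i
      using s by (auto simp: simple_bochner_integrable_iff intro: simple_function_compose1)
    have "(\<lambda>i. ennreal \<bar>C\<bar> * \<integral>\<^sup>+\<omega>. ennreal (N (f \<omega> - s i \<omega>)) \<partial>M) \<longlonglongrightarrow> ennreal \<bar>C\<bar> * 0"
      by (intro ennreal_tendsto_cmult s(3)) simp
    then have up: "(\<lambda>i. ennreal \<bar>C\<bar> * \<integral>\<^sup>+\<omega>. ennreal (N (f \<omega> - s i \<omega>)) \<partial>M) \<longlonglongrightarrow> 0" by simp
    show "(\<lambda>i. \<integral>\<^sup>+\<omega>. ennreal (norm (h (f \<omega>) - h (s i \<omega>))) \<partial>M) \<longlonglongrightarrow> 0"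
    proof (rule tendsto_sandwich[OF _ _ tendsto_const up])
      have "(\<integral>\<^sup>+\<omega>. ennreal (norm (h (f \<omega>) - h (s i \<omega>))) \<partial>M)
         \<le> (\<integral>\<^sup>+\<omega>. ennreal \<bar>C\<bar> * ennreal (N (f \<omega> - s i \<omega>)) \<partial>M)" for i
      proof (rule nn_integral_mono)
        fix \<omega> assume w: "\<omega> \<in> space M"
        have sV: "s i \<omega> \<in> V" using s(2)[of i] w by auto
        then have "norm (h (f \<omega>) - h (s i \<omega>)) \<le> C * N (f \<omega> - s i \<omega>)"
          using bd[of "f \<omega> - s i \<omega>"] diff[of "f \<omega>" "s i \<omega>"] fV[OF w] by simp
        also have "\<dots> \<le> \<bar>C\<bar> * N (f \<omega> - s i \<omega>)"
          using N_nonneg[of "f \<omega> - s i \<omega>"] sV fV[OF w] by (intro mult_right_mono) auto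
        finally show "ennreal (norm (h (f \<omega>) - h (s i \<omega>))) \<le> ennreal \<bar>C\<bar> * ennreal (N (f \<omega> - s i \<omega>))"
          using N_nonneg[of "f \<omega> - s i \<omega>"] sV fV[OF w] by (subst ennreal_mult[symmetric]) (auto intro: ennreal_leI)
      qed
      also have "(\<integral>\<^sup>+\<omega>. ennreal \<bar>C\<bar> * ennreal (N (f \<omega> - s i \<omega>)) \<partial>M) =
          ennreal \<bar>C\<bar> * \<integral>\<^sup>+\<omega>. ennreal (N (f \<omega> - s i \<omega>)) \<partial>M" for i
        by (rule nn_integral_cmult) simp
      finally show "\<forall>\<^sub>F i in sequentially. (\<integral>\<^sup>+\<omega>. ennreal (norm (h (f \<omega>) - h (s i \<omega>))) \<partial>M)
         \<le> ennreal \<bar>C\<bar> * \<integral>\<^sup>+\<omega>. ennreal (N (f \<omega> - s i \<omega>)) \<partial>M" by simp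
    qed auto
    have "(\<lambda>i. h (?S i)) \<longlonglongrightarrow> h x"
    proof (rule LIM_zero_cancel, rule Lim_null_comparison)
      show "(\<lambda>i. C * N (?S i - x)) \<longlonglongrightarrow> 0" using tendsto_mult_left[OF s(4), of C] by simp
      show "\<forall>\<^sub>F i in sequentially. norm (h (?S i) - h x) \<le> C * N (?S i - x)"
        using bd[of "?S i - x" for i] diff[OF V f(1)] V f(1) by simp
    qed
    then show "(\<lambda>i. Bochner_Integration.simple_bochner_integral M (\<lambda>\<omega>. h (s i \<omega>))) \<longlonglongrightarrow> h x"
      using simple_bochner_integral_linear_on[OF subspace_V lin s(1,2)] by simp
  qed (rule meas)
qed

end

text \<open>The argument for functionals, with values in a second carrier. It is applied to weak
  derivatives as maps from the Sobolev space to \<open>L2\<close> and yields the mean of a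
  derivative.\<close>

lemma has_bochner_integral_on_linear:
  assumes "normed_carrier V N" "normed_carrier W K"
    and M: "finite_measure M" and h: "has_bochner_integral_on M V N f x"
    and DW: "\<And>x. x \<in> V \<Longrightarrow> D x \<in> W" and lin: "linear_on V D" and bd: "\<And>x. x \<in> V \<Longrightarrow> K (D x) \<le> C * N x"
  shows "has_bochner_integral_on M W K (\<lambda>\<omega>. D (f \<omega>)) (D x)"
proof -
  interpret finite_measure M by fact
  interpret V: normed_carrier V N by fact
  interpret W: normed_carrier W K by fact
  from h obtain s where s: "\<And>i. simple_function M (s i)" "\<And>i. s i ` space M \<subseteq> V"
    "(\<lambda>i. \<integral>\<^sup>+\<omega>. ennreal (N (f \<omega> - s i \<omega>)) \<partial>M) \<longlonglongrightarrow> 0"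
    "(\<lambda>i. N (Bochner_Integration.simple_bochner_integral M (s i) - x)) \<longlonglongrightarrow> 0" and f: "x \<in> V" "f \<in> M \<rightarrow>\<^sub>M borel_on V N"
    by (rule has_bochner_integral_onE[OF finite_measure_axioms]) blast
  let ?S = "\<lambda>i. Bochner_Integration.simple_bochner_integral M (s i)"
  have VS: "?S i \<in> V" for i by (intro V.simple_integral_in_V s)
  have fV: "f \<omega> \<in> V" if "\<omega> \<in> space M" for \<omega> using measurable_space[OF f(2) that] by simp
  have diff: "D (x - y) = D x - D y" if "x \<in> V" "y \<in> V" for x y
    using linear_on_diff[OF V.subspace_V lin that] .
  have lip: "K (D x - D y) \<le> C * N (x - y)" if "x \<in> V" "y \<in> V" for x y
    using bd[of "x - y"] diff that by simp
  have meas: "(\<lambda>\<omega>. D (f \<omega>)) \<in> M \<rightarrow>\<^sub>M borel_on W K"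
    by (rule measurable_compose[OF f(2) measurable_lipschitz_carrier[OF assms(1,2) DW lip]])
  have [measurable]: "(\<lambda>\<omega>. N (f \<omega> - s i \<omega>)) \<in> borel_measurable M" for i
    using s f by (intro V.measurable_N_diff_simple)
  show ?thesis
    unfolding has_bochner_integral_on_def
  proof (intro conjI exI[of _ "\<lambda>i \<omega>. D (s i \<omega>)"] allI meas DW f(1))
    show "Bochner_Integration.simple_bochner_integrable M (\<lambda>\<omega>. D (s i \<omega>))" for i
      using s by (auto simp: simple_bochner_integrable_iff intro: simple_function_compose1)
    show "(\<lambda>\<omega>. D (s i \<omega>)) ` space M \<subseteq> W" for i using s(2)[of i] DW by auto
    have "(\<lambda>i. ennreal \<bar>C\<bar> * \<integral>\<^sup>+\<omega>. ennreal (N (f \<omega> - s i \<omega>)) \<partial>M) \<longlonglongrightarrow> ennreal \<bar>C\<bar> * 0"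
      by (intro ennreal_tendsto_cmult s(3)) simp
    then have up: "(\<lambda>i. ennreal \<bar>C\<bar> * \<integral>\<^sup>+\<omega>. ennreal (N (f \<omega> - s i \<omega>)) \<partial>M) \<longlonglongrightarrow> 0" by simp
    show "(\<lambda>i. \<integral>\<^sup>+\<omega>. ennreal (K (D (f \<omega>) - D (s i \<omega>))) \<partial>M) \<longlonglongrightarrow> 0"
    proof (rule tendsto_sandwich[OF _ _ tendsto_const up])
      have "(\<integral>\<^sup>+\<omega>. ennreal (K (D (f \<omega>) - D (s i \<omega>))) \<partial>M)
         \<le> (\<integral>\<^sup>+\<omega>. ennreal \<bar>C\<bar> * ennreal (N (f \<omega> - s i \<omega>)) \<partial>M)" for i
      proof (rule nn_integral_mono)
        fix \<omega> assume w: "\<omega> \<in> space M"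
        have sV: "s i \<omega> \<in> V" using s(2)[of i] w by auto
        then have "K (D (f \<omega>) - D (s i \<omega>)) \<le> C * N (f \<omega> - s i \<omega>)"
          using lip[OF fV[OF w]] by simp
        also have "\<dots> \<le> \<bar>C\<bar> * N (f \<omega> - s i \<omega>)"
          using V.N_nonneg[of "f \<omega> - s i \<omega>"] sV fV[OF w] by (intro mult_right_mono) auto
        finally show "ennreal (K (D (f \<omega>) - D (s i \<omega>))) \<le> ennreal \<bar>C\<bar> * ennreal (N (f \<omega> - s i \<omega>))"
          using V.N_nonneg[of "f \<omega> - s i \<omega>"] sV fV[OF w] by (subst ennreal_mult[symmetric]) (auto intro: ennreal_leI)
      qed
      also have "(\<integral>\<^sup>+\<omega>. ennreal \<bar>C\<bar> * ennreal (N (f \<omega> - s i \<omega>)) \<partial>M) =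
          ennreal \<bar>C\<bar> * \<integral>\<^sup>+\<omega>. ennreal (N (f \<omega> - s i \<omega>)) \<partial>M" for i
        by (rule nn_integral_cmult) simp
      finally show "\<forall>\<^sub>F i in sequentially. (\<integral>\<^sup>+\<omega>. ennreal (K (D (f \<omega>) - D (s i \<omega>))) \<partial>M)
         \<le> ennreal \<bar>C\<bar> * \<integral>\<^sup>+\<omega>. ennreal (N (f \<omega> - s i \<omega>)) \<partial>M" by simp
    qed auto
    have "(\<lambda>i. K (D (?S i) - D x)) \<longlonglongrightarrow> 0"
    proof (rule Lim_null_comparison)
      show "(\<lambda>i. C * N (?S i - x)) \<longlonglongrightarrow> 0" using tendsto_mult_left[OF s(4), of C] by simp
      show "\<forall>\<^sub>F i in sequentially. norm (K (D (?S i) - D x)) \<le> C * N (?S i - x)"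
        using lip[OF VS f(1)] W.N_nonneg VS f(1) DW by simp
    qed
    then show "(\<lambda>i. K (Bochner_Integration.simple_bochner_integral M (\<lambda>\<omega>. D (s i \<omega>)) - D x)) \<longlonglongrightarrow> 0"
      using simple_bochner_integral_linear_on[OF V.subspace_V lin s(1,2)] by simp
  qed
qed

text \<open>By \<open>N_simple_integral_diff\<close> the integrals of the approximating functions
  form a Cauchy sequence, and completeness provides their limit, which is then the integral of
  \<open>f\<close>.\<close>

lemma (in banach_carrier) bochner_integrable_onI:
  assumes M: "finite_measure M" and f: "f \<in> M \<rightarrow>\<^sub>M borel_on V N"
    and s: "\<And>i. simple_function M (s i)" "\<And>i. s i ` space M \<subseteq> V"
    and lim: "(\<lambda>i. \<integral>\<^sup>+\<omega>. ennreal (N (f \<omega> - s i \<omega>)) \<partial>M) \<longlonglongrightarrow> 0"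
  shows "bochner_integrable_on M V N f"
proof -
  interpret finite_measure M by fact
  let ?S = "\<lambda>i. Bochner_Integration.simple_bochner_integral M (s i)"
  have VS: "?S i \<in> V" for i by (intro simple_integral_in_V s)
  have "carrier_Cauchy ?S"
    unfolding carrier_Cauchy_def
  proof (intro allI impI)
    fix e :: real assume e: "e > 0"
    then have "\<forall>\<^sub>F i in sequentially. (\<integral>\<^sup>+\<omega>. ennreal (N (f \<omega> - s i \<omega>)) \<partial>M) < ennreal (e / 2)"
      using lim by (intro order_tendstoD) auto
    then obtain n0 where n0: "\<And>i. i \<ge> n0 \<Longrightarrow> (\<integral>\<^sup>+\<omega>. ennreal (N (f \<omega> - s i \<omega>)) \<partial>M) < ennreal (e / 2)"
      unfolding eventually_sequentially by blast
    have "N (?S m - ?S n) < e" if "m \<ge> n0" "n \<ge> n0" for m n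
    proof -
      have "ennreal (N (?S m - ?S n)) < ennreal (e/2) + ennreal (e/2)"
        using N_simple_integral_diff[OF M f s s, of m n] n0[OF that(1)] n0[OF that(2)]
        by (meson add_strict_mono le_less_trans)
      also have "\<dots> = ennreal e" using e by (simp flip: ennreal_plus)
      finally show ?thesis using VS N_nonneg by (simp add: ennreal_less_iff)
    qed
    then show "\<exists>K. \<forall>m\<ge>K. \<forall>n\<ge>K. N (?S m - ?S n) < e" by blast
  qed
  from complete[OF VS this] obtain l where l: "l \<in> V" "(\<lambda>i. N (?S i - l)) \<longlonglongrightarrow> 0" by blast
  have "has_bochner_integral_on M V N f l"
    unfolding has_bochner_integral_on_def simple_bochner_integrable_iff
    using s f l lim by blast
  then show ?thesis by (auto simp: bochner_integrable_on_def)
qed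

text \<open>The simple functions \<open>s n\<close> are chosen in \<open>V\<close> and then composed
  with \<open>Q\<close>; separability enters for \<open>V\<close>, completeness for
  \<open>W\<close>. The second moment of \<open>f\<close> matches the quadratic growth of
  \<open>Q\<close>.\<close>

lemma bochner_integrable_on_quadratic:
  assumes "normed_carrier V N" "banach_carrier W K" and sep: "normed_carrier.separable V N"
    and M: "finite_measure M" and f: "f \<in> M \<rightarrow>\<^sub>M borel_on V N" and int: "integrable M (\<lambda>\<omega>. (N (f \<omega>))\<^sup>2)"
    and QW: "\<And>x. x \<in> V \<Longrightarrow> Q x \<in> W"
    and quad: "\<And>x y. x \<in> V \<Longrightarrow> y \<in> V \<Longrightarrow> K (Q x - Q y) \<le> N (x - y) * (N x + N y)"
  shows "bochner_integrable_on M W K (\<lambda>\<omega>. Q (f \<omega>))"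
proof -
  interpret V: normed_carrier V N by fact
  interpret W: banach_carrier W K by fact
  interpret finite_measure M by fact
  obtain s where s: "\<And>n. simple_function M (s n)" "\<And>n. s n ` space M \<subseteq> V"
    and le: "\<And>n \<omega>. \<omega> \<in> space M \<Longrightarrow> N (f \<omega> - s n \<omega>) \<le> N (f \<omega>)"
    and lim: "\<And>\<omega>. \<omega> \<in> space M \<Longrightarrow> (\<lambda>n. N (f \<omega> - s n \<omega>)) \<longlonglongrightarrow> 0"
    using V.simple_approximation[OF sep f] by blast
  have fV: "f \<omega> \<in> V" if "\<omega> \<in> space M" for \<omega> using measurable_space[OF f that] by simp
  have sV: "s n \<omega> \<in> V" if "\<omega> \<in> space M" for n \<omega> using s(2)[of n] that by auto
  have meas: "(\<lambda>\<omega>. Q (f \<omega>)) \<in> M \<rightarrow>\<^sub>M borel_on W K"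
    by (rule measurable_compose[OF f measurable_quadratic_carrier[OF assms(1) W.normed_carrier_axioms QW quad]])
  have Nf: "(\<lambda>\<omega>. N (f \<omega>)) \<in> borel_measurable M" by (rule measurable_compose[OF f V.measurable_N])
  have Nfs: "(\<lambda>\<omega>. N (f \<omega> - s n \<omega>)) \<in> borel_measurable M" for n
    using s f by (intro V.measurable_N_diff_simple)
  have sQ: "simple_function M (\<lambda>\<omega>. Q (s n \<omega>))" "(\<lambda>\<omega>. Q (s n \<omega>)) ` space M \<subseteq> W" for n
    using s QW by (auto intro: simple_function_compose1)
  \<comment> \<open>The factor 3 comes from \<open>N (s n \<omega>) \<le> N (f \<omega>) + N (f
    \<omega> - s n \<omega>)\<close>, which is at most twice \<open>N (f \<omega>)\<close>.\<close>
  have bound: "K (Q (f \<omega>) - Q (s n \<omega>)) \<le> N (f \<omega> - s n \<omega>) * (3 * N (f \<omega>))" if w: "\<omega> \<in> space M" for n \<omega>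
  proof -
    have "K (Q (f \<omega>) - Q (s n \<omega>)) \<le> N (f \<omega> - s n \<omega>) * (N (f \<omega>) + N (s n \<omega>))"
      using quad fV sV w by simp
    also have "N (s n \<omega>) \<le> N (f \<omega>) + N (f \<omega> - s n \<omega>)"
      using V.N_le_diff[of "s n \<omega>" "f \<omega>"] V.N_commute[of "s n \<omega>" "f \<omega>"] fV sV w by simp
    finally show ?thesis
      using le[OF w, of n] V.N_nonneg[of "f \<omega> - s n \<omega>"] fV sV w
      by (smt (verit, best) mult_left_mono V.V_diff)
  qed
  show ?thesis
  proof (rule W.bochner_integrable_onI[OF M meas sQ])
    have "(\<lambda>n. \<integral>\<^sup>+\<omega>. ennreal (K (Q (f \<omega>) - Q (s n \<omega>))) \<partial>M) \<longlonglongrightarrow> (\<integral>\<^sup>+\<omega>. 0 \<partial>M)"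
    proof (rule nn_integral_dominated_convergence[where w="\<lambda>\<omega>. ennreal (3 * (N (f \<omega>))\<^sup>2)"])
      show "(\<lambda>\<omega>. ennreal (K (Q (f \<omega>) - Q (s n \<omega>)))) \<in> borel_measurable M" for n
        using W.measurable_N_diff_simple[OF meas sQ] by measurable
      show "AE \<omega> in M. ennreal (K (Q (f \<omega>) - Q (s n \<omega>))) \<le> ennreal (3 * (N (f \<omega>))\<^sup>2)" for n
      proof (rule AE_I2, rule ennreal_leI)
        fix \<omega> assume w: "\<omega> \<in> space M"
        have "K (Q (f \<omega>) - Q (s n \<omega>)) \<le> N (f \<omega> - s n \<omega>) * (3 * N (f \<omega>))" by (rule bound[OF w])
        also have "\<dots> \<le> N (f \<omega>) * (3 * N (f \<omega>))"
          using le[OF w] V.N_nonneg[OF fV[OF w]] by (intro mult_right_mono) auto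
        finally show "K (Q (f \<omega>) - Q (s n \<omega>)) \<le> 3 * (N (f \<omega>))\<^sup>2" by (simp add: power2_eq_square)
      qed
      have "(\<integral>\<^sup>+\<omega>. ennreal (3 * (N (f \<omega>))\<^sup>2) \<partial>M) = ennreal (\<integral>\<omega>. 3 * (N (f \<omega>))\<^sup>2 \<partial>M)"
        using int by (intro nn_integral_eq_integral) auto
      then show "(\<integral>\<^sup>+\<omega>. ennreal (3 * (N (f \<omega>))\<^sup>2) \<partial>M) < \<infinity>" by simp
      show "AE \<omega> in M. (\<lambda>n. ennreal (K (Q (f \<omega>) - Q (s n \<omega>)))) \<longlonglongrightarrow> 0"
      proof (rule AE_I2)
        fix \<omega> assume w: "\<omega> \<in> space M"
        have "(\<lambda>n. K (Q (f \<omega>) - Q (s n \<omega>))) \<longlonglongrightarrow> 0"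
        proof (rule Lim_null_comparison)
          show "(\<lambda>n. N (f \<omega> - s n \<omega>) * (3 * N (f \<omega>))) \<longlonglongrightarrow> 0"
            using tendsto_mult_right[OF lim[OF w], of "3 * N (f \<omega>)"] by simp
          show "\<forall>\<^sub>F n in sequentially. norm (K (Q (f \<omega>) - Q (s n \<omega>))) \<le> N (f \<omega> - s n \<omega>) * (3 * N (f \<omega>))"
            using bound[OF w] W.N_nonneg QW fV sV w by simp
        qed
        then show "(\<lambda>n. ennreal (K (Q (f \<omega>) - Q (s n \<omega>)))) \<longlonglongrightarrow> 0"
          by (subst W.ennreal_tendsto_0_iff) (use W.N_nonneg QW fV sV w in auto)
      qed
    qed (use Nf in auto)
    then show "(\<lambda>n. \<integral>\<^sup>+\<omega>. ennreal (K (Q (f \<omega>) - Q (s n \<omega>))) \<partial>M) \<longlonglongrightarrow> 0" by simp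
  qed
qed

lemma (in banach_carrier) bochner_integrable_on_self:
  assumes sep: "separable" and M: "finite_measure M"
    and f: "f \<in> M \<rightarrow>\<^sub>M borel_on V N" and int: "integrable M (\<lambda>\<omega>. N (f \<omega>))"
  shows "bochner_integrable_on M V N f"
proof -
  interpret finite_measure M by fact
  obtain s where s: "\<And>n. simple_function M (s n)" "\<And>n. s n ` space M \<subseteq> V"
    and le: "\<And>n \<omega>. \<omega> \<in> space M \<Longrightarrow> N (f \<omega> - s n \<omega>) \<le> N (f \<omega>)"
    and lim: "\<And>\<omega>. \<omega> \<in> space M \<Longrightarrow> (\<lambda>n. N (f \<omega> - s n \<omega>)) \<longlonglongrightarrow> 0"
    using simple_approximation[OF sep f] by blast
  have fV: "f \<omega> \<in> V" if "\<omega> \<in> space M" for \<omega> using measurable_space[OF f that] by simp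
  have sV: "s n \<omega> \<in> V" if "\<omega> \<in> space M" for n \<omega> using s(2)[of n] that by auto
  show ?thesis
  proof (rule bochner_integrable_onI[OF M f s])
    have "(\<lambda>n. \<integral>\<^sup>+\<omega>. ennreal (N (f \<omega> - s n \<omega>)) \<partial>M) \<longlonglongrightarrow> (\<integral>\<^sup>+\<omega>. 0 \<partial>M)"
    proof (rule nn_integral_dominated_convergence[where w="\<lambda>\<omega>. ennreal (N (f \<omega>))"])
      show "(\<lambda>\<omega>. ennreal (N (f \<omega> - s n \<omega>))) \<in> borel_measurable M" for n
        using measurable_N_diff_simple[OF f s] by measurable
      have "(\<integral>\<^sup>+\<omega>. ennreal (N (f \<omega>)) \<partial>M) = ennreal (\<integral>\<omega>. N (f \<omega>) \<partial>M)"
        using int fV by (intro nn_integral_eq_integral) (auto intro: N_nonneg)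
      then show "(\<integral>\<^sup>+\<omega>. ennreal (N (f \<omega>)) \<partial>M) < \<infinity>" by simp
      show "AE \<omega> in M. (\<lambda>n. ennreal (N (f \<omega> - s n \<omega>))) \<longlonglongrightarrow> 0"
        by (rule AE_I2, subst ennreal_tendsto_0_iff) (use N_nonneg fV sV lim in auto)
    qed (use le int in \<open>auto intro!: ennreal_leI\<close>)
    then show "(\<lambda>n. \<integral>\<^sup>+\<omega>. ennreal (N (f \<omega> - s n \<omega>)) \<partial>M) \<longlonglongrightarrow> 0" by simp
  qed
qed

section \<open>Hilbert spaces given by a carrier set\<close>

locale inner_carrier =
  fixes V :: "'v::real_vector set" and ip :: "'v \<Rightarrow> 'v \<Rightarrow> real" and N :: "'v \<Rightarrow> real"
  assumes subspace_carrier: "subspace V"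
    and ip_commute: "x \<in> V \<Longrightarrow> y \<in> V \<Longrightarrow> ip x y = ip y x"
    and ip_add_left: "x \<in> V \<Longrightarrow> y \<in> V \<Longrightarrow> z \<in> V \<Longrightarrow> ip (x + y) z = ip x z + ip y z"
    and ip_scale_left: "x \<in> V \<Longrightarrow> y \<in> V \<Longrightarrow> ip (c *\<^sub>R x) y = c * ip x y"
    and ip_nonneg: "x \<in> V \<Longrightarrow> 0 \<le> ip x x"
    and ip_eq_0: "x \<in> V \<Longrightarrow> ip x x = 0 \<Longrightarrow> x = 0"
    and N_ip: "N x = sqrt (ip x x)"
begin

lemma in_V:
  shows "0 \<in> V" "x \<in> V \<Longrightarrow> y \<in> V \<Longrightarrow> x + y \<in> V" "x \<in> V \<Longrightarrow> y \<in> V \<Longrightarrow> x - y \<in> V"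
    "x \<in> V \<Longrightarrow> c *\<^sub>R x \<in> V"
  using subspace_carrier by (auto simp: subspace_0 subspace_add subspace_diff subspace_scale)

lemma ip_add_right: "x \<in> V \<Longrightarrow> y \<in> V \<Longrightarrow> z \<in> V \<Longrightarrow> ip z (x + y) = ip z x + ip z y"
  using ip_add_left ip_commute in_V by metis

lemma ip_scale_right: "x \<in> V \<Longrightarrow> y \<in> V \<Longrightarrow> ip y (c *\<^sub>R x) = c * ip y x"
  using ip_scale_left ip_commute in_V by metis

lemma ip_linear: "y \<in> V \<Longrightarrow> linear_on V (\<lambda>x. ip x y)"
  by (rule linear_onI) (auto simp: ip_add_left ip_scale_left)

lemma ip_linear_right: "y \<in> V \<Longrightarrow> linear_on V (ip y)"
  by (rule linear_onI) (auto simp: ip_add_right ip_scale_right)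

lemmas ip_diff_left = linear_on_diff[OF subspace_carrier ip_linear]
lemmas ip_diff_right = linear_on_diff[OF subspace_carrier ip_linear_right]

lemma ip_0 [simp]: "x \<in> V \<Longrightarrow> ip 0 x = 0" "x \<in> V \<Longrightarrow> ip x 0 = 0"
  using ip_diff_left[of x x x] ip_diff_right[of x x x] in_V by auto

lemma N_power2: "x \<in> V \<Longrightarrow> (N x)\<^sup>2 = ip x x"
  by (simp add: N_ip ip_nonneg)

lemma N_ge_0: "x \<in> V \<Longrightarrow> 0 \<le> N x"
  by (simp add: N_ip ip_nonneg)

lemma N_add_power2: "x \<in> V \<Longrightarrow> y \<in> V \<Longrightarrow> (N (x + y))\<^sup>2 = (N x)\<^sup>2 + 2 * ip x y + (N y)\<^sup>2"
  using ip_commute[of x y] by (simp add: N_power2 in_V ip_add_left ip_add_right)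

lemma N_diff_power2: "x \<in> V \<Longrightarrow> y \<in> V \<Longrightarrow> (N (x - y))\<^sup>2 = (N x)\<^sup>2 - 2 * ip x y + (N y)\<^sup>2"
  using ip_commute[of x y] by (simp add: N_power2 in_V ip_diff_left ip_diff_right)

lemma N_scaleR: "x \<in> V \<Longrightarrow> N (c *\<^sub>R x) = \<bar>c\<bar> * N x"
  by (simp add: N_ip ip_scale_left ip_scale_right in_V real_sqrt_mult flip: power2_eq_square mult.assoc)

lemma ip_Cauchy_Schwarz: "x \<in> V \<Longrightarrow> y \<in> V \<Longrightarrow> \<bar>ip x y\<bar> \<le> N x * N y"
proof -
  assume V: "x \<in> V" "y \<in> V"
  have "(ip x y)\<^sup>2 \<le> (N x)\<^sup>2 * (N y)\<^sup>2"
  proof (cases "ip y y = 0")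
    case True
    then have "y = 0" using ip_eq_0[OF V(2)] by simp
    then show ?thesis using V by simp
  next
    case False
    with V ip_nonneg[of y] have pos: "ip y y > 0" by simp
    define t where "t = ip x y / ip y y"
    have "0 \<le> (N (x - t *\<^sub>R y))\<^sup>2" by simp
    also have "\<dots> = (N x)\<^sup>2 - 2 * (t * ip x y) + t\<^sup>2 * (N y)\<^sup>2"
      using V by (simp add: N_diff_power2 in_V N_scaleR power_mult_distrib ip_scale_right)
    also have "\<dots> = ip x x - 2 * (t * ip x y) + t\<^sup>2 * ip y y"
      using V by (simp add: N_power2)
    also have "\<dots> = ip x x - (ip x y)\<^sup>2 / ip y y"
      using pos by (simp add: t_def power2_eq_square)
    finally show ?thesis using V pos by (simp add: N_power2 field_simps)
  qed
  then have "\<bar>ip x y\<bar>\<^sup>2 \<le> (N x * N y)\<^sup>2" by (simp add: power_mult_distrib)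
  then show ?thesis using V N_ge_0 by (simp add: abs_le_square_iff[symmetric] abs_mult)
qed

lemma N_add_le: "x \<in> V \<Longrightarrow> y \<in> V \<Longrightarrow> N (x + y) \<le> N x + N y"
proof -
  assume V: "x \<in> V" "y \<in> V"
  have "(N (x + y))\<^sup>2 \<le> (N x + N y)\<^sup>2"
    using ip_Cauchy_Schwarz[OF V] V by (simp add: N_add_power2 power2_sum)
  then show ?thesis using V N_ge_0 by (intro power2_le_imp_le[of "N (x + y)"]) auto
qed

sublocale normed_carrier V N
proof
  show "x = 0" if "x \<in> V" "N x = 0" for x
    using ip_eq_0[of x] N_power2[of x] that by simp
qed (auto simp: subspace_carrier N_ge_0 N_add_le N_scaleR)

lemma ip_eqI:
  assumes "x \<in> V" "y \<in> V" "\<And>z. z \<in> V \<Longrightarrow> ip x z = ip y z" shows "x = y"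
proof -
  have "ip (x - y) (x - y) = 0" using assms by (simp add: ip_diff_left)
  then show ?thesis using ip_eq_0[of "x - y"] assms by simp
qed

lemma ip_tendsto:
  assumes "\<And>n. x n \<in> V" "l \<in> V" "y \<in> V" "(\<lambda>n. N (x n - l)) \<longlonglongrightarrow> 0"
  shows "(\<lambda>n. ip (x n) y) \<longlonglongrightarrow> ip l y"
proof (rule LIM_zero_cancel, rule Lim_null_comparison)
  show "(\<lambda>n. N (x n - l) * N y) \<longlonglongrightarrow> 0" using tendsto_mult_right[OF assms(4), of "N y"] by simp
  show "\<forall>\<^sub>F n in sequentially. norm (ip (x n) y - ip l y) \<le> N (x n - l) * N y"
    using ip_Cauchy_Schwarz[of "x n - l" y for n] assms by (simp add: ip_diff_left)
qed

text \<open>Finiteness is built in, since only finite sections of a trace are formed.\<close>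

definition orthonormal :: "'v set \<Rightarrow> bool" where
  "orthonormal E \<longleftrightarrow> finite E \<and> E \<subseteq> V \<and> (\<forall>x\<in>E. \<forall>y\<in>E. ip x y = (if x = y then 1 else 0))"

text \<open>For orthonormal \<open>E\<close> this is the orthogonal projection onto the span of
  \<open>E\<close>. Membership in the span is expressed by \<open>proj E d = d\<close>.\<close>

definition proj :: "'v set \<Rightarrow> 'v \<Rightarrow> 'v" where
  "proj E x = (\<Sum>e\<in>E. ip x e *\<^sub>R e)"

lemma ip_sum_scale_left:
  "(\<And>i. i \<in> I \<Longrightarrow> f i \<in> V) \<Longrightarrow> y \<in> V \<Longrightarrow> ip (\<Sum>i\<in>I. c i *\<^sub>R f i) y = (\<Sum>i\<in>I. c i * ip (f i) y)"
  using linear_on_sum[OF subspace_carrier ip_linear, of y I f c] by simp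

lemma proj_in_V: "orthonormal E \<Longrightarrow> proj E x \<in> V"
  unfolding proj_def orthonormal_def by (intro V_sum V_scale) auto

lemma ip_proj:
  assumes "orthonormal E" "y \<in> V" shows "ip (proj E x) y = (\<Sum>e\<in>E. ip x e * ip e y)"
  unfolding proj_def using assms by (intro ip_sum_scale_left) (auto simp: orthonormal_def)

lemma ip_proj_basis:
  assumes "orthonormal E" "e \<in> E" shows "ip (proj E x) e = ip x e"
proof -
  have "e \<in> V" using assms by (auto simp: orthonormal_def)
  then have "ip (proj E x) e = (\<Sum>u\<in>E. ip x u * ip u e)" by (rule ip_proj[OF assms(1)])
  also have "\<dots> = (\<Sum>u\<in>E. if u = e then ip x u else 0)"
    by (rule sum.cong) (use assms in \<open>auto simp: orthonormal_def\<close>)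
  also have "\<dots> = ip x e" using assms by (simp add: orthonormal_def)
  finally show ?thesis .
qed

lemma N_proj_power2:
  assumes "orthonormal E" "x \<in> V" shows "(N (proj E x))\<^sup>2 = (\<Sum>e\<in>E. (ip x e)\<^sup>2)"
proof -
  have "(N (proj E x))\<^sup>2 = (\<Sum>e\<in>E. ip x e * ip e (proj E x))"
    using assms by (simp add: N_power2 proj_in_V ip_proj)
  also have "\<dots> = (\<Sum>e\<in>E. ip x e * ip x e)"
    using assms ip_commute[OF _ proj_in_V[OF assms(1)]] ip_proj_basis[OF assms(1)]
    by (intro sum.cong) (auto simp: orthonormal_def)
  finally show ?thesis by (simp add: power2_eq_square)
qed

lemma ip_proj_self:
  assumes "orthonormal E" "x \<in> V" shows "ip (proj E x) x = (N (proj E x))\<^sup>2"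
  using assms ip_commute by (subst N_proj_power2) (auto simp: ip_proj power2_eq_square orthonormal_def intro!: sum.cong)

lemma N_proj_Pythagoras:
  assumes "orthonormal E" "x \<in> V" shows "(N x)\<^sup>2 = (N (proj E x))\<^sup>2 + (N (x - proj E x))\<^sup>2"
  using assms ip_proj_self[OF assms] ip_commute[of x "proj E x"] by (simp add: N_diff_power2 proj_in_V)

lemma N_proj_le: "orthonormal E \<Longrightarrow> x \<in> V \<Longrightarrow> N (proj E x) \<le> N x"
  using N_proj_Pythagoras[of E x] by (intro power2_le_imp_le[of "N (proj E x)"]) (auto intro: N_nonneg)

text \<open>As \<open>d\<close> is fixed by the projection, \<open>x - proj E x\<close> equals
  \<open>(x - d) - proj E (x - d)\<close>, and by Pythagoras subtracting the projection does not
  increase the norm.\<close>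

lemma N_proj_nearest:
  assumes "orthonormal E" "x \<in> V" "d \<in> V" "proj E d = d"
  shows "N (x - proj E x) \<le> N (x - d)"
proof -
  have pd: "proj E (x - d) = proj E x - proj E d"
    unfolding proj_def sum_subtractf[symmetric]
    by (rule sum.cong) (use assms in \<open>auto simp: orthonormal_def ip_diff_left algebra_simps subset_iff\<close>)
  have "(N (x - proj E x))\<^sup>2 = (N ((x - d) - proj E (x - d)))\<^sup>2" using pd assms by simp
  also have "\<dots> \<le> (N (x - d))\<^sup>2" using N_proj_Pythagoras[of E "x - d"] assms by simp
  finally show ?thesis using assms by (intro power2_le_imp_le[of "N (x - proj E x)"]) (auto intro: N_nonneg)
qed

text \<open>Gram-Schmidt: the component \<open>r\<close> of the new vector that is orthogonal to the
  system so far is normalised and adjoined, unless it vanishes.\<close>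

lemma orthonormal_exists:
  assumes "finite D" "D \<subseteq> V" shows "\<exists>E. orthonormal E \<and> (\<forall>d\<in>D. proj E d = d)"
  using assms
proof (induction D rule: finite_induct)
  case empty
  show ?case by (intro exI[of _ "{}"]) (auto simp: orthonormal_def)
next
  case (insert d D)
  then obtain E where E: "orthonormal E" and PD: "\<And>x. x \<in> D \<Longrightarrow> proj E x = x" by auto
  have d: "d \<in> V" using insert by auto
  define r where "r = d - proj E d"
  have rV: "r \<in> V" using d proj_in_V[OF E] by (simp add: r_def)
  show ?case
  proof (cases "r = 0")
    case True
    then show ?thesis using E PD by (intro exI[of _ E]) (auto simp: r_def)
  next
    case False
    then have Nr: "N r > 0" using N_eq_0[OF rV] N_nonneg[OF rV] by linarith
    define u where "u = (1 / N r) *\<^sub>R r"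
    have uV: "u \<in> V" using rV by (simp add: u_def)
    have uu: "ip u u = 1"
    proof -
      have "ip u u = (1 / N r) * ((1 / N r) * (N r)\<^sup>2)"
        using rV by (simp add: u_def ip_scale_left ip_scale_right N_power2)
      then show ?thesis using Nr by (simp add: power2_eq_square)
    qed
    have EV: "e \<in> V" if "e \<in> E" for e using E that by (auto simp: orthonormal_def)
    have re: "ip r e = 0" if "e \<in> E" for e
      using that d EV proj_in_V[OF E] ip_proj_basis[OF E that] by (simp add: r_def ip_diff_left)
    have ue: "ip u e = 0" "ip e u = 0" if "e \<in> E" for e
      using re[OF that] rV EV[OF that] ip_commute[of u e] uV by (simp_all add: u_def ip_scale_left)
    have uE: "u \<notin> E" using ue uu by auto
    have E': "orthonormal (insert u E)"
      using E uV uu ue uE by (auto simp: orthonormal_def)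
    have proj': "proj (insert u E) x = ip x u *\<^sub>R u + proj E x" for x
      unfolding proj_def using E uE by (simp add: orthonormal_def)
    have 1: "ip (proj E x) u = 0" for x
      by (subst ip_proj[OF E uV]) (simp add: ue)
    have "proj (insert u E) x = x" if "x \<in> insert d D" for x
    proof (cases "x = d")
      case True
      have "ip d u = ip r u" using 1[of d] d uV proj_in_V[OF E] by (simp add: r_def ip_diff_left)
      also have "\<dots> = (1 / N r) * (N r)\<^sup>2" using rV by (simp add: u_def ip_scale_right N_power2)
      also have "\<dots> = N r" using Nr by (simp add: power2_eq_square)
      finally have "ip d u *\<^sub>R u = r" using Nr by (simp add: u_def)
      then show ?thesis using True proj' by (simp add: r_def)
    next
      case False
      then have "x \<in> D" using that by simp
      then show ?thesis using proj'[of x] 1[of x] PD[of x] by simp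
    qed
    with E' show ?thesis by blast
  qed
qed

end

locale hilbert_carrier = inner_carrier +
  assumes banach: "banach_carrier V N"
begin

sublocale banach_carrier V N by (rule banach)

text \<open>The projection theorem, with closedness in sequential form: the parallelogram law makes
  a minimising sequence Cauchy, and the first variation at the minimiser gives
  orthogonality.\<close>

lemma projection:
  assumes M: "subspace M" "M \<subseteq> V"
    and closed: "\<And>x l. (\<And>n. x n \<in> M) \<Longrightarrow> l \<in> V \<Longrightarrow> (\<lambda>n. N (x n - l)) \<longlonglongrightarrow> 0 \<Longrightarrow> l \<in> M"
    and f: "f \<in> V"
  shows "\<exists>g\<in>M. \<forall>m\<in>M. ip (f - g) m = 0"
proof -
  define D where "D = (\<lambda>m. (N (f - m))\<^sup>2) ` M"
  define \<delta> where "\<delta> = Inf D"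
  have M0: "0 \<in> M" using M(1) by (rule subspace_0)
  have D: "D \<noteq> {}" "bdd_below D" using M0 by (auto simp: D_def intro!: bdd_belowI[of _ 0])
  have \<delta>le: "\<delta> \<le> (N (f - m))\<^sup>2" if "m \<in> M" for m
    unfolding \<delta>_def using that by (intro cInf_lower D) (auto simp: D_def)
  have "\<exists>m\<in>M. (N (f - m))\<^sup>2 < \<delta> + 1 / real (Suc n)" for n
    using cInf_lessD[OF D(1), of "\<delta> + 1 / real (Suc n)"] by (auto simp: \<delta>_def D_def)
  then obtain m where m: "\<And>n. m n \<in> M" and mlt: "\<And>n. (N (f - m n))\<^sup>2 < \<delta> + 1 / real (Suc n)" by metis
  have mV: "m n \<in> V" for n using m M by blast
  have diff: "(N (m i - m j))\<^sup>2 < 2 / real (Suc i) + 2 / real (Suc j)" for i j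
  proof -
    let ?a = "f - m i" and ?b = "f - m j"
    have par: "(N (?a + ?b))\<^sup>2 + (N (?a - ?b))\<^sup>2 = 2 * (N ?a)\<^sup>2 + 2 * (N ?b)\<^sup>2"
      using N_add_power2[of ?a ?b] N_diff_power2[of ?a ?b] mV f by simp
    \<comment> \<open>The midpoint belongs to \<open>M\<close>, so its squared distance from
      \<open>f\<close> is at least \<open>\<delta>\<close>. This bounds \<open>N (?a + ?b)\<close>
      from below and hence \<open>N (?a - ?b)\<close> from above.\<close>
    have mid: "(1/2) *\<^sub>R (m i + m j) \<in> M" using m M(1) by (intro subspace_scale subspace_add)
    have "?a + ?b = 2 *\<^sub>R (f - (1/2) *\<^sub>R (m i + m j))"
      by (simp add: algebra_simps scaleR_2)
    then have "(N (?a + ?b))\<^sup>2 = 4 * (N (f - (1/2) *\<^sub>R (m i + m j)))\<^sup>2"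
      using f mV by (simp add: N_scale power_mult_distrib)
    then have "(N (?a + ?b))\<^sup>2 \<ge> 4 * \<delta>" using \<delta>le[OF mid] by simp
    moreover have "N (?a - ?b) = N (m i - m j)"
      using N_commute[OF mV mV, of j i] by (simp add: algebra_simps)
    ultimately show ?thesis using par mlt[of i] mlt[of j] by (simp del: of_nat_Suc)
  qed
  have "carrier_Cauchy m"
    unfolding carrier_Cauchy_def
  proof (intro allI impI)
    fix e :: real assume e: "e > 0"
    obtain K :: nat where K: "4 / e\<^sup>2 < real K" using reals_Archimedean2 by blast
    have "N (m i - m j) < e" if "i \<ge> K" "j \<ge> K" for i j
    proof -
      have Kpos: "real K > 0" using K e by (meson divide_pos_pos less_trans zero_less_numeral zero_less_power)
      have "2 / real (Suc i) \<le> 2 / real K" "2 / real (Suc j) \<le> 2 / real K"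
        using that Kpos by (auto intro!: divide_left_mono)
      then have "(N (m i - m j))\<^sup>2 < 4 / real K" using diff[of i j] by simp
      also have "\<dots> < e\<^sup>2" using K Kpos e by (simp add: field_simps)
      finally show ?thesis using e by (simp add: power2_less_imp_less)
    qed
    then show "\<exists>K. \<forall>i\<ge>K. \<forall>j\<ge>K. N (m i - m j) < e" by blast
  qed
  from complete[OF mV this] obtain g where gV: "g \<in> V" and lim: "(\<lambda>n. N (m n - g)) \<longlonglongrightarrow> 0" by blast
  have gM: "g \<in> M" using closed[OF m gV lim] .
  have "(\<lambda>n. N ((f - m n) - (f - g))) \<longlonglongrightarrow> 0"
    using lim N_commute[OF gV mV] by simp
  then have "(\<lambda>n. (N (f - m n))\<^sup>2) \<longlonglongrightarrow> (N (f - g))\<^sup>2"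
    using f mV gV by (intro tendsto_power limit_N) auto
  moreover have "(\<lambda>n. \<delta> + 1 / real (Suc n)) \<longlonglongrightarrow> \<delta> + 0"
    by (intro tendsto_add tendsto_const LIMSEQ_Suc lim_1_over_n)
  ultimately have min: "(N (f - g))\<^sup>2 \<le> \<delta>"
    using mlt by (intro LIMSEQ_le) (auto intro: less_imp_le)
  show ?thesis
  proof (intro bexI[OF _ gM] ballI)
    fix v assume v: "v \<in> M"
    then have vV: "v \<in> V" using M by blast
    let ?h = "f - g"
    have hV: "?h \<in> V" using f gV by simp
    have ineq: "2 * t * ip ?h v \<le> t\<^sup>2 * (N v)\<^sup>2" for t
    proof -
      have "g + t *\<^sub>R v \<in> M" using gM v M(1) by (intro subspace_scale subspace_add)
      then have "(N ?h)\<^sup>2 \<le> (N (f - (g + t *\<^sub>R v)))\<^sup>2" using \<delta>le min by force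
      also have "f - (g + t *\<^sub>R v) = ?h - t *\<^sub>R v" by simp
      also have "(N (?h - t *\<^sub>R v))\<^sup>2 = (N ?h)\<^sup>2 - 2 * t * ip ?h v + t\<^sup>2 * (N v)\<^sup>2"
        using hV vV by (simp add: N_diff_power2 ip_scale_right N_scale power_mult_distrib)
      finally show ?thesis by simp
    qed
    show "ip ?h v = 0"
    proof (cases "N v = 0")
      case True
      then show ?thesis using N_eq_0[OF vV] hV by simp
    next
      case False
      then have pos: "(N v)\<^sup>2 > 0" by simp
      \<comment> \<open>The value of \<open>t\<close> that minimises the norm of
        \<open>?h - t *\<^sub>R v\<close>; for it the inequality reduces to
        \<open>t * ip ?h v \<le> 0\<close>.\<close>
      define t where "t = ip ?h v / (N v)\<^sup>2"
      have "t * (N v)\<^sup>2 = ip ?h v" using pos by (simp add: t_def)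
      then have "2 * (t * ip ?h v) \<le> t * ip ?h v" using ineq[of t] by (simp add: power2_eq_square mult.assoc)
      then have "t * ip ?h v \<le> 0" by linarith
      then have "(ip ?h v)\<^sup>2 / (N v)\<^sup>2 \<le> 0" by (simp add: t_def power2_eq_square)
      then have "(ip ?h v)\<^sup>2 \<le> 0" using pos by (simp only: divide_le_0_iff) linarith
      then show ?thesis by simp
    qed
  qed
qed

text \<open>A nonzero functional vanishes on a closed hyperplane; take \<open>f\<close> with
  \<open>h f \<noteq> 0\<close> and let \<open>u\<close> be its component orthogonal to that
  hyperplane. A multiple of \<open>u\<close> represents \<open>h\<close>. Boundedness of
  \<open>h\<close> makes the hyperplane closed.\<close>

lemma Riesz:
  assumes lin: "linear_on V h" and bd: "\<And>x. x \<in> V \<Longrightarrow> \<bar>h x\<bar> \<le> C * N x"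
  obtains d where "d \<in> V" "\<And>x. x \<in> V \<Longrightarrow> h x = ip x d"
proof (cases "\<forall>x\<in>V. h x = 0")
  case True
  then show ?thesis using that[of 0] by auto
next
  case False
  then obtain f where f: "f \<in> V" "h f \<noteq> 0" by blast
  let ?M = "{x \<in> V. h x = 0}"
  have diff: "h (x - y) = h x - h y" if "x \<in> V" "y \<in> V" for x y
    using linear_on_diff[OF subspace_carrier lin that] .
  have sub: "subspace ?M"
    unfolding subspace_def using linear_on_0[OF subspace_carrier lin] linear_on_add[OF lin] linear_on_scale[OF lin] by auto
  have closed: "l \<in> ?M" if x: "\<And>n. x n \<in> ?M" and l: "l \<in> V" "(\<lambda>n. N (x n - l)) \<longlonglongrightarrow> 0" for x l
  proof -
    have "\<bar>h l\<bar> \<le> C * N (x n - l)" for n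
      using bd[of "x n - l"] diff[of "x n" l] x[of n] l by simp
    moreover have "(\<lambda>n. C * N (x n - l)) \<longlonglongrightarrow> 0" using tendsto_mult_left[OF l(2), of C] by simp
    ultimately have "\<bar>h l\<bar> \<le> 0" by (intro LIMSEQ_le_const) auto
    with l show ?thesis by simp
  qed
  have MV: "?M \<subseteq> V" by auto
  obtain g where g: "g \<in> ?M" "\<And>m. m \<in> ?M \<Longrightarrow> ip (f - g) m = 0"
  proof -
    have "\<exists>g\<in>?M. \<forall>m\<in>?M. ip (f - g) m = 0"
      by (rule projection[OF sub MV _ f(1)]) (rule closed)
    then show thesis using that by auto
  qed
  define u where "u = f - g"
  have uV: "u \<in> V" and hu: "h u = h f" using g f diff[of f g] by (auto simp: u_def)
  then have uu: "ip u u \<noteq> 0" using f linear_on_0[OF subspace_carrier lin] ip_eq_0[OF uV] by auto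
  show ?thesis
  proof (rule that[of "(h u / ip u u) *\<^sub>R u"])
    fix x assume x: "x \<in> V"
    have "x - (h x / h u) *\<^sub>R u \<in> ?M"
      using x uV f hu diff[of x "(h x / h u) *\<^sub>R u"] linear_on_scale[OF lin uV] by simp
    then have "ip u (x - (h x / h u) *\<^sub>R u) = 0" using g(2) by (simp add: u_def)
    then have "ip u x = (h x / h u) * ip u u" using x uV by (simp add: ip_diff_right ip_scale_right)
    then show "h x = ip x ((h u / ip u u) *\<^sub>R u)"
      using x uV uu f hu ip_commute[of x u] by (simp add: ip_scale_right)
  qed (use uV in simp)
qed

text \<open>The closure \<open>M\<close> of the rational combinations of the \<open>d n\<close> is a
  closed subspace, so every \<open>x\<close> has a projection to \<open>M\<close>. The remaining
  part is orthogonal to all \<open>d n\<close>, and totality makes it zero.\<close>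

lemma separable_of_total:
  assumes d: "\<And>n::nat. d n \<in> V" and total: "\<And>x. x \<in> V \<Longrightarrow> (\<And>n. ip x (d n) = 0) \<Longrightarrow> x = 0"
  shows "separable"
proof -
  \<comment> \<open>A rational combination is coded by the list of its coefficients and indices.
    There are countably many such lists, addition is concatenation, and \<open>from_nat\<close>
    finally enumerates them.\<close>
  define R :: "(rat \<times> nat) list \<Rightarrow> 'a" where "R l = sum_list (map (\<lambda>(q, i). of_rat q *\<^sub>R d i) l)" for l
  have RV: "R l \<in> V" for l
    unfolding R_def by (induction l) (auto simp: d)
  define M where "M = {x \<in> V. \<forall>e>0. \<exists>l. N (x - R l) < e}"
  have MV: "M \<subseteq> V" by (auto simp: M_def)
  have M_D: "\<exists>l. N (x - R l) < e" if "x \<in> M" "e > 0" for x e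
    using that by (auto simp: M_def)
  have RM: "R l \<in> M" for l using RV by (auto simp: M_def intro: exI[of _ l])
  have M_add: "x + y \<in> M" if xy: "x \<in> M" "y \<in> M" for x y
    unfolding M_def
  proof (intro CollectI conjI allI impI)
    have V: "x \<in> V" "y \<in> V" using xy by (auto simp: M_def)
    then show "x + y \<in> V" by simp
    fix e :: real assume "e > 0"
    then have e2: "e/2 > 0" by simp
    obtain l where l1: "N (x - R l) < e/2" using M_D[OF xy(1) e2] by blast
    obtain l' where l2: "N (y - R l') < e/2" using M_D[OF xy(2) e2] by blast
    have eq: "x + y - R (l @ l') = (x - R l) + (y - R l')" by (simp add: R_def)
    have "N (x + y - R (l @ l')) \<le> N (x - R l) + N (y - R l')"
      unfolding eq using V RV by (intro N_triangle) auto
    with l1 l2 show "\<exists>l. N (x + y - R l) < e" by (intro exI[of _ "l @ l'"]) linarith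
  qed
  have M_closed: "l \<in> M" if x: "\<And>n. x n \<in> M" and l: "l \<in> V" "(\<lambda>n. N (x n - l)) \<longlonglongrightarrow> 0" for x l
    unfolding M_def
  proof (intro CollectI conjI allI impI)
    fix e :: real assume "e > 0"
    then have "e/2 > 0" by simp
    from LIMSEQ_D[OF l(2) this] obtain n where "norm (N (x n - l) - 0) < e/2"
      by blast
    then have n: "N (x n - l) < e/2" by simp
    obtain k where k: "N (x n - R k) < e/2" using M_D[OF x \<open>e/2 > 0\<close>] by blast
    have "N (l - R k) \<le> N (l - x n) + N (x n - R k)"
      using x[of n] l RV by (intro N_diff_triangle) (auto simp: M_def)
    then show "\<exists>k. N (l - R k) < e" using n k N_commute[of l "x n"] x[of n] l
      by (intro exI[of _ k]) (auto simp: M_def)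
  qed (rule l)
  have R_scale: "\<exists>l'. R l' = of_rat q *\<^sub>R R l" for q l
    by (rule exI[of _ "map (\<lambda>(p, i). (q * p, i)) l"])
       (induction l; auto simp: R_def of_rat_mult scaleR_add_right)
  have M_rat: "of_rat q *\<^sub>R x \<in> M" if x: "x \<in> M" for q x
    unfolding M_def
  proof (intro CollectI conjI allI impI)
    have V: "x \<in> V" using x by (auto simp: M_def)
    then show "of_rat q *\<^sub>R x \<in> V" by simp
    fix e :: real assume e: "e > 0"
    define c where "c = \<bar>of_rat q\<bar> + (1::real)"
    have c: "c > 0" unfolding c_def by (intro add_nonneg_pos) auto
    obtain l where l: "N (x - R l) < e / c" using M_D[OF x divide_pos_pos[OF e c]] by blast
    obtain l' where l': "R l' = of_rat q *\<^sub>R R l" using R_scale by blast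
    have "N (of_rat q *\<^sub>R x - R l') = \<bar>of_rat q\<bar> * N (x - R l)"
      using V RV by (simp add: l' N_scale flip: scaleR_diff_right)
    also have "\<dots> \<le> c * N (x - R l)" using V RV by (intro mult_right_mono N_nonneg) (auto simp: c_def)
    also have "\<dots> < e" using l c by (simp add: pos_less_divide_eq mult.commute)
    finally show "\<exists>l. N (of_rat q *\<^sub>R x - R l) < e" by blast
  qed
  \<comment> \<open>Real multiples are limits of rational ones, so this rests on closedness and on
    stability under rational scaling.\<close>
  have M_scale: "c *\<^sub>R x \<in> M" if x: "x \<in> M" for c x
  proof -
    have V: "x \<in> V" using x by (auto simp: M_def)
    have "\<exists>q::rat. \<bar>of_rat q - c\<bar> < 1 / real (Suc n)" for n
    proof -
      obtain q :: rat where "c < of_rat q" "of_rat q < c + 1 / real (Suc n)"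
        using of_rat_dense[of c "c + 1 / real (Suc n)"] by auto
      then show ?thesis by (intro exI[of _ q]) auto
    qed
    then obtain q :: "nat \<Rightarrow> rat" where q: "\<And>n. \<bar>of_rat (q n) - c\<bar> < 1 / real (Suc n)" by metis
    show ?thesis
    proof (rule M_closed[of "\<lambda>n. of_rat (q n) *\<^sub>R x"])
      show "(\<lambda>n. N (of_rat (q n) *\<^sub>R x - c *\<^sub>R x)) \<longlonglongrightarrow> 0"
      proof (rule Lim_null_comparison)
        show "(\<lambda>n. 1 / real (Suc n) * N x) \<longlonglongrightarrow> 0"
          using tendsto_mult_right[OF LIMSEQ_Suc[OF lim_1_over_n], of "N x"] by simp
        have "N (of_rat (q n) *\<^sub>R x - c *\<^sub>R x) \<le> 1 / real (Suc n) * N x" for n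
        proof -
          have "N (of_rat (q n) *\<^sub>R x - c *\<^sub>R x) = \<bar>of_rat (q n) - c\<bar> * N x"
            using V by (simp add: N_scale flip: scaleR_diff_left)
          also have "\<dots> \<le> 1 / real (Suc n) * N x"
            using q[of n] V by (intro mult_right_mono N_nonneg) auto
          finally show ?thesis .
        qed
        then show "\<forall>\<^sub>F n in sequentially. norm (N (of_rat (q n) *\<^sub>R x - c *\<^sub>R x)) \<le> 1 / real (Suc n) * N x"
          using V N_nonneg by simp
      qed
    qed (use V x M_rat in auto)
  qed
  have "R [] = 0" by (simp add: R_def)
  then have sub: "subspace M" unfolding subspace_def using RM[of "[]"] M_add M_scale by auto
  have "x \<in> M" if x: "x \<in> V" for x
  proof -
    obtain g where g: "g \<in> M" "\<And>m. m \<in> M \<Longrightarrow> ip (x - g) m = 0"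
    proof -
      have "\<exists>g\<in>M. \<forall>m\<in>M. ip (x - g) m = 0"
        by (rule projection[OF sub MV _ x]) (rule M_closed)
      then show thesis using that by auto
    qed
    have "ip (x - g) (d n) = 0" for n
      using g(2)[OF RM[of "[(1, n)]"]] by (simp add: R_def)
    then have "x - g = 0" using x g(1) MV by (intro total) auto
    with g show ?thesis by simp
  qed
  then have dense: "\<exists>n. N (x - R (from_nat n)) < e" if "x \<in> V" "e > 0" for x e
    using M_D[of x e] that by (metis from_nat_to_nat)
  then show ?thesis unfolding separable_def using RV dense by (intro exI[of _ "\<lambda>n. R (from_nat n)"]) auto
qed

end

section \<open>The space of square-integrable classes\<close>

lemma rep_aefun_measurable [measurable]: "rep_aefun f \<in> borel_measurable lborel"
  using Quotient_rep_reflp[OF Quotient_aefun, of f] by blast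

lemma rep_abs_aefun:
  "h \<in> borel_measurable lborel \<Longrightarrow> AE x in lborel. rep_aefun (abs_aefun h) x = h x"
  using Quotient_rep_abs[OF Quotient_aefun, of h] by auto

lemma aefun_eqI: "AE x in lborel. rep_aefun f x = rep_aefun g x \<Longrightarrow> f = g"
  using Quotient_rel_rep[OF Quotient_aefun, of f g] by simp

lemma abs_aefun_eqI:
  assumes "h \<in> borel_measurable lborel" "AE x in lborel. rep_aefun f x = h x" shows "abs_aefun h = f"
  by (rule aefun_eqI) (use rep_abs_aefun[OF assms(1)] assms(2) in eventually_elim, simp)

lemma abs_rep_aefun: "abs_aefun (rep_aefun f) = f"
  by (rule abs_aefun_eqI) auto

lemma rep_aefun_0: "AE x in lborel. rep_aefun 0 x = 0"
  unfolding zero_aefun_def by (rule rep_abs_aefun) simp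

lemma rep_aefun_add: "AE x in lborel. rep_aefun (f + g) x = rep_aefun f x + rep_aefun g x"
proof -
  have "f + g = abs_aefun (\<lambda>x. rep_aefun f x + rep_aefun g x)"
    using plus_aefun.abs_eq[of "rep_aefun f" "rep_aefun g"] by (simp add: abs_rep_aefun eq_onp_def)
  then show ?thesis by (simp add: rep_abs_aefun)
qed

lemma rep_aefun_diff: "AE x in lborel. rep_aefun (f - g) x = rep_aefun f x - rep_aefun g x"
proof -
  have "f - g = abs_aefun (\<lambda>x. rep_aefun f x - rep_aefun g x)"
    using minus_aefun.abs_eq[of "rep_aefun f" "rep_aefun g"] by (simp add: abs_rep_aefun eq_onp_def)
  then show ?thesis by (simp add: rep_abs_aefun)
qed

lemma rep_aefun_scale: "AE x in lborel. rep_aefun (c *\<^sub>R f) x = c * rep_aefun f x"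
proof -
  have "c *\<^sub>R f = abs_aefun (\<lambda>x. c * rep_aefun f x)"
    using scaleR_aefun.abs_eq[of "rep_aefun f" c] by (simp add: abs_rep_aefun eq_onp_def)
  then show ?thesis by (simp add: rep_abs_aefun)
qed

lemma rep_aefun_sum:
  "AE x in lborel. rep_aefun (\<Sum>i\<in>I. f i) x = (\<Sum>i\<in>I. rep_aefun (f i) x)"
proof (induction I rule: infinite_finite_induct)
  case (insert i I)
  have "AE x in lborel. rep_aefun (f i + (\<Sum>i\<in>I. f i)) x = rep_aefun (f i) x + rep_aefun (\<Sum>i\<in>I. f i) x"
    by (rule rep_aefun_add)
  with insert.IH show ?case by eventually_elim (simp add: insert.hyps)
qed (use rep_aefun_0 in auto)

definition L2_norm :: "'a::euclidean_space set \<Rightarrow> 'a aefun \<Rightarrow> real" where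
  "L2_norm U f = sqrt (L2_inner U f f)"

lemma L2_I:
  assumes "h \<in> borel_measurable lborel" "integrable lborel (\<lambda>x. (h x)\<^sup>2)"
    and "AE x in lborel. x \<notin> U \<longrightarrow> h x = 0"
  shows "abs_aefun h \<in> L2 U"
  unfolding L2_def
proof (intro CollectI conjI)
  note rep = rep_abs_aefun[OF assms(1)]
  show "integrable lborel (\<lambda>x. (rep_aefun (abs_aefun h) x)\<^sup>2)"
    by (rule integrable_cong_AE_imp[OF assms(2)], simp, use rep in eventually_elim, simp)
  show "AE x in lborel. x \<notin> U \<longrightarrow> rep_aefun (abs_aefun h) x = 0"
    using rep assms(3) by eventually_elim simp
qed

lemma L2_D:
  assumes "f \<in> L2 U"
  shows "integrable lborel (\<lambda>x. (rep_aefun f x)\<^sup>2)" "AE x in lborel. x \<notin> U \<longrightarrow> rep_aefun f x = 0"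
  using assms by (auto simp: L2_def)

lemma integrable_mult_of_squares:
  fixes f g :: "'a \<Rightarrow> real"
  assumes [measurable]: "f \<in> borel_measurable M" "g \<in> borel_measurable M"
    and "integrable M (\<lambda>x. (f x)\<^sup>2)" "integrable M (\<lambda>x. (g x)\<^sup>2)"
  shows "integrable M (\<lambda>x. f x * g x)"
proof (rule Bochner_Integration.integrable_bound)
  show "integrable M (\<lambda>x. (f x)\<^sup>2 + (g x)\<^sup>2)" using assms by simp
  have "\<bar>a * b\<bar> \<le> a\<^sup>2 + b\<^sup>2" for a b :: real
  proof -
    have "2 * (\<bar>a\<bar> * \<bar>b\<bar>) \<le> a\<^sup>2 + b\<^sup>2"
      using sum_squares_bound[of "\<bar>a\<bar>" "\<bar>b\<bar>"] by (simp add: mult.assoc)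
    moreover have "0 \<le> \<bar>a\<bar> * \<bar>b\<bar>" by simp
    ultimately show ?thesis unfolding abs_mult by linarith
  qed
  then show "AE x in M. norm (f x * g x) \<le> norm ((f x)\<^sup>2 + (g x)\<^sup>2)"
    by (intro AE_I2) (metis real_norm_def order_trans abs_ge_self)
qed simp

lemma L2_mult_integrable:
  assumes "f \<in> L2 U" "g \<in> L2 U'" shows "integrable lborel (\<lambda>x. rep_aefun f x * rep_aefun g x)"
  using assms by (intro integrable_mult_of_squares L2_D) auto

text \<open>An element of \<open>L2 U\<close> vanishes almost everywhere outside \<open>U\<close>,
  and this property of one factor turns the integral over \<open>U\<close> into one over the whole
  space.\<close>

lemma L2_inner_eq:
  assumes "f \<in> L2 U" "U \<in> sets borel"
  shows "L2_inner U f g = (\<integral>x. rep_aefun f x * rep_aefun g x \<partial>lborel)"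
  unfolding L2_inner_def set_lebesgue_integral_def
proof (rule integral_cong_AE)
  have [measurable]: "U \<in> sets borel" by fact
  show "(\<lambda>x. indicat_real U x *\<^sub>R (rep_aefun f x * rep_aefun g x)) \<in> borel_measurable lborel" by measurable
  show "AE x in lborel. indicat_real U x *\<^sub>R (rep_aefun f x * rep_aefun g x) = rep_aefun f x * rep_aefun g x"
    using L2_D(2)[OF assms(1)] by eventually_elim (auto simp: indicator_def)
qed simp

lemma subspace_L2: "subspace (L2 U)"
  unfolding subspace_def
proof (intro conjI ballI allI)
  show "0 \<in> L2 U" unfolding zero_aefun_def by (rule L2_I) auto
  fix f g assume fg: "f \<in> L2 U" "g \<in> L2 U"
  have "f + g = abs_aefun (\<lambda>x. rep_aefun f x + rep_aefun g x)"
    by (rule abs_aefun_eqI[symmetric]) (use rep_aefun_add in auto)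
  moreover have "abs_aefun (\<lambda>x. rep_aefun f x + rep_aefun g x) \<in> L2 U"
  proof (rule L2_I)
    have "integrable lborel (\<lambda>x. (rep_aefun f x)\<^sup>2 + (rep_aefun g x)\<^sup>2 + 2 * (rep_aefun f x * rep_aefun g x))"
      using fg by (intro Bochner_Integration.integrable_add integrable_mult_right L2_mult_integrable L2_D) auto
    then show "integrable lborel (\<lambda>x. (rep_aefun f x + rep_aefun g x)\<^sup>2)"
      by (simp add: power2_sum mult.assoc)
    show "AE x in lborel. x \<notin> U \<longrightarrow> rep_aefun f x + rep_aefun g x = 0"
      using L2_D(2)[OF fg(1)] L2_D(2)[OF fg(2)] by eventually_elim simp
  qed simp
  ultimately show "f + g \<in> L2 U" by simp
next
  fix c f assume f: "f \<in> L2 U"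
  have "c *\<^sub>R f = abs_aefun (\<lambda>x. c * rep_aefun f x)"
    by (rule abs_aefun_eqI[symmetric]) (use rep_aefun_scale in auto)
  moreover have "abs_aefun (\<lambda>x. c * rep_aefun f x) \<in> L2 U"
  proof (rule L2_I)
    show "AE x in lborel. x \<notin> U \<longrightarrow> c * rep_aefun f x = 0"
      using L2_D(2)[OF f] by eventually_elim simp
  qed (use L2_D(1)[OF f] in \<open>auto simp: power_mult_distrib\<close>)
  ultimately show "c *\<^sub>R f \<in> L2 U" by simp
qed

lemma inner_carrier_L2:
  assumes U: "U \<in> sets borel" shows "inner_carrier (L2 U) (L2_inner U) (L2_norm U)"
proof
  fix f g h :: "'a aefun" and c :: real
  show "subspace (L2 U)" by (rule subspace_L2)
  assume f: "f \<in> L2 U"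
  show "0 \<le> L2_inner U f f" by (simp add: L2_inner_eq[OF f U])
  {
    assume "L2_inner U f f = 0"
    then have "(\<integral>x. (rep_aefun f x)\<^sup>2 \<partial>lborel) = 0" by (simp add: L2_inner_eq[OF f U] power2_eq_square)
    then have *: "AE x in lborel. (rep_aefun f x)\<^sup>2 = 0"
      using L2_D(1)[OF f] by (subst (asm) integral_nonneg_eq_0_iff_AE) auto
    show "f = 0" by (intro aefun_eqI) (use * rep_aefun_0 in eventually_elim, simp)
  }
  assume g: "g \<in> L2 U"
  show "L2_inner U f g = L2_inner U g f" by (simp add: L2_inner_eq[OF f U] L2_inner_eq[OF g U] mult.commute)
  have "AE x in lborel. rep_aefun (c *\<^sub>R f) x * rep_aefun g x = c * (rep_aefun f x * rep_aefun g x)"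
    using rep_aefun_scale[of c f] by eventually_elim simp
  then have "(\<integral>x. rep_aefun (c *\<^sub>R f) x * rep_aefun g x \<partial>lborel) = (\<integral>x. c * (rep_aefun f x * rep_aefun g x) \<partial>lborel)"
    by (intro integral_cong_AE) auto
  then show "L2_inner U (c *\<^sub>R f) g = c * L2_inner U f g"
    by (simp add: L2_inner_eq[OF f U] L2_inner_eq[OF subspace_scale[OF subspace_L2 f] U])
  assume h: "h \<in> L2 U"
  have "AE x in lborel. rep_aefun (f + g) x * rep_aefun h x = rep_aefun f x * rep_aefun h x + rep_aefun g x * rep_aefun h x"
    using rep_aefun_add[of f g] by eventually_elim (simp add: algebra_simps)
  then have "(\<integral>x. rep_aefun (f + g) x * rep_aefun h x \<partial>lborel)
      = (\<integral>x. rep_aefun f x * rep_aefun h x + rep_aefun g x * rep_aefun h x \<partial>lborel)"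
    by (intro integral_cong_AE) auto
  then show "L2_inner U (f + g) h = L2_inner U f h + L2_inner U g h"
    using f g h by (simp add: L2_inner_eq[OF _ U] subspace_add[OF subspace_L2 f g] L2_mult_integrable)
next
  show "L2_norm U f = sqrt (L2_inner U f f)" for f by (simp add: L2_norm_def)
qed

lemma nn_integral_L2_norm:
  assumes "U \<in> sets borel" "f \<in> L2 U"
  shows "(\<integral>\<^sup>+x. ennreal ((rep_aefun f x)\<^sup>2) \<partial>lborel) = ennreal ((L2_norm U f)\<^sup>2)"
proof -
  interpret inner_carrier "L2 U" "L2_inner U" "L2_norm U" by (rule inner_carrier_L2) fact
  have "(\<integral>\<^sup>+x. ennreal ((rep_aefun f x)\<^sup>2) \<partial>lborel) = ennreal (\<integral>x. (rep_aefun f x)\<^sup>2 \<partial>lborel)"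
    using assms L2_D by (intro nn_integral_eq_integral) auto
  also have "(\<integral>x. (rep_aefun f x)\<^sup>2 \<partial>lborel) = (L2_norm U f)\<^sup>2"
    unfolding N_power2[OF assms(2)] L2_inner_eq[OF assms(2,1)] by (simp add: power2_eq_square)
  finally show ?thesis .
qed

text \<open>The Riesz-Fischer argument. The partial sums of \<open>\<bar>r n x\<bar>\<close> are
  bounded in norm by \<open>B\<close>; by monotone convergence the supremum \<open>G\<close> of
  their squares is integrable. So the series converges absolutely almost everywhere, and
  \<open>G\<close> dominates the squared remainders.\<close>

lemma L2_series_convergent:
  fixes U :: "'a::euclidean_space set"
  assumes U: "U \<in> sets borel" and u: "\<And>n. u n \<in> L2 U" and S: "summable (\<lambda>n. L2_norm U (u n))"
  shows "\<exists>l\<in>L2 U. (\<lambda>n. L2_norm U ((\<Sum>i<n. u i) - l)) \<longlonglongrightarrow> 0"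
proof -
  interpret inner_carrier "L2 U" "L2_inner U" "L2_norm U" by (rule inner_carrier_L2) fact
  define r where "r n = rep_aefun (u n)" for n
  have [measurable]: "r n \<in> borel_measurable lborel" for n by (simp add: r_def)
  \<comment> \<open>The classes of the absolute values have the same norms, so the triangle
    inequality in \<open>L2\<close> controls the sum of absolute values.\<close>
  define v where "v n = abs_aefun (\<lambda>x. \<bar>r n x\<bar>)" for n
  have vV: "v n \<in> L2 U" for n
    unfolding v_def
  proof (rule L2_I)
    show "AE x in lborel. x \<notin> U \<longrightarrow> \<bar>r n x\<bar> = 0"
      using L2_D(2)[OF u[of n]] by eventually_elim (simp add: r_def)
  qed (use L2_D(1)[OF u] in \<open>auto simp: r_def\<close>)
  have rep_v: "AE x in lborel. rep_aefun (v n) x = \<bar>r n x\<bar>" for n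
    unfolding v_def by (rule rep_abs_aefun) simp
  have "L2_inner U (v n) (v n) = L2_inner U (u n) (u n)" for n
    unfolding L2_inner_eq[OF vV U] L2_inner_eq[OF u U]
    by (rule integral_cong_AE; simp?) (use rep_v[of n] in eventually_elim, simp add: r_def)
  then have Nv: "L2_norm U (v n) = L2_norm U (u n)" for n by (simp add: L2_norm_def)
  define B where "B = (\<Sum>n. L2_norm U (u n))"
  define g where "g m x = (\<Sum>n<m. \<bar>r n x\<bar>)" for m x
  have g_mono: "g m x \<le> g m' x" if "m \<le> m'" for m m' x
    unfolding g_def using that by (intro sum_mono2) auto
  have g0: "0 \<le> g m x" for m x by (auto simp: g_def intro: sum_nonneg)
  have [measurable]: "g m \<in> borel_measurable lborel" for m unfolding g_def by measurable
  have g_bound: "(\<integral>\<^sup>+x. ennreal ((g m x)\<^sup>2) \<partial>lborel) \<le> ennreal (B\<^sup>2)" for m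
  proof -
    have "AE x in lborel. \<forall>n\<in>{..<m}. rep_aefun (v n) x = \<bar>r n x\<bar>"
      using rep_v by (intro AE_finite_allI) auto
    then have *: "AE x in lborel. rep_aefun (\<Sum>n<m. v n) x = g m x"
      using rep_aefun_sum[of v "{..<m}"] by eventually_elim (simp add: g_def)
    have "(\<integral>\<^sup>+x. ennreal ((g m x)\<^sup>2) \<partial>lborel) = (\<integral>\<^sup>+x. ennreal ((rep_aefun (\<Sum>n<m. v n) x)\<^sup>2) \<partial>lborel)"
      by (intro nn_integral_cong_AE) (use * in eventually_elim, simp)
    also have "\<dots> = ennreal ((L2_norm U (\<Sum>n<m. v n))\<^sup>2)"
      using vV by (intro nn_integral_L2_norm U V_sum)
    also have "\<dots> \<le> ennreal (B\<^sup>2)"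
    proof (intro ennreal_leI power_mono N_nonneg V_sum vV)
      have "L2_norm U (\<Sum>n<m. v n) \<le> (\<Sum>n<m. L2_norm U (u n))"
        using N_sum[of "{..<m}" v] vV Nv by simp
      also have "\<dots> \<le> B" unfolding B_def using S u by (intro sum_le_suminf) (auto intro: N_nonneg)
      finally show "L2_norm U (\<Sum>n<m. v n) \<le> B" .
    qed
    finally show ?thesis .
  qed
  define G where "G x = (SUP m. ennreal ((g m x)\<^sup>2))" for x
  have [measurable]: "G \<in> borel_measurable lborel" unfolding G_def by measurable
  have G_ge: "ennreal ((g m x)\<^sup>2) \<le> G x" for m x unfolding G_def by (rule SUP_upper) simp
  have "(\<integral>\<^sup>+x. G x \<partial>lborel) = (SUP m. \<integral>\<^sup>+x. ennreal ((g m x)\<^sup>2) \<partial>lborel)"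
    unfolding G_def
    by (rule nn_integral_monotone_convergence_SUP)
       (auto simp: incseq_def le_fun_def intro!: ennreal_leI power_mono g_mono g0)
  also have "\<dots> \<le> ennreal (B\<^sup>2)" using g_bound by (intro SUP_least) auto
  finally have G_fin: "(\<integral>\<^sup>+x. G x \<partial>lborel) < \<infinity>" using le_less_trans by (metis ennreal_less_top infinity_ennreal_def)
  then have "AE x in lborel. G x \<noteq> \<infinity>" by (intro nn_integral_PInf_AE) auto
  then have sm: "AE x in lborel. summable (\<lambda>n. \<bar>r n x\<bar>)"
  proof eventually_elim
    case (elim x)
    have "g m x \<le> 1 + enn2real (G x)" for m
    proof -
      have "(g m x)\<^sup>2 \<le> enn2real (G x)"
        using enn2real_mono[OF G_ge[of m x]] elim by (simp add: less_top)
      moreover have "g m x \<le> 1 + (g m x)\<^sup>2"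
        using zero_le_power2[of "g m x - 1"] g0[of m x] by (simp add: power2_diff)
      ultimately show ?thesis by simp
    qed
    then have "(\<Sum>n\<le>m. \<bar>r n x\<bar>) \<le> 1 + enn2real (G x)" for m
      unfolding g_def lessThan_Suc_atMost[symmetric] by blast
    then show ?case by (intro bounded_imp_summable[where B="1 + enn2real (G x)"]) auto
  qed
  define h where "h x = (\<Sum>n. r n x)" for x
  have [measurable]: "h \<in> borel_measurable lborel" unfolding h_def by measurable
  \<comment> \<open>A remainder is the limit of finite blocks from \<open>m\<close> to
    \<open>k\<close>; each of them is at most \<open>g k x\<close> in absolute value, and so at most
    \<open>G x\<close> when squared.\<close>
  have key: "AE x in lborel. \<forall>m. ennreal (((\<Sum>n<m. r n x) - h x)\<^sup>2) \<le> G x"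
    using sm
  proof (eventually_elim, intro allI)
    fix x m assume s: "summable (\<lambda>n. \<bar>r n x\<bar>)"
    have lim: "(\<lambda>k. (\<Sum>n<k. r n x)) \<longlonglongrightarrow> h x"
      unfolding h_def by (rule summable_LIMSEQ[OF summable_rabs_cancel[OF s]])
    have lim2: "(\<lambda>k. ennreal (((\<Sum>n<m. r n x) - (\<Sum>n<k. r n x))\<^sup>2)) \<longlonglongrightarrow> ennreal (((\<Sum>n<m. r n x) - h x)\<^sup>2)"
      by (intro tendsto_ennrealI tendsto_power tendsto_diff tendsto_const lim)
    have "ennreal (((\<Sum>n<m. r n x) - (\<Sum>n<k. r n x))\<^sup>2) \<le> G x" if "k \<ge> m" for k
    proof -
      have "(\<Sum>n<k. r n x) - (\<Sum>n<m. r n x) = (\<Sum>n=m..<k. r n x)"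
        using that by (metis atLeast0LessThan sum_diff_nat_ivl zero_le)
      then have "\<bar>(\<Sum>n<m. r n x) - (\<Sum>n<k. r n x)\<bar> = \<bar>\<Sum>n=m..<k. r n x\<bar>" by (simp add: abs_minus_commute)
      also have "\<dots> \<le> (\<Sum>n=m..<k. \<bar>r n x\<bar>)" by (rule sum_abs)
      also have "\<dots> \<le> g k x" unfolding g_def by (rule sum_mono2) auto
      finally have "\<bar>(\<Sum>n<m. r n x) - (\<Sum>n<k. r n x)\<bar>\<^sup>2 \<le> (g k x)\<^sup>2" by (intro power_mono) auto
      then have "ennreal (((\<Sum>n<m. r n x) - (\<Sum>n<k. r n x))\<^sup>2) \<le> ennreal ((g k x)\<^sup>2)" by (intro ennreal_leI) simp
      then show ?thesis using G_ge[of k x] by (rule order_trans)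
    qed
    then show "ennreal (((\<Sum>n<m. r n x) - h x)\<^sup>2) \<le> G x"
      using LIMSEQ_le_const2[OF lim2, of "G x"] by blast
  qed
  have hL2: "abs_aefun h \<in> L2 U"
  proof (rule L2_I)
    have "AE x in lborel. ennreal (norm ((h x)\<^sup>2)) \<le> G x"
      using key by eventually_elim (drule spec[of _ 0], simp)
    then have "(\<integral>\<^sup>+x. ennreal (norm ((h x)\<^sup>2)) \<partial>lborel) \<le> (\<integral>\<^sup>+x. G x \<partial>lborel)"
      by (rule nn_integral_mono_AE)
    then show "integrable lborel (\<lambda>x. (h x)\<^sup>2)"
      unfolding integrable_iff_bounded using G_fin by auto
    have "AE x in lborel. \<forall>n. x \<notin> U \<longrightarrow> r n x = 0"
      using L2_D(2)[OF u] by (subst AE_all_countable) (auto simp: r_def)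
    then show "AE x in lborel. x \<notin> U \<longrightarrow> h x = 0" by eventually_elim (auto simp: h_def)
  qed simp
  have "(\<lambda>m. \<integral>\<^sup>+x. ennreal (((\<Sum>n<m. r n x) - h x)\<^sup>2) \<partial>lborel) \<longlonglongrightarrow> (\<integral>\<^sup>+(x::'a). 0 \<partial>lborel)"
  proof (rule nn_integral_dominated_convergence[where w=G])
    show "AE x in lborel. ennreal (((\<Sum>n<m. r n x) - h x)\<^sup>2) \<le> G x" for m
      using key by eventually_elim simp
    show "AE x in lborel. (\<lambda>m. ennreal (((\<Sum>n<m. r n x) - h x)\<^sup>2)) \<longlonglongrightarrow> 0"
      using sm
    proof eventually_elim
      case (elim x)
      have lim: "(\<lambda>k. (\<Sum>n<k. r n x)) \<longlonglongrightarrow> h x"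
        unfolding h_def by (rule summable_LIMSEQ[OF summable_rabs_cancel[OF elim]])
      have "(\<lambda>m. ennreal (((\<Sum>n<m. r n x) - h x)\<^sup>2)) \<longlonglongrightarrow> ennreal ((h x - h x)\<^sup>2)"
        by (intro tendsto_ennrealI tendsto_power tendsto_diff tendsto_const lim)
      then show ?case by simp
    qed
  qed (use G_fin in auto)
  moreover have "(\<integral>\<^sup>+x. ennreal (((\<Sum>n<m. r n x) - h x)\<^sup>2) \<partial>lborel)
      = ennreal ((L2_norm U ((\<Sum>i<m. u i) - abs_aefun h))\<^sup>2)" for m
  proof -
    have *: "AE x in lborel. rep_aefun ((\<Sum>i<m. u i) - abs_aefun h) x = (\<Sum>n<m. r n x) - h x"
      using rep_aefun_diff[of "\<Sum>i<m. u i" "abs_aefun h"] rep_aefun_sum[of u "{..<m}"]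
        rep_abs_aefun[OF \<open>h \<in> borel_measurable lborel\<close>]
      by eventually_elim (simp add: r_def)
    have "(\<integral>\<^sup>+x. ennreal (((\<Sum>n<m. r n x) - h x)\<^sup>2) \<partial>lborel)
       = (\<integral>\<^sup>+x. ennreal ((rep_aefun ((\<Sum>i<m. u i) - abs_aefun h) x)\<^sup>2) \<partial>lborel)"
      by (intro nn_integral_cong_AE) (use * in eventually_elim, simp)
    also have "\<dots> = ennreal ((L2_norm U ((\<Sum>i<m. u i) - abs_aefun h))\<^sup>2)"
      by (intro nn_integral_L2_norm U V_diff V_sum u hL2)
    finally show ?thesis .
  qed
  ultimately have "(\<lambda>m. (L2_norm U ((\<Sum>i<m. u i) - abs_aefun h))\<^sup>2) \<longlonglongrightarrow> 0"
    by (simp add: ennreal_tendsto_0_iff)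
  then have "(\<lambda>m. sqrt ((L2_norm U ((\<Sum>i<m. u i) - abs_aefun h))\<^sup>2)) \<longlonglongrightarrow> sqrt 0"
    by (rule tendsto_real_sqrt)
  moreover have "0 \<le> L2_norm U ((\<Sum>i<m. u i) - abs_aefun h)" for m
    by (intro N_nonneg V_diff V_sum u hL2)
  ultimately have "(\<lambda>m. L2_norm U ((\<Sum>i<m. u i) - abs_aefun h)) \<longlonglongrightarrow> 0" by simp
  with hL2 show ?thesis by blast
qed

lemma hilbert_carrier_L2:
  assumes U: "U \<in> sets borel" shows "hilbert_carrier (L2 U) (L2_inner U) (L2_norm U)"
proof -
  interpret inner_carrier "L2 U" "L2_inner U" "L2_norm U" by (rule inner_carrier_L2) fact
  show ?thesis
    by (intro hilbert_carrier.intro hilbert_carrier_axioms.intro inner_carrier_axioms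
        banach_carrierI_series L2_series_convergent U)
qed

text \<open>The sets over which \<open>g\<close> integrates to 0 form a Dynkin system. The integral
  over the whole space is what handles complements; it is a separate hypothesis because a generator
  such as the boxes need not contain the whole space.\<close>

lemma AE_zero_of_pi_system:
  fixes g :: "'a::euclidean_space \<Rightarrow> real"
  assumes g: "integrable lborel g" and E: "Int_stable E" "sets borel = sigma_sets UNIV E"
    and "(\<integral>x. g x \<partial>lborel) = 0" and zero: "\<And>A. A \<in> E \<Longrightarrow> (LINT x:A|lborel. g x) = 0"
  shows "AE x in lborel. g x = 0"
proof (rule sigma_finite_measure.density_zero[OF sigma_finite_lborel g])
  have si: "set_integrable lborel A g" if "A \<in> sets borel" for A
    unfolding set_integrable_def using that g by (intro integrable_mult_indicator) auto
  fix A assume "A \<in> sets (lborel :: 'a measure)"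
  then have A: "A \<in> sigma_sets UNIV E" using E by simp
  have "E \<subseteq> Pow UNIV" by simp
  from E(1) this A show "(LINT x:A|lborel. g x) = 0"
  proof (induction rule: sigma_sets_induct_disjoint)
    case (compl A)
    then have [measurable]: "A \<in> sets borel" using E by simp
    have "(LINT x:UNIV - A|lborel. g x) = (\<integral>x. g x - indicator A x *\<^sub>R g x \<partial>lborel)"
      unfolding set_lebesgue_integral_def by (intro Bochner_Integration.integral_cong) (auto simp: indicator_def)
    also have "\<dots> = 0"
      using compl assms(4) g si[of A] by (simp add: set_lebesgue_integral_def set_integrable_def)
    finally show ?case .
  next
    case (union A)
    then have A: "A i \<in> sets borel" for i using E by auto
    have "(LINT x:(\<Union>i. A i)|lborel. g x) = (\<Sum>i. LINT x:(A i)|lborel. g x)"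
      using A union(1) by (intro lebesgue_integral_countable_add si) (auto simp: disjoint_family_on_def)
    then show ?case using union by simp
  qed (use zero in \<open>auto simp: set_lebesgue_integral_def\<close>)
qed

section \<open>Test functions and the fundamental lemma\<close>

lemma pderivs_append: "pderivs (bs @ cs) \<phi> = pderivs bs (pderivs cs \<phi>)"
  by (induction bs) auto

lemma smooth_differentiable: "smooth \<phi> \<Longrightarrow> \<phi> differentiable (at x)"
  unfolding smooth_def differentiable_on_def by (drule bspec[of _ _ "[]"]) auto

lemma smooth_has_derivative: "smooth \<phi> \<Longrightarrow> (\<phi> has_derivative frechet_derivative \<phi> (at x)) (at x)"
  using smooth_differentiable frechet_derivative_works by blast

lemma smooth_pderivs:
  fixes \<phi> :: "'a::euclidean_space \<Rightarrow> real"
  assumes "smooth \<phi>" "cs \<in> lists Basis" shows "smooth (pderivs cs \<phi>)"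
  unfolding smooth_def
proof
  fix bs :: "'a list" assume "bs \<in> lists Basis"
  then have "bs @ cs \<in> lists Basis" using assms by auto
  then have "pderivs (bs @ cs) \<phi> differentiable_on UNIV" using assms(1) by (auto simp: smooth_def)
  then show "pderivs bs (pderivs cs \<phi>) differentiable_on UNIV" by (simp add: pderivs_append)
qed

text \<open>Induction on the list of directions. Smoothness can thus be shown by naming a class that
  contains the function and is stable under partial derivatives, without formulas for the higher
  derivatives.\<close>

lemma smooth_coinduct:
  fixes \<phi> :: "'a::euclidean_space \<Rightarrow> real"
  assumes "P \<phi>"
    and step: "\<And>f. P f \<Longrightarrow> \<exists>D. (\<forall>x. (f has_derivative D x) (at x)) \<and> (\<forall>b\<in>Basis. P (\<lambda>x. D x b))"
  shows "smooth \<phi>"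
proof -
  have P: "P (pderivs bs \<phi>)" if "bs \<in> lists Basis" for bs
    using that
  proof (induction bs)
    case (Cons b bs)
    then obtain D where D: "\<And>x. (pderivs bs \<phi> has_derivative D x) (at x)" "P (\<lambda>x. D x b)"
      using step[of "pderivs bs \<phi>"] by auto
    have "pderivs (b # bs) \<phi> = (\<lambda>x. D x b)"
      using frechet_derivative_at[OF D(1)] by simp
    with D(2) show ?case by simp
  qed (use assms in simp)
  show ?thesis
    unfolding smooth_def differentiable_on_def differentiable_def
  proof (intro ballI)
    fix bs :: "'a list" and x assume "bs \<in> lists Basis"
    with step[OF P] obtain D where "\<forall>x. (pderivs bs \<phi> has_derivative D x) (at x)" by blast
    then show "\<exists>D. (pderivs bs \<phi> has_derivative D) (at x within UNIV)" by auto
  qed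
qed

text \<open>The function \<open>exp (- 1 / t)\<close>, flat at 0, with a polynomial in
  \<open>1 / t\<close> as a factor. The polynomial makes the family closed under
  differentiation.\<close>

definition flat :: "real poly \<Rightarrow> real \<Rightarrow> real" where
  "flat p t = (if t > 0 then poly p (1 / t) * exp (- (1 / t)) else 0)"

lemma poly_times_exp_tendsto_0: "((\<lambda>y. poly p y * exp (- y)) \<longlongrightarrow> (0::real)) at_top"
proof -
  have "((\<lambda>y. \<Sum>i\<le>degree p. coeff p i * (y ^ i / exp y)) \<longlongrightarrow> (\<Sum>i\<le>degree p. coeff p i * 0)) at_top"
    by (intro tendsto_intros tendsto_power_div_exp_0)
  moreover have "poly p y * exp (- y) = (\<Sum>i\<le>degree p. coeff p i * (y ^ i / exp y))" for y :: real
    by (simp add: poly_altdef sum_distrib_right exp_minus divide_inverse mult.assoc)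
  ultimately show ?thesis by simp
qed

text \<open>With \<open>y = 1 / t\<close> one has \<open>d/dt = - y\<^sup>2 d/dy\<close>. Applied to
  \<open>p(y) exp (- y)\<close> this gives \<open>(p(y) - p'(y)) y\<^sup>2 exp (- y)\<close>, and
  \<open>[:0, 0, 1:]\<close> is the polynomial \<open>y\<^sup>2\<close>.\<close>

lemma flat_deriv: "(flat p has_real_derivative flat ((p - pderiv p) * [:0, 0, 1:]) t) (at t)"
proof -
  let ?q = "(p - pderiv p) * [:0, 0, 1:]"
  consider "t > 0" | "t < 0" | "t = 0" by linarith
  then show ?thesis
  proof cases
    case 1
    have "((\<lambda>t. poly p (1 / t) * exp (- (1 / t))) has_real_derivative flat ?q t) (at t)"
      using 1 by (auto simp: flat_def field_simps power2_eq_square intro!: derivative_eq_intros DERIV_chain2[OF poly_DERIV])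
    then show ?thesis
      by (rule has_field_derivative_transform_within_open[of _ _ _ "{0<..}"]) (use 1 in \<open>auto simp: flat_def\<close>)
  next
    case 2
    have "((\<lambda>t. 0) has_real_derivative flat ?q t) (at t)"
      using 2 by (simp add: flat_def)
    then show ?thesis
      by (rule has_field_derivative_transform_within_open[of _ _ _ "{..<0}"]) (use 2 in \<open>auto simp: flat_def\<close>)
  next
    case 3
    \<comment> \<open>The difference quotient at 0. From the right it becomes
      \<open>y p(y) exp (- y)\<close> with \<open>y = 1 / h\<close> tending to infinity.\<close>
    have "((\<lambda>h. flat p h / h) \<longlongrightarrow> 0) (at 0)"
    proof (rule filterlim_split_at)
      have "\<forall>\<^sub>F h in at_left 0. flat p h / h = 0"
        unfolding eventually_at_filter by (rule always_eventually) (auto simp: flat_def)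
      then show "((\<lambda>h. flat p h / h) \<longlongrightarrow> 0) (at_left 0)" by (rule tendsto_eventually)
      show "((\<lambda>h. flat p h / h) \<longlongrightarrow> 0) (at_right 0)"
        unfolding filterlim_at_right_to_top
      proof (rule Lim_transform_eventually[OF poly_times_exp_tendsto_0[of "p * [:0, 1:]"]])
        show "\<forall>\<^sub>F y in at_top. poly (p * [:0, 1:]) y * exp (- y) = flat p (inverse y) / inverse y"
          using eventually_gt_at_top[of 0] by eventually_elim (simp add: flat_def field_simps)
      qed
    qed
    then show ?thesis using 3 by (simp add: has_field_derivative_iff flat_def)
  qed
qed

text \<open>The algebra generated by flat functions of affine functions. It contains the constants
  because the chain rule produces the factors \<open>v \<bullet> b\<close>; being stable under
  partial derivatives, it consists of smooth functions.\<close>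

inductive bump_algebra :: "('a::euclidean_space \<Rightarrow> real) \<Rightarrow> bool" where
  flat: "bump_algebra (\<lambda>x. flat p (v \<bullet> x + d))"
| const: "bump_algebra (\<lambda>x. c)"
| add: "bump_algebra f \<Longrightarrow> bump_algebra g \<Longrightarrow> bump_algebra (\<lambda>x. f x + g x)"
| mult: "bump_algebra f \<Longrightarrow> bump_algebra g \<Longrightarrow> bump_algebra (\<lambda>x. f x * g x)"

lemma bump_algebra_derivative:
  "bump_algebra f \<Longrightarrow> \<exists>D. (\<forall>x. (f has_derivative D x) (at x)) \<and> (\<forall>b. bump_algebra (\<lambda>x. D x b))"
proof (induction rule: bump_algebra.induct)
  case (flat p v d)
  let ?q = "(p - pderiv p) * [:0, 0, 1:]"
  have "((\<lambda>x. flat p (v \<bullet> x + d)) has_derivative (\<lambda>h. flat ?q (v \<bullet> x + d) * (v \<bullet> h))) (at x)" for x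
  proof -
    have "((\<lambda>x. v \<bullet> x + d) has_derivative (\<lambda>h. v \<bullet> h)) (at x)"
      by (auto intro!: derivative_eq_intros)
    from has_derivative_compose[OF this flat_deriv[unfolded has_field_derivative_def]] show ?thesis .
  qed
  moreover have "bump_algebra (\<lambda>x. flat ?q (v \<bullet> x + d) * (v \<bullet> b))" for b
    by (intro bump_algebra.intros)
  ultimately show ?case
    by (intro exI[of _ "\<lambda>x h. flat ?q (v \<bullet> x + d) * (v \<bullet> h)"]) auto
next
  case (const c)
  show ?case by (intro exI[of _ "\<lambda>x h. 0"]) (auto intro: bump_algebra.const)
next
  case (add f g)
  then obtain D E where D: "\<And>x. (f has_derivative D x) (at x)" "\<And>b. bump_algebra (\<lambda>x. D x b)"
    and E: "\<And>x. (g has_derivative E x) (at x)" "\<And>b. bump_algebra (\<lambda>x. E x b)" by blast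
  have "((\<lambda>x. f x + g x) has_derivative (\<lambda>h. D x h + E x h)) (at x)" for x
    by (rule has_derivative_add[OF D(1) E(1)])
  moreover have "bump_algebra (\<lambda>x. D x b + E x b)" for b by (intro bump_algebra.add D E)
  ultimately show ?case by (intro exI[of _ "\<lambda>x h. D x h + E x h"]) auto
next
  case (mult f g)
  then obtain D E where D: "\<And>x. (f has_derivative D x) (at x)" "\<And>b. bump_algebra (\<lambda>x. D x b)"
    and E: "\<And>x. (g has_derivative E x) (at x)" "\<And>b. bump_algebra (\<lambda>x. E x b)" by blast
  have "((\<lambda>x. f x * g x) has_derivative (\<lambda>h. f x * E x h + D x h * g x)) (at x)" for x
    by (rule has_derivative_mult[OF D(1) E(1)])
  moreover have "bump_algebra (\<lambda>x. f x * E x b + D x b * g x)" for b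
    by (intro bump_algebra.add bump_algebra.mult D E mult.hyps)
  ultimately show ?case by (intro exI[of _ "\<lambda>x h. f x * E x h + D x h * g x"]) auto
qed

lemma bump_algebra_smooth: "bump_algebra f \<Longrightarrow> smooth f"
  by (rule smooth_coinduct[of bump_algebra]) (use bump_algebra_derivative in blast)+

lemma bump_algebra_prod:
  "(\<And>i. i \<in> I \<Longrightarrow> bump_algebra (f i)) \<Longrightarrow> bump_algebra (\<lambda>x. \<Prod>i\<in>I. f i x)"
  by (induction I rule: infinite_finite_induct) (auto intro: bump_algebra.intros)

text \<open>Since \<open>exp (- 1 / (n t))\<close> tends to \<open>1\<close> for \<open>t > 0\<close>, these functions increase to the indicator of the box.\<close>

definition box_bump :: "'a::euclidean_space \<Rightarrow> 'a \<Rightarrow> nat \<Rightarrow> 'a \<Rightarrow> real" where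
  "box_bump a b n x = (\<Prod>i\<in>Basis. flat 1 ((real n *\<^sub>R i) \<bullet> x + (- real n * (a \<bullet> i)))
      * flat 1 ((- real n *\<^sub>R i) \<bullet> x + real n * (b \<bullet> i)))"

lemma flat_1_range: "0 \<le> flat 1 t" "flat 1 t \<le> 1"
  by (auto simp: flat_def)

lemma box_bump_range: "0 \<le> box_bump a b n x" "box_bump a b n x \<le> 1"
  unfolding box_bump_def
  by (auto intro!: prod_nonneg prod_le_1 mult_nonneg_nonneg mult_le_one flat_1_range)

lemma box_bump_smooth: "smooth (box_bump a b n)"
proof -
  have "bump_algebra (box_bump a b n)"
    unfolding box_bump_def[abs_def] by (intro bump_algebra_prod bump_algebra.intros)
  then show ?thesis by (rule bump_algebra_smooth)
qed

lemma box_bump_outside: assumes "x \<notin> box a b" shows "box_bump a b n x = 0"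
proof -
  obtain i where i: "i \<in> Basis" "\<not> (a \<bullet> i < x \<bullet> i \<and> x \<bullet> i < b \<bullet> i)"
    using assms by (auto simp: mem_box)
  then have "real n * (x \<bullet> i) \<le> real n * (a \<bullet> i) \<or> real n * (b \<bullet> i) \<le> real n * (x \<bullet> i)"
    by (auto intro: mult_left_mono)
  then have "flat 1 ((real n *\<^sub>R i) \<bullet> x + (- real n * (a \<bullet> i))) * flat 1 ((- real n *\<^sub>R i) \<bullet> x + real n * (b \<bullet> i)) = 0"
    by (auto simp: flat_def inner_commute)
  then show ?thesis unfolding box_bump_def using i(1) by (intro prod_zero) auto
qed

lemma flat_1_tendsto: assumes "t > 0" shows "(\<lambda>n. flat 1 (real n * t)) \<longlonglongrightarrow> 1"
proof -
  have "(\<lambda>n. exp (- (inverse t * (1 / real n)))) \<longlonglongrightarrow> exp (- (inverse t * 0))"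
    by (intro tendsto_intros lim_1_over_n)
  then have "(\<lambda>n. exp (- (1 / (real n * t)))) \<longlonglongrightarrow> 1" by (simp add: field_simps)
  then show ?thesis
    by (rule Lim_transform_eventually)
       (use eventually_gt_at_top[of 0] in eventually_elim, use assms in \<open>simp add: flat_def\<close>)
qed

lemma box_bump_tendsto: assumes "x \<in> box a b" shows "(\<lambda>n. box_bump a b n x) \<longlonglongrightarrow> 1"
proof -
  have "(\<lambda>n. box_bump a b n x) \<longlonglongrightarrow> (\<Prod>i\<in>(Basis::'a set). 1 * 1)"
    unfolding box_bump_def
  proof (intro tendsto_prod tendsto_mult)
    fix i :: 'a assume i: "i \<in> Basis"
    have "(\<lambda>n. flat 1 (real n * (x \<bullet> i - a \<bullet> i))) \<longlonglongrightarrow> 1" "(\<lambda>n. flat 1 (real n * (b \<bullet> i - x \<bullet> i))) \<longlonglongrightarrow> 1"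
      using assms i by (auto simp: mem_box intro!: flat_1_tendsto)
    then show "(\<lambda>n. flat 1 ((real n *\<^sub>R i) \<bullet> x + (- real n * (a \<bullet> i)))) \<longlonglongrightarrow> 1"
      "(\<lambda>n. flat 1 ((- real n *\<^sub>R i) \<bullet> x + real n * (b \<bullet> i))) \<longlonglongrightarrow> 1"
      by (simp_all add: algebra_simps inner_commute)
  qed
  then show ?thesis by simp
qed

lemma test_function_box_bump:
  assumes "cbox a b \<subseteq> U" shows "test_function U (box_bump a b n)"
  unfolding test_function_def
proof (intro conjI exI[of _ "cbox a b"] allI impI)
  fix x assume "x \<notin> cbox a b"
  then show "box_bump a b n x = 0" using box_subset_cbox by (intro box_bump_outside) blast
qed (use assms box_bump_smooth in auto)

lemma test_function_smooth: "test_function U \<phi> \<Longrightarrow> smooth \<phi>"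
  by (simp add: test_function_def)

lemma test_function_pderiv:
  assumes \<phi>: "test_function U \<phi>" and b: "b \<in> Basis"
  shows "test_function U (\<lambda>x. frechet_derivative \<phi> (at x) b)"
proof -
  obtain K where K: "compact K" "K \<subseteq> U" "\<And>x. x \<notin> K \<Longrightarrow> \<phi> x = 0" and s: "smooth \<phi>"
    using \<phi> unfolding test_function_def by blast
  have "frechet_derivative \<phi> (at x) b = 0" if x: "x \<notin> K" for x
  proof -
    have "((\<lambda>x. 0) has_derivative (\<lambda>h. 0)) (at x)" by simp
    then have "(\<phi> has_derivative (\<lambda>h. 0)) (at x)"
      by (rule has_derivative_transform_within_open[of _ _ _ _ "- K"])
         (use K x compact_imp_closed in \<open>auto simp: open_Compl\<close>)
    then show ?thesis using frechet_derivative_at by metis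
  qed
  moreover have "smooth (\<lambda>x. frechet_derivative \<phi> (at x) b)"
    using smooth_pderivs[OF s, of "[b]"] b by simp
  ultimately show ?thesis unfolding test_function_def using K by blast
qed

lemma test_function_pderivs:
  "test_function U \<phi> \<Longrightarrow> bs \<in> lists Basis \<Longrightarrow> test_function U (pderivs bs \<phi>)"
  by (induction bs) (auto intro: test_function_pderiv)

lemma test_function_continuous: "test_function U \<phi> \<Longrightarrow> continuous_on UNIV \<phi>"
  using smooth_differentiable[OF test_function_smooth]
  by (auto simp: continuous_on_eq_continuous_within intro!: differentiable_imp_continuous_within)

lemma test_function_measurable [measurable_dest]:
  "test_function U \<phi> \<Longrightarrow> \<phi> \<in> borel_measurable borel"
  by (intro borel_measurable_continuous_onI test_function_continuous)

lemma test_function_bounded: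
  assumes "test_function U \<phi>"
  obtains B K where "compact K" "K \<subseteq> U" "\<And>x. \<bar>\<phi> x\<bar> \<le> B * indicator K x"
proof -
  obtain K where K: "compact K" "K \<subseteq> U" "\<And>x. x \<notin> K \<Longrightarrow> \<phi> x = 0"
    using assms unfolding test_function_def by blast
  have "compact (\<phi> ` K)"
    by (rule compact_continuous_image[OF continuous_on_subset[OF test_function_continuous[OF assms]] K(1)]) simp
  then have "bounded (\<phi> ` K)" by (rule compact_imp_bounded)
  then obtain B where B: "\<forall>y\<in>\<phi> ` K. norm y \<le> B" unfolding bounded_iff by blast
  have "\<bar>\<phi> x\<bar> \<le> B * indicator K x" for x
    using B K(3)[of x] by (cases "x \<in> K") auto
  with K show thesis by (intro that[of K B])
qed

lemma integrable_indicator_compact: "compact (K :: 'a::euclidean_space set) \<Longrightarrow> integrable lborel (indicat_real K)"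
  by (intro integrable_real_indicator emeasure_compact_finite) (auto simp: borel_compact emeasure_compact_finite)

lemma test_function_L2:
  assumes \<phi>: "test_function U \<phi>" shows "abs_aefun \<phi> \<in> L2 U"
proof -
  obtain B K where K: "compact K" "K \<subseteq> U" "\<And>x. \<bar>\<phi> x\<bar> \<le> B * indicator K x"
    by (rule test_function_bounded[OF \<phi>]) (rule that)
  have [measurable]: "\<phi> \<in> borel_measurable borel" by (rule test_function_measurable[OF \<phi>])
  show ?thesis
  proof (rule L2_I)
    show "integrable lborel (\<lambda>x. (\<phi> x)\<^sup>2)"
    proof (rule Bochner_Integration.integrable_bound)
      show "integrable lborel (\<lambda>x. B\<^sup>2 * indicat_real K x)"
        by (intro integrable_mult_right integrable_indicator_compact K)
      have "(\<phi> x)\<^sup>2 \<le> B\<^sup>2 * indicator K x" for x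
        using power_mono[OF K(3)[of x], of 2] K(3)[of x] by (cases "x \<in> K") auto
      then show "AE x in lborel. norm ((\<phi> x)\<^sup>2) \<le> norm (B\<^sup>2 * indicat_real K x)" by simp
    qed simp
    have "\<phi> x = 0" if "x \<notin> U" for x
      using K(3)[of x] that K(2) by (cases "x \<in> K") auto
    then show "AE x in lborel. x \<notin> U \<longrightarrow> \<phi> x = 0" by simp
  qed simp
qed

text \<open>Fix a box whose closure lies in \<open>U\<close>. Its intersections with other boxes are
  again such boxes, so \<open>g\<close> integrates to 0 over all of them and the pi-system argument
  applies. By Lindelof countably many such boxes cover \<open>U\<close>.\<close>

lemma AE_zero_of_box_integrals:
  fixes g :: "'a::euclidean_space \<Rightarrow> real"
  assumes U: "open U"
    and int: "\<And>a b. cbox a b \<subseteq> U \<Longrightarrow> set_integrable lborel (box a b) g"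
    and zero: "\<And>a b. cbox a b \<subseteq> U \<Longrightarrow> box a b \<noteq> {} \<Longrightarrow> (LINT x:box a b|lborel. g x) = 0"
  shows "AE x in lborel. x \<in> U \<longrightarrow> g x = 0"
proof -
  have zero': "(LINT x:box a b|lborel. g x) = 0" if "cbox a b \<subseteq> U" for a b
    using zero[OF that] by (cases "box a b = {}") (auto simp: set_lebesgue_integral_def)
  define F where "F = {box a b | a b. cbox a b \<subseteq> U}"
  have "\<And>S. S \<in> F \<Longrightarrow> open S" by (auto simp: F_def)
  from Lindelof[OF this] obtain F' where F': "F' \<subseteq> F" "countable F'" "\<Union>F' = \<Union>F" by blast
  have U_F: "U \<subseteq> \<Union>F"
  proof
    fix x assume "x \<in> U"
    then obtain e where e: "e > 0" "cball x e \<subseteq> U" using U open_contains_cball by blast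
    obtain a b where ab: "x \<in> box a b" "box a b \<subseteq> ball x e" using rational_boxes[OF e(1), of x] by blast
    have "cbox a b = closure (box a b)" using ab(1) by (metis closure_box empty_iff)
    also have "\<dots> \<subseteq> cball x e" using ab(2) by (meson ball_subset_cball closed_cball closure_minimal order_trans)
    finally have "box a b \<in> F" using e(2) unfolding F_def by blast
    then show "x \<in> \<Union>F" using ab(1) by blast
  qed
  have "AE x in lborel. x \<in> Q \<longrightarrow> g x = 0" if QF: "Q \<in> F" for Q
  proof -
    obtain a b where Q: "Q = box a b" "cbox a b \<subseteq> U" using QF unfolding F_def by blast
    have "AE x in lborel. indicator Q x * g x = 0"
    proof (rule AE_zero_of_pi_system[where E="range (\<lambda>(a, b). box a b)"])
      show "integrable lborel (\<lambda>x. indicator Q x * g x)"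
        using int[OF Q(2)] by (simp add: Q set_integrable_def)
      show "Int_stable (range (\<lambda>(a, b). box a b :: 'a set))"
        by (auto simp: Int_stable_def box_Int_box)
      show "sets borel = sigma_sets UNIV (range (\<lambda>(a, b). box a b :: 'a set))"
        unfolding borel_eq_box by (rule sets_measure_of) simp
      show "(\<integral>x. indicator Q x * g x \<partial>lborel) = 0"
        using zero'[OF Q(2)] by (simp add: Q set_lebesgue_integral_def)
      fix A :: "'a set" assume "A \<in> range (\<lambda>(a, b). box a b)"
      then obtain c d where A: "A = box c d" by auto
      define l where "l = (\<Sum>i\<in>Basis. max (c \<bullet> i) (a \<bullet> i) *\<^sub>R i)"
      define u where "u = (\<Sum>i\<in>Basis. min (d \<bullet> i) (b \<bullet> i) *\<^sub>R i)"
      have AQ: "A \<inter> Q = box l u" by (simp add: A Q l_def u_def box_Int_box)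
      have "cbox l u \<subseteq> cbox a b" by (auto simp: mem_box l_def u_def)
      then have "(LINT x:box l u|lborel. g x) = 0" using zero' Q(2) by blast
      then show "(LINT x:A|lborel. indicator Q x * g x) = 0"
        unfolding AQ[symmetric] by (simp add: set_lebesgue_integral_def indicator_inter_arith mult.assoc)
    qed
    then show ?thesis by eventually_elim (auto simp: indicator_def split: if_splits)
  qed
  then have "AE x in lborel. \<forall>Q\<in>F'. x \<in> Q \<longrightarrow> g x = 0"
    using F'(1) by (subst AE_ball_countable[OF F'(2)]) auto
  then show ?thesis by eventually_elim (use U_F F'(3) in blast)
qed

text \<open>The common core of two fundamental lemmas: it asks for bounded approximations of the
  indicators of boxes against which \<open>f\<close> integrates to 0, whether these are bumps or, on
  a product space, products of bumps.\<close>

lemma L2_zero_of_box_approximations: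
  fixes f :: "'a::euclidean_space aefun"
  assumes U: "open U" and f: "f \<in> L2 U"
    and h: "\<And>a b. cbox a b \<subseteq> U \<Longrightarrow> box a b \<noteq> {} \<Longrightarrow> \<exists>h. \<forall>n. h n \<in> borel_measurable borel \<and>
        (\<forall>x. \<bar>h n x\<bar> \<le> indicator (box a b) x) \<and> (\<forall>x\<in>box a b. (\<lambda>n. h n x) \<longlonglongrightarrow> 1) \<and>
        (\<integral>x. rep_aefun f x * h n x \<partial>lborel) = 0"
  shows "f = 0"
proof -
  have int: "integrable lborel (\<lambda>x. indicator (box a b) x * rep_aefun f x)" for a b :: 'a
  proof (rule integrable_mult_of_squares[OF _ _ _ L2_D(1)[OF f]])
    have "integrable lborel (indicat_real (box a b))"
      using emeasure_lborel_box_finite[of a b] by (intro integrable_real_indicator) (auto simp: less_top)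
    moreover have "(\<lambda>x. (indicat_real (box a b) x)\<^sup>2) = indicat_real (box a b)"
      by (auto simp: indicator_def fun_eq_iff)
    ultimately show "integrable lborel (\<lambda>x. (indicat_real (box a b) x)\<^sup>2)" by simp
  qed auto
  have zero: "AE x in lborel. x \<in> U \<longrightarrow> rep_aefun f x = 0"
  proof (rule AE_zero_of_box_integrals[OF U])
    show "set_integrable lborel (box a b) (rep_aefun f)" for a b
      using int by (simp add: set_integrable_def)
    fix a b assume ab: "cbox a b \<subseteq> U" "box a b \<noteq> {}"
    then obtain h where h: "\<And>n. h n \<in> borel_measurable borel" "\<And>n x. \<bar>h n x\<bar> \<le> indicator (box a b) x"
      "\<And>x. x \<in> box a b \<Longrightarrow> (\<lambda>n. h n x) \<longlonglongrightarrow> 1" "\<And>n. (\<integral>x. rep_aefun f x * h n x \<partial>lborel) = 0"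
      using h[OF ab] by blast
    have [measurable]: "h n \<in> borel_measurable borel" for n by (rule h(1))
    have "(\<lambda>n. \<integral>x. rep_aefun f x * h n x \<partial>lborel) \<longlonglongrightarrow> (\<integral>x. indicator (box a b) x * rep_aefun f x \<partial>lborel)"
    proof (rule integral_dominated_convergence)
      show "integrable lborel (\<lambda>x. \<bar>indicator (box a b) x * rep_aefun f x\<bar>)" using int by simp
      show "AE x in lborel. (\<lambda>n. rep_aefun f x * h n x) \<longlonglongrightarrow> indicator (box a b) x * rep_aefun f x"
      proof (rule AE_I2)
        fix x
        have "(\<lambda>n. h n x) \<longlonglongrightarrow> indicator (box a b) x"
        proof (cases "x \<in> box a b")
          case False
          then have "h n x = 0" for n using h(2)[of n x] by simp
          then show ?thesis using False by simp
        qed (use h(3) in auto)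
        then have "(\<lambda>n. rep_aefun f x * h n x) \<longlonglongrightarrow> rep_aefun f x * indicator (box a b) x"
          by (intro tendsto_intros)
        then show "(\<lambda>n. rep_aefun f x * h n x) \<longlonglongrightarrow> indicator (box a b) x * rep_aefun f x"
          by (simp add: mult.commute)
      qed
      show "AE x in lborel. norm (rep_aefun f x * h n x) \<le> \<bar>indicator (box a b) x * rep_aefun f x\<bar>" for n
        using h(2)[of n] by (auto intro!: AE_I2 mult_left_mono simp: abs_mult mult.commute[of "indicator _ _"])
    qed auto
    then have lim0: "(\<lambda>n::nat. 0) \<longlonglongrightarrow> (\<integral>x. indicator (box a b) x * rep_aefun f x \<partial>lborel)" using h(4) by simp
    then show "(LINT x:box a b|lborel. rep_aefun f x) = 0"
      using LIMSEQ_unique[OF lim0 tendsto_const] by (simp add: set_lebesgue_integral_def)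
  qed
  show ?thesis
    by (intro aefun_eqI) (use zero L2_D(2)[OF f] rep_aefun_0 in eventually_elim, auto)
qed

lemma L2_inner_test:
  assumes "f \<in> L2 U" "U \<in> sets borel" "\<phi> \<in> borel_measurable lborel"
  shows "L2_inner U f (abs_aefun \<phi>) = (\<integral>x. rep_aefun f x * \<phi> x \<partial>lborel)"
  unfolding L2_inner_eq[OF assms(1,2)]
proof (rule integral_cong_AE)
  show "AE x in lborel. rep_aefun f x * rep_aefun (abs_aefun \<phi>) x = rep_aefun f x * \<phi> x"
    using rep_abs_aefun[OF assms(3)] by eventually_elim simp
qed (use assms(3) in auto)

text \<open>The fundamental lemma of the calculus of variations, with the bumps as approximations.
  It makes weak derivatives unique.\<close>

lemma L2_zero_of_test_functions:
  assumes U: "open U" and f: "f \<in> L2 U"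
    and zero: "\<And>\<phi>. test_function U \<phi> \<Longrightarrow> L2_inner U f (abs_aefun \<phi>) = 0"
  shows "f = 0"
proof (rule L2_zero_of_box_approximations[OF U f])
  fix a b assume ab: "cbox a b \<subseteq> U"
  have \<phi>: "test_function U (box_bump a b n)" for n by (rule test_function_box_bump[OF ab])
  have "(\<integral>x. rep_aefun f x * box_bump a b n x \<partial>lborel) = 0" for n
    using zero[OF \<phi>[of n]] L2_inner_test[OF f _ , of "box_bump a b n"] test_function_measurable[OF \<phi>[of n]] U by simp
  moreover have "\<bar>box_bump a b n x\<bar> \<le> indicator (box a b) x" for n x
    using box_bump_range[of a b n x] box_bump_outside[of x a b n] by (auto simp: indicator_def)
  ultimately show "\<exists>h. \<forall>n. h n \<in> borel_measurable borel \<and>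
        (\<forall>x. \<bar>h n x\<bar> \<le> indicator (box a b) x) \<and> (\<forall>x\<in>box a b. (\<lambda>n. h n x) \<longlonglongrightarrow> 1) \<and>
        (\<integral>x. rep_aefun f x * h n x \<partial>lborel) = 0"
    using test_function_measurable[OF \<phi>] box_bump_tendsto by (intro exI[of _ "box_bump a b"]) auto
qed

section \<open>Sobolev spaces\<close>

lemma set_integral_test:
  assumes [measurable]: "U \<in> sets borel" "\<psi> \<in> borel_measurable borel"
  shows "(LINT x:U|lborel. rep_aefun f x * \<psi> x) = L2_inner U f (abs_aefun \<psi>)"
  unfolding L2_inner_def set_lebesgue_integral_def
proof (rule integral_cong_AE)
  have "\<psi> \<in> borel_measurable lborel" by simp
  from rep_abs_aefun[OF this]
  show "AE x in lborel. indicat_real U x *\<^sub>R (rep_aefun f x * \<psi> x)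
      = indicat_real U x *\<^sub>R (rep_aefun f x * rep_aefun (abs_aefun \<psi>) x)"
    by eventually_elim simp
qed measurable

text \<open>Test functions and their derivatives define elements of \<open>L2 U\<close>, so the
  defining identity is one between inner products. Linearity and passage to the limit then come from
  the inner product.\<close>

lemma weak_deriv_iff:
  assumes U: "open U" and bs: "bs \<in> lists Basis"
  shows "weak_deriv U bs f g \<longleftrightarrow> (\<forall>\<phi>. test_function U \<phi> \<longrightarrow>
    L2_inner U f (abs_aefun (pderivs bs \<phi>)) = (- 1) ^ length bs * L2_inner U g (abs_aefun \<phi>))"
proof -
  have "(LINT x:U|lborel. rep_aefun f x * \<phi> x) = L2_inner U f (abs_aefun \<phi>)" if "test_function U \<phi>" for f \<phi>
    using U test_function_measurable[OF that] by (intro set_integral_test) auto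
  then show ?thesis unfolding weak_deriv_def using test_function_pderivs[OF _ bs] by auto
qed

lemma weak_derivD:
  "open U \<Longrightarrow> bs \<in> lists Basis \<Longrightarrow> weak_deriv U bs f g \<Longrightarrow> test_function U \<phi> \<Longrightarrow>
    L2_inner U f (abs_aefun (pderivs bs \<phi>)) = (- 1) ^ length bs * L2_inner U g (abs_aefun \<phi>)"
  by (simp add: weak_deriv_iff)

lemma weak_deriv_unique:
  assumes U: "open U" and bs: "bs \<in> lists Basis"
    and g: "g \<in> L2 U" "weak_deriv U bs f g" and g': "g' \<in> L2 U" "weak_deriv U bs f g'"
  shows "g = g'"
proof -
  interpret inner_carrier "L2 U" "L2_inner U" "L2_norm U" by (rule inner_carrier_L2) (use U in simp)
  have "g - g' = 0"
  proof (rule L2_zero_of_test_functions[OF U])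
    fix \<phi> assume \<phi>: "test_function U \<phi>"
    have "(- 1) ^ length bs * L2_inner U g (abs_aefun \<phi>) = (- 1) ^ length bs * L2_inner U g' (abs_aefun \<phi>)"
      using weak_derivD[OF U bs g(2) \<phi>] weak_derivD[OF U bs g'(2) \<phi>] by simp
    then show "L2_inner U (g - g') (abs_aefun \<phi>) = 0"
      using g(1) g'(1) test_function_L2[OF \<phi>] by (simp add: ip_diff_left)
  qed (use g g' in auto)
  then show ?thesis by simp
qed

lemma wderiv_eq:
  assumes "open U" "bs \<in> lists Basis" "g \<in> L2 U" "weak_deriv U bs f g"
  shows "wderiv U bs f = g"
  unfolding wderiv_def using assms weak_deriv_unique[OF assms(1,2)] by (intro the_equality) auto

lemma has_wderiv_wderiv:
  assumes "open U" "bs \<in> lists Basis" "has_wderiv U bs f"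
  shows "wderiv U bs f \<in> L2 U" "weak_deriv U bs f (wderiv U bs f)"
  using assms wderiv_eq[OF assms(1,2)] unfolding has_wderiv_def by auto

lemma has_wderivI: "g \<in> L2 U \<Longrightarrow> weak_deriv U bs f g \<Longrightarrow> has_wderiv U bs f"
  by (auto simp: has_wderiv_def)

lemma weak_deriv_add:
  assumes U: "open U" and bs: "bs \<in> lists Basis"
    and fg: "f \<in> L2 U" "g \<in> L2 U" "weak_deriv U bs f g"
    and fg': "f' \<in> L2 U" "g' \<in> L2 U" "weak_deriv U bs f' g'"
  shows "weak_deriv U bs (f + f') (g + g')"
proof -
  interpret inner_carrier "L2 U" "L2_inner U" "L2_norm U" by (rule inner_carrier_L2) (use U in simp)
  show ?thesis
    unfolding weak_deriv_iff[OF U bs]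
  proof (intro allI impI)
    fix \<phi> assume \<phi>: "test_function U \<phi>"
    show "L2_inner U (f + f') (abs_aefun (pderivs bs \<phi>)) = (- 1) ^ length bs * L2_inner U (g + g') (abs_aefun \<phi>)"
      using fg fg' test_function_L2[OF \<phi>] test_function_L2[OF test_function_pderivs[OF \<phi> bs]]
        weak_derivD[OF U bs fg(3) \<phi>] weak_derivD[OF U bs fg'(3) \<phi>]
      by (simp add: ip_add_left distrib_left)
  qed
qed

lemma weak_deriv_scale:
  assumes U: "open U" and bs: "bs \<in> lists Basis"
    and fg: "f \<in> L2 U" "g \<in> L2 U" "weak_deriv U bs f g"
  shows "weak_deriv U bs (c *\<^sub>R f) (c *\<^sub>R g)"
proof -
  interpret inner_carrier "L2 U" "L2_inner U" "L2_norm U" by (rule inner_carrier_L2) (use U in simp)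
  show ?thesis
    unfolding weak_deriv_iff[OF U bs]
  proof (intro allI impI)
    fix \<phi> assume \<phi>: "test_function U \<phi>"
    show "L2_inner U (c *\<^sub>R f) (abs_aefun (pderivs bs \<phi>)) = (- 1) ^ length bs * L2_inner U (c *\<^sub>R g) (abs_aefun \<phi>)"
      using fg test_function_L2[OF \<phi>] test_function_L2[OF test_function_pderivs[OF \<phi> bs]]
        weak_derivD[OF U bs fg(3) \<phi>]
      by (simp add: ip_scale_left)
  qed
qed

text \<open>Weak differentiation is a closed operator: for a fixed test function both sides of the
  defining identity are continuous in \<open>L2\<close>. This gives the completeness of the Sobolev
  spaces and the termwise differentiation of series of kernels.\<close>

lemma weak_deriv_limit:
  assumes U: "open U" and bs: "bs \<in> lists Basis"
    and fg: "\<And>n. f n \<in> L2 U" "\<And>n. g n \<in> L2 U" "\<And>n. weak_deriv U bs (f n) (g n)"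
    and lim: "l \<in> L2 U" "(\<lambda>n. L2_norm U (f n - l)) \<longlonglongrightarrow> 0" "m \<in> L2 U" "(\<lambda>n. L2_norm U (g n - m)) \<longlonglongrightarrow> 0"
  shows "weak_deriv U bs l m"
proof -
  interpret inner_carrier "L2 U" "L2_inner U" "L2_norm U" by (rule inner_carrier_L2) (use U in simp)
  show ?thesis
    unfolding weak_deriv_iff[OF U bs]
  proof (intro allI impI)
    fix \<phi> assume \<phi>: "test_function U \<phi>"
    note L = test_function_L2[OF \<phi>] test_function_L2[OF test_function_pderivs[OF \<phi> bs]]
    have "(\<lambda>n. L2_inner U (f n) (abs_aefun (pderivs bs \<phi>))) \<longlonglongrightarrow> L2_inner U l (abs_aefun (pderivs bs \<phi>))"
      by (rule ip_tendsto[OF fg(1) lim(1) L(2) lim(2)])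
    moreover have "(\<lambda>n. (- 1) ^ length bs * L2_inner U (g n) (abs_aefun \<phi>)) \<longlonglongrightarrow> (- 1) ^ length bs * L2_inner U m (abs_aefun \<phi>)"
      by (intro tendsto_intros ip_tendsto[OF fg(2) lim(3) L(1) lim(4)])
    ultimately show "L2_inner U l (abs_aefun (pderivs bs \<phi>)) = (- 1) ^ length bs * L2_inner U m (abs_aefun \<phi>)"
      unfolding weak_derivD[OF U bs fg(3) \<phi>] by (rule LIMSEQ_unique)
  qed
qed

lemma weak_deriv_Nil: "weak_deriv U [] f f"
  by (simp add: weak_deriv_def)

lemma mdirs_Basis: "mdirs \<alpha> \<in> lists Basis"
  by (auto simp: mdirs_def in_lists_conv_set Basis_vec_def)

lemma mdirs_0 [simp]: "mdirs (\<lambda>_. 0) = []"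
  by (simp add: mdirs_def)

lemma mdeg_0 [simp]: "mdeg (\<lambda>_. 0) = 0"
  by (simp add: mdeg_def)

lemma mdeg_eq_0: "mdeg \<alpha> = 0 \<longleftrightarrow> \<alpha> = (\<lambda>_. 0)"
  by (auto simp: mdeg_def)

lemma finite_mdeg [simp]: "finite {\<alpha> :: 'n::finite mindex. mdeg \<alpha> \<le> k}"
proof (rule finite_subset)
  have "\<alpha> i \<le> mdeg \<alpha>" for \<alpha> :: "'n mindex" and i
    unfolding mdeg_def by (rule member_le_sum) auto
  then show "{\<alpha> :: 'n mindex. mdeg \<alpha> \<le> k} \<subseteq> PiE UNIV (\<lambda>_. {..k})"
    by (auto intro: order_trans)
  show "finite (PiE (UNIV :: 'n set) (\<lambda>_. {..k}))" by (intro finite_PiE) auto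
qed

lemma wderiv_Nil: "open U \<Longrightarrow> f \<in> L2 U \<Longrightarrow> wderiv U [] f = f"
  by (simp add: wderiv_eq weak_deriv_Nil)

lemma Sobolev_L2: "f \<in> Sobolev \<Theta> k \<Longrightarrow> f \<in> L2 \<Theta>"
  by (simp add: Sobolev_def)

lemma Sobolev_0: "Sobolev \<Theta> 0 = L2 \<Theta>"
  by (auto simp: Sobolev_def mdeg_eq_0 intro: has_wderivI weak_deriv_Nil)

lemma Sobolev_inner_0: "open \<Theta> \<Longrightarrow> f \<in> L2 \<Theta> \<Longrightarrow> g \<in> L2 \<Theta> \<Longrightarrow> Sobolev_inner \<Theta> 0 f g = L2_inner \<Theta> f g"
  by (simp add: Sobolev_inner_def mdeg_eq_0 wderiv_Nil)

lemma Sobolev_norm_0: "open \<Theta> \<Longrightarrow> f \<in> L2 \<Theta> \<Longrightarrow> Sobolev_norm \<Theta> 0 f = L2_norm \<Theta> f"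
  by (simp add: Sobolev_norm_def L2_norm_def Sobolev_inner_0)

lemma mderiv_Sobolev:
  assumes "open \<Theta>" "f \<in> Sobolev \<Theta> k" "mdeg \<alpha> \<le> k"
  shows "mderiv \<Theta> \<alpha> f \<in> L2 \<Theta>" "weak_deriv \<Theta> (mdirs \<alpha>) f (mderiv \<Theta> \<alpha> f)"
  using has_wderiv_wderiv[OF assms(1) mdirs_Basis] assms by (auto simp: Sobolev_def)

text \<open>Exhibiting weak derivatives proves membership and, by their uniqueness, computes
  \<open>mderiv\<close>.\<close>

lemma Sobolev_I:
  assumes "open \<Theta>" "f \<in> L2 \<Theta>"
    and "\<And>\<alpha>. mdeg \<alpha> \<le> k \<Longrightarrow> g \<alpha> \<in> L2 \<Theta>" "\<And>\<alpha>. mdeg \<alpha> \<le> k \<Longrightarrow> weak_deriv \<Theta> (mdirs \<alpha>) f (g \<alpha>)"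
  shows "f \<in> Sobolev \<Theta> k" "mdeg \<alpha> \<le> k \<Longrightarrow> mderiv \<Theta> \<alpha> f = g \<alpha>"
  using assms(2-4) wderiv_eq[OF assms(1) mdirs_Basis] by (auto simp: Sobolev_def intro: has_wderivI)

lemma subspace_Sobolev:
  assumes "open \<Theta>" shows "subspace (Sobolev \<Theta> k)"
  unfolding subspace_def
proof (intro conjI ballI allI)
  note L = subspace_L2[of \<Theta>]
  have "weak_deriv \<Theta> (mdirs \<alpha>) 0 0" for \<alpha>
    using weak_deriv_scale[OF assms mdirs_Basis _ _ , of 0 0 \<alpha> 0] subspace_0[OF L]
    by (subst weak_deriv_iff[OF assms mdirs_Basis])
       (simp add: inner_carrier.ip_0[OF inner_carrier_L2] assms test_function_L2 test_function_pderivs[OF _ mdirs_Basis])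
  then show "0 \<in> Sobolev \<Theta> k" using subspace_0[OF L] by (intro Sobolev_I[OF assms]) auto
  show "f + g \<in> Sobolev \<Theta> k" if "f \<in> Sobolev \<Theta> k" "g \<in> Sobolev \<Theta> k" for f g
    using that mderiv_Sobolev[OF assms] Sobolev_L2
    by (intro Sobolev_I(1)[OF assms, where g="\<lambda>\<alpha>. mderiv \<Theta> \<alpha> f + mderiv \<Theta> \<alpha> g"])
       (auto intro!: weak_deriv_add[OF assms mdirs_Basis] subspace_add[OF L])
  show "c *\<^sub>R f \<in> Sobolev \<Theta> k" if "f \<in> Sobolev \<Theta> k" for c f
    using that mderiv_Sobolev[OF assms] Sobolev_L2
    by (intro Sobolev_I(1)[OF assms, where g="\<lambda>\<alpha>. c *\<^sub>R mderiv \<Theta> \<alpha> f"])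
       (auto intro!: weak_deriv_scale[OF assms mdirs_Basis] subspace_scale[OF L])
qed

lemma linear_on_mderiv:
  assumes "open \<Theta>" "mdeg \<alpha> \<le> k" shows "linear_on (Sobolev \<Theta> k) (mderiv \<Theta> \<alpha>)"
proof (rule linear_onI)
  note L = subspace_L2[of \<Theta>]
  show "mderiv \<Theta> \<alpha> (f + g) = mderiv \<Theta> \<alpha> f + mderiv \<Theta> \<alpha> g" if "f \<in> Sobolev \<Theta> k" "g \<in> Sobolev \<Theta> k" for f g
    using that mderiv_Sobolev[OF assms(1) _ assms(2)] Sobolev_L2
    by (intro wderiv_eq[OF assms(1) mdirs_Basis])
       (auto intro!: weak_deriv_add[OF assms(1) mdirs_Basis] subspace_add[OF L])
  show "mderiv \<Theta> \<alpha> (c *\<^sub>R f) = c *\<^sub>R mderiv \<Theta> \<alpha> f" if "f \<in> Sobolev \<Theta> k" for c f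
    using that mderiv_Sobolev[OF assms(1) _ assms(2)] Sobolev_L2
    by (intro wderiv_eq[OF assms(1) mdirs_Basis])
       (auto intro!: weak_deriv_scale[OF assms(1) mdirs_Basis] subspace_scale[OF L])
qed

lemma Sobolev_inner_self:
  assumes "open \<Theta>" "f \<in> Sobolev \<Theta> k"
  shows "Sobolev_inner \<Theta> k f f = (\<Sum>\<alpha> | mdeg \<alpha> \<le> k. (L2_norm \<Theta> (mderiv \<Theta> \<alpha> f))\<^sup>2)"
  unfolding Sobolev_inner_def
  by (rule sum.cong)
     (use assms in \<open>auto intro!: inner_carrier.N_power2[OF inner_carrier_L2, symmetric] mderiv_Sobolev(1)[OF assms]\<close>)

lemma inner_carrier_Sobolev:
  fixes \<Theta> :: "(real^'n::finite) set"
  assumes "open \<Theta>" shows "inner_carrier (Sobolev \<Theta> k) (Sobolev_inner \<Theta> k) (Sobolev_norm \<Theta> k)"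
proof
  interpret L: inner_carrier "L2 \<Theta>" "L2_inner \<Theta>" "L2_norm \<Theta>" by (rule inner_carrier_L2) (use assms in simp)
  fix f g h :: "(real^'n) aefun" and c :: real
  note D = mderiv_Sobolev(1)[OF assms]
  show "subspace (Sobolev \<Theta> k)" by (rule subspace_Sobolev[OF assms])
  assume f: "f \<in> Sobolev \<Theta> k"
  show "0 \<le> Sobolev_inner \<Theta> k f f"
    unfolding Sobolev_inner_self[OF assms f] by (intro sum_nonneg) auto
  {
    assume "Sobolev_inner \<Theta> k f f = 0"
    then have "\<forall>\<alpha>\<in>{\<alpha>. mdeg \<alpha> \<le> k}. (L2_norm \<Theta> (mderiv \<Theta> \<alpha> f))\<^sup>2 = 0"
      unfolding Sobolev_inner_self[OF assms f] by (subst (asm) sum_nonneg_eq_0_iff) auto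
    then have "(L2_norm \<Theta> (mderiv \<Theta> (\<lambda>_. 0) f))\<^sup>2 = 0" by (rule bspec) simp
    then show "f = 0" using L.N_eq_0 Sobolev_L2[OF f] by (simp add: wderiv_Nil[OF assms])
  }
  assume g: "g \<in> Sobolev \<Theta> k"
  show "Sobolev_inner \<Theta> k f g = Sobolev_inner \<Theta> k g f"
    unfolding Sobolev_inner_def by (rule sum.cong) (auto intro!: L.ip_commute D f g)
  show "Sobolev_inner \<Theta> k (c *\<^sub>R f) g = c * Sobolev_inner \<Theta> k f g"
    unfolding Sobolev_inner_def sum_distrib_left
    by (rule sum.cong) (auto simp: linear_on_scale[OF linear_on_mderiv[OF assms] f] intro!: L.ip_scale_left D f g)
  assume h: "h \<in> Sobolev \<Theta> k"
  show "Sobolev_inner \<Theta> k (f + g) h = Sobolev_inner \<Theta> k f h + Sobolev_inner \<Theta> k g h"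
    unfolding Sobolev_inner_def sum.distrib[symmetric]
    by (rule sum.cong) (auto simp: linear_on_add[OF linear_on_mderiv[OF assms] f g] intro!: L.ip_add_left D f g h)
next
  show "Sobolev_norm \<Theta> k f = sqrt (Sobolev_inner \<Theta> k f f)" for f by (simp add: Sobolev_norm_def)
qed

text \<open>The square of the left side is one summand of the squared Sobolev norm. Thus each
  derivative is a contraction into \<open>L2\<close>, which is the form in which it enters the
  covariances and the kernels.\<close>

lemma mderiv_norm_le:
  assumes "open \<Theta>" "f \<in> Sobolev \<Theta> k" "mdeg \<alpha> \<le> k"
  shows "L2_norm \<Theta> (mderiv \<Theta> \<alpha> f) \<le> Sobolev_norm \<Theta> k f"
proof -
  have "(L2_norm \<Theta> (mderiv \<Theta> \<alpha> f))\<^sup>2 \<le> Sobolev_inner \<Theta> k f f"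
    unfolding Sobolev_inner_self[OF assms(1,2)] using assms(3)
    by (intro member_le_sum[where f="\<lambda>\<alpha>. (L2_norm \<Theta> (mderiv \<Theta> \<alpha> f))\<^sup>2"]) auto
  then show ?thesis unfolding Sobolev_norm_def by (rule real_le_rsqrt)
qed

text \<open>Along a Cauchy sequence the derivatives of each order converge in \<open>L2\<close>.
  Closedness of weak differentiation shows that the limits \<open>g \<alpha>\<close> are the
  derivatives of the limit of order 0.\<close>

lemma hilbert_carrier_Sobolev:
  fixes \<Theta> :: "(real^'n::finite) set"
  assumes "open \<Theta>" shows "hilbert_carrier (Sobolev \<Theta> k) (Sobolev_inner \<Theta> k) (Sobolev_norm \<Theta> k)"
proof -
  interpret L: hilbert_carrier "L2 \<Theta>" "L2_inner \<Theta>" "L2_norm \<Theta>" by (rule hilbert_carrier_L2) (use assms in simp)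
  interpret inner_carrier "Sobolev \<Theta> k" "Sobolev_inner \<Theta> k" "Sobolev_norm \<Theta> k"
    by (rule inner_carrier_Sobolev[OF assms])
  note D = mderiv_Sobolev[OF assms]
  show ?thesis
  proof (intro hilbert_carrier.intro hilbert_carrier_axioms.intro banach_carrier.intro banach_carrier_axioms.intro
      inner_carrier_axioms normed_carrier_axioms)
    fix x assume x: "\<And>n. x n \<in> Sobolev \<Theta> k" and C: "carrier_Cauchy x"
    have "\<exists>l\<in>L2 \<Theta>. (\<lambda>n. L2_norm \<Theta> (mderiv \<Theta> \<alpha> (x n) - l)) \<longlonglongrightarrow> 0" if \<alpha>: "mdeg \<alpha> \<le> k" for \<alpha>
    proof (rule L.complete)
      show "L.carrier_Cauchy (\<lambda>n. mderiv \<Theta> \<alpha> (x n))"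
        unfolding L.carrier_Cauchy_def
      proof (intro allI impI)
        fix e :: real assume "e > 0"
        then obtain M where M: "\<And>m n. m \<ge> M \<Longrightarrow> n \<ge> M \<Longrightarrow> Sobolev_norm \<Theta> k (x m - x n) < e"
          using C unfolding carrier_Cauchy_def by blast
        have "L2_norm \<Theta> (mderiv \<Theta> \<alpha> (x m) - mderiv \<Theta> \<alpha> (x n)) < e" if "m \<ge> M" "n \<ge> M" for m n
          using mderiv_norm_le[OF assms V_diff[OF x x] \<alpha>, of m n] M[OF that]
          by (simp add: linear_on_diff[OF subspace_V linear_on_mderiv[OF assms \<alpha>] x x])
        then show "\<exists>M. \<forall>m\<ge>M. \<forall>n\<ge>M. L2_norm \<Theta> (mderiv \<Theta> \<alpha> (x m) - mderiv \<Theta> \<alpha> (x n)) < e" by blast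
      qed
    qed (use D(1)[OF x \<alpha>] in auto)
    then obtain g where g: "\<And>\<alpha>. mdeg \<alpha> \<le> k \<Longrightarrow> g \<alpha> \<in> L2 \<Theta>"
      "\<And>\<alpha>. mdeg \<alpha> \<le> k \<Longrightarrow> (\<lambda>n. L2_norm \<Theta> (mderiv \<Theta> \<alpha> (x n) - g \<alpha>)) \<longlonglongrightarrow> 0" by metis
    define f where "f = g (\<lambda>_. 0)"
    have fL: "f \<in> L2 \<Theta>" and f: "(\<lambda>n. L2_norm \<Theta> (x n - f)) \<longlonglongrightarrow> 0"
      using g[of "\<lambda>_. 0"] Sobolev_L2[OF x] by (auto simp: f_def wderiv_Nil[OF assms])
    have wd: "weak_deriv \<Theta> (mdirs \<alpha>) f (g \<alpha>)" if \<alpha>: "mdeg \<alpha> \<le> k" for \<alpha>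
      by (rule weak_deriv_limit[OF assms mdirs_Basis Sobolev_L2[OF x] D(1)[OF x \<alpha>] D(2)[OF x \<alpha>] fL f g(1)[OF \<alpha>] g(2)[OF \<alpha>]])
    have fS: "f \<in> Sobolev \<Theta> k" and Df: "\<And>\<alpha>. mdeg \<alpha> \<le> k \<Longrightarrow> mderiv \<Theta> \<alpha> f = g \<alpha>"
      using Sobolev_I[OF assms fL g(1) wd] by blast+
    have "(\<lambda>n. sqrt (\<Sum>\<alpha> | mdeg \<alpha> \<le> k. (L2_norm \<Theta> (mderiv \<Theta> \<alpha> (x n) - g \<alpha>))\<^sup>2)) \<longlonglongrightarrow> sqrt (\<Sum>\<alpha>::'n mindex | mdeg \<alpha> \<le> k. 0\<^sup>2)"
      by (intro tendsto_real_sqrt tendsto_sum tendsto_power g(2)) simp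
    moreover have "Sobolev_norm \<Theta> k (x n - f) = sqrt (\<Sum>\<alpha> | mdeg \<alpha> \<le> k. (L2_norm \<Theta> (mderiv \<Theta> \<alpha> (x n) - g \<alpha>))\<^sup>2)" for n
      unfolding Sobolev_norm_def Sobolev_inner_self[OF assms V_diff[OF x fS]]
      by (intro arg_cong[where f=sqrt] sum.cong)
         (auto simp: linear_on_diff[OF subspace_V linear_on_mderiv[OF assms] x fS] Df)
    ultimately have "(\<lambda>n. Sobolev_norm \<Theta> k (x n - f)) \<longlonglongrightarrow> 0" by simp
    with fS show "\<exists>l\<in>Sobolev \<Theta> k. (\<lambda>n. Sobolev_norm \<Theta> k (x n - l)) \<longlonglongrightarrow> 0" by blast
  qed
qed

section \<open>Separability of the Sobolev spaces\<close>

lemma countable_pi_system_borel: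
  obtains E :: "'a::second_countable_topology set set"
  where "countable E" "Int_stable E" "UNIV \<in> E" "sets borel = sigma_sets UNIV E"
proof -
  obtain B :: "'a set set" where B: "countable B" "topological_basis B"
    using ex_countable_basis by blast
  \<comment> \<open>Finite intersections of a countable base are countably many and stable under
    intersection; the empty intersection is the whole space.\<close>
  define E where "E = Inter ` {F. finite F \<and> F \<subseteq> B}"
  have openB: "open b" if "b \<in> B" for b using B(2) that by (rule topological_basis_open)
  have "countable E"
    unfolding E_def using B(1) by (intro countable_image countable_Collect_finite_subset)
  moreover have "Int_stable E"
    unfolding Int_stable_def
  proof (intro ballI)
    fix a b assume "a \<in> E" "b \<in> E"
    then obtain F G where "a = \<Inter>F" "b = \<Inter>G" "finite F" "finite G" "F \<subseteq> B" "G \<subseteq> B" by (auto simp: E_def)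
    then show "a \<inter> b \<in> E" unfolding E_def by (intro image_eqI[of _ _ "F \<union> G"]) auto
  qed
  moreover have "UNIV \<in> E" unfolding E_def by (rule image_eqI[of _ _ "{}"]) auto
  moreover have "sets borel = sigma_sets UNIV E"
  proof
    have "b \<in> E" if "b \<in> B" for b
      unfolding E_def using that by (intro image_eqI[of _ _ "{b}"]) auto
    then have "B \<subseteq> E" by blast
    then show "sets borel \<subseteq> sigma_sets UNIV E"
      unfolding borel_eq_countable_basis[OF B] by (simp add: sets_measure_of_conv sigma_sets_mono')
    have "E \<subseteq> sets borel"
      using openB unfolding E_def by (auto intro!: borel_open open_Inter)
    then show "sigma_sets UNIV E \<subseteq> sets borel"
      using sets.sigma_sets_subset[of E borel] by simp
  qed
  ultimately show thesis by (rule that)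
qed

text \<open>The sequence consists of indicators of countably many generating sets, cut down to balls
  to be integrable. A function orthogonal to all of them integrates to 0 over a pi-system within
  each ball, and so vanishes.\<close>

lemma L2_total_sequence:
  fixes U :: "'a::euclidean_space set"
  assumes U: "open U"
  shows "\<exists>w :: nat \<Rightarrow> 'a aefun. (\<forall>n. w n \<in> L2 U) \<and>
    (\<forall>f\<in>L2 U. (\<forall>n. L2_inner U f (w n) = 0) \<longrightarrow> f = 0)"
proof -
  obtain E :: "'a set set" where E: "countable E" "Int_stable E" "UNIV \<in> E" "sets borel = sigma_sets UNIV E"
    by (rule countable_pi_system_borel)
  define S where "S n = (case prod_decode n of (j, i) \<Rightarrow> ball 0 (real j) \<inter> from_nat_into E i)" for n
  have rangeE: "range (from_nat_into E) = E" using E(1,3) by (intro range_from_nat_into) auto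
  have E_borel: "A \<in> sets borel" if "A \<in> E" for A
    unfolding E(4) using that by (rule sigma_sets.Basic)
  have S_borel [measurable]: "S n \<in> sets borel" for n
  proof -
    have "from_nat_into E i \<in> sets borel" for i using rangeE by (intro E_borel) blast
    then show ?thesis by (auto simp: S_def split: prod.split)
  qed
  have S_bdd: "integrable lborel (indicat_real (S n))" for n
  proof -
    obtain j i where n: "prod_decode n = (j, i)" by force
    have "emeasure lborel (S n) \<le> emeasure lborel (cball 0 (real j) :: 'a set)"
      by (intro emeasure_mono) (auto simp: S_def n)
    also have "\<dots> < \<infinity>" by (intro emeasure_compact_finite) simp
    finally show ?thesis by (intro integrable_real_indicator) auto
  qed
  have U' [measurable]: "U \<in> sets borel" using U by simp
  define w where "w n = abs_aefun (indicat_real (S n \<inter> U))" for n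
  have wm: "indicat_real (S n \<inter> U) \<in> borel_measurable lborel" for n by simp
  show ?thesis
  proof (intro exI[of _ w] conjI allI ballI impI)
    show "w n \<in> L2 U" for n
      unfolding w_def
    proof (rule L2_I)
      have "integrable lborel (\<lambda>x. indicat_real U x *\<^sub>R indicat_real (S n) x)"
        by (intro integrable_mult_indicator S_bdd) simp
      moreover have "(\<lambda>x. (indicat_real (S n \<inter> U) x)\<^sup>2) = (\<lambda>x. indicat_real U x *\<^sub>R indicat_real (S n) x)"
        by (auto simp: indicator_def fun_eq_iff)
      ultimately show "integrable lborel (\<lambda>x. (indicat_real (S n \<inter> U) x)\<^sup>2)" by simp
    qed (auto simp: wm)
    fix f assume f: "f \<in> L2 U" and zero: "\<forall>n. L2_inner U f (w n) = 0"
    have zeroS: "(\<integral>x. indicator (S n) x * rep_aefun f x \<partial>lborel) = 0" for n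
    proof -
      have "(\<integral>x. indicator (S n) x * rep_aefun f x \<partial>lborel) = (\<integral>x. rep_aefun f x * indicator (S n \<inter> U) x \<partial>lborel)"
        by (rule integral_cong_AE; simp?) (use L2_D(2)[OF f] in eventually_elim, auto simp: indicator_def)
      also have "\<dots> = L2_inner U f (w n)"
        unfolding w_def using L2_inner_test[OF f U' wm] by simp
      finally show ?thesis using zero by simp
    qed
    have "AE x in lborel. indicator (ball 0 (real j)) x * rep_aefun f x = 0" for j
    proof (rule AE_zero_of_pi_system[OF _ E(2,4)])
      show "integrable lborel (\<lambda>x. indicat_real (ball 0 (real j)) x * rep_aefun f x)"
      proof (rule integrable_mult_of_squares[OF _ _ _ L2_D(1)[OF f]])
        have "emeasure lborel (ball 0 (real j) :: 'a set) \<le> emeasure lborel (cball 0 (real j) :: 'a set)"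
          by (intro emeasure_mono) auto
        also have "\<dots> < \<infinity>" by (intro emeasure_compact_finite) simp
        finally have "integrable lborel (indicat_real (ball 0 (real j) :: 'a set))"
          by (intro integrable_real_indicator) auto
        moreover have "(\<lambda>x. (indicat_real (ball 0 (real j)) x)\<^sup>2) = indicat_real (ball 0 (real j) :: 'a set)"
          by (auto simp: indicator_def fun_eq_iff)
        ultimately show "integrable lborel (\<lambda>x::'a. (indicat_real (ball 0 (real j)) x)\<^sup>2)" by simp
      qed (auto intro!: borel_measurable_indicator borel_open)
      have *: "(LINT x:A|lborel. indicator (ball 0 (real j)) x * rep_aefun f x) = 0" if A: "A \<in> E" for A
      proof -
        obtain i where i: "A = from_nat_into E i" using A rangeE by blast
        have "S (prod_encode (j, i)) = ball 0 (real j) \<inter> A" by (simp add: S_def i)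
        then have "(\<integral>x. indicator (ball 0 (real j) \<inter> A) x * rep_aefun f x \<partial>lborel) = 0"
          using zeroS[of "prod_encode (j, i)"] by simp
        then show ?thesis
          by (simp add: set_lebesgue_integral_def indicator_inter_arith mult.assoc mult.left_commute)
      qed
      show "(\<integral>x. indicator (ball 0 (real j)) x * rep_aefun f x \<partial>lborel) = 0"
        using *[OF E(3)] by (simp add: set_lebesgue_integral_def)
      show "(LINT x:A|lborel. indicator (ball 0 (real j)) x * rep_aefun f x) = 0" if "A \<in> E" for A
        by (rule *[OF that])
    qed
    then have *: "AE x in lborel. \<forall>j. indicator (ball 0 (real j)) x * rep_aefun f x = 0"
      by (subst AE_all_countable) auto
    show "f = 0"
    proof (rule aefun_eqI)
      show "AE x in lborel. rep_aefun f x = rep_aefun 0 x"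
        using * rep_aefun_0
      proof eventually_elim
        case (elim x)
        obtain j where "norm x < real j" using reals_Archimedean2 by blast
        then show ?case using elim(1)[rule_format, of j] elim(2) by (simp add: indicator_def)
      qed
    qed
  qed
qed

text \<open>The functionals \<open>L2_inner \<Theta> f (w n)\<close> of \<open>f\<close> have Riesz
  representatives \<open>d n\<close> in the Sobolev space. What is orthogonal to all
  \<open>d n\<close> is orthogonal in \<open>L2\<close> to the total sequence \<open>w\<close>,
  hence 0; so the \<open>d n\<close> are total.\<close>

lemma separable_Sobolev:
  fixes \<Theta> :: "(real^'n::finite) set"
  assumes "open \<Theta>" shows "normed_carrier.separable (Sobolev \<Theta> k) (Sobolev_norm \<Theta> k)"
proof -
  interpret L: hilbert_carrier "L2 \<Theta>" "L2_inner \<Theta>" "L2_norm \<Theta>" by (rule hilbert_carrier_L2) (use assms in simp)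
  interpret hilbert_carrier "Sobolev \<Theta> k" "Sobolev_inner \<Theta> k" "Sobolev_norm \<Theta> k"
    by (rule hilbert_carrier_Sobolev[OF assms])
  obtain w :: "nat \<Rightarrow> (real^'n) aefun" where w: "\<And>n. w n \<in> L2 \<Theta>"
    "\<And>f. f \<in> L2 \<Theta> \<Longrightarrow> (\<And>n. L2_inner \<Theta> f (w n) = 0) \<Longrightarrow> f = 0"
    using L2_total_sequence[OF assms] by blast
  have "\<exists>d\<in>Sobolev \<Theta> k. \<forall>f\<in>Sobolev \<Theta> k. L2_inner \<Theta> f (w n) = Sobolev_inner \<Theta> k f d" for n
  proof -
    have lin: "linear_on (Sobolev \<Theta> k) (\<lambda>f. L2_inner \<Theta> f (w n))"
      by (rule linear_onI) (auto simp: L.ip_add_left L.ip_scale_left w(1) Sobolev_L2)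
    have bd: "\<bar>L2_inner \<Theta> f (w n)\<bar> \<le> L2_norm \<Theta> (w n) * Sobolev_norm \<Theta> k f" if f: "f \<in> Sobolev \<Theta> k" for f
    proof -
      have "\<bar>L2_inner \<Theta> f (w n)\<bar> \<le> L2_norm \<Theta> f * L2_norm \<Theta> (w n)"
        by (rule L.ip_Cauchy_Schwarz[OF Sobolev_L2[OF f] w(1)])
      also have "\<dots> \<le> Sobolev_norm \<Theta> k f * L2_norm \<Theta> (w n)"
        using mderiv_norm_le[OF assms f, of "\<lambda>_. 0"] Sobolev_L2[OF f]
        by (intro mult_right_mono L.N_nonneg w(1)) (simp add: wderiv_Nil[OF assms])
      finally show ?thesis by (simp add: mult.commute)
    qed
    show ?thesis by (rule Riesz[OF lin bd]) auto
  qed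
  then obtain d where d: "\<And>n. d n \<in> Sobolev \<Theta> k"
    "\<And>n f. f \<in> Sobolev \<Theta> k \<Longrightarrow> L2_inner \<Theta> f (w n) = Sobolev_inner \<Theta> k f (d n)" by metis
  show ?thesis
  proof (rule separable_of_total[of d])
    fix f assume f: "f \<in> Sobolev \<Theta> k" "\<And>n. Sobolev_inner \<Theta> k f (d n) = 0"
    show "f = 0" by (rule w(2)[OF Sobolev_L2[OF f(1)]]) (use d(2)[OF f(1)] f(2) in simp)
  qed (rule d(1))
qed

section \<open>Nuclear operators\<close>

lemma double_series_nonneg:
  fixes c :: "nat \<Rightarrow> nat \<Rightarrow> real"
  assumes c: "\<And>j i. 0 \<le> c j i" and S: "\<And>j. summable (c j)" "summable (\<lambda>j. \<Sum>i. c j i)"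
  shows "(\<lambda>n. case prod_decode n of (j, i) \<Rightarrow> c j i) sums (\<Sum>j. \<Sum>i. c j i)"
proof -
  let ?C = "\<lambda>n. case prod_decode n of (j, i) \<Rightarrow> c j i"
  have C0: "0 \<le> ?C n" for n using c by (auto split: prod.split)
  have s0: "0 \<le> (\<Sum>i. c j i)" for j using c S by (intro suminf_nonneg)
  have "(\<Sum>n. ennreal (?C n)) = (\<Sum>n. (\<lambda>(j, i). ennreal (c j i)) (prod_decode n))"
    by (intro suminf_cong) (simp split: prod.split)
  also have "\<dots> = (\<Sum>j. ennreal (\<Sum>i. c j i))"
    by (rule suminf_ennreal_2dimen) (simp add: suminf_ennreal2[OF c S(1)])
  also have "\<dots> = ennreal (\<Sum>j. \<Sum>i. c j i)" by (rule suminf_ennreal2[OF s0 S(2)])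
  finally have eq: "(\<Sum>n. ennreal (?C n)) = ennreal (\<Sum>j. \<Sum>i. c j i)" .
  then have sm: "summable ?C" by (intro summable_suminf_not_top C0) simp
  with eq have "ennreal (\<Sum>n. ?C n) = ennreal (\<Sum>j. \<Sum>i. c j i)" by (simp add: suminf_ennreal2[OF C0 sm])
  then have "(\<Sum>n. ?C n) = (\<Sum>j. \<Sum>i. c j i)"
    using suminf_nonneg[OF sm C0] suminf_nonneg[OF S(2) s0] by (simp add: ennreal_inj)
  with sm show ?thesis by (simp add: sums_iff)
qed

text \<open>Positive and negative parts are summed separately; both are dominated by
  \<open>\<bar>c j i\<bar>\<close>.\<close>

lemma double_series:
  fixes c :: "nat \<Rightarrow> nat \<Rightarrow> real"
  assumes S: "\<And>j. summable (\<lambda>i. \<bar>c j i\<bar>)" "summable (\<lambda>j. \<Sum>i. \<bar>c j i\<bar>)"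
  shows "(\<lambda>n. case prod_decode n of (j, i) \<Rightarrow> c j i) sums (\<Sum>j. \<Sum>i. c j i)"
proof -
  define p where "p j i = max (c j i) 0" for j i
  define m where "m j i = max (- c j i) 0" for j i
  have pm: "c j i = p j i - m j i" for j i by (simp add: p_def m_def)
  have sp: "summable (p j)" for j
    by (rule summable_comparison_test[OF _ S(1)[of j]]) (auto simp: p_def)
  have sm: "summable (m j)" for j
    by (rule summable_comparison_test[OF _ S(1)[of j]]) (auto simp: m_def)
  have spp: "summable (\<lambda>j. \<Sum>i. p j i)"
  proof (rule summable_comparison_test[OF _ S(2)], intro exI allI impI)
    fix j show "norm (\<Sum>i. p j i) \<le> (\<Sum>i. \<bar>c j i\<bar>)"
    proof -
      have "0 \<le> (\<Sum>i. p j i)" by (rule suminf_nonneg[OF sp]) (simp add: p_def)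
      moreover have "(\<Sum>i. p j i) \<le> (\<Sum>i. \<bar>c j i\<bar>)" by (rule suminf_le[OF _ sp S(1)]) (auto simp: p_def)
      ultimately show ?thesis by simp
    qed
  qed
  have smm: "summable (\<lambda>j. \<Sum>i. m j i)"
  proof (rule summable_comparison_test[OF _ S(2)], intro exI allI impI)
    fix j show "norm (\<Sum>i. m j i) \<le> (\<Sum>i. \<bar>c j i\<bar>)"
    proof -
      have "0 \<le> (\<Sum>i. m j i)" by (rule suminf_nonneg[OF sm]) (simp add: m_def)
      moreover have "(\<Sum>i. m j i) \<le> (\<Sum>i. \<bar>c j i\<bar>)" by (rule suminf_le[OF _ sm S(1)]) (auto simp: m_def)
      ultimately show ?thesis by simp
    qed
  qed
  have "(\<lambda>n. (case prod_decode n of (j, i) \<Rightarrow> p j i) - (case prod_decode n of (j, i) \<Rightarrow> m j i))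
      sums ((\<Sum>j. \<Sum>i. p j i) - (\<Sum>j. \<Sum>i. m j i))"
    by (intro sums_diff double_series_nonneg sp sm spp smm) (simp_all add: p_def m_def)
  moreover have "(\<Sum>j. \<Sum>i. c j i) = (\<Sum>j. \<Sum>i. p j i) - (\<Sum>j. \<Sum>i. m j i)"
    by (simp add: pm suminf_diff[OF sp sm, symmetric] suminf_diff[OF spp smm])
  moreover have "(\<lambda>n. (case prod_decode n of (j, i) \<Rightarrow> p j i) - (case prod_decode n of (j, i) \<Rightarrow> m j i))
      = (\<lambda>n. case prod_decode n of (j, i) \<Rightarrow> c j i)"
    by (simp add: pm fun_eq_iff split: prod.split)
  ultimately show ?thesis by simp
qed

lemma sum_fun_apply: "(\<Sum>i\<in>I. f i) x = (\<Sum>i\<in>I. f i x :: 'a::comm_monoid_add)"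
  by (induction I rule: infinite_finite_induct) auto

section \<open>Nuclear operators through their matrix coefficients\<close>

locale sobolev_space =
  fixes \<Theta> :: "(real^'n::finite) set" and k :: nat
  assumes open_domain: "open \<Theta>"
begin

abbreviation "H \<equiv> Sobolev \<Theta> k"
abbreviation "ip \<equiv> Sobolev_inner \<Theta> k"
abbreviation "N \<equiv> Sobolev_norm \<Theta> k"

sublocale hilbert_carrier H ip N
  by (rule hilbert_carrier_Sobolev[OF open_domain])

lemma separable_H: separable
  by (rule separable_Sobolev[OF open_domain])

lemma tensor_eq: "f \<in> H \<Longrightarrow> tensor \<Theta> k a b f = ip f b *\<^sub>R a"
  by (simp add: tensor_def)

lemma nuclear_rep_carrier:
  assumes "nuclear_rep \<Theta> k T a b" shows "a i \<in> H" "b i \<in> H" "summable (\<lambda>i. N (a i) * N (b i))"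
  using assms by (auto simp: nuclear_rep_def)

lemma nuclear_carrier:
  assumes "T \<in> nuclear \<Theta> k" shows "f \<in> H \<Longrightarrow> T f \<in> H" "f \<notin> H \<Longrightarrow> T f = 0"
  using assms by (auto simp: nuclear_def)

lemma coeff_bound:
  assumes "a \<in> H" "b \<in> H" "f \<in> H" "g \<in> H"
  shows "\<bar>ip f b * ip a g\<bar> \<le> (N a * N b) * (N f * N g)"
proof -
  have "\<bar>ip f b\<bar> * \<bar>ip a g\<bar> \<le> (N f * N b) * (N a * N g)"
    using assms by (intro mult_mono ip_Cauchy_Schwarz mult_nonneg_nonneg N_nonneg) auto
  then show ?thesis by (simp add: abs_mult mult_ac)
qed

lemma coeff_summable:
  assumes "\<And>i. a i \<in> H" "\<And>i. b i \<in> H" "summable (\<lambda>i. N (a i) * N (b i))" "f \<in> H" "g \<in> H"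
  shows "summable (\<lambda>i. \<bar>ip f (b i) * ip (a i) g\<bar>)"
    and "(\<Sum>i. \<bar>ip f (b i) * ip (a i) g\<bar>) \<le> (\<Sum>i. N (a i) * N (b i)) * (N f * N g)"
proof -
  have le: "\<bar>ip f (b i) * ip (a i) g\<bar> \<le> (N (a i) * N (b i)) * (N f * N g)" for i
    using assms by (intro coeff_bound)
  have s: "summable (\<lambda>i. (N (a i) * N (b i)) * (N f * N g))"
    using assms(3) by (rule summable_mult2)
  show sm: "summable (\<lambda>i. \<bar>ip f (b i) * ip (a i) g\<bar>)"
    by (rule summable_comparison_test[OF _ s]) (use le in auto)
  show "(\<Sum>i. \<bar>ip f (b i) * ip (a i) g\<bar>) \<le> (\<Sum>i. N (a i) * N (b i)) * (N f * N g)"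
    using suminf_le[OF le sm s] by (simp add: suminf_mult2[OF assms(3), symmetric])
qed

text \<open>The scalar form of a representation, by continuity of the inner product. From here on
  nuclear operators are handled through the numbers \<open>ip (T f) g\<close>, whose series converge
  absolutely.\<close>

lemma nuclear_rep_sums:
  assumes r: "nuclear_rep \<Theta> k T a b" and TH: "T f \<in> H" and f: "f \<in> H" and g: "g \<in> H"
  shows "(\<lambda>i. ip f (b i) * ip (a i) g) sums ip (T f) g"
proof -
  note ab = nuclear_rep_carrier[OF r]
  have tH: "tensor \<Theta> k (a i) (b i) f \<in> H" for i using ab f by (simp add: tensor_eq)
  then have sH: "(\<Sum>i<m. tensor \<Theta> k (a i) (b i) f) \<in> H" for m by (intro V_sum) auto
  have "(\<lambda>m. N (T f - (\<Sum>i<m. tensor \<Theta> k (a i) (b i) f))) \<longlonglongrightarrow> 0"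
    using r f by (auto simp: nuclear_rep_def)
  then have "(\<lambda>m. N ((\<Sum>i<m. tensor \<Theta> k (a i) (b i) f) - T f)) \<longlonglongrightarrow> 0"
    using N_commute[OF TH sH] by simp
  from ip_tendsto[OF sH TH g this]
  have "(\<lambda>m. ip (\<Sum>i<m. ip f (b i) *\<^sub>R a i) g) \<longlonglongrightarrow> ip (T f) g" by (simp add: tensor_eq[OF f])
  then show ?thesis unfolding sums_def using ab g by (simp add: ip_sum_scale_left)
qed

text \<open>Summability of the products of norms makes the series of the vectors
  \<open>ip f (b i) *\<^sub>R a i\<close> converge in norm, and the matrix coefficients identify its
  sum with \<open>T f\<close>.\<close>

lemma nuclear_repI:
  assumes ab: "\<And>i. a i \<in> H" "\<And>i. b i \<in> H" "summable (\<lambda>i. N (a i) * N (b i))"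
    and T: "\<And>f. f \<in> H \<Longrightarrow> T f \<in> H"
      "\<And>f g. f \<in> H \<Longrightarrow> g \<in> H \<Longrightarrow> (\<lambda>i. ip f (b i) * ip (a i) g) sums ip (T f) g"
  shows "nuclear_rep \<Theta> k T a b"
proof -
  have "(\<lambda>m. N (T f - (\<Sum>i<m. tensor \<Theta> k (a i) (b i) f))) \<longlonglongrightarrow> 0" if f: "f \<in> H" for f
  proof -
    have "N (ip f (b i) *\<^sub>R a i) \<le> (N (a i) * N (b i)) * N f" for i
    proof -
      have "\<bar>ip f (b i)\<bar> * N (a i) \<le> (N f * N (b i)) * N (a i)"
        using ab f by (intro mult_right_mono ip_Cauchy_Schwarz N_nonneg) auto
      then show ?thesis using ab by (simp add: N_scale mult_ac)
    qed
    then have "summable (\<lambda>i. N (ip f (b i) *\<^sub>R a i))"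
      using ab by (intro summable_comparison_test[OF _ summable_mult2[OF ab(3), of "N f"]])
        (auto intro!: exI[of _ 0] simp: N_nonneg)
    then obtain l where l: "l \<in> H" "(\<lambda>m. N ((\<Sum>i<m. ip f (b i) *\<^sub>R a i) - l)) \<longlonglongrightarrow> 0"
      using series_convergent[of "\<lambda>i. ip f (b i) *\<^sub>R a i"] ab V_scale by blast
    have sH: "(\<Sum>i<m. ip f (b i) *\<^sub>R a i) \<in> H" for m using ab by (intro V_sum) auto
    have "T f = l"
    proof (rule ip_eqI[OF T(1)[OF f] l(1)])
      fix g assume g: "g \<in> H"
      have "(\<lambda>m. \<Sum>i<m. ip f (b i) * ip (a i) g) \<longlonglongrightarrow> ip l g"
        using ip_tendsto[OF sH l(1) g l(2)] ab g by (simp add: ip_sum_scale_left)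
      then show "ip (T f) g = ip l g"
        using T(2)[OF f g] unfolding sums_def by (rule LIMSEQ_unique[rotated])
    qed
    then show ?thesis using l(2) N_commute[OF l(1) sH] f by (simp add: tensor_eq)
  qed
  then show ?thesis using ab unfolding nuclear_rep_def by auto
qed

lemma nuclearI:
  "(\<And>f. f \<in> H \<Longrightarrow> T f \<in> H) \<Longrightarrow> (\<And>f. f \<notin> H \<Longrightarrow> T f = 0) \<Longrightarrow> nuclear_rep \<Theta> k T a b \<Longrightarrow> T \<in> nuclear \<Theta> k"
  by (auto simp: nuclear_def)

text \<open>For fixed \<open>f\<close> the sum of the coefficients is a bounded functional of
  \<open>g\<close>; its Riesz representative is the value of the operator at
  \<open>f\<close>.\<close>

lemma nuclear_of_series:
  assumes ab: "\<And>i. a i \<in> H" "\<And>i. b i \<in> H" "summable (\<lambda>i. N (a i) * N (b i))"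
  shows "\<exists>T\<in>nuclear \<Theta> k. nuclear_rep \<Theta> k T a b"
proof -
  have "\<exists>z\<in>H. \<forall>g\<in>H. (\<lambda>i. ip f (b i) * ip (a i) g) sums ip z g" if f: "f \<in> H" for f
  proof -
    define h where "h g = (\<Sum>i. ip f (b i) * ip (a i) g)" for g
    have sm: "summable (\<lambda>i. ip f (b i) * ip (a i) g)" if "g \<in> H" for g
      using coeff_summable(1)[OF ab f that] by (rule summable_rabs_cancel)
    have lin: "linear_on H h"
    proof (rule linear_onI)
      fix x y assume xy: "x \<in> H" "y \<in> H"
      have "h (x + y) = (\<Sum>i. ip f (b i) * ip (a i) x + ip f (b i) * ip (a i) y)"
        unfolding h_def using xy ab by (intro suminf_cong) (simp add: ip_add_right distrib_left)
      then show "h (x + y) = h x + h y" unfolding h_def by (simp add: suminf_add[OF sm[OF xy(1)] sm[OF xy(2)]])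
    next
      fix x c assume x: "x \<in> H"
      have "h (c *\<^sub>R x) = (\<Sum>i. c * (ip f (b i) * ip (a i) x))"
        unfolding h_def using x ab by (intro suminf_cong) (simp add: ip_scale_right)
      then show "h (c *\<^sub>R x) = c *\<^sub>R h x" unfolding h_def by (simp add: suminf_mult[OF sm[OF x]])
    qed
    have bd: "\<bar>h g\<bar> \<le> ((\<Sum>i. N (a i) * N (b i)) * N f) * N g" if g: "g \<in> H" for g
      unfolding h_def using summable_rabs[OF coeff_summable(1)[OF ab f g]] coeff_summable(2)[OF ab f g]
      by (simp add: mult.assoc)
    have "\<exists>z\<in>H. \<forall>g\<in>H. h g = ip g z" by (rule Riesz[OF lin bd]) auto
    then obtain z where z: "z \<in> H" "\<And>g. g \<in> H \<Longrightarrow> h g = ip g z" by blast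
    have "(\<lambda>i. ip f (b i) * ip (a i) g) sums ip z g" if "g \<in> H" for g
      using summable_sums[OF sm[OF that]] z that ip_commute by (simp add: h_def)
    with z(1) show ?thesis by blast
  qed
  then have "\<forall>f\<in>H. \<exists>z. z \<in> H \<and> (\<forall>g\<in>H. (\<lambda>i. ip f (b i) * ip (a i) g) sums ip z g)" by blast
  from bchoice[OF this] obtain Z
    where Z: "\<forall>f\<in>H. Z f \<in> H \<and> (\<forall>g\<in>H. (\<lambda>i. ip f (b i) * ip (a i) g) sums ip (Z f) g)" ..
  define T where "T f = (if f \<in> H then Z f else 0)" for f
  have "nuclear_rep \<Theta> k T a b"
    by (rule nuclear_repI[OF ab]) (auto simp: T_def Z)
  then show ?thesis by (intro bexI[of _ T] nuclearI) (auto simp: T_def Z)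
qed

lemma nuclear_rep_norm_nonneg:
  assumes "nuclear_rep \<Theta> k T a b" shows "0 \<le> (\<Sum>i. N (a i) * N (b i))"
  using nuclear_rep_carrier[OF assms] by (intro suminf_nonneg mult_nonneg_nonneg N_nonneg)

lemma nuclear_norm_le_rep:
  assumes "nuclear_rep \<Theta> k T a b" shows "nuclear_norm \<Theta> k T \<le> (\<Sum>i. N (a i) * N (b i))"
  unfolding nuclear_norm_def
  using assms nuclear_rep_norm_nonneg by (intro cInf_lower bdd_belowI[of _ 0]) auto

lemma nuclear_norm_nonneg:
  assumes "T \<in> nuclear \<Theta> k" shows "0 \<le> nuclear_norm \<Theta> k T"
  unfolding nuclear_norm_def
  using assms nuclear_rep_norm_nonneg by (intro cInf_greatest) (auto simp: nuclear_def)

lemma nuclear_norm_approx: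
  assumes "T \<in> nuclear \<Theta> k" "e > 0"
  shows "\<exists>a b. nuclear_rep \<Theta> k T a b \<and> (\<Sum>i. N (a i) * N (b i)) < nuclear_norm \<Theta> k T + e"
proof -
  have "{\<Sum>i. N (a i) * N (b i) | a b. nuclear_rep \<Theta> k T a b} \<noteq> {}"
    using assms(1) by (auto simp: nuclear_def)
  from cInf_lessD[OF this, of "nuclear_norm \<Theta> k T + e"] show ?thesis
    using assms(2) unfolding nuclear_norm_def by auto
qed

lemma nuclear_norm_greatest:
  assumes "T \<in> nuclear \<Theta> k" "\<And>a b. nuclear_rep \<Theta> k T a b \<Longrightarrow> c \<le> (\<Sum>i. N (a i) * N (b i))"
  shows "c \<le> nuclear_norm \<Theta> k T"
  unfolding nuclear_norm_def
  using assms by (intro cInf_greatest) (auto simp: nuclear_def)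

lemma nuclear_eqI:
  assumes "S \<in> nuclear \<Theta> k" "T \<in> nuclear \<Theta> k" "\<And>f g. f \<in> H \<Longrightarrow> g \<in> H \<Longrightarrow> ip (S f) g = ip (T f) g"
  shows "S = T"
proof
  fix f show "S f = T f"
    using nuclear_carrier[OF assms(1)] nuclear_carrier[OF assms(2)] assms(3)
    by (cases "f \<in> H") (auto intro: ip_eqI)
qed

text \<open>\<open>prod_decode\<close> enumerates the pairs of an operator index \<open>j\<close>
  and a term index \<open>i\<close>. The merged series costs the sum of the costs, and absolute
  convergence allows it to be summed row by row.\<close>

lemma nuclear_rep_concat:
  assumes r: "\<And>j. nuclear_rep \<Theta> k (T j) (a j) (b j)" and TH: "\<And>j f. f \<in> H \<Longrightarrow> T j f \<in> H"
    and S: "summable (\<lambda>j. \<Sum>i. N (a j i) * N (b j i))"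
  shows "\<exists>A B L. nuclear_rep \<Theta> k L A B \<and> L \<in> nuclear \<Theta> k \<and>
    (\<Sum>n. N (A n) * N (B n)) = (\<Sum>j. \<Sum>i. N (a j i) * N (b j i)) \<and>
    (\<forall>f\<in>H. \<forall>g\<in>H. (\<lambda>j. ip (T j f) g) sums ip (L f) g)"
proof -
  define A where "A n = (case prod_decode n of (j, i) \<Rightarrow> a j i)" for n
  define B where "B n = (case prod_decode n of (j, i) \<Rightarrow> b j i)" for n
  note ab = nuclear_rep_carrier[OF r]
  have nn: "0 \<le> N (a j i) * N (b j i)" for j i using ab by (intro mult_nonneg_nonneg N_nonneg)
  have AB: "A n \<in> H" "B n \<in> H" for n using ab by (auto simp: A_def B_def split: prod.split)
  have "(\<lambda>n. case prod_decode n of (j, i) \<Rightarrow> N (a j i) * N (b j i)) sums (\<Sum>j. \<Sum>i. N (a j i) * N (b j i))"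
    by (rule double_series_nonneg[OF nn ab(3) S])
  moreover have "(\<lambda>n. case prod_decode n of (j, i) \<Rightarrow> N (a j i) * N (b j i)) = (\<lambda>n. N (A n) * N (B n))"
    by (auto simp: A_def B_def fun_eq_iff split: prod.split)
  ultimately have sums: "(\<lambda>n. N (A n) * N (B n)) sums (\<Sum>j. \<Sum>i. N (a j i) * N (b j i))" by simp
  from nuclear_of_series[OF AB sums_summable[OF sums]]
  obtain L where L: "L \<in> nuclear \<Theta> k" "nuclear_rep \<Theta> k L A B" by blast
  have "(\<lambda>j. ip (T j f) g) sums ip (L f) g" if f: "f \<in> H" and g: "g \<in> H" for f g
  proof -
    let ?c = "\<lambda>j i. ip f (b j i) * ip (a j i) g"
    have sm1: "summable (\<lambda>i. \<bar>?c j i\<bar>)" for j by (rule coeff_summable(1)[OF ab f g])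
    have sm2: "summable (\<lambda>j. \<Sum>i. \<bar>?c j i\<bar>)"
    proof (rule summable_comparison_test[OF _ summable_mult2[OF S, of "N f * N g"]], intro exI allI impI)
      fix j show "norm (\<Sum>i. \<bar>?c j i\<bar>) \<le> (\<Sum>i. N (a j i) * N (b j i)) * (N f * N g)"
        using coeff_summable(2)[OF ab f g, of j] suminf_nonneg[OF sm1[of j]] by simp
    qed
    have row: "(\<Sum>i. ?c j i) = ip (T j f) g" for j
      using nuclear_rep_sums[OF r TH[OF f] f g] by (rule sums_unique[symmetric])
    have "(\<lambda>n. case prod_decode n of (j, i) \<Rightarrow> ?c j i) sums (\<Sum>j. \<Sum>i. ?c j i)"
      by (rule double_series[OF sm1 sm2])
    moreover have "(\<lambda>n. case prod_decode n of (j, i) \<Rightarrow> ?c j i) = (\<lambda>n. ip f (B n) * ip (A n) g)"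
      by (auto simp: A_def B_def fun_eq_iff split: prod.split)
    ultimately have "(\<lambda>n. ip f (B n) * ip (A n) g) sums (\<Sum>j. ip (T j f) g)" by (simp add: row)
    then have "ip (L f) g = (\<Sum>j. ip (T j f) g)"
      using nuclear_rep_sums[OF L(2) nuclear_carrier(1)[OF L(1) f] f g] sums_unique2 by blast
    moreover have "summable (\<lambda>j. ip (T j f) g)"
    proof (rule summable_comparison_test[OF _ sm2], intro exI allI impI)
      fix j show "norm (ip (T j f) g) \<le> (\<Sum>i. \<bar>?c j i\<bar>)"
        unfolding row[symmetric] using summable_rabs[OF sm1[of j]] by simp
    qed
    ultimately show ?thesis by (simp add: sums_iff)
  qed
  with L sums show ?thesis by (intro exI[of _ A] exI[of _ B] exI[of _ L]) (auto simp: sums_iff)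
qed

text \<open>Near-optimal representations of the summands are merged into one. Both the triangle
  inequality and the completeness of the space of nuclear operators are drawn from this.\<close>

lemma nuclear_series:
  assumes T: "\<And>j. T j \<in> nuclear \<Theta> k" and S: "summable (\<lambda>j. nuclear_norm \<Theta> k (T j))"
  obtains L where "L \<in> nuclear \<Theta> k" "nuclear_norm \<Theta> k L \<le> (\<Sum>j. nuclear_norm \<Theta> k (T j))"
    "\<And>f g. f \<in> H \<Longrightarrow> g \<in> H \<Longrightarrow> (\<lambda>j. ip (T j f) g) sums ip (L f) g"
proof -
  have step: "\<exists>L\<in>nuclear \<Theta> k. nuclear_norm \<Theta> k L \<le> (\<Sum>j. nuclear_norm \<Theta> k (T j)) + e \<and>
     (\<forall>f\<in>H. \<forall>g\<in>H. (\<lambda>j. ip (T j f) g) sums ip (L f) g)" if e: "e > 0" for e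
  proof -
    \<comment> \<open>The surplus allowed for the \<open>j\<close>-th operator is
      \<open>e * (1/2) ^ Suc j\<close>, and these surpluses add up to \<open>e\<close>.\<close>
    have "\<exists>a b. nuclear_rep \<Theta> k (T j) a b \<and> (\<Sum>i. N (a i) * N (b i)) < nuclear_norm \<Theta> k (T j) + e * (1/2) ^ Suc j" for j
      by (rule nuclear_norm_approx[OF T]) (use e in simp)
    then obtain a b where r: "\<And>j. nuclear_rep \<Theta> k (T j) (a j) (b j)"
      and le: "\<And>j. (\<Sum>i. N (a j i) * N (b j i)) < nuclear_norm \<Theta> k (T j) + e * (1/2) ^ Suc j" by metis
    have geo: "(\<lambda>j. e * (1/2) ^ Suc j) sums (e * 1)" by (intro sums_mult power_half_series)
    have sm: "summable (\<lambda>j. nuclear_norm \<Theta> k (T j) + e * (1/2) ^ Suc j)"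
      by (intro summable_add S sums_summable[OF geo])
    have sm': "summable (\<lambda>j. \<Sum>i. N (a j i) * N (b j i))"
      using le nuclear_rep_norm_nonneg[OF r] by (intro summable_comparison_test[OF _ sm]) (auto intro: less_imp_le)
    obtain A B L where L: "nuclear_rep \<Theta> k L A B" "L \<in> nuclear \<Theta> k"
      "(\<Sum>n. N (A n) * N (B n)) = (\<Sum>j. \<Sum>i. N (a j i) * N (b j i))"
      "\<forall>f\<in>H. \<forall>g\<in>H. (\<lambda>j. ip (T j f) g) sums ip (L f) g"
      using nuclear_rep_concat[OF r nuclear_carrier(1)[OF T] sm'] by blast
    have "nuclear_norm \<Theta> k L \<le> (\<Sum>j. \<Sum>i. N (a j i) * N (b j i))"
      using nuclear_norm_le_rep[OF L(1)] L(3) by simp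
    also have "\<dots> \<le> (\<Sum>j. nuclear_norm \<Theta> k (T j) + e * (1/2) ^ Suc j)"
      by (rule suminf_le[OF _ sm' sm]) (use le in \<open>auto intro: less_imp_le\<close>)
    also have "\<dots> = (\<Sum>j. nuclear_norm \<Theta> k (T j)) + e"
      using suminf_add[OF S sums_summable[OF geo]] sums_unique[OF geo] by simp
    finally show ?thesis using L by blast
  qed
  \<comment> \<open>The operator found in \<open>step\<close> might depend on \<open>e\<close>, but
    its matrix coefficients do not. So one \<open>L\<close> serves every \<open>e\<close>, and the
    surplus can tend to 0.\<close>
  obtain L where L: "L \<in> nuclear \<Theta> k" "\<forall>f\<in>H. \<forall>g\<in>H. (\<lambda>j. ip (T j f) g) sums ip (L f) g"
    using step[of 1] by auto
  have "nuclear_norm \<Theta> k L \<le> (\<Sum>j. nuclear_norm \<Theta> k (T j)) + e" if e0: "e > 0" for e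
  proof -
    obtain L' where L': "L' \<in> nuclear \<Theta> k" "nuclear_norm \<Theta> k L' \<le> (\<Sum>j. nuclear_norm \<Theta> k (T j)) + e"
      "\<forall>f\<in>H. \<forall>g\<in>H. (\<lambda>j. ip (T j f) g) sums ip (L' f) g"
      using step[OF e0] by blast
    have "L = L'" by (rule nuclear_eqI[OF L(1) L'(1)]) (use L(2) L'(3) sums_unique2 in blast)
    with L'(2) show ?thesis by simp
  qed
  then have "nuclear_norm \<Theta> k L \<le> (\<Sum>j. nuclear_norm \<Theta> k (T j))" by (rule field_le_epsilon)
  with L that show thesis by blast
qed

lemma tensor_nuclear:
  assumes "a \<in> H" "b \<in> H"
  shows "tensor \<Theta> k a b \<in> nuclear \<Theta> k" "nuclear_norm \<Theta> k (tensor \<Theta> k a b) \<le> N a * N b"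
proof -
  define A where "A i = (if i = 0 then a else 0)" for i :: nat
  define B where "B i = (if i = 0 then b else 0)" for i :: nat
  have AB: "A i \<in> H" "B i \<in> H" for i using assms by (auto simp: A_def B_def)
  have "(\<lambda>i. N (A i) * N (B i)) = (\<lambda>i. if i = 0 then N a * N b else 0)" by (auto simp: A_def B_def)
  then have sums: "(\<lambda>i. N (A i) * N (B i)) sums (N a * N b)"
    using sums_single[of 0 "\<lambda>_. N a * N b"] by simp
  have "(\<lambda>i. ip f (B i) * ip (A i) g) sums ip (tensor \<Theta> k a b f) g" if "f \<in> H" "g \<in> H" for f g
  proof -
    have "(\<lambda>i. ip f (B i) * ip (A i) g) = (\<lambda>i. if i = 0 then ip f b * ip a g else 0)"
      using that by (auto simp: A_def B_def)
    then show ?thesis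
      using sums_single[of 0 "\<lambda>_. ip f b * ip a g"] that assms by (simp add: tensor_eq ip_scale_left)
  qed
  then have r: "nuclear_rep \<Theta> k (tensor \<Theta> k a b) A B"
    using assms by (intro nuclear_repI AB sums_summable[OF sums]) (auto simp: tensor_eq)
  show "tensor \<Theta> k a b \<in> nuclear \<Theta> k"
    using assms by (intro nuclearI[OF _ _ r]) (auto simp: tensor_def)
  show "nuclear_norm \<Theta> k (tensor \<Theta> k a b) \<le> N a * N b"
    using nuclear_norm_le_rep[OF r] sums by (simp add: sums_iff)
qed

text \<open>Cauchy-Schwarz in each term bounds the coefficient by the cost of any representation
  times \<open>N f * N g\<close>. It makes matrix coefficients continuous on the space of nuclear
  operators.\<close>

lemma nuclear_bound:
  assumes T: "T \<in> nuclear \<Theta> k" and f: "f \<in> H" and g: "g \<in> H"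
  shows "\<bar>ip (T f) g\<bar> \<le> nuclear_norm \<Theta> k T * (N f * N g)"
proof (rule field_le_epsilon)
  fix e :: real assume e: "e > 0"
  \<comment> \<open>The added 1 keeps the divisor positive when \<open>f\<close> or \<open>g\<close>
    is 0; an excess \<open>e / c\<close> in the norm then costs at most \<open>e\<close>.\<close>
  define c where "c = N f * N g + 1"
  have c: "c > 0" using f g by (auto simp: c_def intro!: add_nonneg_pos mult_nonneg_nonneg N_nonneg)
  obtain a b where r: "nuclear_rep \<Theta> k T a b"
    and lt: "(\<Sum>i. N (a i) * N (b i)) < nuclear_norm \<Theta> k T + e / c"
    using nuclear_norm_approx[OF T, of "e / c"] e c by auto
  note ab = nuclear_rep_carrier[OF r]
  have "ip (T f) g = (\<Sum>i. ip f (b i) * ip (a i) g)"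
    using nuclear_rep_sums[OF r nuclear_carrier(1)[OF T f] f g] by (rule sums_unique)
  then have "\<bar>ip (T f) g\<bar> \<le> (\<Sum>i. N (a i) * N (b i)) * (N f * N g)"
    using summable_rabs[OF coeff_summable(1)[OF ab f g]] coeff_summable(2)[OF ab f g] by simp
  also have "\<dots> \<le> (nuclear_norm \<Theta> k T + e / c) * (N f * N g)"
    using lt f g by (intro mult_right_mono mult_nonneg_nonneg N_nonneg) auto
  also have "\<dots> = nuclear_norm \<Theta> k T * (N f * N g) + (e / c) * (N f * N g)" by (rule distrib_right)
  also have "(e / c) * (N f * N g) \<le> (e / c) * c"
    using e c by (intro mult_left_mono) (auto simp: c_def)
  also have "(e / c) * c = e" using c by simp
  finally show "\<bar>ip (T f) g\<bar> \<le> nuclear_norm \<Theta> k T * (N f * N g) + e" by simp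
qed

lemma nuclear_zero: "0 \<in> nuclear \<Theta> k" "nuclear_norm \<Theta> k 0 = 0"
proof -
  have "tensor \<Theta> k 0 0 = 0" by (auto simp: tensor_def)
  then have "0 \<in> nuclear \<Theta> k" "nuclear_norm \<Theta> k 0 \<le> 0" using tensor_nuclear[of 0 0] by auto
  then show "0 \<in> nuclear \<Theta> k" "nuclear_norm \<Theta> k 0 = 0" using nuclear_norm_nonneg[of 0] by auto
qed

lemma nuclear_add:
  assumes S: "S \<in> nuclear \<Theta> k" and T: "T \<in> nuclear \<Theta> k"
  shows "S + T \<in> nuclear \<Theta> k" "nuclear_norm \<Theta> k (S + T) \<le> nuclear_norm \<Theta> k S + nuclear_norm \<Theta> k T"
proof -
  \<comment> \<open>The finite sum is a series with zeros from index 2 on, so the result on series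
    yields the triangle inequality.\<close>
  define U where "U j = (if j = 0 then S else if j = 1 then T else 0)" for j :: nat
  have UN: "U j \<in> nuclear \<Theta> k" for j using S T nuclear_zero by (auto simp: U_def)
  have fin: "(\<lambda>j. h (U j)) sums (h S + h T)" if "h 0 = (0::real)" for h
    using sums_finite[of "{0,1}" "\<lambda>j. h (U j)"] that by (simp add: U_def)
  have nn: "(\<lambda>j. nuclear_norm \<Theta> k (U j)) sums (nuclear_norm \<Theta> k S + nuclear_norm \<Theta> k T)"
    by (rule fin) (rule nuclear_zero)
  obtain L where L: "L \<in> nuclear \<Theta> k" "nuclear_norm \<Theta> k L \<le> (\<Sum>j. nuclear_norm \<Theta> k (U j))"
    and sums: "\<And>f g. f \<in> H \<Longrightarrow> g \<in> H \<Longrightarrow> (\<lambda>j. ip (U j f) g) sums ip (L f) g"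
    using nuclear_series[OF UN sums_summable[OF nn]] by metis
  have "L f = S f + T f" for f
  proof (cases "f \<in> H")
    case True
    show ?thesis
    proof (rule ip_eqI)
      fix g assume g: "g \<in> H"
      have "(\<lambda>j. ip (U j f) g) sums (ip (S f) g + ip (T f) g)"
        by (rule fin[of "\<lambda>V. ip (V f) g"]) (use g in simp)
      then show "ip (L f) g = ip (S f + T f) g"
        using sums[OF True g] sums_unique2 nuclear_carrier(1)[OF S True] nuclear_carrier(1)[OF T True] g
        by (simp add: ip_add_left) blast
    qed (use nuclear_carrier(1)[OF S True] nuclear_carrier(1)[OF T True] nuclear_carrier(1)[OF L(1) True] in auto)
  qed (use nuclear_carrier(2)[OF S] nuclear_carrier(2)[OF T] nuclear_carrier(2)[OF L(1)] in auto)
  then have "L = S + T" by auto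
  with L sums_unique[OF nn]
  show "S + T \<in> nuclear \<Theta> k" "nuclear_norm \<Theta> k (S + T) \<le> nuclear_norm \<Theta> k S + nuclear_norm \<Theta> k T" by auto
qed

text \<open>Scaling a representation scales its cost. Equality of the norms is obtained afterwards
  by applying this inequality to the inverse scalar.\<close>

lemma nuclear_scale_le:
  assumes T: "T \<in> nuclear \<Theta> k"
  shows "c *\<^sub>R T \<in> nuclear \<Theta> k" "nuclear_norm \<Theta> k (c *\<^sub>R T) \<le> \<bar>c\<bar> * nuclear_norm \<Theta> k T"
proof -
  have rep: "nuclear_rep \<Theta> k (c *\<^sub>R T) (\<lambda>i. c *\<^sub>R a i) b \<and> (\<Sum>i. N (c *\<^sub>R a i) * N (b i)) = \<bar>c\<bar> * (\<Sum>i. N (a i) * N (b i))"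
    if r: "nuclear_rep \<Theta> k T a b" for a b
  proof -
    note ab = nuclear_rep_carrier[OF r]
    have "(\<lambda>i. N (c *\<^sub>R a i) * N (b i)) = (\<lambda>i. \<bar>c\<bar> * (N (a i) * N (b i)))" using ab by (simp add: N_scale mult.assoc)
    then have sums: "(\<lambda>i. N (c *\<^sub>R a i) * N (b i)) sums (\<bar>c\<bar> * (\<Sum>i. N (a i) * N (b i)))"
      using sums_mult[OF summable_sums[OF ab(3)], of "\<bar>c\<bar>"] by simp
    have "nuclear_rep \<Theta> k (c *\<^sub>R T) (\<lambda>i. c *\<^sub>R a i) b"
    proof (rule nuclear_repI)
      fix f g assume f: "f \<in> H" and g: "g \<in> H"
      have "(\<lambda>i. ip f (b i) * ip (c *\<^sub>R a i) g) = (\<lambda>i. c * (ip f (b i) * ip (a i) g))"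
        using ab g by (simp add: ip_scale_left mult.left_commute)
      then show "(\<lambda>i. ip f (b i) * ip (c *\<^sub>R a i) g) sums ip ((c *\<^sub>R T) f) g"
        using sums_mult[OF nuclear_rep_sums[OF r nuclear_carrier(1)[OF T f] f g], of c] nuclear_carrier(1)[OF T f] g
        by (simp add: scaleR_fun_def ip_scale_left)
    qed (use ab sums nuclear_carrier(1)[OF T] in \<open>auto simp: scaleR_fun_def sums_iff\<close>)
    with sums show ?thesis by (simp add: sums_iff)
  qed
  obtain a b where "nuclear_rep \<Theta> k T a b" using T by (auto simp: nuclear_def)
  with rep show cT: "c *\<^sub>R T \<in> nuclear \<Theta> k"
    using nuclear_carrier[OF T] by (intro nuclearI[of _ "\<lambda>i. c *\<^sub>R a i" b]) (auto simp: scaleR_fun_def)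
  show "nuclear_norm \<Theta> k (c *\<^sub>R T) \<le> \<bar>c\<bar> * nuclear_norm \<Theta> k T"
  proof (cases "c = 0")
    case True
    then show ?thesis using nuclear_zero by simp
  next
    case False
    have "nuclear_norm \<Theta> k (c *\<^sub>R T) / \<bar>c\<bar> \<le> nuclear_norm \<Theta> k T"
    proof (rule nuclear_norm_greatest[OF T])
      fix a b assume "nuclear_rep \<Theta> k T a b"
      from rep[OF this] have "nuclear_norm \<Theta> k (c *\<^sub>R T) \<le> \<bar>c\<bar> * (\<Sum>i. N (a i) * N (b i))"
        using nuclear_norm_le_rep by metis
      then show "nuclear_norm \<Theta> k (c *\<^sub>R T) / \<bar>c\<bar> \<le> (\<Sum>i. N (a i) * N (b i))"
        using False by (simp add: pos_divide_le_eq mult.commute)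
    qed
    then show ?thesis using False by (simp add: pos_divide_le_eq mult.commute)
  qed
qed

sublocale nuc: normed_carrier "nuclear \<Theta> k" "nuclear_norm \<Theta> k"
proof
  show "subspace (nuclear \<Theta> k)"
    unfolding subspace_def using nuclear_zero nuclear_add nuclear_scale_le by blast
  fix S T :: "(real^'n) aefun \<Rightarrow> (real^'n) aefun" and c
  assume T: "T \<in> nuclear \<Theta> k"
  show "0 \<le> nuclear_norm \<Theta> k T" by (rule nuclear_norm_nonneg[OF T])
  show "T = 0" if "nuclear_norm \<Theta> k T = 0"
    using nuclear_bound[OF T] that by (intro nuclear_eqI[OF T nuclear_zero(1)]) auto
  show "nuclear_norm \<Theta> k (c *\<^sub>R T) = \<bar>c\<bar> * nuclear_norm \<Theta> k T"
  proof (cases "c = 0")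
    case True
    then show ?thesis using nuclear_zero by simp
  next
    case False
    have "nuclear_norm \<Theta> k T \<le> \<bar>inverse c\<bar> * nuclear_norm \<Theta> k (c *\<^sub>R T)"
      using nuclear_scale_le(2)[OF nuclear_scale_le(1)[OF T, of c], of "inverse c"] False by simp
    then have "\<bar>c\<bar> * nuclear_norm \<Theta> k T \<le> nuclear_norm \<Theta> k (c *\<^sub>R T)"
      using False by (simp add: field_simps)
    with nuclear_scale_le(2)[OF T, of c] show ?thesis by simp
  qed
  assume "S \<in> nuclear \<Theta> k"
  then show "nuclear_norm \<Theta> k (T + S) \<le> nuclear_norm \<Theta> k T + nuclear_norm \<Theta> k S"
    by (rule nuclear_add(2)[OF T])
qed

text \<open>The remainder of an absolutely convergent series is the sum of the shifted series, so
  its norm is at most the tail of the norms.\<close>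

sublocale nuc: banach_carrier "nuclear \<Theta> k" "nuclear_norm \<Theta> k"
proof (rule nuc.banach_carrierI_series)
  fix u assume u: "\<And>n. u n \<in> nuclear \<Theta> k" and S: "summable (\<lambda>n. nuclear_norm \<Theta> k (u n))"
  obtain L where L: "L \<in> nuclear \<Theta> k" "nuclear_norm \<Theta> k L \<le> (\<Sum>j. nuclear_norm \<Theta> k (u j))"
    "\<And>f g. f \<in> H \<Longrightarrow> g \<in> H \<Longrightarrow> (\<lambda>j. ip (u j f) g) sums ip (L f) g"
    using nuclear_series[OF u S] by metis
  have le: "nuclear_norm \<Theta> k ((\<Sum>i<n. u i) - L) \<le> (\<Sum>j. nuclear_norm \<Theta> k (u (j + n)))" for n
  proof -
    obtain R where R: "R \<in> nuclear \<Theta> k" "nuclear_norm \<Theta> k R \<le> (\<Sum>j. nuclear_norm \<Theta> k (u (j + n)))"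
      "\<And>f g. f \<in> H \<Longrightarrow> g \<in> H \<Longrightarrow> (\<lambda>j. ip (u (j + n) f) g) sums ip (R f) g"
      using nuclear_series[of "\<lambda>j. u (j + n)"] u summable_ignore_initial_segment[OF S, of n] by metis
    have sN: "(\<Sum>i<n. u i) \<in> nuclear \<Theta> k" using u by (intro nuc.V_sum)
    have "L - (\<Sum>i<n. u i) = R"
    proof (rule nuclear_eqI[OF nuc.V_diff[OF L(1) sN] R(1)])
      fix f g assume f: "f \<in> H" and g: "g \<in> H"
      have uf: "u i f \<in> H" for i by (rule nuclear_carrier(1)[OF u f])
      have "ip (R f) g = ip (L f) g - (\<Sum>i<n. ip (u i f) g)"
        using R(3)[OF f g] L(3)[OF f g] sums_unique2 sums_split_initial_segment by blast
      also have "(\<Sum>i<n. ip (u i f) g) = ip ((\<Sum>i<n. u i) f) g"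
        using ip_sum_scale_left[of "{..<n}" "\<lambda>i. u i f" g "\<lambda>_. 1"] uf g by (simp add: sum_fun_apply)
      finally show "ip ((L - (\<Sum>i<n. u i)) f) g = ip (R f) g"
        using nuclear_carrier(1)[OF L(1) f] nuclear_carrier(1)[OF sN f] g by (simp add: ip_diff_left)
    qed
    then show ?thesis using R(2) nuc.N_commute[OF L(1) sN] by simp
  qed
  have "(\<lambda>n. nuclear_norm \<Theta> k ((\<Sum>i<n. u i) - L)) \<longlonglongrightarrow> 0"
  proof (rule Lim_null_comparison)
    have "(\<lambda>n. (\<Sum>j. nuclear_norm \<Theta> k (u j)) - (\<Sum>j<n. nuclear_norm \<Theta> k (u j))) \<longlonglongrightarrow>
        (\<Sum>j. nuclear_norm \<Theta> k (u j)) - (\<Sum>j. nuclear_norm \<Theta> k (u j))"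
      by (intro tendsto_intros summable_LIMSEQ[OF S])
    then show "(\<lambda>n. \<Sum>j. nuclear_norm \<Theta> k (u (j + n))) \<longlonglongrightarrow> 0"
      by (simp add: suminf_minus_initial_segment[OF S])
    have "(\<Sum>i<n. u i) - L \<in> nuclear \<Theta> k" for n using u L(1) by (intro nuc.V_diff nuc.V_sum)
    then show "\<forall>\<^sub>F n in sequentially. norm (nuclear_norm \<Theta> k ((\<Sum>i<n. u i) - L)) \<le> (\<Sum>j. nuclear_norm \<Theta> k (u (j + n)))"
      using le nuclear_norm_nonneg by simp
  qed
  with L(1) show "\<exists>L\<in>nuclear \<Theta> k. (\<lambda>n. nuclear_norm \<Theta> k ((\<Sum>i<n. u i) - L)) \<longlonglongrightarrow> 0" by blast
qed

text \<open>A term \<open>a i \<otimes> b i\<close> contributes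
  \<open>ip (proj E (a i)) (b i)\<close> to the finite trace, which is at most
  \<open>N (a i) * N (b i)\<close> because projections do not increase norms. Hence the trace is
  below the cost of every representation.\<close>

lemma trace_le_nuclear_norm:
  assumes T: "T \<in> nuclear \<Theta> k" and E: "orthonormal E"
  shows "(\<Sum>e\<in>E. ip (T e) e) \<le> nuclear_norm \<Theta> k T"
proof (rule nuclear_norm_greatest[OF T])
  fix a b assume r: "nuclear_rep \<Theta> k T a b"
  note ab = nuclear_rep_carrier[OF r]
  have EH: "e \<in> H" if "e \<in> E" for e using E that by (auto simp: orthonormal_def)
  have "(\<lambda>i. \<Sum>e\<in>E. ip e (b i) * ip (a i) e) sums (\<Sum>e\<in>E. ip (T e) e)"
    by (intro sums_sum nuclear_rep_sums[OF r] nuclear_carrier(1)[OF T] EH)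
  then have "(\<Sum>e\<in>E. ip (T e) e) = (\<Sum>i. \<Sum>e\<in>E. ip e (b i) * ip (a i) e)" by (rule sums_unique)
  also have "\<dots> \<le> (\<Sum>i. N (a i) * N (b i))"
  proof (rule suminf_le[OF _ sums_summable ab(3)])
    fix i
    have "(\<Sum>e\<in>E. ip e (b i) * ip (a i) e) = ip (proj E (a i)) (b i)"
      using ip_proj[OF E ab(2)] by (simp add: mult.commute)
    also have "\<dots> \<le> N (proj E (a i)) * N (b i)"
      using ip_Cauchy_Schwarz[OF proj_in_V[OF E] ab(2)] by (rule order_trans[OF abs_ge_self])
    also have "\<dots> \<le> N (a i) * N (b i)"
      by (intro mult_right_mono N_proj_le[OF E] ab N_nonneg)
    finally show "(\<Sum>e\<in>E. ip e (b i) * ip (a i) e) \<le> N (a i) * N (b i)" .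
  qed fact
  finally show "(\<Sum>e\<in>E. ip (T e) e) \<le> (\<Sum>i. N (a i) * N (b i))" .
qed

end

section \<open>Covariance operators\<close>

context sobolev_space
begin

text \<open>The difference splits as \<open>a \<otimes> (b - d) + (a - c) \<otimes> d\<close>. On
  the diagonal this is the quadratic estimate that integrability asks for.\<close>

lemma tensor_diff_bound:
  assumes "a \<in> H" "b \<in> H" "c \<in> H" "d \<in> H"
  shows "nuclear_norm \<Theta> k (tensor \<Theta> k a b - tensor \<Theta> k c d) \<le> N a * N (b - d) + N (a - c) * N d"
proof -
  have "(tensor \<Theta> k a b - tensor \<Theta> k c d) f = (tensor \<Theta> k a (b - d) + tensor \<Theta> k (a - c) d) f" for f
    using assms by (cases "f \<in> H") (simp_all add: tensor_def ip_diff_right algebra_simps)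
  then have "tensor \<Theta> k a b - tensor \<Theta> k c d = tensor \<Theta> k a (b - d) + tensor \<Theta> k (a - c) d" by (rule ext)
  then have "nuclear_norm \<Theta> k (tensor \<Theta> k a b - tensor \<Theta> k c d)
      \<le> nuclear_norm \<Theta> k (tensor \<Theta> k a (b - d)) + nuclear_norm \<Theta> k (tensor \<Theta> k (a - c) d)"
    using assms by (simp add: nuclear_add(2) tensor_nuclear(1))
  also have "\<dots> \<le> N a * N (b - d) + N (a - c) * N d"
    using assms by (intro add_mono tensor_nuclear(2)) auto
  finally show ?thesis .
qed

text \<open>Two contractions \<open>D\<close> and \<open>E\<close> of a separable space cover both
  uses: the identity twice for the covariance of order \<open>k\<close>, and two derivatives into
  \<open>L2\<close> for the covariances of order 0.\<close>

lemma bochner_integrable_tensor: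
  assumes V: "normed_carrier V M" "normed_carrier.separable V M" and P: "finite_measure P"
    and f: "f \<in> P \<rightarrow>\<^sub>M borel_on V M" "integrable P (\<lambda>\<omega>. (M (f \<omega>))\<^sup>2)"
    and D: "linear_on V D" "\<And>x. x \<in> V \<Longrightarrow> D x \<in> H" "\<And>x. x \<in> V \<Longrightarrow> N (D x) \<le> M x"
    and E: "linear_on V E" "\<And>x. x \<in> V \<Longrightarrow> E x \<in> H" "\<And>x. x \<in> V \<Longrightarrow> N (E x) \<le> M x"
  shows "bochner_integrable_on P (nuclear \<Theta> k) (nuclear_norm \<Theta> k) (\<lambda>\<omega>. tensor \<Theta> k (D (f \<omega>)) (E (f \<omega>)))"
proof (rule bochner_integrable_on_quadratic[OF V(1) nuc.banach_carrier_axioms V(2) P f])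
  interpret V: normed_carrier V M by fact
  show "tensor \<Theta> k (D x) (E x) \<in> nuclear \<Theta> k" if "x \<in> V" for x
    using that D E by (intro tensor_nuclear) auto
  fix x y assume xy: "x \<in> V" "y \<in> V"
  have diff: "D x - D y = D (x - y)" "E x - E y = E (x - y)"
    using linear_on_diff[OF V.subspace_V D(1) xy] linear_on_diff[OF V.subspace_V E(1) xy] by auto
  have "nuclear_norm \<Theta> k (tensor \<Theta> k (D x) (E x) - tensor \<Theta> k (D y) (E y))
      \<le> N (D x) * N (E (x - y)) + N (D (x - y)) * N (E y)"
    using tensor_diff_bound[of "D x" "E x" "D y" "E y"] xy D E by (simp add: diff)
  also have "\<dots> \<le> M x * M (x - y) + M (x - y) * M y"
    using xy D E by (intro add_mono mult_mono N_nonneg V.N_nonneg) auto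
  also have "\<dots> = M (x - y) * (M x + M y)" by (simp add: algebra_simps)
  finally show "nuclear_norm \<Theta> k (tensor \<Theta> k (D x) (E x) - tensor \<Theta> k (D y) (E y)) \<le> M (x - y) * (M x + M y)" .
qed

text \<open>\<open>ip (T f) g\<close> is a bounded linear functional of the nuclear operator
  \<open>T\<close>, so it may be taken under the integral.\<close>

lemma bochner_tensor_eval:
  assumes P: "finite_measure P"
    and C: "has_bochner_integral_on P (nuclear \<Theta> k) (nuclear_norm \<Theta> k) (\<lambda>\<omega>. tensor \<Theta> k (A \<omega>) (B \<omega>)) C"
    and AB: "\<And>\<omega>. \<omega> \<in> space P \<Longrightarrow> A \<omega> \<in> H" "\<And>\<omega>. \<omega> \<in> space P \<Longrightarrow> B \<omega> \<in> H"
    and f: "f \<in> H" and g: "g \<in> H"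
  shows "has_bochner_integral P (\<lambda>\<omega>. ip f (B \<omega>) * ip (A \<omega>) g) (ip (C f) g)"
proof -
  have "has_bochner_integral P (\<lambda>\<omega>. ip (tensor \<Theta> k (A \<omega>) (B \<omega>) f) g) (ip (C f) g)"
  proof (rule nuc.has_bochner_integral_linear_real[OF P C])
    show "linear_on (nuclear \<Theta> k) (\<lambda>T. ip (T f) g)"
      using nuclear_carrier(1)[OF _ f] g
      by (intro linear_onI) (auto simp: scaleR_fun_def ip_add_left ip_scale_left)
    show "\<bar>ip (T f) g\<bar> \<le> (N f * N g) * nuclear_norm \<Theta> k T" if "T \<in> nuclear \<Theta> k" for T
      using nuclear_bound[OF that f g] by (simp add: mult.commute)
  qed
  moreover have "ip (tensor \<Theta> k (A \<omega>) (B \<omega>) f) g = ip f (B \<omega>) * ip (A \<omega>) g" if "\<omega> \<in> space P" for \<omega>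
    using AB[OF that] f g by (simp add: tensor_eq ip_scale_left)
  ultimately show ?thesis by (simp cong: has_bochner_integral_cong)
qed

text \<open>\<open>u\<close> is the value at \<open>f\<close> of the Hilbert adjoint of the
  derivative, seen as a bounded map from the Sobolev space to \<open>L2\<close>; it exists by the
  Riesz theorem.\<close>

lemma mderiv_adjoint:
  assumes \<alpha>: "mdeg \<alpha> \<le> k" and f: "f \<in> L2 \<Theta>"
  shows "\<exists>u\<in>H. \<forall>x\<in>H. L2_inner \<Theta> (mderiv \<Theta> \<alpha> x) f = ip x u"
proof -
  interpret L: inner_carrier "L2 \<Theta>" "L2_inner \<Theta>" "L2_norm \<Theta>"
    by (rule inner_carrier_L2) (use open_domain in simp)
  note D = mderiv_Sobolev(1)[OF open_domain _ \<alpha>]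
  show ?thesis
  proof (rule Riesz)
    show "linear_on H (\<lambda>x. L2_inner \<Theta> (mderiv \<Theta> \<alpha> x) f)"
      using linear_on_mderiv[OF open_domain \<alpha>] D f
      by (intro linear_onI) (auto simp: linear_on_add linear_on_scale L.ip_add_left L.ip_scale_left)
    show "\<bar>L2_inner \<Theta> (mderiv \<Theta> \<alpha> x) f\<bar> \<le> L2_norm \<Theta> f * N x" if x: "x \<in> H" for x
    proof -
      have "\<bar>L2_inner \<Theta> (mderiv \<Theta> \<alpha> x) f\<bar> \<le> L2_norm \<Theta> (mderiv \<Theta> \<alpha> x) * L2_norm \<Theta> f"
        by (rule L.ip_Cauchy_Schwarz[OF D[OF x] f])
      also have "\<dots> \<le> N x * L2_norm \<Theta> f"
        by (intro mult_right_mono mderiv_norm_le[OF open_domain x \<alpha>] L.N_nonneg f)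
      finally show ?thesis by (simp add: mult.commute)
    qed
  qed auto
qed

end

section \<open>The covariance of a random element and of its derivatives\<close>

locale random_sobolev = sobolev_space \<Theta> k + prob_space P
  for \<Theta> :: "(real^'n::finite) set" and k and P :: "'w measure" +
  fixes X :: "'w \<Rightarrow> (real^'n) aefun"
  assumes X_random: "random_element P \<Theta> k X"
    and X_square: "integrable P (\<lambda>\<omega>. (N (X \<omega>))\<^sup>2)"
begin

abbreviation "m \<equiv> mean P \<Theta> k X"

definition Y :: "'w \<Rightarrow> (real^'n) aefun" where "Y \<omega> = X \<omega> - m"

lemma X_measurable: "X \<in> P \<rightarrow>\<^sub>M borel_on H N"
  using X_random by (simp add: random_element_def)

lemma X_in_H: "\<omega> \<in> space P \<Longrightarrow> X \<omega> \<in> H"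
  using measurable_space[OF X_measurable] by simp

lemma X_norm_integrable: "integrable P (\<lambda>\<omega>. N (X \<omega>))"
proof (rule Bochner_Integration.integrable_bound)
  show "integrable P (\<lambda>\<omega>. 1 + (N (X \<omega>))\<^sup>2)" using X_square by simp
  show "(\<lambda>\<omega>. N (X \<omega>)) \<in> borel_measurable P"
    by (rule measurable_compose[OF X_measurable measurable_N])
  have "\<bar>t\<bar> \<le> 1 + t\<^sup>2" for t :: real
    using zero_le_power2[of "\<bar>t\<bar> - 1"] by (simp add: power2_diff)
  then show "AE \<omega> in P. norm (N (X \<omega>)) \<le> norm (1 + (N (X \<omega>))\<^sup>2)"
    by (intro AE_I2) (simp add: add_nonneg_nonneg)
qed

lemma mean_exists: "bochner_integrable_on P H N X"
  by (rule bochner_integrable_on_self[OF separable_H finite_measure_axioms X_measurable X_norm_integrable])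

lemma has_mean: "has_bochner_integral_on P H N X m"
  unfolding mean_def by (rule has_bochner_integral_on_integral[OF finite_measure_axioms mean_exists])

lemma mean_in_H: "m \<in> H"
  by (rule has_bochner_integral_onD(1)[OF has_mean])

lemma Y_in_H: "\<omega> \<in> space P \<Longrightarrow> Y \<omega> \<in> H"
  unfolding Y_def using X_in_H mean_in_H by simp

lemma Y_measurable: "Y \<in> P \<rightarrow>\<^sub>M borel_on H N"
  unfolding Y_def[abs_def] by (rule measurable_translate[OF X_measurable mean_in_H])

lemma Y_square: "integrable P (\<lambda>\<omega>. (N (Y \<omega>))\<^sup>2)"
proof (rule Bochner_Integration.integrable_bound)
  show "integrable P (\<lambda>\<omega>. 2 * (N (X \<omega>))\<^sup>2 + 2 * (N m)\<^sup>2)" using X_square by simp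
  show "(\<lambda>\<omega>. (N (Y \<omega>))\<^sup>2) \<in> borel_measurable P"
    using measurable_compose[OF Y_measurable measurable_N] by measurable
  show "AE \<omega> in P. norm ((N (Y \<omega>))\<^sup>2) \<le> norm (2 * (N (X \<omega>))\<^sup>2 + 2 * (N m)\<^sup>2)"
  proof (rule AE_I2)
    fix \<omega> assume w: "\<omega> \<in> space P"
    have "(N (Y \<omega>))\<^sup>2 \<le> (N (X \<omega>) + N m)\<^sup>2"
      using N_diff_le[OF X_in_H[OF w] mean_in_H] N_nonneg[OF Y_in_H[OF w]] by (intro power_mono) (auto simp: Y_def)
    also have "\<dots> \<le> 2 * (N (X \<omega>))\<^sup>2 + 2 * (N m)\<^sup>2"
      using zero_le_power2[of "N (X \<omega>) - N m"] by (simp add: power2_sum power2_diff)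
    finally show "norm ((N (Y \<omega>))\<^sup>2) \<le> norm (2 * (N (X \<omega>))\<^sup>2 + 2 * (N m)\<^sup>2)" by simp
  qed
qed

abbreviation "C \<equiv> Cov P \<Theta> k X X"

lemma cov_integrand_eq: "cov_integrand P \<Theta> k X X = (\<lambda>\<omega>. tensor \<Theta> k (Y \<omega>) (Y \<omega>))"
  by (rule ext) (simp add: cov_integrand_def Y_def)

lemma has_cov: "has_bochner_integral_on P (nuclear \<Theta> k) (nuclear_norm \<Theta> k) (\<lambda>\<omega>. tensor \<Theta> k (Y \<omega>) (Y \<omega>)) C"
  unfolding Cov_def cov_integrand_eq
proof (rule nuc.has_bochner_integral_on_integral[OF finite_measure_axioms])
  have id: "linear_on H (\<lambda>x. x)" by (rule linear_onI) auto
  show "bochner_integrable_on P (nuclear \<Theta> k) (nuclear_norm \<Theta> k) (\<lambda>\<omega>. tensor \<Theta> k (Y \<omega>) (Y \<omega>))"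
    by (rule bochner_integrable_tensor[OF normed_carrier_axioms separable_H finite_measure_axioms Y_measurable Y_square id _ _ id])
       auto
qed

lemma cov_exists_self: "cov_exists P \<Theta> k X X"
  unfolding cov_exists_def cov_integrand_eq
  using mean_exists has_cov by (auto simp: bochner_integrable_on_def)

lemma cov_nuclear: "C \<in> nuclear \<Theta> k"
  by (rule has_bochner_integral_onD(1)[OF has_cov])

lemma cov_eval:
  assumes "f \<in> H" "g \<in> H"
  shows "has_bochner_integral P (\<lambda>\<omega>. ip f (Y \<omega>) * ip (Y \<omega>) g) (ip (C f) g)"
  by (rule bochner_tensor_eval[OF finite_measure_axioms has_cov Y_in_H Y_in_H assms])

lemma cov_self_adjoint:
  assumes f: "f \<in> H" and g: "g \<in> H" shows "ip (C f) g = ip f (C g)"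
proof -
  have "ip (C f) g = (\<integral>\<omega>. ip f (Y \<omega>) * ip (Y \<omega>) g \<partial>P)"
    using cov_eval[OF f g] by (rule has_bochner_integral_integral_eq[symmetric])
  also have "\<dots> = (\<integral>\<omega>. ip g (Y \<omega>) * ip (Y \<omega>) f \<partial>P)"
    using f g Y_in_H ip_commute by (intro Bochner_Integration.integral_cong) auto
  also have "\<dots> = ip (C g) f"
    using cov_eval[OF g f] by (rule has_bochner_integral_integral_eq)
  also have "\<dots> = ip f (C g)" by (rule ip_commute[OF nuclear_carrier(1)[OF cov_nuclear g] f])
  finally show ?thesis .
qed

lemma cov_nonneg:
  assumes f: "f \<in> H" shows "0 \<le> ip (C f) f"
proof -
  have "0 \<le> (\<integral>\<omega>. ip f (Y \<omega>) * ip (Y \<omega>) f \<partial>P)"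
    using ip_commute[OF f Y_in_H] by (intro integral_nonneg_AE AE_I2) auto
  then show ?thesis using cov_eval[OF f f] by (simp add: has_bochner_integral_integral_eq)
qed

lemma cov_norm_le: "nuclear_norm \<Theta> k C \<le> (\<integral>\<omega>. (N (Y \<omega>))\<^sup>2 \<partial>P)"
proof -
  have "ennreal (nuclear_norm \<Theta> k C) \<le> (\<integral>\<^sup>+\<omega>. ennreal (nuclear_norm \<Theta> k (tensor \<Theta> k (Y \<omega>) (Y \<omega>))) \<partial>P)"
    by (rule nuc.N_bochner_integral_le[OF finite_measure_axioms has_cov])
  also have "\<dots> \<le> (\<integral>\<^sup>+\<omega>. ennreal ((N (Y \<omega>))\<^sup>2) \<partial>P)"
    using tensor_nuclear(2)[OF Y_in_H Y_in_H]
    by (intro nn_integral_mono ennreal_leI) (simp add: power2_eq_square)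
  also have "\<dots> = ennreal (\<integral>\<omega>. (N (Y \<omega>))\<^sup>2 \<partial>P)"
    using Y_square by (intro nn_integral_eq_integral) auto
  finally show ?thesis by (simp add: integral_nonneg_AE)
qed

lemma cov_norm_ge: "(\<integral>\<omega>. (N (Y \<omega>))\<^sup>2 \<partial>P) \<le> nuclear_norm \<Theta> k C"
proof -
  obtain s where s: "\<And>n. simple_function P (s n)" "\<And>n. s n ` space P \<subseteq> H"
    and le: "\<And>n \<omega>. \<omega> \<in> space P \<Longrightarrow> N (Y \<omega> - s n \<omega>) \<le> N (Y \<omega>)"
    and lim: "\<And>\<omega>. \<omega> \<in> space P \<Longrightarrow> (\<lambda>n. N (Y \<omega> - s n \<omega>)) \<longlonglongrightarrow> 0"
    using simple_approximation[OF separable_H Y_measurable] by blast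
  have sH: "s n \<omega> \<in> H" if "\<omega> \<in> space P" for n \<omega> using s(2)[of n] that by auto
  have meas: "(\<lambda>\<omega>. N (Y \<omega> - s n \<omega>)) \<in> borel_measurable P" for n
    by (rule measurable_N_diff_simple[OF Y_measurable s])
  have sq_le: "(N (Y \<omega> - s n \<omega>))\<^sup>2 \<le> (N (Y \<omega>))\<^sup>2" if w: "\<omega> \<in> space P" for n \<omega>
    using le[OF w, of n] N_nonneg[of "Y \<omega> - s n \<omega>"] Y_in_H[OF w] sH[OF w] by (intro power_mono) auto
  have int: "integrable P (\<lambda>\<omega>. (N (Y \<omega> - s n \<omega>))\<^sup>2)" for n
    by (rule Bochner_Integration.integrable_bound[OF Y_square]) (use meas sq_le in auto)
  \<comment> \<open>\<open>s n \<omega>\<close> lies in the span of \<open>E\<close>, so the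
    projection of \<open>Y \<omega>\<close> is at least as close to \<open>Y \<omega>\<close>. By
    Pythagoras the projection retains \<open>(N (Y \<omega>))\<^sup>2\<close> up to a loss of at
    most \<open>(N (Y \<omega> - s n \<omega>))\<^sup>2\<close>.\<close>
  have lower: "(\<integral>\<omega>. (N (Y \<omega>))\<^sup>2 \<partial>P) - (\<integral>\<omega>. (N (Y \<omega> - s n \<omega>))\<^sup>2 \<partial>P) \<le> nuclear_norm \<Theta> k C" for n
  proof -
    have "finite (s n ` space P)" using s(1) by (simp add: simple_function_def)
    then obtain E where E: "orthonormal E" and PE: "\<And>d. d \<in> s n ` space P \<Longrightarrow> proj E d = d"
      using orthonormal_exists[OF _ s(2)] by blast
    have EH: "e \<in> H" if "e \<in> E" for e using E that by (auto simp: orthonormal_def)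
    have "has_bochner_integral P (\<lambda>\<omega>. \<Sum>e\<in>E. ip e (Y \<omega>) * ip (Y \<omega>) e) (\<Sum>e\<in>E. ip (C e) e)"
      by (intro has_bochner_integral_sum cov_eval EH)
    moreover have "(\<Sum>e\<in>E. ip e (Y \<omega>) * ip (Y \<omega>) e) = (N (proj E (Y \<omega>)))\<^sup>2" if w: "\<omega> \<in> space P" for \<omega>
      unfolding N_proj_power2[OF E Y_in_H[OF w]]
      by (intro sum.cong refl) (use ip_commute[OF EH Y_in_H[OF w]] in \<open>simp add: power2_eq_square\<close>)
    ultimately have tr: "has_bochner_integral P (\<lambda>\<omega>. (N (proj E (Y \<omega>)))\<^sup>2) (\<Sum>e\<in>E. ip (C e) e)"
      by (simp cong: has_bochner_integral_cong)
    have "(\<integral>\<omega>. (N (Y \<omega>))\<^sup>2 \<partial>P) - (\<integral>\<omega>. (N (Y \<omega> - s n \<omega>))\<^sup>2 \<partial>P)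
        = (\<integral>\<omega>. (N (Y \<omega>))\<^sup>2 - (N (Y \<omega> - s n \<omega>))\<^sup>2 \<partial>P)"
      using Y_square int by simp
    also have "\<dots> \<le> (\<integral>\<omega>. (N (proj E (Y \<omega>)))\<^sup>2 \<partial>P)"
    proof (rule integral_mono)
      fix \<omega> assume w: "\<omega> \<in> space P"
      have "N (Y \<omega> - proj E (Y \<omega>)) \<le> N (Y \<omega> - s n \<omega>)"
        by (rule N_proj_nearest[OF E Y_in_H[OF w] sH[OF w] PE]) (use w in simp)
      then have "(N (Y \<omega> - proj E (Y \<omega>)))\<^sup>2 \<le> (N (Y \<omega> - s n \<omega>))\<^sup>2"
        using Y_in_H[OF w] proj_in_V[OF E] by (intro power_mono N_nonneg) auto
      then show "(N (Y \<omega>))\<^sup>2 - (N (Y \<omega> - s n \<omega>))\<^sup>2 \<le> (N (proj E (Y \<omega>)))\<^sup>2"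
        using N_proj_Pythagoras[OF E Y_in_H[OF w]] by simp
    qed (use Y_square int tr in \<open>auto simp: has_bochner_integral_iff\<close>)
    also have "\<dots> = (\<Sum>e\<in>E. ip (C e) e)" using tr by (rule has_bochner_integral_integral_eq)
    also have "\<dots> \<le> nuclear_norm \<Theta> k C" by (rule trace_le_nuclear_norm[OF cov_nuclear E])
    finally show ?thesis .
  qed
  have "(\<lambda>n. \<integral>\<omega>. (N (Y \<omega> - s n \<omega>))\<^sup>2 \<partial>P) \<longlonglongrightarrow> (\<integral>\<omega>. 0 \<partial>P)"
  proof (rule integral_dominated_convergence[OF _ _ Y_square])
    show "AE \<omega> in P. (\<lambda>n. (N (Y \<omega> - s n \<omega>))\<^sup>2) \<longlonglongrightarrow> 0"
    proof (rule AE_I2)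
      fix \<omega> assume "\<omega> \<in> space P"
      from tendsto_power[OF lim[OF this], of 2] show "(\<lambda>n. (N (Y \<omega> - s n \<omega>))\<^sup>2) \<longlonglongrightarrow> 0" by simp
    qed
  qed (use meas sq_le in auto)
  then have "(\<lambda>n. (\<integral>\<omega>. (N (Y \<omega>))\<^sup>2 \<partial>P) - (\<integral>\<omega>. (N (Y \<omega> - s n \<omega>))\<^sup>2 \<partial>P)) \<longlonglongrightarrow> (\<integral>\<omega>. (N (Y \<omega>))\<^sup>2 \<partial>P) - 0"
    by (intro tendsto_intros) simp
  then show ?thesis using lower by (intro LIMSEQ_le_const2) auto
qed

lemma cov_norm: "nuclear_norm \<Theta> k C = (\<integral>\<omega>. (N (Y \<omega>))\<^sup>2 \<partial>P)"
  using cov_norm_le cov_norm_ge by simp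

text \<open>\<open>L2 \<Theta>\<close> is the Sobolev space of order 0. The theory of nuclear
  operators becomes available for it under the prefix \<open>L\<close>; \<open>Sobolev_0\<close> and
  \<open>Sobolev_inner_0\<close> translate.\<close>

sublocale L: sobolev_space \<Theta> 0
  by standard (rule open_domain)

lemma mderiv_in_L: "x \<in> H \<Longrightarrow> mdeg \<alpha> \<le> k \<Longrightarrow> mderiv \<Theta> \<alpha> x \<in> L.H"
  using mderiv_Sobolev(1)[OF open_domain] by (simp add: Sobolev_0)

lemma mderiv_L_norm_le: "x \<in> H \<Longrightarrow> mdeg \<alpha> \<le> k \<Longrightarrow> L.N (mderiv \<Theta> \<alpha> x) \<le> N x"
  using mderiv_norm_le[OF open_domain] mderiv_Sobolev(1)[OF open_domain] by (simp add: Sobolev_norm_0[OF open_domain])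

text \<open>Differentiation is linear and a contraction from the Sobolev space to \<open>L2\<close>,
  so it commutes with the Bochner integral.\<close>

lemma has_mean_mderiv:
  assumes \<alpha>: "mdeg \<alpha> \<le> k"
  shows "has_bochner_integral_on P L.H L.N (\<lambda>\<omega>. mderiv \<Theta> \<alpha> (X \<omega>)) (mderiv \<Theta> \<alpha> m)"
  by (rule has_bochner_integral_on_linear[OF normed_carrier_axioms L.normed_carrier_axioms finite_measure_axioms has_mean,
        where C=1])
     (use mderiv_in_L mderiv_L_norm_le linear_on_mderiv[OF open_domain] \<alpha> in auto)

lemma mean_mderiv: "mdeg \<alpha> \<le> k \<Longrightarrow> mean P \<Theta> 0 (\<lambda>\<omega>. mderiv \<Theta> \<alpha> (X \<omega>)) = mderiv \<Theta> \<alpha> m"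
  unfolding mean_def[of P \<Theta> 0]
  by (rule L.bochner_integral_on_eq[OF finite_measure_axioms has_mean_mderiv])

text \<open>Makes the results on covariances available for each derivative, as a random element of
  order 0.\<close>

lemma random_sobolev_mderiv:
  assumes \<alpha>: "mdeg \<alpha> \<le> k" shows "random_sobolev \<Theta> 0 P (\<lambda>\<omega>. mderiv \<Theta> \<alpha> (X \<omega>))"
proof
  show "random_element P \<Theta> 0 (\<lambda>\<omega>. mderiv \<Theta> \<alpha> (X \<omega>))"
    unfolding random_element_def by (rule has_bochner_integral_onD(2)[OF has_mean_mderiv[OF \<alpha>]])
  then have "(\<lambda>\<omega>. L.N (mderiv \<Theta> \<alpha> (X \<omega>))) \<in> borel_measurable P"
    unfolding random_element_def by (rule measurable_compose[OF _ L.measurable_N])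
  moreover have "(L.N (mderiv \<Theta> \<alpha> (X \<omega>)))\<^sup>2 \<le> (N (X \<omega>))\<^sup>2" if w: "\<omega> \<in> space P" for \<omega>
    by (intro power_mono mderiv_L_norm_le L.N_nonneg mderiv_in_L X_in_H w \<alpha>)
  ultimately show "integrable P (\<lambda>\<omega>. (L.N (mderiv \<Theta> \<alpha> (X \<omega>)))\<^sup>2)"
    by (intro Bochner_Integration.integrable_bound[OF X_square]) auto
qed

lemma Y_mderiv: "\<omega> \<in> space P \<Longrightarrow> mdeg \<alpha> \<le> k \<Longrightarrow>
    mderiv \<Theta> \<alpha> (X \<omega>) - mean P \<Theta> 0 (\<lambda>\<omega>. mderiv \<Theta> \<alpha> (X \<omega>)) = mderiv \<Theta> \<alpha> (Y \<omega>)"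
  using linear_on_diff[OF subspace_V linear_on_mderiv[OF open_domain] X_in_H mean_in_H]
  by (simp add: mean_mderiv Y_def)

abbreviation "C0 \<alpha> \<beta> \<equiv> Cov P \<Theta> 0 (\<lambda>\<omega>. mderiv \<Theta> \<alpha> (X \<omega>)) (\<lambda>\<omega>. mderiv \<Theta> \<beta> (X \<omega>))"

lemma has_cov_mderiv:
  assumes \<alpha>: "mdeg \<alpha> \<le> k" and \<beta>: "mdeg \<beta> \<le> k"
  shows "has_bochner_integral_on P (nuclear \<Theta> 0) (nuclear_norm \<Theta> 0)
      (\<lambda>\<omega>. tensor \<Theta> 0 (mderiv \<Theta> \<alpha> (Y \<omega>)) (mderiv \<Theta> \<beta> (Y \<omega>))) (C0 \<alpha> \<beta>)"
    and "cov_exists P \<Theta> 0 (\<lambda>\<omega>. mderiv \<Theta> \<alpha> (X \<omega>)) (\<lambda>\<omega>. mderiv \<Theta> \<beta> (X \<omega>))"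
proof -
  have eq: "cov_integrand P \<Theta> 0 (\<lambda>\<omega>. mderiv \<Theta> \<alpha> (X \<omega>)) (\<lambda>\<omega>. mderiv \<Theta> \<beta> (X \<omega>)) \<omega>
      = tensor \<Theta> 0 (mderiv \<Theta> \<alpha> (Y \<omega>)) (mderiv \<Theta> \<beta> (Y \<omega>))" if "\<omega> \<in> space P" for \<omega>
    unfolding cov_integrand_def using Y_mderiv[OF that] \<alpha> \<beta> by simp
  have int: "bochner_integrable_on P (nuclear \<Theta> 0) (nuclear_norm \<Theta> 0)
      (\<lambda>\<omega>. tensor \<Theta> 0 (mderiv \<Theta> \<alpha> (Y \<omega>)) (mderiv \<Theta> \<beta> (Y \<omega>)))"
    by (rule L.bochner_integrable_tensor[OF normed_carrier_axioms separable_H finite_measure_axioms Y_measurable Y_square])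
       (use linear_on_mderiv[OF open_domain] mderiv_in_L mderiv_L_norm_le \<alpha> \<beta> in auto)
  \<comment> \<open>The integrands are compared on \<open>space P\<close>, where \<open>X\<close>
    takes values in the Sobolev space; congruence carries this over to the integrals.\<close>
  have C0: "C0 \<alpha> \<beta> = bochner_integral_on P (nuclear \<Theta> 0) (nuclear_norm \<Theta> 0)
      (\<lambda>\<omega>. tensor \<Theta> 0 (mderiv \<Theta> \<alpha> (Y \<omega>)) (mderiv \<Theta> \<beta> (Y \<omega>)))"
    unfolding Cov_def by (rule bochner_integral_on_cong(1)) (rule eq)
  have int': "bochner_integrable_on P (nuclear \<Theta> 0) (nuclear_norm \<Theta> 0)
      (cov_integrand P \<Theta> 0 (\<lambda>\<omega>. mderiv \<Theta> \<alpha> (X \<omega>)) (\<lambda>\<omega>. mderiv \<Theta> \<beta> (X \<omega>)))"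
    using int by (subst bochner_integral_on_cong(2)) (rule eq)
  show "has_bochner_integral_on P (nuclear \<Theta> 0) (nuclear_norm \<Theta> 0)
      (\<lambda>\<omega>. tensor \<Theta> 0 (mderiv \<Theta> \<alpha> (Y \<omega>)) (mderiv \<Theta> \<beta> (Y \<omega>))) (C0 \<alpha> \<beta>)"
    unfolding C0
    by (rule L.nuc.has_bochner_integral_on_integral[OF finite_measure_axioms int])
  show "cov_exists P \<Theta> 0 (\<lambda>\<omega>. mderiv \<Theta> \<alpha> (X \<omega>)) (\<lambda>\<omega>. mderiv \<Theta> \<beta> (X \<omega>))"
    unfolding cov_exists_def
    using int' has_mean_mderiv \<alpha> \<beta> by (auto simp: bochner_integrable_on_def)
qed

lemma cov_mderiv_nuclear: "mdeg \<alpha> \<le> k \<Longrightarrow> mdeg \<beta> \<le> k \<Longrightarrow> C0 \<alpha> \<beta> \<in> nuclear \<Theta> 0"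
  by (rule has_bochner_integral_onD(1)[OF has_cov_mderiv(1)])

text \<open>The pairing of \<open>f\<close> with the derivative of order \<open>\<beta>\<close>
  becomes \<open>ip u (Y \<omega>)\<close>, and that of \<open>g\<close> with the derivative of
  order \<open>\<alpha>\<close> becomes \<open>ip (Y \<omega>) v\<close>. So one and the same scalar
  integral computes both sides.\<close>

lemma cov_mderiv_eval:
  assumes \<alpha>: "mdeg \<alpha> \<le> k" and \<beta>: "mdeg \<beta> \<le> k" and f: "f \<in> L2 \<Theta>" and g: "g \<in> L2 \<Theta>"
    and u: "u \<in> H" "\<And>x. x \<in> H \<Longrightarrow> L2_inner \<Theta> (mderiv \<Theta> \<beta> x) f = ip x u"
    and v: "v \<in> H" "\<And>x. x \<in> H \<Longrightarrow> L2_inner \<Theta> (mderiv \<Theta> \<alpha> x) g = ip x v"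
  shows "L2_inner \<Theta> (C0 \<alpha> \<beta> f) g = ip (C u) v"
proof -
  note D = mderiv_Sobolev(1)[OF open_domain]
  have fg: "f \<in> L.H" "g \<in> L.H" using f g by (auto simp: Sobolev_0)
  have "has_bochner_integral P (\<lambda>\<omega>. L.ip f (mderiv \<Theta> \<beta> (Y \<omega>)) * L.ip (mderiv \<Theta> \<alpha> (Y \<omega>)) g) (L.ip (C0 \<alpha> \<beta> f) g)"
    by (rule L.bochner_tensor_eval[OF finite_measure_axioms has_cov_mderiv(1)[OF \<alpha> \<beta>] _ _ fg])
       (use mderiv_in_L Y_in_H \<alpha> \<beta> in auto)
  moreover have "L.ip f (mderiv \<Theta> \<beta> (Y \<omega>)) * L.ip (mderiv \<Theta> \<alpha> (Y \<omega>)) g = ip u (Y \<omega>) * ip (Y \<omega>) v"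
    if w: "\<omega> \<in> space P" for \<omega>
    using L.ip_commute[OF fg(1) mderiv_in_L[OF Y_in_H[OF w] \<beta>]] ip_commute[OF u(1) Y_in_H[OF w]]
      u(2)[OF Y_in_H[OF w]] v(2)[OF Y_in_H[OF w]] D[OF Y_in_H[OF w] \<alpha>] D[OF Y_in_H[OF w] \<beta>] f g
    by (simp add: Sobolev_inner_0[OF open_domain])
  ultimately have "has_bochner_integral P (\<lambda>\<omega>. ip u (Y \<omega>) * ip (Y \<omega>) v) (L.ip (C0 \<alpha> \<beta> f) g)"
    by (simp cong: has_bochner_integral_cong)
  then have "L.ip (C0 \<alpha> \<beta> f) g = ip (C u) v" using cov_eval[OF u(1) v(1)] by (rule has_bochner_integral_eq)
  moreover have "C0 \<alpha> \<beta> f \<in> L2 \<Theta>"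
    using L.nuclear_carrier(1)[OF cov_mderiv_nuclear[OF \<alpha> \<beta>] fg(1)] by (simp add: Sobolev_0)
  ultimately show ?thesis using g by (simp add: Sobolev_inner_0[OF open_domain])
qed

text \<open>\<open>cov_norm\<close> applies to \<open>C\<close> and to every
  \<open>C0 \<alpha> \<alpha>\<close>, and \<open>(N (Y \<omega>))\<^sup>2\<close> is the sum of the
  squared \<open>L2\<close> norms of the derivatives of \<open>Y \<omega>\<close>.\<close>

lemma cov_norm_sum: "nuclear_norm \<Theta> k C = (\<Sum>\<alpha> | mdeg \<alpha> \<le> k. nuclear_norm \<Theta> 0 (C0 \<alpha> \<alpha>))"
proof -
  have C0: "nuclear_norm \<Theta> 0 (C0 \<alpha> \<alpha>) = (\<integral>\<omega>. (L2_norm \<Theta> (mderiv \<Theta> \<alpha> (Y \<omega>)))\<^sup>2 \<partial>P)"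
    and int: "integrable P (\<lambda>\<omega>. (L2_norm \<Theta> (mderiv \<Theta> \<alpha> (Y \<omega>)))\<^sup>2)" if \<alpha>: "mdeg \<alpha> \<le> k" for \<alpha>
  proof -
    interpret R: random_sobolev \<Theta> 0 P "\<lambda>\<omega>. mderiv \<Theta> \<alpha> (X \<omega>)" by (rule random_sobolev_mderiv[OF \<alpha>])
    have eq: "(L.N (R.Y \<omega>))\<^sup>2 = (L2_norm \<Theta> (mderiv \<Theta> \<alpha> (Y \<omega>)))\<^sup>2" if w: "\<omega> \<in> space P" for \<omega>
      using Y_mderiv[OF w \<alpha>] mderiv_Sobolev(1)[OF open_domain Y_in_H[OF w] \<alpha>]
      by (simp add: R.Y_def Sobolev_norm_0[OF open_domain])
    show "nuclear_norm \<Theta> 0 (C0 \<alpha> \<alpha>) = (\<integral>\<omega>. (L2_norm \<Theta> (mderiv \<Theta> \<alpha> (Y \<omega>)))\<^sup>2 \<partial>P)"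
      unfolding R.cov_norm by (intro Bochner_Integration.integral_cong eq) auto
    show "integrable P (\<lambda>\<omega>. (L2_norm \<Theta> (mderiv \<Theta> \<alpha> (Y \<omega>)))\<^sup>2)"
      using R.Y_square by (subst (asm) Bochner_Integration.integrable_cong[OF refl eq]) auto
  qed
  have "nuclear_norm \<Theta> k C = (\<integral>\<omega>. (\<Sum>\<alpha> | mdeg \<alpha> \<le> k. (L2_norm \<Theta> (mderiv \<Theta> \<alpha> (Y \<omega>)))\<^sup>2) \<partial>P)"
    unfolding cov_norm using Y_in_H
    by (intro Bochner_Integration.integral_cong refl) (simp add: N_power2 Sobolev_inner_self[OF open_domain])
  also have "\<dots> = (\<Sum>\<alpha> | mdeg \<alpha> \<le> k. \<integral>\<omega>. (L2_norm \<Theta> (mderiv \<Theta> \<alpha> (Y \<omega>)))\<^sup>2 \<partial>P)"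
    by (rule Bochner_Integration.integral_sum) (use int in auto)
  also have "\<dots> = (\<Sum>\<alpha> | mdeg \<alpha> \<le> k. nuclear_norm \<Theta> 0 (C0 \<alpha> \<alpha>))"
    by (intro sum.cong) (use C0 in auto)
  finally show ?thesis .
qed

end

section \<open>Product kernels\<close>

lemma lborel_Fubini:
  fixes F :: "'a::euclidean_space \<times> 'b::euclidean_space \<Rightarrow> real"
  assumes F: "integrable lborel F"
  shows "AE y in lborel. integrable lborel (\<lambda>x. F (x, y))"
    and "integrable lborel (\<lambda>y. \<integral>x. F (x, y) \<partial>lborel)"
    and "(\<integral>y. (\<integral>x. F (x, y) \<partial>lborel) \<partial>lborel) = (\<integral>p. F p \<partial>lborel)"
    and "(\<integral>x. (\<integral>y. F (x, y) \<partial>lborel) \<partial>lborel) = (\<integral>p. F p \<partial>lborel)"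
proof -
  have *: "integrable (lborel \<Otimes>\<^sub>M lborel) (case_prod (\<lambda>x y. F (x, y)))"
    using F by (simp add: lborel_prod)
  show "AE y in lborel. integrable lborel (\<lambda>x. F (x, y))"
    by (rule lborel_pair.AE_integrable_snd[OF *])
  show "integrable lborel (\<lambda>y. \<integral>x. F (x, y) \<partial>lborel)"
    by (rule lborel_pair.integrable_snd[OF *])
  show "(\<integral>y. (\<integral>x. F (x, y) \<partial>lborel) \<partial>lborel) = (\<integral>p. F p \<partial>lborel)"
    using lborel_pair.integral_snd[OF *] by (simp add: lborel_prod)
  show "(\<integral>x. (\<integral>y. F (x, y) \<partial>lborel) \<partial>lborel) = (\<integral>p. F p \<partial>lborel)"
    using lborel_pair.integral_fst[OF *] by (simp add: lborel_prod)
qed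

lemma borel_measurable_fst_snd [measurable]:
  "fst \<in> borel_measurable (borel :: ('a::second_countable_topology \<times> 'b::second_countable_topology) measure)"
  "snd \<in> borel_measurable (borel :: ('a::second_countable_topology \<times> 'b::second_countable_topology) measure)"
  by (intro borel_measurable_continuous_onI continuous_on_fst continuous_on_snd continuous_on_id)+

lemma rep_aefun_borel [measurable]: "rep_aefun f \<in> borel_measurable borel"
  using rep_aefun_measurable[of f] by simp

lemma integrable_product:
  fixes f :: "'a::euclidean_space \<Rightarrow> real" and g :: "'b::euclidean_space \<Rightarrow> real"
  assumes f: "integrable lborel f" and g: "integrable lborel g"
  shows "integrable lborel (\<lambda>p. f (fst p) * g (snd p))"
    and "(\<integral>p. f (fst p) * g (snd p) \<partial>lborel) = (\<integral>x. f x \<partial>lborel) * (\<integral>y. g y \<partial>lborel)"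
proof -
  have [measurable]: "f \<in> borel_measurable borel" "g \<in> borel_measurable borel"
    using f g by (auto dest: borel_measurable_integrable)
  have "integrable (lborel \<Otimes>\<^sub>M lborel) (\<lambda>p. f (fst p) * g (snd p))"
  proof (rule lborel_pair.Fubini_integrable)
    show "(\<lambda>p. f (fst p) * g (snd p)) \<in> borel_measurable (lborel \<Otimes>\<^sub>M lborel)"
      unfolding lborel_prod by simp
  qed (use f g in \<open>auto simp: abs_mult\<close>)
  then show int: "integrable lborel (\<lambda>p. f (fst p) * g (snd p))" by (simp add: lborel_prod)
  show "(\<integral>p. f (fst p) * g (snd p) \<partial>lborel) = (\<integral>x. f x \<partial>lborel) * (\<integral>y. g y \<partial>lborel)"
    using lborel_Fubini(4)[OF int] by simp
qed

text \<open>The cylinder over a null set is a null set of the product space.\<close>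

lemma AE_lborel_fst:
  assumes "AE x in lborel. Q (x::'a::euclidean_space)"
  shows "AE p in (lborel :: ('a \<times> 'b::euclidean_space) measure). Q (fst p)"
proof -
  obtain Z where Z: "{x \<in> space lborel. \<not> Q x} \<subseteq> Z" "Z \<in> null_sets lborel"
    using assms by (auto simp: eventually_ae_filter)
  have "emeasure (lborel \<Otimes>\<^sub>M lborel) (Z \<times> (UNIV :: 'b set)) = 0"
    using Z(2) by (subst lborel.emeasure_pair_measure_Times) (auto simp: null_sets_def)
  moreover have "Z \<times> (UNIV :: 'b set) \<in> sets (lborel \<Otimes>\<^sub>M lborel)"
    using Z(2) by (intro pair_measureI) auto
  ultimately have "Z \<times> (UNIV :: 'b set) \<in> null_sets lborel" unfolding lborel_prod by (rule null_setsI)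
  then show ?thesis by (rule AE_I') (use Z(1) in auto)
qed

lemma AE_lborel_snd:
  assumes "AE x in lborel. Q (x::'b::euclidean_space)"
  shows "AE p in (lborel :: ('a::euclidean_space \<times> 'b) measure). Q (snd p)"
proof -
  obtain Z where Z: "{x \<in> space lborel. \<not> Q x} \<subseteq> Z" "Z \<in> null_sets lborel"
    using assms by (auto simp: eventually_ae_filter)
  have "emeasure (lborel \<Otimes>\<^sub>M lborel) ((UNIV :: 'a set) \<times> Z) = 0"
    using Z(2) by (subst lborel.emeasure_pair_measure_Times) (auto simp: null_sets_def)
  moreover have "(UNIV :: 'a set) \<times> Z \<in> sets (lborel \<Otimes>\<^sub>M lborel)"
    using Z(2) by (intro pair_measureI) auto
  ultimately have "(UNIV :: 'a set) \<times> Z \<in> null_sets lborel" unfolding lborel_prod by (rule null_setsI)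
  then show ?thesis by (rule AE_I') (use Z(1) in auto)
qed

text \<open>The elementary kernel \<open>y(s) z(t)\<close>. The integral operator on
  \<open>L2\<close> with this kernel is the rank-one operator that sends \<open>f\<close> to the
  multiple of \<open>z\<close> by the inner product of \<open>f\<close> and
  \<open>y\<close>.\<close>

definition prod_aefun :: "'a::euclidean_space aefun \<Rightarrow> 'b::euclidean_space aefun \<Rightarrow> ('a \<times> 'b) aefun" where
  "prod_aefun y z = abs_aefun (\<lambda>p. rep_aefun y (fst p) * rep_aefun z (snd p))"

lemma rep_prod_aefun:
  "AE p in lborel. rep_aefun (prod_aefun y z) p = rep_aefun y (fst p) * rep_aefun z (snd p)"
  unfolding prod_aefun_def by (rule rep_abs_aefun) simp

lemma prod_aefun_abs:
  assumes "\<phi> \<in> borel_measurable borel" "\<psi> \<in> borel_measurable borel"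
  shows "prod_aefun (abs_aefun \<phi>) (abs_aefun \<psi>) = abs_aefun (\<lambda>p. \<phi> (fst p) * \<psi> (snd p))"
proof -
  have "abs_aefun (\<lambda>p. \<phi> (fst p) * \<psi> (snd p)) = prod_aefun (abs_aefun \<phi>) (abs_aefun \<psi>)"
  proof (rule abs_aefun_eqI)
    show "(\<lambda>p. \<phi> (fst p) * \<psi> (snd p)) \<in> borel_measurable lborel" using assms by simp
    have "\<phi> \<in> borel_measurable lborel" "\<psi> \<in> borel_measurable lborel" using assms by auto
    note AE_lborel_fst[OF rep_abs_aefun[OF this(1)]] AE_lborel_snd[OF rep_abs_aefun[OF this(2)]]
    with rep_prod_aefun[of "abs_aefun \<phi>" "abs_aefun \<psi>"]
    show "AE p in lborel. rep_aefun (prod_aefun (abs_aefun \<phi>) (abs_aefun \<psi>)) p = \<phi> (fst p) * \<psi> (snd p)"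
      by eventually_elim simp
  qed
  then show ?thesis by simp
qed

lemma prod_aefun_add: "prod_aefun (x + y) z = prod_aefun x z + prod_aefun y z"
proof (rule aefun_eqI)
  show "AE p in lborel. rep_aefun (prod_aefun (x + y) z) p = rep_aefun (prod_aefun x z + prod_aefun y z) p"
    using rep_prod_aefun[of "x + y" z] rep_prod_aefun[of x z] rep_prod_aefun[of y z]
      rep_aefun_add[of "prod_aefun x z" "prod_aefun y z"] AE_lborel_fst[OF rep_aefun_add[of x y]]
    by eventually_elim (simp add: distrib_right)
qed

lemma prod_aefun_scale: "prod_aefun (c *\<^sub>R x) z = c *\<^sub>R prod_aefun x z"
proof (rule aefun_eqI)
  show "AE p in lborel. rep_aefun (prod_aefun (c *\<^sub>R x) z) p = rep_aefun (c *\<^sub>R prod_aefun x z) p"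
    using rep_prod_aefun[of "c *\<^sub>R x" z] rep_prod_aefun[of x z]
      rep_aefun_scale[of c "prod_aefun x z"] AE_lborel_fst[OF rep_aefun_scale[of c x]]
    by eventually_elim simp
qed

lemma prod_aefun_L2:
  assumes y: "y \<in> L2 U" and z: "z \<in> L2 W"
  shows "prod_aefun y z \<in> L2 (U \<times> W)"
  unfolding prod_aefun_def
proof (rule L2_I)
  show "integrable lborel (\<lambda>p. (rep_aefun y (fst p) * rep_aefun z (snd p))\<^sup>2)"
    using integrable_product(1)[OF L2_D(1)[OF y] L2_D(1)[OF z]] by (simp add: power_mult_distrib)
  show "AE p in lborel. p \<notin> U \<times> W \<longrightarrow> rep_aefun y (fst p) * rep_aefun z (snd p) = 0"
    using AE_lborel_fst[OF L2_D(2)[OF y]] AE_lborel_snd[OF L2_D(2)[OF z]]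
    by eventually_elim (auto simp: mem_Times_iff)
qed simp

lemma L2_inner_prod_aefun:
  assumes U: "U \<in> sets borel" "W \<in> sets borel"
    and y: "y \<in> L2 U" "y' \<in> L2 U" and z: "z \<in> L2 W" "z' \<in> L2 W"
  shows "L2_inner (U \<times> W) (prod_aefun y z) (prod_aefun y' z') = L2_inner U y y' * L2_inner W z z'"
proof -
  have UW: "U \<times> W \<in> sets borel" using U by (rule borel_Times)
  have "L2_inner (U \<times> W) (prod_aefun y z) (prod_aefun y' z')
      = (\<integral>p. (rep_aefun y (fst p) * rep_aefun y' (fst p)) * (rep_aefun z (snd p) * rep_aefun z' (snd p)) \<partial>lborel)"
    unfolding L2_inner_eq[OF prod_aefun_L2[OF y(1) z(1)] UW]
    by (rule integral_cong_AE; simp?)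
       (use rep_prod_aefun[of y z] rep_prod_aefun[of y' z'] in eventually_elim, simp)
  also have "\<dots> = L2_inner U y y' * L2_inner W z z'"
    unfolding L2_inner_eq[OF y(1) U(1)] L2_inner_eq[OF z(1) U(2)]
    by (rule integrable_product(2)[OF L2_mult_integrable[OF y] L2_mult_integrable[OF z]])
  finally show ?thesis .
qed

lemma L2_norm_prod_aefun:
  assumes "U \<in> sets borel" "W \<in> sets borel" "y \<in> L2 U" "z \<in> L2 W"
  shows "L2_norm (U \<times> W) (prod_aefun y z) = L2_norm U y * L2_norm W z"
  unfolding L2_norm_def using assms by (simp add: L2_inner_prod_aefun real_sqrt_mult)

section \<open>Integral operators with square-integrable kernels\<close>

lemma Cauchy_Schwarz_integral:
  fixes f g :: "'a::euclidean_space \<Rightarrow> real"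
  assumes f: "f \<in> borel_measurable lborel" "integrable lborel (\<lambda>x. (f x)\<^sup>2)"
    and g: "g \<in> borel_measurable lborel" "integrable lborel (\<lambda>x. (g x)\<^sup>2)"
  shows "(\<integral>x. f x * g x \<partial>lborel)\<^sup>2 \<le> (\<integral>x. (f x)\<^sup>2 \<partial>lborel) * (\<integral>x. (g x)\<^sup>2 \<partial>lborel)"
proof -
  \<comment> \<open>The functions are turned into classes on the whole space to use the abstract
    inequality. The lemma is meant for single slices of a kernel, which are given as
    functions.\<close>
  interpret inner_carrier "L2 (UNIV :: 'a set)" "L2_inner UNIV" "L2_norm UNIV" by (rule inner_carrier_L2) simp
  have L: "abs_aefun f \<in> L2 UNIV" "abs_aefun g \<in> L2 UNIV" using assms by (auto intro: L2_I)
  have ip: "L2_inner UNIV (abs_aefun h) (abs_aefun h') = (\<integral>x. h x * h' x \<partial>lborel)"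
    if h: "h \<in> borel_measurable lborel" "h' \<in> borel_measurable lborel" and hL: "abs_aefun h \<in> L2 (UNIV :: 'a set)"
    for h h' :: "'a \<Rightarrow> real"
    unfolding L2_inner_test[OF hL _ h(2), of, simplified]
    by (rule integral_cong_AE) (use h rep_abs_aefun[OF h(1)] in auto)
  have "\<bar>L2_inner UNIV (abs_aefun f) (abs_aefun g)\<bar>\<^sup>2 \<le> (L2_norm UNIV (abs_aefun f) * L2_norm UNIV (abs_aefun g))\<^sup>2"
    by (intro power_mono ip_Cauchy_Schwarz L) simp
  then show ?thesis
    using ip[OF f(1) g(1) L(1)] ip[OF f(1) f(1) L(1)] ip[OF g(1) g(1) L(2)] L
    by (simp add: power_mult_distrib N_power2 power2_eq_square[symmetric])
qed

lemma rep_aefun_slice [measurable]: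
  "(\<lambda>s. rep_aefun (K :: ('a::euclidean_space \<times> 'b::euclidean_space) aefun) (s, t)) \<in> borel_measurable borel"
  by (rule measurable_compose[OF _ rep_aefun_borel])
     (intro borel_measurable_continuous_onI continuous_intros)

text \<open>On almost every slice Cauchy-Schwarz bounds the square of \<open>A t\<close> by the
  integral of the squared slice times that of the square of \<open>F\<close>, and by Fubini this
  bound is integrable in \<open>t\<close>. The pairing with \<open>G\<close> becomes a pairing of
  the kernel with \<open>prod_aefun F G\<close>, the form in which kernel operators are used
  afterwards.\<close>

lemma kernel_integral:
  fixes K :: "('a::euclidean_space \<times> 'b::euclidean_space) aefun"
  assumes UW: "U \<in> sets borel" "W \<in> sets borel" and K: "K \<in> L2 (U \<times> W)" and F: "F \<in> L2 U"
  defines "A \<equiv> \<lambda>t. indicator W t * (\<integral>s. rep_aefun K (s, t) * rep_aefun F s \<partial>lborel)"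
  shows "A \<in> borel_measurable lborel" "abs_aefun A \<in> L2 W"
    and "G \<in> L2 W \<Longrightarrow> L2_inner W (abs_aefun A) G = L2_inner (U \<times> W) K (prod_aefun F G)"
    and "AE t in lborel. integrable lborel (\<lambda>s. rep_aefun K (s, t) * rep_aefun F s)"
proof -
  let ?I = "\<lambda>t. \<integral>s. rep_aefun K (s, t) * rep_aefun F s \<partial>lborel"
  have "(\<lambda>p. rep_aefun K (snd p, fst p) * rep_aefun F (snd p)) \<in> borel_measurable (borel :: ('b \<times> 'a) measure)"
    by (intro borel_measurable_times measurable_compose[OF _ rep_aefun_borel]
        borel_measurable_continuous_onI continuous_intros)
  then have "case_prod (\<lambda>t s. rep_aefun K (s, t) * rep_aefun F s) \<in> borel_measurable (lborel \<Otimes>\<^sub>M lborel)"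
    by (simp add: lborel_prod case_prod_beta')
  then have Im: "?I \<in> borel_measurable lborel" by (rule lborel.borel_measurable_lebesgue_integral)
  have [measurable]: "W \<in> sets borel" "?I \<in> borel_measurable borel" using UW Im by auto
  show Am: "A \<in> borel_measurable lborel" unfolding A_def by measurable
  have K2: "AE t in lborel. integrable lborel (\<lambda>s. (rep_aefun K (s, t))\<^sup>2)"
    by (rule lborel_Fubini(1)[OF L2_D(1)[OF K]])
  have int: "integrable lborel (\<lambda>t. \<integral>s. (rep_aefun K (s, t))\<^sup>2 \<partial>lborel)"
    by (rule lborel_Fubini(2)[OF L2_D(1)[OF K]])
  show "AE t in lborel. integrable lborel (\<lambda>s. rep_aefun K (s, t) * rep_aefun F s)"
    using K2 by eventually_elim (intro integrable_mult_of_squares L2_D(1)[OF F]; simp)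
  show AL: "abs_aefun A \<in> L2 W"
  proof (rule L2_I[OF Am])
    show "integrable lborel (\<lambda>t. (A t)\<^sup>2)"
    proof (rule Bochner_Integration.integrable_bound)
      show "integrable lborel (\<lambda>t. (\<integral>s. (rep_aefun K (s, t))\<^sup>2 \<partial>lborel) * (\<integral>s. (rep_aefun F s)\<^sup>2 \<partial>lborel))"
        by (rule integrable_mult_left) (rule int)
      show "(\<lambda>t. (A t)\<^sup>2) \<in> borel_measurable lborel" using Am by simp
      show "AE t in lborel. norm ((A t)\<^sup>2) \<le> norm ((\<integral>s. (rep_aefun K (s, t))\<^sup>2 \<partial>lborel) * (\<integral>s. (rep_aefun F s)\<^sup>2 \<partial>lborel))"
        using K2
      proof eventually_elim
        case (elim t)
        have "(?I t)\<^sup>2 \<le> (\<integral>s. (rep_aefun K (s, t))\<^sup>2 \<partial>lborel) * (\<integral>s. (rep_aefun F s)\<^sup>2 \<partial>lborel)"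
          by (rule Cauchy_Schwarz_integral) (use elim L2_D(1)[OF F] in simp_all)
        moreover have "(A t)\<^sup>2 \<le> (?I t)\<^sup>2" by (auto simp: A_def indicator_def)
        ultimately show ?case by simp
      qed
    qed
    show "AE t in lborel. t \<notin> W \<longrightarrow> A t = 0" by (simp add: A_def)
  qed
  assume G: "G \<in> L2 W"
  let ?P = "\<lambda>p. rep_aefun K p * (rep_aefun F (fst p) * rep_aefun G (snd p))"
  have UW': "U \<times> W \<in> sets borel" using UW by (rule borel_Times)
  have KP: "AE p in lborel. rep_aefun K p * rep_aefun (prod_aefun F G) p = ?P p"
    using rep_prod_aefun[of F G] by eventually_elim simp
  have Pint: "integrable lborel ?P"
    by (rule integrable_cong_AE_imp[OF L2_mult_integrable[OF K prod_aefun_L2[OF F G]] _ KP]) simp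
  have "L2_inner W (abs_aefun A) G = (\<integral>t. A t * rep_aefun G t \<partial>lborel)"
    unfolding L2_inner_eq[OF AL UW(2)]
    by (rule integral_cong_AE) (use Am rep_abs_aefun[OF Am] in auto)
  also have "\<dots> = (\<integral>t. ?I t * rep_aefun G t \<partial>lborel)"
    by (rule integral_cong_AE; simp?) (use Am L2_D(2)[OF G] in \<open>auto simp: A_def indicator_def\<close>)
  also have "\<dots> = (\<integral>t. (\<integral>s. ?P (s, t) \<partial>lborel) \<partial>lborel)"
    by (simp add: mult.assoc[symmetric])
  also have "\<dots> = (\<integral>p. ?P p \<partial>lborel)" by (rule lborel_Fubini(3)[OF Pint])
  also have "\<dots> = L2_inner (U \<times> W) K (prod_aefun F G)"
    unfolding L2_inner_eq[OF K UW']
  proof (rule integral_cong_AE)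
    show "AE p in lborel. ?P p = rep_aefun K p * rep_aefun (prod_aefun F G) p"
      using KP by eventually_elim (rule sym)
  qed simp_all
  finally show "L2_inner W (abs_aefun A) G = L2_inner (U \<times> W) K (prod_aefun F G)" .
qed

text \<open>This is the shape of \<open>T_op\<close>, with the sum inside the integral. The integral
  is split at those \<open>t\<close> at which all terms are integrable in \<open>s\<close>, that is,
  at almost every \<open>t\<close>.\<close>

lemma kernel_integral_sum:
  fixes K :: "'i \<Rightarrow> ('a::euclidean_space \<times> 'b::euclidean_space) aefun"
  assumes I: "finite I" and UW: "U \<in> sets borel" "W \<in> sets borel"
    and K: "\<And>i. i \<in> I \<Longrightarrow> K i \<in> L2 (U \<times> W)" and F: "\<And>i. i \<in> I \<Longrightarrow> F i \<in> L2 U"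
  defines "A \<equiv> \<lambda>t. indicator W t * (LINT s:U|lborel. (\<Sum>i\<in>I. rep_aefun (K i) (s, t) * rep_aefun (F i) s))"
  shows "abs_aefun A \<in> L2 W"
    and "G \<in> L2 W \<Longrightarrow> L2_inner W (abs_aefun A) G = (\<Sum>i\<in>I. L2_inner (U \<times> W) (K i) (prod_aefun (F i) G))"
proof -
  interpret W: inner_carrier "L2 W" "L2_inner W" "L2_norm W" by (rule inner_carrier_L2) fact
  define B where "B i = (\<lambda>t. indicator W t * (\<integral>s. rep_aefun (K i) (s, t) * rep_aefun (F i) s \<partial>lborel))" for i
  have k: "B i \<in> borel_measurable lborel" "abs_aefun (B i) \<in> L2 W"
    "G \<in> L2 W \<Longrightarrow> L2_inner W (abs_aefun (B i)) G = L2_inner (U \<times> W) (K i) (prod_aefun (F i) G)"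
    "AE t in lborel. integrable lborel (\<lambda>s. rep_aefun (K i) (s, t) * rep_aefun (F i) s)" if i: "i \<in> I" for i G
    unfolding B_def using kernel_integral[OF UW K[OF i] F[OF i]] by blast+
  have [measurable]: "U \<in> sets borel" "W \<in> sets borel" by fact+
  have "(\<lambda>p. indicator U (snd p) *\<^sub>R (\<Sum>i\<in>I. rep_aefun (K i) (snd p, fst p) * rep_aefun (F i) (snd p)))
      \<in> borel_measurable (borel :: ('b \<times> 'a) measure)"
    by (intro borel_measurable_scaleR borel_measurable_sum borel_measurable_times
        measurable_compose[OF _ rep_aefun_borel] measurable_compose[OF _ borel_measurable_indicator]
        borel_measurable_fst_snd UW)
       (auto intro!: borel_measurable_continuous_onI continuous_intros)
  then have "case_prod (\<lambda>t s. indicator U s *\<^sub>R (\<Sum>i\<in>I. rep_aefun (K i) (s, t) * rep_aefun (F i) s))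
      \<in> borel_measurable (lborel \<Otimes>\<^sub>M lborel)"
    by (simp add: lborel_prod case_prod_beta')
  then have "(\<lambda>t. LINT s:U|lborel. (\<Sum>i\<in>I. rep_aefun (K i) (s, t) * rep_aefun (F i) s)) \<in> borel_measurable lborel"
    unfolding set_lebesgue_integral_def by (rule lborel.borel_measurable_lebesgue_integral)
  then have Am: "A \<in> borel_measurable lborel" unfolding A_def by simp
  have "AE s in lborel. \<forall>i\<in>I. s \<notin> U \<longrightarrow> rep_aefun (F i) s = 0"
    using L2_D(2)[OF F] by (intro AE_finite_allI I)
  then have set_int: "(LINT s:U|lborel. (\<Sum>i\<in>I. rep_aefun (K i) (s, t) * rep_aefun (F i) s))
      = (\<integral>s. (\<Sum>i\<in>I. rep_aefun (K i) (s, t) * rep_aefun (F i) s) \<partial>lborel)" for t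
    unfolding set_lebesgue_integral_def
    by (intro integral_cong_AE) (auto simp: indicator_def elim!: eventually_mono intro!: sum.cong)
  have "AE t in lborel. \<forall>i\<in>I. integrable lborel (\<lambda>s. rep_aefun (K i) (s, t) * rep_aefun (F i) s)"
    using k(4) by (intro AE_finite_allI I)
  then have AE_A: "AE t in lborel. A t = (\<Sum>i\<in>I. B i t)"
    by eventually_elim (simp add: A_def B_def set_int sum_distrib_left)
  have "AE t in lborel. \<forall>i\<in>I. rep_aefun (abs_aefun (B i)) t = B i t"
    by (intro AE_finite_allI I rep_abs_aefun k(1))
  then have *: "AE t in lborel. rep_aefun (\<Sum>i\<in>I. abs_aefun (B i)) t = A t"
    using AE_A rep_aefun_sum[of "\<lambda>i. abs_aefun (B i)" I] by eventually_elim simp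
  have A_eq: "abs_aefun A = (\<Sum>i\<in>I. 1 *\<^sub>R abs_aefun (B i))"
    using abs_aefun_eqI[OF Am *] by simp
  show "abs_aefun A \<in> L2 W" unfolding A_eq using k(2) by (intro W.V_sum W.V_scale)
  show "L2_inner W (abs_aefun A) G = (\<Sum>i\<in>I. L2_inner (U \<times> W) (K i) (prod_aefun (F i) G))" if G: "G \<in> L2 W"
    unfolding A_eq using W.ip_sum_scale_left[of I "\<lambda>i. abs_aefun (B i)" G "\<lambda>_. 1"] k(2) k(3)[OF _ G] G by simp
qed

section \<open>Weak derivatives of product kernels\<close>

lemma in_lists_Basis_prod:
  "bs \<in> lists Basis \<Longrightarrow> map (\<lambda>v. (v, 0)) bs \<in> lists (Basis :: ('a::euclidean_space \<times> 'b::euclidean_space) set)"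
  "cs \<in> lists Basis \<Longrightarrow> map (\<lambda>v. (0, v)) cs \<in> lists (Basis :: ('a::euclidean_space \<times> 'b::euclidean_space) set)"
  by (auto simp: in_lists_conv_set Basis_prod_def)

lemma pderivs_slice_fst:
  assumes "smooth \<phi>" "bs \<in> lists Basis"
  shows "pderivs bs (\<lambda>s. \<phi> (s, t)) = (\<lambda>s. pderivs (map (\<lambda>v. (v, 0)) bs) \<phi> (s, t))"
  using assms(2)
proof (induction bs)
  case (Cons b bs)
  let ?\<psi> = "pderivs (map (\<lambda>v. (v, 0)) bs) \<phi>"
  have "bs \<in> lists Basis" using Cons.hyps by blast
  then have "smooth ?\<psi>" by (intro smooth_pderivs assms(1) in_lists_Basis_prod)
  then have D: "(?\<psi> has_derivative frechet_derivative ?\<psi> (at (s, t))) (at (s, t))" for s by (rule smooth_has_derivative)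
  have "((\<lambda>s. (s, t)) has_derivative (\<lambda>h. (h, 0))) (at s)" for s
    by (auto intro!: derivative_eq_intros)
  from has_derivative_compose[OF this D]
  have "frechet_derivative (\<lambda>s. ?\<psi> (s, t)) (at s) = (\<lambda>h. frechet_derivative ?\<psi> (at (s, t)) (h, 0))" for s
    by (rule frechet_derivative_at[symmetric])
  with Cons show ?case by simp
qed simp

lemma pderivs_slice_snd:
  assumes "smooth \<phi>" "bs \<in> lists Basis"
  shows "pderivs bs (\<lambda>t. \<phi> (s, t)) = (\<lambda>t. pderivs (map (\<lambda>v. (0, v)) bs) \<phi> (s, t))"
  using assms(2)
proof (induction bs)
  case (Cons b bs)
  let ?\<psi> = "pderivs (map (\<lambda>v. (0, v)) bs) \<phi>"
  have "bs \<in> lists Basis" using Cons.hyps by blast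
  then have "smooth ?\<psi>" by (intro smooth_pderivs assms(1) in_lists_Basis_prod)
  then have D: "(?\<psi> has_derivative frechet_derivative ?\<psi> (at (s, t))) (at (s, t))" for t by (rule smooth_has_derivative)
  have "((\<lambda>t. (s, t)) has_derivative (\<lambda>h. (0, h))) (at t)" for t
    by (auto intro!: derivative_eq_intros)
  from has_derivative_compose[OF this D]
  have "frechet_derivative (\<lambda>t. ?\<psi> (s, t)) (at t) = (\<lambda>h. frechet_derivative ?\<psi> (at (s, t)) (0, h))" for t
    by (rule frechet_derivative_at[symmetric])
  with Cons show ?case by simp
qed simp

text \<open>Composition with the affine embedding of the slice preserves smoothness, and the
  projection of a slice of a compact set is compact. So a weak derivative in one variable can be
  tested with the slices of a test function on the product.\<close>

lemma test_function_slice: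
  assumes \<phi>: "test_function (U \<times> W) \<phi>"
  shows "test_function U (\<lambda>s. \<phi> (s, t))" "test_function W (\<lambda>t. \<phi> (s, t))"
proof -
  obtain K where K: "compact K" "K \<subseteq> U \<times> W" "\<And>p. p \<notin> K \<Longrightarrow> \<phi> p = 0" and s: "smooth \<phi>"
    using \<phi> unfolding test_function_def by blast
  have diff: "pderivs bs \<phi> differentiable (at p)" if "bs \<in> lists Basis" for bs p
    using smooth_differentiable[OF smooth_pderivs[OF s that]] .
  have "smooth (\<lambda>s. \<phi> (s, t))"
    unfolding smooth_def
  proof
    fix bs :: "'a list" assume bs: "bs \<in> lists Basis"
    have "(pderivs (map (\<lambda>v. (v, 0)) bs) \<phi> \<circ> (\<lambda>s. (s, t))) differentiable (at s)" for s
      by (rule differentiable_chain_at)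
         (use diff[OF in_lists_Basis_prod(1)[OF bs]] in \<open>auto intro!: differentiable_Pair\<close>)
    then show "pderivs bs (\<lambda>s. \<phi> (s, t)) differentiable_on UNIV"
      unfolding pderivs_slice_fst[OF s bs] differentiable_on_def comp_def by simp
  qed
  moreover have "compact (fst ` (K \<inter> UNIV \<times> {t}))"
    by (intro compact_continuous_image continuous_on_fst continuous_on_id compact_Int_closed K closed_Times) auto
  moreover have "fst ` (K \<inter> UNIV \<times> {t}) \<subseteq> U" using K(2) by auto
  moreover have "\<phi> (s, t) = 0" if "s \<notin> fst ` (K \<inter> UNIV \<times> {t})" for s
    using that by (intro K(3)) force
  ultimately show "test_function U (\<lambda>s. \<phi> (s, t))" unfolding test_function_def by blast
  have "smooth (\<lambda>t. \<phi> (s, t))"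
    unfolding smooth_def
  proof
    fix bs :: "'b list" assume bs: "bs \<in> lists Basis"
    have "(pderivs (map (\<lambda>v. (0, v)) bs) \<phi> \<circ> (\<lambda>t. (s, t))) differentiable (at t)" for t
      by (rule differentiable_chain_at)
         (use diff[OF in_lists_Basis_prod(2)[OF bs]] in \<open>auto intro!: differentiable_Pair\<close>)
    then show "pderivs bs (\<lambda>t. \<phi> (s, t)) differentiable_on UNIV"
      unfolding pderivs_slice_snd[OF s bs] differentiable_on_def comp_def by simp
  qed
  moreover have "compact (snd ` (K \<inter> {s} \<times> UNIV))"
    by (intro compact_continuous_image continuous_on_snd continuous_on_id compact_Int_closed K closed_Times) auto
  moreover have "snd ` (K \<inter> {s} \<times> UNIV) \<subseteq> W" using K(2) by auto
  moreover have "\<phi> (s, t) = 0" if "t \<notin> snd ` (K \<inter> {s} \<times> UNIV)" for t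
    using that by (intro K(3)) force
  ultimately show "test_function W (\<lambda>t. \<phi> (s, t))" unfolding test_function_def by blast
qed

text \<open>The two orders of integration: one serves to move derivatives in the first variable at
  fixed \<open>t\<close>, the other to move those in the second variable at fixed
  \<open>s\<close>.\<close>

lemma L2_inner_prod_test:
  assumes U: "open U" "open W" and y: "y \<in> L2 U" and z: "z \<in> L2 W" and \<phi>: "test_function (U \<times> W) \<phi>"
  shows "L2_inner (U \<times> W) (prod_aefun y z) (abs_aefun \<phi>)
      = (\<integral>t. L2_inner U y (abs_aefun (\<lambda>s. \<phi> (s, t))) * rep_aefun z t \<partial>lborel)"
    and "L2_inner (U \<times> W) (prod_aefun y z) (abs_aefun \<phi>)
      = (\<integral>s. L2_inner W z (abs_aefun (\<lambda>t. \<phi> (s, t))) * rep_aefun y s \<partial>lborel)"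
proof -
  have UW: "U \<in> sets borel" "W \<in> sets borel" "U \<times> W \<in> sets borel" using U by (auto intro: borel_Times)
  have [measurable]: "\<phi> \<in> borel_measurable borel" by (rule test_function_measurable[OF \<phi>])
  let ?F = "\<lambda>p. rep_aefun y (fst p) * rep_aefun z (snd p) * \<phi> p"
  have AE: "AE p in lborel. rep_aefun (prod_aefun y z) p * rep_aefun (abs_aefun \<phi>) p = ?F p"
    using rep_prod_aefun[of y z] rep_abs_aefun[of \<phi>] by (auto elim: eventually_elim2)
  have int: "integrable lborel ?F"
    by (rule integrable_cong_AE_imp[OF L2_mult_integrable[OF prod_aefun_L2[OF y z] test_function_L2[OF \<phi>]] _ AE]) simp
  have eq: "L2_inner (U \<times> W) (prod_aefun y z) (abs_aefun \<phi>) = (\<integral>p. ?F p \<partial>lborel)"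
    unfolding L2_inner_eq[OF prod_aefun_L2[OF y z] UW(3)]
    by (rule integral_cong_AE; simp?) (rule AE)
  have 1: "L2_inner U y (abs_aefun (\<lambda>s. \<phi> (s, t))) = (\<integral>s. rep_aefun y s * \<phi> (s, t) \<partial>lborel)" for t
    using test_function_measurable[OF test_function_slice(1)[OF \<phi>]] by (intro L2_inner_test y UW) simp
  have 2: "L2_inner W z (abs_aefun (\<lambda>t. \<phi> (s, t))) = (\<integral>t. rep_aefun z t * \<phi> (s, t) \<partial>lborel)" for s
    using test_function_measurable[OF test_function_slice(2)[OF \<phi>]] by (intro L2_inner_test z UW) simp
  show "L2_inner (U \<times> W) (prod_aefun y z) (abs_aefun \<phi>)
      = (\<integral>t. L2_inner U y (abs_aefun (\<lambda>s. \<phi> (s, t))) * rep_aefun z t \<partial>lborel)"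
    unfolding eq 1 lborel_Fubini(3)[OF int, symmetric] integral_mult_left_zero[symmetric]
    by (intro Bochner_Integration.integral_cong) (auto simp: mult_ac)
  show "L2_inner (U \<times> W) (prod_aefun y z) (abs_aefun \<phi>)
      = (\<integral>s. L2_inner W z (abs_aefun (\<lambda>t. \<phi> (s, t))) * rep_aefun y s \<partial>lborel)"
    unfolding eq 2 lborel_Fubini(4)[OF int, symmetric] integral_mult_left_zero[symmetric]
    by (intro Bochner_Integration.integral_cong) (auto simp: mult_ac)
qed

text \<open>A test function on the product need not be a product, so the derivatives are moved slice
  by slice: those in the first variable at fixed \<open>t\<close>, while \<open>\<psi>\<close> still
  carries the derivatives in the second variable, and then these at fixed \<open>s\<close>.\<close>

lemma weak_deriv_prod_aefun:
  assumes U: "open U" "open W" and bs: "bs \<in> lists Basis" and cs: "cs \<in> lists Basis"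
    and y: "y \<in> L2 U" "y' \<in> L2 U" "weak_deriv U bs y y'" and z: "z \<in> L2 W" "z' \<in> L2 W" "weak_deriv W cs z z'"
  shows "weak_deriv (U \<times> W) (map (\<lambda>v. (v, 0)) bs @ map (\<lambda>v. (0, v)) cs) (prod_aefun y z) (prod_aefun y' z')"
proof -
  have ds: "map (\<lambda>v. (v, 0)) bs @ map (\<lambda>v. (0, v)) cs \<in> lists Basis"
    using in_lists_Basis_prod bs cs by auto
  show ?thesis
    unfolding weak_deriv_iff[OF open_Times[OF U] ds]
  proof (intro allI impI)
    fix \<phi> assume \<phi>: "test_function (U \<times> W) \<phi>"
    define \<psi> where "\<psi> = pderivs (map (\<lambda>v. (0, v)) cs) \<phi>"
    have \<psi>: "test_function (U \<times> W) \<psi>"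
      unfolding \<psi>_def by (intro test_function_pderivs \<phi> in_lists_Basis_prod cs)
    have \<chi>: "test_function (U \<times> W) (pderivs (map (\<lambda>v. (v, 0)) bs) \<psi>)"
      by (intro test_function_pderivs \<psi> in_lists_Basis_prod bs)
    have 1: "L2_inner U y (abs_aefun (\<lambda>s. pderivs (map (\<lambda>v. (v, 0)) bs) \<psi> (s, t)))
        = (- 1) ^ length bs * L2_inner U y' (abs_aefun (\<lambda>s. \<psi> (s, t)))" for t
      using weak_derivD[OF U(1) bs y(3) test_function_slice(1)[OF \<psi>]]
      by (simp add: pderivs_slice_fst[OF test_function_smooth[OF \<psi>] bs])
    have 2: "L2_inner W z (abs_aefun (\<lambda>t. \<psi> (s, t)))
        = (- 1) ^ length cs * L2_inner W z' (abs_aefun (\<lambda>t. \<phi> (s, t)))" for s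
      using weak_derivD[OF U(2) cs z(3) test_function_slice(2)[OF \<phi>]]
      by (simp add: \<psi>_def pderivs_slice_snd[OF test_function_smooth[OF \<phi>] cs])
    have "L2_inner (U \<times> W) (prod_aefun y z) (abs_aefun (pderivs (map (\<lambda>v. (v, 0)) bs) \<psi>))
        = (- 1) ^ length bs * L2_inner (U \<times> W) (prod_aefun y' z) (abs_aefun \<psi>)"
      unfolding L2_inner_prod_test(1)[OF U y(1) z(1) \<chi>] L2_inner_prod_test(1)[OF U y(2) z(1) \<psi>] 1
      by (simp add: mult.assoc)
    also have "L2_inner (U \<times> W) (prod_aefun y' z) (abs_aefun \<psi>)
        = (- 1) ^ length cs * L2_inner (U \<times> W) (prod_aefun y' z') (abs_aefun \<phi>)"
      unfolding L2_inner_prod_test(2)[OF U y(2) z(1) \<psi>] L2_inner_prod_test(2)[OF U y(2) z(2) \<phi>] 2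
      by (simp add: mult.assoc)
    finally show "L2_inner (U \<times> W) (prod_aefun y z)
        (abs_aefun (pderivs (map (\<lambda>v. (v, 0)) bs @ map (\<lambda>v. (0, v)) cs) \<phi>))
      = (- 1) ^ length (map (\<lambda>v. (v, 0)) bs @ map (\<lambda>v. (0, v)) cs) * L2_inner (U \<times> W) (prod_aefun y' z') (abs_aefun \<phi>)"
      by (simp add: pderivs_append \<psi>_def power_add)
  qed
qed

text \<open>The products of smooth functions of the two variables form a class stable under partial
  derivatives: a basis vector of the product space lies in one factor, and the derivative meets that
  factor only.\<close>

lemma smooth_product:
  fixes f :: "'a::euclidean_space \<Rightarrow> real" and g :: "'b::euclidean_space \<Rightarrow> real"
  assumes "smooth f" "smooth g" shows "smooth (\<lambda>p. f (fst p) * g (snd p))"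
proof (rule smooth_coinduct[of "\<lambda>F. \<exists>f g. smooth f \<and> smooth g \<and> F = (\<lambda>p::'a \<times> 'b. f (fst p) * g (snd p))"])
  show "\<exists>f' g'. smooth f' \<and> smooth g' \<and> (\<lambda>p. f (fst p) * g (snd p)) = (\<lambda>p. f' (fst p) * g' (snd p))"
    using assms by blast
  fix F :: "'a \<times> 'b \<Rightarrow> real"
  assume "\<exists>f g. smooth f \<and> smooth g \<and> F = (\<lambda>p. f (fst p) * g (snd p))"
  then obtain f g where f: "smooth f" and g: "smooth g" and F: "F = (\<lambda>p. f (fst p) * g (snd p))" by blast
  let ?Df = "\<lambda>x. frechet_derivative f (at x)" and ?Dg = "\<lambda>y. frechet_derivative g (at y)"
  let ?D = "\<lambda>p h. f (fst p) * ?Dg (snd p) (snd h) + ?Df (fst p) (fst h) * g (snd p)"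
  have "(F has_derivative ?D p) (at p)" for p
  proof -
    have "((\<lambda>p. f (fst p)) has_derivative (\<lambda>h. ?Df (fst p) (fst h))) (at p)"
      by (rule has_derivative_compose[OF _ smooth_has_derivative[OF f]]) (auto intro!: derivative_eq_intros)
    moreover have "((\<lambda>p. g (snd p)) has_derivative (\<lambda>h. ?Dg (snd p) (snd h))) (at p)"
      by (rule has_derivative_compose[OF _ smooth_has_derivative[OF g]]) (auto intro!: derivative_eq_intros)
    ultimately show ?thesis unfolding F by (rule has_derivative_mult)
  qed
  moreover have "\<exists>f' g'. smooth f' \<and> smooth g' \<and> (\<lambda>p. ?D p b) = (\<lambda>p. f' (fst p) * g' (snd p))"
    if b: "b \<in> Basis" for b :: "'a \<times> 'b"
  proof -
    \<comment> \<open>A derivative in direction 0 vanishes, so for a basis vector one of the two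
      summands of the product rule drops out.\<close>
    have f0: "?Df x 0 = 0" for x using smooth_has_derivative[OF f, of x] by (simp add: has_derivative_def linear_simps(3))
    have g0: "?Dg x 0 = 0" for x using smooth_has_derivative[OF g, of x] by (simp add: has_derivative_def linear_simps(3))
    consider u where "u \<in> Basis" "b = (u, 0)" | v where "v \<in> Basis" "b = (0, v)"
      using b by (auto simp: Basis_prod_def)
    then show ?thesis
    proof cases
      case (1 u)
      have "smooth (\<lambda>x. ?Df x u)" using smooth_pderivs[OF f, of "[u]"] 1 by simp
      with g show ?thesis using 1 by (intro exI[of _ "\<lambda>x. ?Df x u"] exI[of _ g]) (simp add: g0)
    next
      case (2 v)
      have "smooth (\<lambda>y. ?Dg y v)" using smooth_pderivs[OF g, of "[v]"] 2 by simp
      with f show ?thesis using 2 by (intro exI[of _ f] exI[of _ "\<lambda>y. ?Dg y v"]) (simp add: f0)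
    qed
  qed
  ultimately show "\<exists>D. (\<forall>p. (F has_derivative D p) (at p)) \<and>
      (\<forall>b\<in>Basis. \<exists>f g. smooth f \<and> smooth g \<and> (\<lambda>p. D p b) = (\<lambda>p. f (fst p) * g (snd p)))"
    by (intro exI[of _ ?D]) blast
qed

lemma test_function_product:
  assumes "test_function U f" "test_function W g" shows "test_function (U \<times> W) (\<lambda>p. f (fst p) * g (snd p))"
proof -
  obtain K where K: "compact K" "K \<subseteq> U" "\<And>x. x \<notin> K \<Longrightarrow> f x = 0"
    using assms(1) unfolding test_function_def by blast
  obtain J where J: "compact J" "J \<subseteq> W" "\<And>x. x \<notin> J \<Longrightarrow> g x = 0"
    using assms(2) unfolding test_function_def by blast
  show ?thesis
    unfolding test_function_def
    using smooth_product[OF assms[THEN test_function_smooth]] K J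
    by (intro conjI exI[of _ "K \<times> J"] compact_Times) (auto simp: mem_Times_iff)
qed

lemma pderivs_product_fst:
  assumes f: "smooth f" and g: "smooth g" and bs: "bs \<in> lists Basis"
  shows "pderivs (map (\<lambda>v. (v, 0)) bs) (\<lambda>p. f (fst p) * g (snd p)) = (\<lambda>p. pderivs bs f (fst p) * g (snd p))"
  using bs
proof (induction bs)
  case (Cons b bs)
  let ?f = "pderivs bs f"
  have "bs \<in> lists Basis" using Cons.hyps by blast
  then have sf: "smooth ?f" by (intro smooth_pderivs f)
  have "((\<lambda>p. ?f (fst p) * g (snd p)) has_derivative
      (\<lambda>h. ?f (fst p) * frechet_derivative g (at (snd p)) (snd h) + frechet_derivative ?f (at (fst p)) (fst h) * g (snd p))) (at p)" for p
  proof (rule has_derivative_mult)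
    show "((\<lambda>p. ?f (fst p)) has_derivative (\<lambda>h. frechet_derivative ?f (at (fst p)) (fst h))) (at p)"
      by (rule has_derivative_compose[OF _ smooth_has_derivative[OF sf]]) (auto intro!: derivative_eq_intros)
    show "((\<lambda>p. g (snd p)) has_derivative (\<lambda>h. frechet_derivative g (at (snd p)) (snd h))) (at p)"
      by (rule has_derivative_compose[OF _ smooth_has_derivative[OF g]]) (auto intro!: derivative_eq_intros)
  qed
  from frechet_derivative_at[OF this, symmetric]
  have "frechet_derivative (\<lambda>p. ?f (fst p) * g (snd p)) (at p) (b, 0)
      = ?f (fst p) * frechet_derivative g (at (snd p)) 0 + frechet_derivative ?f (at (fst p)) b * g (snd p)" for p
    by simp
  moreover have "frechet_derivative g (at x) 0 = 0" for x
    using smooth_has_derivative[OF g, of x] by (simp add: has_derivative_def linear_simps(3))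
  ultimately show ?case using Cons by simp
qed simp

text \<open>A box in the product space is a product of boxes, and the products of bumps in the two
  factors approximate its indicator.\<close>

lemma L2_prod_zero:
  fixes h :: "('a::euclidean_space \<times> 'b::euclidean_space) aefun"
  assumes U: "open U" "open W" and h: "h \<in> L2 (U \<times> W)"
    and zero: "\<And>\<phi> \<psi>. test_function U \<phi> \<Longrightarrow> test_function W \<psi> \<Longrightarrow>
      L2_inner (U \<times> W) h (abs_aefun (\<lambda>p. \<phi> (fst p) * \<psi> (snd p))) = 0"
  shows "h = 0"
proof (rule L2_zero_of_box_approximations[OF open_Times[OF U] h])
  fix a b :: "'a \<times> 'b" assume ab: "cbox a b \<subseteq> U \<times> W" "box a b \<noteq> {}"
  \<comment> \<open>An inclusion between products splits into inclusions of the factors only if the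
    smaller product is nonempty.\<close>
  have ne: "cbox (fst a) (fst b) \<noteq> {}" "cbox (snd a) (snd b) \<noteq> {}"
    using ab(2) box_subset_cbox unfolding box_prod by fastforce+
  then have sub: "cbox (fst a) (fst b) \<subseteq> U" "cbox (snd a) (snd b) \<subseteq> W"
    using ab(1) unfolding cbox_prod by (auto simp: times_subset_iff)
  define \<phi> where "\<phi> = box_bump (fst a) (fst b)"
  define \<psi> where "\<psi> = box_bump (snd a) (snd b)"
  have \<phi>: "test_function U (\<phi> n)" and \<psi>: "test_function W (\<psi> n)" for n
    unfolding \<phi>_def \<psi>_def by (intro test_function_box_bump sub)+
  note meas = test_function_measurable[OF test_function_product[OF \<phi> \<psi>]]
  have UW: "U \<times> W \<in> sets borel" using open_Times[OF U] by simp
  show "\<exists>g. \<forall>n. g n \<in> borel_measurable borel \<and>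
        (\<forall>x. \<bar>g n x\<bar> \<le> indicator (box a b) x) \<and> (\<forall>x\<in>box a b. (\<lambda>n. g n x) \<longlonglongrightarrow> 1) \<and>
        (\<integral>x. rep_aefun h x * g n x \<partial>lborel) = 0"
  proof (intro exI[of _ "\<lambda>n p. \<phi> n (fst p) * \<psi> n (snd p)"] allI conjI ballI)
    fix n
    show "(\<lambda>p. \<phi> n (fst p) * \<psi> n (snd p)) \<in> borel_measurable borel" by (rule meas)
    show "(\<integral>x. rep_aefun h x * (\<phi> n (fst x) * \<psi> n (snd x)) \<partial>lborel) = 0"
      using zero[OF \<phi> \<psi>, of n n] L2_inner_test[OF h UW, of "\<lambda>p. \<phi> n (fst p) * \<psi> n (snd p)"] meas[of n n] by simp
    show "\<bar>\<phi> n (fst p) * \<psi> n (snd p)\<bar> \<le> indicator (box a b) p" for p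
    proof (cases "p \<in> box a b")
      case True
      then show ?thesis
        by (auto simp: \<phi>_def \<psi>_def abs_mult abs_of_nonneg[OF box_bump_range(1)]
            intro!: mult_le_one box_bump_range)
    next
      case False
      then have "fst p \<notin> box (fst a) (fst b) \<or> snd p \<notin> box (snd a) (snd b)"
        by (auto simp: box_prod mem_Times_iff)
      then have "\<phi> n (fst p) * \<psi> n (snd p) = 0" by (auto simp: \<phi>_def \<psi>_def box_bump_outside)
      then show ?thesis by (simp only: abs_zero) simp
    qed
  next
    fix p assume "p \<in> box a b"
    then have "fst p \<in> box (fst a) (fst b)" "snd p \<in> box (snd a) (snd b)" by (auto simp: box_prod mem_Times_iff)
    from tendsto_mult[OF box_bump_tendsto[OF this(1)] box_bump_tendsto[OF this(2)]]
    show "(\<lambda>n. \<phi> n (fst p) * \<psi> n (snd p)) \<longlonglongrightarrow> 1" by (simp add: \<phi>_def \<psi>_def)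
  qed
qed

section \<open>The kernel of a nuclear operator\<close>

lemma weak_deriv_sum:
  fixes n :: nat
  assumes U: "open U" and bs: "bs \<in> lists Basis"
    and fg: "\<And>i. i < n \<Longrightarrow> f i \<in> L2 U" "\<And>i. i < n \<Longrightarrow> g i \<in> L2 U" "\<And>i. i < n \<Longrightarrow> weak_deriv U bs (f i) (g i)"
  shows "weak_deriv U bs (\<Sum>i<n. f i) (\<Sum>i<n. g i)"
  using fg
proof (induction n)
  case 0
  have "0 \<in> L2 U" by (rule subspace_0[OF subspace_L2])
  then show ?case
    by (simp add: weak_deriv_iff[OF U bs] inner_carrier.ip_0[OF inner_carrier_L2] U test_function_L2
        test_function_pderivs[OF _ bs])
next
  case (Suc n)
  have "weak_deriv U bs ((\<Sum>i<n. f i) + f n) ((\<Sum>i<n. g i) + g n)"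
    using Suc by (intro weak_deriv_add[OF U bs] subspace_sum[OF subspace_L2] Suc.IH) auto
  then show ?case by simp
qed

lemma mdirs2_Basis: "mdirs2 \<alpha> \<beta> \<in> lists Basis"
  unfolding mdirs2_def using in_lists_Basis_prod mdirs_Basis by (simp only: append_in_lists_conv) blast

lemma mdirs2_0: "mdirs2 \<alpha> (\<lambda>_. 0) = map (\<lambda>v. (v, 0)) (mdirs \<alpha>)" "mdirs2 (\<lambda>_. 0) (\<lambda>_. 0) = []"
  by (simp_all add: mdirs2_def)

context sobolev_space
begin

lemma open_square: "open (\<Theta> \<times> \<Theta>)"
  by (intro open_Times open_domain)

lemma borel_domain: "\<Theta> \<in> sets borel" "\<Theta> \<times> \<Theta> \<in> sets borel"
  using open_domain open_square by auto

interpretation L: hilbert_carrier "L2 \<Theta>" "L2_inner \<Theta>" "L2_norm \<Theta>"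
  by (rule hilbert_carrier_L2[OF borel_domain(1)])

interpretation K: hilbert_carrier "L2 (\<Theta> \<times> \<Theta>)" "L2_inner (\<Theta> \<times> \<Theta>)" "L2_norm (\<Theta> \<times> \<Theta>)"
  by (rule hilbert_carrier_L2[OF borel_domain(2)])

lemma mderiv2_Sobolev_mixed:
  assumes "c \<in> Sobolev_mixed \<Theta> k" "mdeg \<alpha> \<le> k" "mdeg \<beta> \<le> k"
  shows "mderiv2 \<Theta> \<alpha> \<beta> c \<in> L2 (\<Theta> \<times> \<Theta>)" "weak_deriv (\<Theta> \<times> \<Theta>) (mdirs2 \<alpha> \<beta>) c (mderiv2 \<Theta> \<alpha> \<beta> c)"
  using has_wderiv_wderiv[OF open_square mdirs2_Basis] assms by (auto simp: Sobolev_mixed_def)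

text \<open>The weak form of the integral operator: paired with \<open>g\<close> it is a sum of
  inner products on the square, in which derivatives of kernels can be compared.\<close>

lemma T_op_inner:
  assumes c: "c \<in> Sobolev_mixed \<Theta> k" and f: "f \<in> H"
  shows "T_op \<Theta> k c f \<in> L2 \<Theta>"
    and "g \<in> L2 \<Theta> \<Longrightarrow> L2_inner \<Theta> (T_op \<Theta> k c f) g
      = (\<Sum>\<alpha> | mdeg \<alpha> \<le> k. L2_inner (\<Theta> \<times> \<Theta>) (mderiv2 \<Theta> \<alpha> (\<lambda>_. 0) c) (prod_aefun (mderiv \<Theta> \<alpha> f) g))"
proof -
  have K: "mderiv2 \<Theta> \<alpha> (\<lambda>_. 0) c \<in> L2 (\<Theta> \<times> \<Theta>)" and F: "mderiv \<Theta> \<alpha> f \<in> L2 \<Theta>"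
    if "\<alpha> \<in> {\<alpha>. mdeg \<alpha> \<le> k}" for \<alpha>
    using that mderiv2_Sobolev_mixed(1)[OF c] mderiv_Sobolev(1)[OF open_domain f] by auto
  note ks = kernel_integral_sum[OF finite_mdeg borel_domain(1) borel_domain(1) K F]
  show "T_op \<Theta> k c f \<in> L2 \<Theta>" unfolding T_op_def using ks(1) f by simp
  show "L2_inner \<Theta> (T_op \<Theta> k c f) g
      = (\<Sum>\<alpha> | mdeg \<alpha> \<le> k. L2_inner (\<Theta> \<times> \<Theta>) (mderiv2 \<Theta> \<alpha> (\<lambda>_. 0) c) (prod_aefun (mderiv \<Theta> \<alpha> f) g))"
    if g: "g \<in> L2 \<Theta>"
    unfolding T_op_def using ks(2)[OF _ _ g] f by simp
qed

text \<open>The definition of \<open>nuclear\<close> does not mention linearity; it is read off from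
  a representation through the matrix coefficients.\<close>

lemma linear_on_nuclear:
  assumes T: "T \<in> nuclear \<Theta> k" shows "linear_on H T"
proof -
  obtain a b where r: "nuclear_rep \<Theta> k T a b" using T by (auto simp: nuclear_def)
  note ab = nuclear_rep_carrier[OF r] and s = nuclear_rep_sums[OF r nuclear_carrier(1)[OF T]]
  show ?thesis
  proof (rule linear_onI)
    fix x y assume xy: "x \<in> H" "y \<in> H"
    show "T (x + y) = T x + T y"
    proof (rule ip_eqI)
      fix z assume z: "z \<in> H"
      have "(\<lambda>i. ip (x + y) (b i) * ip (a i) z) = (\<lambda>i. ip x (b i) * ip (a i) z + ip y (b i) * ip (a i) z)"
        using xy ab by (simp add: ip_add_left distrib_right)
      then have "(\<lambda>i. ip (x + y) (b i) * ip (a i) z) sums (ip (T x) z + ip (T y) z)"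
        using sums_add[OF s[OF xy(1) xy(1) z] s[OF xy(2) xy(2) z]] by simp
      then have "ip (T (x + y)) z = ip (T x) z + ip (T y) z"
        using s[OF V_add[OF xy] V_add[OF xy] z] sums_unique2 by blast
      then show "ip (T (x + y)) z = ip (T x + T y) z"
        using xy z nuclear_carrier(1)[OF T] by (simp add: ip_add_left)
    qed (use xy nuclear_carrier(1)[OF T] in auto)
  next
    fix x c assume x: "x \<in> H"
    show "T (c *\<^sub>R x) = c *\<^sub>R T x"
    proof (rule ip_eqI)
      fix z assume z: "z \<in> H"
      have "(\<lambda>i. ip (c *\<^sub>R x) (b i) * ip (a i) z) = (\<lambda>i. c * (ip x (b i) * ip (a i) z))"
        using x ab by (simp add: ip_scale_left mult.assoc)
      then have "(\<lambda>i. ip (c *\<^sub>R x) (b i) * ip (a i) z) sums (c * ip (T x) z)"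
        using sums_mult[OF s[OF x x z], of c] by simp
      then have "ip (T (c *\<^sub>R x)) z = c * ip (T x) z"
        using s[OF V_scale[OF x] V_scale[OF x] z] sums_unique2 by blast
      then show "ip (T (c *\<^sub>R x)) z = ip (c *\<^sub>R T x) z"
        using x z nuclear_carrier(1)[OF T] by (simp add: ip_scale_left)
    qed (use x nuclear_carrier(1)[OF T] in auto)
  qed
qed

text \<open>For each pair of orders the differentiated series converges absolutely in
  \<open>L2\<close> of the square, because the norm of a product kernel is the product of the norms
  and derivatives are contractions. The adjoints enter as arbitrary \<open>u\<close> and
  \<open>v\<close> that represent the two functionals.\<close>

lemma nuclear_kernel:
  assumes T: "T \<in> nuclear \<Theta> k"
  shows "\<exists>c\<in>Sobolev_mixed \<Theta> k. \<forall>\<alpha> \<beta> f g u v. mdeg \<alpha> \<le> k \<longrightarrow> mdeg \<beta> \<le> k \<longrightarrow> f \<in> L2 \<Theta> \<longrightarrow> g \<in> L2 \<Theta> \<longrightarrow>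
    u \<in> H \<longrightarrow> v \<in> H \<longrightarrow> (\<forall>x\<in>H. L2_inner \<Theta> (mderiv \<Theta> \<alpha> x) f = ip x u) \<longrightarrow>
    (\<forall>x\<in>H. L2_inner \<Theta> (mderiv \<Theta> \<beta> x) g = ip x v) \<longrightarrow>
    L2_inner (\<Theta> \<times> \<Theta>) (mderiv2 \<Theta> \<alpha> \<beta> c) (prod_aefun f g) = ip (T u) v"
proof -
  obtain a b where r: "nuclear_rep \<Theta> k T a b" using T by (auto simp: nuclear_def)
  note ab = nuclear_rep_carrier[OF r]
  note D = mderiv_Sobolev[OF open_domain]
  \<comment> \<open>In \<open>a i \<otimes> b i\<close> the vector \<open>b i\<close> is paired with
    the argument, so it carries the integration variable \<open>s\<close> and the order
    \<open>\<alpha>\<close>; \<open>a i\<close> carries \<open>t\<close> and the order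
    \<open>\<beta>\<close>.\<close>
  define p where "p \<alpha> \<beta> i = prod_aefun (mderiv \<Theta> \<alpha> (b i)) (mderiv \<Theta> \<beta> (a i))" for \<alpha> \<beta> i
  have pL: "p \<alpha> \<beta> i \<in> L2 (\<Theta> \<times> \<Theta>)" if "mdeg \<alpha> \<le> k" "mdeg \<beta> \<le> k" for \<alpha> \<beta> i
    unfolding p_def by (intro prod_aefun_L2 D(1)[OF ab(2) that(1)] D(1)[OF ab(1) that(2)])
  have "\<exists>l\<in>L2 (\<Theta> \<times> \<Theta>). (\<lambda>n. L2_norm (\<Theta> \<times> \<Theta>) ((\<Sum>i<n. p \<alpha> \<beta> i) - l)) \<longlonglongrightarrow> 0"
    if \<alpha>\<beta>: "mdeg \<alpha> \<le> k" "mdeg \<beta> \<le> k" for \<alpha> \<beta>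
  proof (rule K.series_convergent[OF pL[OF \<alpha>\<beta>]])
    show "summable (\<lambda>i. L2_norm (\<Theta> \<times> \<Theta>) (p \<alpha> \<beta> i))"
    proof (rule summable_comparison_test[OF _ ab(3)], intro exI allI impI)
      fix i
      have "L2_norm (\<Theta> \<times> \<Theta>) (p \<alpha> \<beta> i) = L2_norm \<Theta> (mderiv \<Theta> \<alpha> (b i)) * L2_norm \<Theta> (mderiv \<Theta> \<beta> (a i))"
        unfolding p_def
        by (intro L2_norm_prod_aefun borel_domain D(1)[OF ab(2) \<alpha>\<beta>(1)] D(1)[OF ab(1) \<alpha>\<beta>(2)])
      also have "\<dots> \<le> N (b i) * N (a i)"
        by (intro mult_mono mderiv_norm_le[OF open_domain] L.N_nonneg N_nonneg ab \<alpha>\<beta>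
            D(1)[OF ab(1) \<alpha>\<beta>(2)])
      finally show "norm (L2_norm (\<Theta> \<times> \<Theta>) (p \<alpha> \<beta> i)) \<le> N (a i) * N (b i)"
        using K.N_nonneg[OF pL[OF \<alpha>\<beta>]] by (simp add: mult.commute)
    qed
  qed
  then have "\<exists>\<kappa>. \<forall>\<alpha> \<beta>. mdeg \<alpha> \<le> k \<and> mdeg \<beta> \<le> k \<longrightarrow> \<kappa> \<alpha> \<beta> \<in> L2 (\<Theta> \<times> \<Theta>) \<and>
      (\<lambda>n. L2_norm (\<Theta> \<times> \<Theta>) ((\<Sum>i<n. p \<alpha> \<beta> i) - \<kappa> \<alpha> \<beta>)) \<longlonglongrightarrow> 0"
    by (intro choice allI) blast
  then obtain \<kappa> where \<kappa>L: "\<And>\<alpha> \<beta>. mdeg \<alpha> \<le> k \<Longrightarrow> mdeg \<beta> \<le> k \<Longrightarrow> \<kappa> \<alpha> \<beta> \<in> L2 (\<Theta> \<times> \<Theta>)"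
    and \<kappa>: "\<And>\<alpha> \<beta>. mdeg \<alpha> \<le> k \<Longrightarrow> mdeg \<beta> \<le> k \<Longrightarrow>
      (\<lambda>n. L2_norm (\<Theta> \<times> \<Theta>) ((\<Sum>i<n. p \<alpha> \<beta> i) - \<kappa> \<alpha> \<beta>)) \<longlonglongrightarrow> 0" by auto
  define c where "c = \<kappa> (\<lambda>_. 0) (\<lambda>_. 0)"
  have cL: "c \<in> L2 (\<Theta> \<times> \<Theta>)" unfolding c_def by (rule \<kappa>L) auto
  have sL: "(\<Sum>i<n. p \<alpha> \<beta> i) \<in> L2 (\<Theta> \<times> \<Theta>)" if "mdeg \<alpha> \<le> k" "mdeg \<beta> \<le> k" for \<alpha> \<beta> n
    by (intro K.V_sum pL that)
  have wd: "weak_deriv (\<Theta> \<times> \<Theta>) (mdirs2 \<alpha> \<beta>) c (\<kappa> \<alpha> \<beta>)" if \<alpha>\<beta>: "mdeg \<alpha> \<le> k" "mdeg \<beta> \<le> k" for \<alpha> \<beta>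
  proof (rule weak_deriv_limit[OF open_square mdirs2_Basis])
    have 0: "mdeg (\<lambda>_::'n. 0) \<le> k" by simp
    show "(\<lambda>n. L2_norm (\<Theta> \<times> \<Theta>) ((\<Sum>i<n. p (\<lambda>_. 0) (\<lambda>_. 0) i) - c)) \<longlonglongrightarrow> 0"
      unfolding c_def by (rule \<kappa>[OF 0 0])
    show "weak_deriv (\<Theta> \<times> \<Theta>) (mdirs2 \<alpha> \<beta>) (\<Sum>i<n. p (\<lambda>_. 0) (\<lambda>_. 0) i) (\<Sum>i<n. p \<alpha> \<beta> i)" for n
    proof (rule weak_deriv_sum[OF open_square mdirs2_Basis pL[OF 0 0] pL[OF \<alpha>\<beta>]])
      fix i
      have "weak_deriv (\<Theta> \<times> \<Theta>) (mdirs2 \<alpha> \<beta>) (prod_aefun (b i) (a i)) (p \<alpha> \<beta> i)"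
        unfolding mdirs2_def p_def
        by (intro weak_deriv_prod_aefun open_domain mdirs_Basis Sobolev_L2[OF ab(1)] Sobolev_L2[OF ab(2)]
            D[OF ab(2) \<alpha>\<beta>(1)] D[OF ab(1) \<alpha>\<beta>(2)])
      then show "weak_deriv (\<Theta> \<times> \<Theta>) (mdirs2 \<alpha> \<beta>) (p (\<lambda>_. 0) (\<lambda>_. 0) i) (p \<alpha> \<beta> i)"
        by (simp add: p_def wderiv_Nil[OF open_domain Sobolev_L2[OF ab(1)]] wderiv_Nil[OF open_domain Sobolev_L2[OF ab(2)]])
    qed
  qed (use sL \<kappa>L \<kappa> \<alpha>\<beta> cL in auto)
  have c: "c \<in> Sobolev_mixed \<Theta> k"
    unfolding Sobolev_mixed_def using cL has_wderivI[OF \<kappa>L wd] by blast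
  have eval: "L2_inner (\<Theta> \<times> \<Theta>) (mderiv2 \<Theta> \<alpha> \<beta> c) (prod_aefun f g) = ip (T u) v"
    if \<alpha>\<beta>: "mdeg \<alpha> \<le> k" "mdeg \<beta> \<le> k" and fg: "f \<in> L2 \<Theta>" "g \<in> L2 \<Theta>" and uv: "u \<in> H" "v \<in> H"
      and u: "\<forall>x\<in>H. L2_inner \<Theta> (mderiv \<Theta> \<alpha> x) f = ip x u" and v: "\<forall>x\<in>H. L2_inner \<Theta> (mderiv \<Theta> \<beta> x) g = ip x v"
    for \<alpha> \<beta> f g u v
  proof -
    have "mderiv2 \<Theta> \<alpha> \<beta> c = \<kappa> \<alpha> \<beta>"
      by (rule wderiv_eq[OF open_square mdirs2_Basis \<kappa>L[OF \<alpha>\<beta>] wd[OF \<alpha>\<beta>]])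
    moreover have "(\<lambda>n. L2_inner (\<Theta> \<times> \<Theta>) (\<Sum>i<n. p \<alpha> \<beta> i) (prod_aefun f g)) \<longlonglongrightarrow> L2_inner (\<Theta> \<times> \<Theta>) (\<kappa> \<alpha> \<beta>) (prod_aefun f g)"
      by (rule K.ip_tendsto[OF sL[OF \<alpha>\<beta>] \<kappa>L[OF \<alpha>\<beta>] prod_aefun_L2[OF fg] \<kappa>[OF \<alpha>\<beta>]])
    moreover have "L2_inner (\<Theta> \<times> \<Theta>) (\<Sum>i<n. p \<alpha> \<beta> i) (prod_aefun f g) = (\<Sum>i<n. ip u (b i) * ip (a i) v)" for n
    proof -
      have "L2_inner (\<Theta> \<times> \<Theta>) (\<Sum>i<n. p \<alpha> \<beta> i) (prod_aefun f g) = (\<Sum>i<n. L2_inner (\<Theta> \<times> \<Theta>) (p \<alpha> \<beta> i) (prod_aefun f g))"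
        using K.ip_sum_scale_left[of "{..<n}" "p \<alpha> \<beta>" "prod_aefun f g" "\<lambda>_. 1"] pL[OF \<alpha>\<beta>] prod_aefun_L2[OF fg] by simp
      also have "\<dots> = (\<Sum>i<n. ip u (b i) * ip (a i) v)"
      proof (rule sum.cong)
        fix i
        have "L2_inner (\<Theta> \<times> \<Theta>) (p \<alpha> \<beta> i) (prod_aefun f g)
            = L2_inner \<Theta> (mderiv \<Theta> \<alpha> (b i)) f * L2_inner \<Theta> (mderiv \<Theta> \<beta> (a i)) g"
          unfolding p_def
          by (intro L2_inner_prod_aefun borel_domain fg D(1)[OF ab(2) \<alpha>\<beta>(1)] D(1)[OF ab(1) \<alpha>\<beta>(2)])
        then show "L2_inner (\<Theta> \<times> \<Theta>) (p \<alpha> \<beta> i) (prod_aefun f g) = ip u (b i) * ip (a i) v"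
          using u v ab uv ip_commute[OF uv(1) ab(2)] by simp
      qed simp
      finally show ?thesis .
    qed
    moreover have "(\<lambda>n. \<Sum>i<n. ip u (b i) * ip (a i) v) \<longlonglongrightarrow> ip (T u) v"
      using nuclear_rep_sums[OF r nuclear_carrier(1)[OF T uv(1)] uv] by (simp add: sums_def)
    ultimately show ?thesis using LIMSEQ_unique by simp
  qed
  show ?thesis using eval by (intro bexI[OF _ c]) blast
qed

lemma T_op_unique:
  assumes c: "c \<in> Sobolev_mixed \<Theta> k" and c': "c' \<in> Sobolev_mixed \<Theta> k" and eq: "T_op \<Theta> k c = T_op \<Theta> k c'"
  shows "c' = c"
proof -
  note Dc = mderiv2_Sobolev_mixed[OF c] and Dc' = mderiv2_Sobolev_mixed[OF c']
  have cL: "c \<in> L2 (\<Theta> \<times> \<Theta>)" "c' \<in> L2 (\<Theta> \<times> \<Theta>)" using c c' by (auto simp: Sobolev_mixed_def)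
  define d where "d \<alpha> = mderiv2 \<Theta> \<alpha> (\<lambda>_. 0) c - mderiv2 \<Theta> \<alpha> (\<lambda>_. 0) c'" for \<alpha> :: "'n mindex"
  have dL: "d \<alpha> \<in> L2 (\<Theta> \<times> \<Theta>)" if "mdeg \<alpha> \<le> k" for \<alpha>
    unfolding d_def using that Dc(1) Dc'(1) by simp
  have d0: "d (\<lambda>_. 0) = c - c'" unfolding d_def mdirs2_0 by (simp add: wderiv_Nil[OF open_square] cL)
  have "c - c' = 0"
  proof (rule L2_prod_zero[OF open_domain open_domain K.V_diff[OF cL]])
    fix \<phi> \<psi> assume \<phi>: "test_function \<Theta> \<phi>" and \<psi>: "test_function \<Theta> \<psi>"
    define g where "g = abs_aefun \<psi>"
    have gL: "g \<in> L2 \<Theta>" unfolding g_def by (rule test_function_L2[OF \<psi>])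
    \<comment> \<open>\<open>e \<alpha>\<close> is the integral of \<open>d \<alpha>\<close> over
      \<open>t\<close> against \<open>g\<close>; the Riesz theorem provides it directly as an
      element of \<open>L2\<close>.\<close>
    have "\<exists>e\<in>L2 \<Theta>. \<forall>f\<in>L2 \<Theta>. L2_inner (\<Theta> \<times> \<Theta>) (d \<alpha>) (prod_aefun f g) = L2_inner \<Theta> f e"
      if \<alpha>: "mdeg \<alpha> \<le> k" for \<alpha>
    proof (rule L.Riesz)
      show "linear_on (L2 \<Theta>) (\<lambda>f. L2_inner (\<Theta> \<times> \<Theta>) (d \<alpha>) (prod_aefun f g))"
        using dL[OF \<alpha>] gL by (intro linear_onI)
          (auto simp: prod_aefun_add prod_aefun_scale K.ip_add_right K.ip_scale_right prod_aefun_L2)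
      show "\<bar>L2_inner (\<Theta> \<times> \<Theta>) (d \<alpha>) (prod_aefun f g)\<bar> \<le> (L2_norm (\<Theta> \<times> \<Theta>) (d \<alpha>) * L2_norm \<Theta> g) * L2_norm \<Theta> f"
        if f: "f \<in> L2 \<Theta>" for f
        using K.ip_Cauchy_Schwarz[OF dL[OF \<alpha>] prod_aefun_L2[OF f gL]]
        by (simp add: L2_norm_prod_aefun[OF borel_domain(1) borel_domain(1) f gL] mult_ac)
    qed auto
    then have "\<exists>e. \<forall>\<alpha>. mdeg \<alpha> \<le> k \<longrightarrow> e \<alpha> \<in> L2 \<Theta> \<and>
        (\<forall>f\<in>L2 \<Theta>. L2_inner (\<Theta> \<times> \<Theta>) (d \<alpha>) (prod_aefun f g) = L2_inner \<Theta> f (e \<alpha>))"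
      by (intro choice allI) blast
    then obtain e where eL: "\<And>\<alpha>. mdeg \<alpha> \<le> k \<Longrightarrow> e \<alpha> \<in> L2 \<Theta>" and
      e: "\<And>\<alpha> f. mdeg \<alpha> \<le> k \<Longrightarrow> f \<in> L2 \<Theta> \<Longrightarrow> L2_inner (\<Theta> \<times> \<Theta>) (d \<alpha>) (prod_aefun f g) = L2_inner \<Theta> f (e \<alpha>)"
      by auto
    define h where "h = e (\<lambda>_. 0)"
    have hL: "h \<in> L2 \<Theta>" unfolding h_def by (rule eL) simp
    have h: "L2_inner \<Theta> h f = L2_inner (\<Theta> \<times> \<Theta>) (c - c') (prod_aefun f g)" if "f \<in> L2 \<Theta>" for f
      using e[of "\<lambda>_. 0" f] that L.ip_commute[OF hL that] by (simp add: d0 h_def)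
    have prod: "prod_aefun (abs_aefun \<xi>) g = abs_aefun (\<lambda>p. \<xi> (fst p) * \<psi> (snd p))" if "test_function \<Theta> \<xi>" for \<xi>
      unfolding g_def by (intro prod_aefun_abs test_function_measurable[OF that] test_function_measurable[OF \<psi>])
    \<comment> \<open>Differentiation in \<open>s\<close> commutes with integration over
      \<open>t\<close>: the product of \<open>\<xi>\<close> and \<open>\<psi>\<close> is a test
      function on the square, and its derivatives in the first variable fall on \<open>\<xi>\<close>
      alone.\<close>
    have wd: "weak_deriv \<Theta> (mdirs \<alpha>) h (e \<alpha>)" if \<alpha>: "mdeg \<alpha> \<le> k" for \<alpha>
      unfolding weak_deriv_iff[OF open_domain mdirs_Basis]
    proof (intro allI impI)
      fix \<xi> assume \<xi>: "test_function \<Theta> \<xi>"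
      note \<xi>' = test_function_pderivs[OF \<xi> mdirs_Basis[of \<alpha>]]
      have 0: "mdeg (\<lambda>_::'n. 0) \<le> k" by simp
      note t = test_function_product[OF \<xi> \<psi>]
      have Dt: "(\<lambda>p. pderivs (mdirs \<alpha>) \<xi> (fst p) * \<psi> (snd p)) = pderivs (mdirs2 \<alpha> (\<lambda>_. 0)) (\<lambda>p. \<xi> (fst p) * \<psi> (snd p))"
        unfolding mdirs2_0
        by (rule pderivs_product_fst[OF test_function_smooth[OF \<xi>] test_function_smooth[OF \<psi>] mdirs_Basis, symmetric])
      note tL = test_function_L2[OF t] test_function_L2[OF test_function_pderivs[OF t mdirs2_Basis]]
      have len: "length (mdirs2 \<alpha> (\<lambda>_. 0)) = length (mdirs \<alpha>)" by (simp add: mdirs2_0)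
      have "L2_inner \<Theta> h (abs_aefun (pderivs (mdirs \<alpha>) \<xi>))
          = L2_inner (\<Theta> \<times> \<Theta>) (c - c') (abs_aefun (pderivs (mdirs2 \<alpha> (\<lambda>_. 0)) (\<lambda>p. \<xi> (fst p) * \<psi> (snd p))))"
        unfolding h[OF test_function_L2[OF \<xi>']] prod[OF \<xi>'] Dt ..
      also have "\<dots> = (- 1) ^ length (mdirs \<alpha>) * L2_inner (\<Theta> \<times> \<Theta>) (d \<alpha>) (abs_aefun (\<lambda>p. \<xi> (fst p) * \<psi> (snd p)))"
        using weak_derivD[OF open_square mdirs2_Basis Dc(2)[OF \<alpha> 0] t] weak_derivD[OF open_square mdirs2_Basis Dc'(2)[OF \<alpha> 0] t]
          cL Dc(1)[OF \<alpha> 0] Dc'(1)[OF \<alpha> 0] tL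
        by (simp add: K.ip_diff_left d_def len right_diff_distrib)
      also have "L2_inner (\<Theta> \<times> \<Theta>) (d \<alpha>) (abs_aefun (\<lambda>p. \<xi> (fst p) * \<psi> (snd p))) = L2_inner \<Theta> (e \<alpha>) (abs_aefun \<xi>)"
        unfolding prod[OF \<xi>, symmetric] e[OF \<alpha> test_function_L2[OF \<xi>]]
        by (rule L.ip_commute[OF test_function_L2[OF \<xi>] eL[OF \<alpha>]])
      finally show "L2_inner \<Theta> h (abs_aefun (pderivs (mdirs \<alpha>) \<xi>)) = (- 1) ^ length (mdirs \<alpha>) * L2_inner \<Theta> (e \<alpha>) (abs_aefun \<xi>)" .
    qed
    have hH: "h \<in> H" and Dh: "\<And>\<alpha>. mdeg \<alpha> \<le> k \<Longrightarrow> mderiv \<Theta> \<alpha> h = e \<alpha>"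
      using Sobolev_I[OF open_domain hL eL wd] by blast+
    \<comment> \<open>The derivative of \<open>h\<close> of order \<open>\<alpha>\<close> is
      \<open>e \<alpha>\<close>, and pairing with \<open>e \<alpha>\<close> is pairing with
      \<open>d \<alpha>\<close> on the square. So the squared norm takes the shape of the two
      operators applied to \<open>h\<close>.\<close>
    have "ip h h = (\<Sum>\<alpha> | mdeg \<alpha> \<le> k. L2_inner (\<Theta> \<times> \<Theta>) (d \<alpha>) (prod_aefun (mderiv \<Theta> \<alpha> h) g))"
      unfolding Sobolev_inner_def by (rule sum.cong) (auto simp: Dh e eL)
    also have "\<dots> = (\<Sum>\<alpha> | mdeg \<alpha> \<le> k. L2_inner (\<Theta> \<times> \<Theta>) (mderiv2 \<Theta> \<alpha> (\<lambda>_. 0) c) (prod_aefun (mderiv \<Theta> \<alpha> h) g)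
        - L2_inner (\<Theta> \<times> \<Theta>) (mderiv2 \<Theta> \<alpha> (\<lambda>_. 0) c') (prod_aefun (mderiv \<Theta> \<alpha> h) g))"
      unfolding d_def
      by (intro sum.cong K.ip_diff_left refl) (auto intro!: Dc(1) Dc'(1) prod_aefun_L2 gL simp: Dh eL)
    also have "\<dots> = L2_inner \<Theta> (T_op \<Theta> k c h) g - L2_inner \<Theta> (T_op \<Theta> k c' h) g"
      by (simp add: sum_subtractf T_op_inner(2)[OF c hH gL] T_op_inner(2)[OF c' hH gL])
    also have "\<dots> = 0" by (simp add: eq)
    finally have "h = 0" by (rule ip_eq_0[OF hH])
    then have "L2_inner (\<Theta> \<times> \<Theta>) (c - c') (prod_aefun (abs_aefun \<phi>) g) = 0"
      using h[OF test_function_L2[OF \<phi>]] test_function_L2[OF \<phi>] by simp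
    then show "L2_inner (\<Theta> \<times> \<Theta>) (c - c') (abs_aefun (\<lambda>p. \<phi> (fst p) * \<psi> (snd p))) = 0"
      by (simp add: prod[OF \<phi>])
  qed
  then show ?thesis by simp
qed

text \<open>Let \<open>u \<alpha>\<close> be the adjoint of the derivative of order
  \<open>\<alpha>\<close>, applied to that derivative of \<open>f\<close>. By the definition of the
  Sobolev inner product the \<open>u \<alpha>\<close> add up to \<open>f\<close>, so by linearity
  the terms of \<open>T_op\<close> add up to the coefficient of \<open>T\<close> at
  \<open>f\<close>.\<close>

lemma nuclear_eq_T_op:
  assumes T: "T \<in> nuclear \<Theta> k" and c: "c \<in> Sobolev_mixed \<Theta> k"
    and eval: "\<And>\<alpha> \<beta> f g u v. mdeg \<alpha> \<le> k \<Longrightarrow> mdeg \<beta> \<le> k \<Longrightarrow> f \<in> L2 \<Theta> \<Longrightarrow> g \<in> L2 \<Theta> \<Longrightarrow>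
      u \<in> H \<Longrightarrow> v \<in> H \<Longrightarrow> \<forall>x\<in>H. L2_inner \<Theta> (mderiv \<Theta> \<alpha> x) f = ip x u \<Longrightarrow>
      \<forall>x\<in>H. L2_inner \<Theta> (mderiv \<Theta> \<beta> x) g = ip x v \<Longrightarrow>
      L2_inner (\<Theta> \<times> \<Theta>) (mderiv2 \<Theta> \<alpha> \<beta> c) (prod_aefun f g) = ip (T u) v"
  shows "T = T_op \<Theta> k c"
proof
  fix f
  show "T f = T_op \<Theta> k c f"
  proof (cases "f \<in> H")
    case False
    then show ?thesis using nuclear_carrier(2)[OF T] by (simp add: T_op_def)
  next
    case f: True
    note D = mderiv_Sobolev(1)[OF open_domain]
    have TfH: "T f \<in> H" by (rule nuclear_carrier(1)[OF T f])
    have "\<exists>u. \<forall>\<alpha>. mdeg \<alpha> \<le> k \<longrightarrow> u \<alpha> \<in> H \<and> (\<forall>x\<in>H. L2_inner \<Theta> (mderiv \<Theta> \<alpha> x) (mderiv \<Theta> \<alpha> f) = ip x (u \<alpha>))"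
      using mderiv_adjoint D[OF f] by (intro choice allI) blast
    then obtain u where uH: "\<And>\<alpha>. mdeg \<alpha> \<le> k \<Longrightarrow> u \<alpha> \<in> H"
      and u: "\<And>\<alpha>. mdeg \<alpha> \<le> k \<Longrightarrow> \<forall>x\<in>H. L2_inner \<Theta> (mderiv \<Theta> \<alpha> x) (mderiv \<Theta> \<alpha> f) = ip x (u \<alpha>)" by auto
    let ?I = "{\<alpha> :: 'n mindex. mdeg \<alpha> \<le> k}"
    have sum_u: "(\<Sum>\<alpha>\<in>?I. 1 *\<^sub>R u \<alpha>) = f"
    proof (rule ip_eqI)
      show sH: "(\<Sum>\<alpha>\<in>?I. 1 *\<^sub>R u \<alpha>) \<in> H" using uH by (intro V_sum V_scale) auto
      fix x assume x: "x \<in> H"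
      have "ip (\<Sum>\<alpha>\<in>?I. 1 *\<^sub>R u \<alpha>) x = (\<Sum>\<alpha>\<in>?I. 1 * ip (u \<alpha>) x)"
        by (rule ip_sum_scale_left) (use uH x in auto)
      also have "\<dots> = (\<Sum>\<alpha>\<in>?I. L2_inner \<Theta> (mderiv \<Theta> \<alpha> x) (mderiv \<Theta> \<alpha> f))"
        using u x uH ip_commute[OF x] by (intro sum.cong) auto
      also have "\<dots> = ip x f" by (simp add: Sobolev_inner_def)
      also have "\<dots> = ip f x" by (rule ip_commute[OF x f])
      finally show "ip (\<Sum>\<alpha>\<in>?I. 1 *\<^sub>R u \<alpha>) x = ip f x" .
    qed (rule f)
    show ?thesis
    proof (rule L.ip_eqI[OF Sobolev_L2[OF TfH] T_op_inner(1)[OF c f]])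
      fix g assume g: "g \<in> L2 \<Theta>"
      have 0: "mdeg (\<lambda>_::'n. 0) \<le> k" by simp
      \<comment> \<open>Order 0 in the second variable: \<open>v\<close> represents the pairing with
        \<open>g\<close> in \<open>L2\<close>, so \<open>ip (T f) v\<close> is
        \<open>L2_inner \<Theta> (T f) g\<close>.\<close>
      obtain v where vH: "v \<in> H" and v: "\<forall>x\<in>H. L2_inner \<Theta> (mderiv \<Theta> (\<lambda>_. 0) x) g = ip x v"
        using mderiv_adjoint[OF 0 g] by blast
      have "L2_inner \<Theta> (T_op \<Theta> k c f) g = (\<Sum>\<alpha>\<in>?I. ip (T (u \<alpha>)) v)"
        unfolding T_op_inner(2)[OF c f g]
        by (rule sum.cong) (use D[OF f] g uH vH u v in \<open>auto intro!: eval\<close>)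
      also have "\<dots> = ip (\<Sum>\<alpha>\<in>?I. 1 *\<^sub>R T (u \<alpha>)) v"
        using ip_sum_scale_left[of ?I "\<lambda>\<alpha>. T (u \<alpha>)" v "\<lambda>_. 1"] nuclear_carrier(1)[OF T uH] vH by simp
      also have "(\<Sum>\<alpha>\<in>?I. 1 *\<^sub>R T (u \<alpha>)) = T (\<Sum>\<alpha>\<in>?I. 1 *\<^sub>R u \<alpha>)"
        by (rule linear_on_sum[OF subspace_V linear_on_nuclear[OF T], symmetric]) (use uH in auto)
      also have "ip (T (\<Sum>\<alpha>\<in>?I. 1 *\<^sub>R u \<alpha>)) v = L2_inner \<Theta> (T f) g"
        unfolding sum_u using v TfH by (simp add: wderiv_Nil[OF open_domain Sobolev_L2])
      finally show "L2_inner \<Theta> (T f) g = L2_inner \<Theta> (T_op \<Theta> k c f) g" by simp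
    qed
  qed
qed

text \<open>For order 0 every square-integrable kernel is admissible, and the sum in
  \<open>T_op\<close> has a single term.\<close>

lemma T_op_0_inner:
  assumes h: "h \<in> L2 (\<Theta> \<times> \<Theta>)" and f: "f \<in> L2 \<Theta>"
  shows "T_op \<Theta> 0 h f \<in> L2 \<Theta>"
    and "g \<in> L2 \<Theta> \<Longrightarrow> L2_inner \<Theta> (T_op \<Theta> 0 h f) g = L2_inner (\<Theta> \<times> \<Theta>) h (prod_aefun f g)"
proof -
  interpret Z: sobolev_space \<Theta> 0 by standard (rule open_domain)
  have hS: "h \<in> Sobolev_mixed \<Theta> 0"
    unfolding Sobolev_mixed_def using h by (auto simp: mdeg_eq_0 mdirs2_0 intro: has_wderivI weak_deriv_Nil)
  have fS: "f \<in> Z.H" using f by (simp add: Sobolev_0)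
  show "T_op \<Theta> 0 h f \<in> L2 \<Theta>" by (rule Z.T_op_inner(1)[OF hS fS])
  show "L2_inner \<Theta> (T_op \<Theta> 0 h f) g = L2_inner (\<Theta> \<times> \<Theta>) h (prod_aefun f g)" if "g \<in> L2 \<Theta>"
    using Z.T_op_inner(2)[OF hS fS that]
    by (simp add: mdeg_eq_0 mdirs2_0 wderiv_Nil[OF open_square h] wderiv_Nil[OF open_domain f])
qed

end

text \<open>The integrand of \<open>C0 \<alpha> \<beta>\<close> pairs the argument with the
  derivative of order \<open>\<beta>\<close>. Hence \<open>\<beta>\<close> belongs to the first
  variable of the kernel, over which one integrates, and \<open>\<alpha>\<close> to the
  second.\<close>

lemma (in random_sobolev) covariance_kernel:
  shows "\<exists>c\<in>Sobolev_mixed \<Theta> k. C = T_op \<Theta> k c \<and>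
      (\<forall>c'\<in>Sobolev_mixed \<Theta> k. C = T_op \<Theta> k c' \<longrightarrow> c' = c) \<and>
      (\<forall>\<alpha> \<beta>. mdeg \<alpha> \<le> k \<and> mdeg \<beta> \<le> k \<longrightarrow> C0 \<alpha> \<beta> = T_op \<Theta> 0 (mderiv2 \<Theta> \<beta> \<alpha> c))"
proof -
  interpret L2: inner_carrier "L2 \<Theta>" "L2_inner \<Theta>" "L2_norm \<Theta>" by (rule inner_carrier_L2[OF borel_domain(1)])
  obtain c where c: "c \<in> Sobolev_mixed \<Theta> k"
    and eval: "\<And>\<alpha> \<beta> f g u v. mdeg \<alpha> \<le> k \<Longrightarrow> mdeg \<beta> \<le> k \<Longrightarrow> f \<in> L2 \<Theta> \<Longrightarrow> g \<in> L2 \<Theta> \<Longrightarrow>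
      u \<in> H \<Longrightarrow> v \<in> H \<Longrightarrow> \<forall>x\<in>H. L2_inner \<Theta> (mderiv \<Theta> \<alpha> x) f = ip x u \<Longrightarrow>
      \<forall>x\<in>H. L2_inner \<Theta> (mderiv \<Theta> \<beta> x) g = ip x v \<Longrightarrow>
      L2_inner (\<Theta> \<times> \<Theta>) (mderiv2 \<Theta> \<alpha> \<beta> c) (prod_aefun f g) = ip (C u) v"
    using nuclear_kernel[OF cov_nuclear] by blast
  have CT: "C = T_op \<Theta> k c" by (rule nuclear_eq_T_op[OF cov_nuclear c eval])
  have "C0 \<alpha> \<beta> = T_op \<Theta> 0 (mderiv2 \<Theta> \<beta> \<alpha> c)" if \<alpha>\<beta>: "mdeg \<alpha> \<le> k" "mdeg \<beta> \<le> k" for \<alpha> \<beta>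
  proof
    fix f
    note h = mderiv2_Sobolev_mixed(1)[OF c \<alpha>\<beta>(2,1)]
    show "C0 \<alpha> \<beta> f = T_op \<Theta> 0 (mderiv2 \<Theta> \<beta> \<alpha> c) f"
    proof (cases "f \<in> L2 \<Theta>")
      case False
      then show ?thesis
        using L.nuclear_carrier(2)[OF cov_mderiv_nuclear[OF \<alpha>\<beta>], of f] by (simp add: T_op_def Sobolev_0)
    next
      case f: True
      have C0L: "C0 \<alpha> \<beta> f \<in> L2 \<Theta>"
        using L.nuclear_carrier(1)[OF cov_mderiv_nuclear[OF \<alpha>\<beta>], of f] f by (simp add: Sobolev_0)
      show ?thesis
      proof (rule L2.ip_eqI[OF C0L T_op_0_inner(1)[OF h f]])
        fix g assume g: "g \<in> L2 \<Theta>"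
        obtain u where u: "u \<in> H" "\<forall>x\<in>H. L2_inner \<Theta> (mderiv \<Theta> \<beta> x) f = ip x u"
          using mderiv_adjoint[OF \<alpha>\<beta>(2) f] by blast
        obtain v where v: "v \<in> H" "\<forall>x\<in>H. L2_inner \<Theta> (mderiv \<Theta> \<alpha> x) g = ip x v"
          using mderiv_adjoint[OF \<alpha>\<beta>(1) g] by blast
        have "L2_inner \<Theta> (C0 \<alpha> \<beta> f) g = ip (C u) v"
          by (rule cov_mderiv_eval[OF \<alpha>\<beta> f g]) (use u v in auto)
        also have "\<dots> = L2_inner \<Theta> (T_op \<Theta> 0 (mderiv2 \<Theta> \<beta> \<alpha> c) f) g"
          unfolding T_op_0_inner(2)[OF h f g] by (rule eval[symmetric, OF \<alpha>\<beta>(2,1) f g u(1) v(1) u(2) v(2)])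
        finally show "L2_inner \<Theta> (C0 \<alpha> \<beta> f) g = L2_inner \<Theta> (T_op \<Theta> 0 (mderiv2 \<Theta> \<beta> \<alpha> c) f) g" .
      qed
    qed
  qed
  then show ?thesis
    using T_op_unique[OF c] CT by (intro bexI[OF _ c]) auto
qed

text \<open>The nuclear norm is the second moment of the centred element. It falls short of the
  second moment of \<open>X\<close> by the squared norm of the mean, which is why the formula in
  terms of \<open>X\<close> itself is stated for mean 0.\<close>

theorem lemma4p2:
  fixes P :: "'w measure" and \<Theta> :: "(real^'n::finite) set" and k :: nat
    and X :: "'w \<Rightarrow> (real^'n) aefun"
  assumes "prob_space P" and "complete_measure P"
    and "open \<Theta>" and "bounded \<Theta>"
    and "random_element P \<Theta> k X"
    and "integrable P (\<lambda>\<omega>. (Sobolev_norm \<Theta> k (X \<omega>))\<^sup>2)"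
  shows "cov_exists P \<Theta> k X X \<and>
      Cov P \<Theta> k X X \<in> nuclear \<Theta> k \<and>
      (\<forall>f\<in>Sobolev \<Theta> k. \<forall>g\<in>Sobolev \<Theta> k.
         Sobolev_inner \<Theta> k (Cov P \<Theta> k X X f) g = Sobolev_inner \<Theta> k f (Cov P \<Theta> k X X g)) \<and>
      (\<forall>f\<in>Sobolev \<Theta> k. Sobolev_inner \<Theta> k (Cov P \<Theta> k X X f) f \<ge> 0) \<and>
      nuclear_norm \<Theta> k (Cov P \<Theta> k X X) = (\<integral>\<omega>. (Sobolev_norm \<Theta> k (X \<omega> - mean P \<Theta> k X))\<^sup>2 \<partial>P) \<and>
      (mean P \<Theta> k X = 0 \<longrightarrow>
         nuclear_norm \<Theta> k (Cov P \<Theta> k X X) = (\<integral>\<omega>. (Sobolev_norm \<Theta> k (X \<omega>))\<^sup>2 \<partial>P)) \<and>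
      (\<exists>c\<in>Sobolev_mixed \<Theta> k.
      Cov P \<Theta> k X X = T_op \<Theta> k c \<and>
      (\<forall>c'\<in>Sobolev_mixed \<Theta> k. Cov P \<Theta> k X X = T_op \<Theta> k c' \<longrightarrow> c' = c) \<and>
      (\<forall>\<alpha> \<beta>. mdeg \<alpha> \<le> k \<and> mdeg \<beta> \<le> k \<longrightarrow>
         cov_exists P \<Theta> 0 (\<lambda>\<omega>. mderiv \<Theta> \<alpha> (X \<omega>)) (\<lambda>\<omega>. mderiv \<Theta> \<beta> (X \<omega>)) \<and>
         Cov P \<Theta> 0 (\<lambda>\<omega>. mderiv \<Theta> \<alpha> (X \<omega>)) (\<lambda>\<omega>. mderiv \<Theta> \<beta> (X \<omega>)) = T_op \<Theta> 0 (mderiv2 \<Theta> \<beta> \<alpha> c) \<and>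
         T_op \<Theta> 0 (mderiv2 \<Theta> \<beta> \<alpha> c) \<in> nuclear \<Theta> 0)) \<and>
      nuclear_norm \<Theta> k (Cov P \<Theta> k X X) =
      (\<Sum>\<alpha> | mdeg \<alpha> \<le> k.
         nuclear_norm \<Theta> 0 (Cov P \<Theta> 0 (\<lambda>\<omega>. mderiv \<Theta> \<alpha> (X \<omega>)) (\<lambda>\<omega>. mderiv \<Theta> \<alpha> (X \<omega>))))"
proof -
  interpret prob_space P by fact
  interpret random_sobolev \<Theta> k P X by standard (use assms in auto)
  have norm: "nuclear_norm \<Theta> k C = (\<integral>\<omega>. (N (X \<omega> - m))\<^sup>2 \<partial>P)"
    using cov_norm by (simp add: Y_def)
  obtain c where c: "c \<in> Sobolev_mixed \<Theta> k" "C = T_op \<Theta> k c"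
    "\<forall>c'\<in>Sobolev_mixed \<Theta> k. C = T_op \<Theta> k c' \<longrightarrow> c' = c"
    "\<forall>\<alpha> \<beta>. mdeg \<alpha> \<le> k \<and> mdeg \<beta> \<le> k \<longrightarrow> C0 \<alpha> \<beta> = T_op \<Theta> 0 (mderiv2 \<Theta> \<beta> \<alpha> c)"
    using covariance_kernel by blast
  have "cov_exists P \<Theta> 0 (\<lambda>\<omega>. mderiv \<Theta> \<alpha> (X \<omega>)) (\<lambda>\<omega>. mderiv \<Theta> \<beta> (X \<omega>)) \<and>
      C0 \<alpha> \<beta> = T_op \<Theta> 0 (mderiv2 \<Theta> \<beta> \<alpha> c) \<and> T_op \<Theta> 0 (mderiv2 \<Theta> \<beta> \<alpha> c) \<in> nuclear \<Theta> 0"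
    if "mdeg \<alpha> \<le> k \<and> mdeg \<beta> \<le> k" for \<alpha> \<beta>
    using that has_cov_mderiv(2) cov_mderiv_nuclear[of \<alpha> \<beta>] c(4) by metis
  then have "\<exists>c\<in>Sobolev_mixed \<Theta> k. C = T_op \<Theta> k c \<and>
      (\<forall>c'\<in>Sobolev_mixed \<Theta> k. C = T_op \<Theta> k c' \<longrightarrow> c' = c) \<and>
      (\<forall>\<alpha> \<beta>. mdeg \<alpha> \<le> k \<and> mdeg \<beta> \<le> k \<longrightarrow>
         cov_exists P \<Theta> 0 (\<lambda>\<omega>. mderiv \<Theta> \<alpha> (X \<omega>)) (\<lambda>\<omega>. mderiv \<Theta> \<beta> (X \<omega>)) \<and>
         C0 \<alpha> \<beta> = T_op \<Theta> 0 (mderiv2 \<Theta> \<beta> \<alpha> c) \<and> T_op \<Theta> 0 (mderiv2 \<Theta> \<beta> \<alpha> c) \<in> nuclear \<Theta> 0)"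
    using c(1-3) by (intro bexI[of _ c]) blast+
  then show ?thesis
    using cov_exists_self cov_nuclear cov_self_adjoint cov_nonneg norm cov_norm_sum
    by (intro conjI) (auto simp: norm)
qed

end
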